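(* Let $$L=-\Delta+R(x),\qquad R(x)=\sum_{1\le i<j\le n}\left(\frac{C_{ij}^+}{(x_i+x_j)^2}+\frac{C_{ij}^-}{(x_i-x_j)^2}\right)+\sum_{i=1}^n\frac{C_i}{x_i^2}+\widetilde R(x),$$ where $\widetilde R$ is real analytic at $x=0$ and the $C_{ij}^\pm,C_i$ are constants (some possibly zero). Let $\mathcal{H}$ be the set of those vectors among $e_i+e_j$, $e_i-e_j$ $(i<j)$ and $e_i$ whose coefficient ($C_{ij}^+$, $C_{ij}^-$, $C_i$ respectively) is non-zero. Assume that $\mathcal{H}$ is irreducible, that $R$ is generic, and that the group $W$ generated by $\{r_\alpha:\alpha\in\mathcal{H}\}$ is the reflection group of type $B_n$ ($n\ge2$) or of type $D_n$ ($n\ge4$), where in the type $D_n$ case $C_i=0$ for all $i$. Assume that $L$ commutes with a differential operator of the form $$P=\sum_{1\le i<j\le n}\partial_i^2\partial_j^2+\sum_{i=1}^n a_2^i\partial_i^2+\sum_{1\le i<j\le n}a_{11}^{ij}\partial_i\partial_j+\sum_{i=1}^n a_1^i\partial_i+a_0 .$$ Then there exist even functions $u(t)$ and $v(t)$ of one variable such that $$R(x)=\sum_{1\le i<j\le n}\{u(x_i+x_j)+u(x_i-x_j)\}+\sum_{i=1}^n v(x_i).$$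
   Context: $e_1,\dots,e_n$ is the standard basis of $\mathbb{R}^n$, $\partial_i=\partial/\partial x_i$, $\Delta=\sum_i\partial_i^2$; $r_\alpha$ is the orthogonal reflection in $H_\alpha=\{x:\langle\alpha,x\rangle=0\}$. The reflection groups of type $B_n$ and $D_n$ are those generated by the reflections in $\{e_i\pm e_j:1\le i<j\le n\}\cup\{e_i:1\le i\le n\}$ and in $\{e_i\pm e_j:1\le i<j\le n\}$, respectively. Constants and functions may be complex-valued. Let $U$ be an open ball centred at $0$ on which $\widetilde R$ is real analytic; $L$ is considered on $D=U\setminus\bigcup_{\alpha\in\mathcal{H}}H_\alpha$, the coefficients of $P$ are real analytic functions on $D$, and the asserted identity for $R$ is on $D$. Irreducible: $\mathcal{H}$ spans $\mathbb{R}^n$ and cannot be partitioned into the union of two proper subsets such that each vector in one is orthogonal to each vector in the other. Generic: $C_\alpha\ne k(k+1)\langle\alpha,\alpha\rangle$ for every integer $k$ and every $\alpha\in\mathcal{H}$, where $C_\alpha$ is the coefficient attached to $\alpha$. *)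

theory Defs
  imports
    "HOL-Analysis.Analysis"
    "HOL-Algebra.Bij"
    "HOL-Algebra.Generated_Groups"
begin

text \<open>
  Coordinates of n-space are indexed by a finite linearly ordered type, so that the condition
  i < j in the sums makes sense; the dimension n is its cardinality.
\<close>

abbreviation stdvec :: "'n::finite \<Rightarrow> real^'n"
  where "stdvec i \<equiv> axis i 1"

subsection \<open>Reflection groups\<close>

definition reflection :: "'a::real_inner \<Rightarrow> 'a \<Rightarrow> 'a"
  where "reflection \<alpha> x = x - (2 * (\<alpha> \<bullet> x) / (\<alpha> \<bullet> \<alpha>)) *\<^sub>R \<alpha>"

definition hyperplane :: "'a::real_inner \<Rightarrow> 'a set"
  where "hyperplane \<alpha> = {x. \<alpha> \<bullet> x = 0}"

definition reflection_group :: "'a::real_inner set \<Rightarrow> ('a \<Rightarrow> 'a) set"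
  where "reflection_group S = generate (BijGroup UNIV) (reflection ` S)"

definition roots_D :: "(real^'n::{finite,linorder}) set"
  where "roots_D = {stdvec i + stdvec j |i j. i < j} \<union> {stdvec i - stdvec j |i j. i < j}"

definition roots_B :: "(real^'n::{finite,linorder}) set"
  where "roots_B = roots_D \<union> range stdvec"

definition irreducible_vectors :: "'a::euclidean_space set \<Rightarrow> bool"
  where "irreducible_vectors S \<longleftrightarrow>
    span S = UNIV \<and>
    \<not> (\<exists>A B. A \<subset> S \<and> B \<subset> S \<and> A \<union> B = S \<and> A \<inter> B = {} \<and>
          (\<forall>\<alpha>\<in>A. \<forall>\<beta>\<in>B. \<alpha> \<bullet> \<beta> = 0))"

subsection \<open>Smooth and real analytic functions of several variables\<close>

definition pderiv_at :: "'n::finite \<Rightarrow> (real^'n \<Rightarrow> complex) \<Rightarrow> real^'n \<Rightarrow> complex"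
  where "pderiv_at i f x = frechet_derivative f (at x) (stdvec i)"

text \<open>
  Used for open sets only: a function is infinitely differentiable iff all its iterated partial
  derivatives exist and are themselves differentiable.
\<close>

definition smooth_function_on :: "(real^'n::finite) set \<Rightarrow> (real^'n \<Rightarrow> complex) \<Rightarrow> bool"
  where "smooth_function_on S f \<longleftrightarrow>
    (\<forall>is. \<forall>x\<in>S. foldr pderiv_at is f differentiable (at x))"

definition real_analytic_at :: "(real^'n::finite \<Rightarrow> complex) \<Rightarrow> real^'n \<Rightarrow> bool"
  where "real_analytic_at f x \<longleftrightarrow>
    (\<exists>r>0. \<exists>c :: ('n \<Rightarrow> nat) \<Rightarrow> complex. \<forall>y\<in>ball x r.
      ((\<lambda>m. c m * of_real (\<Prod>i\<in>UNIV. (y $ i - x $ i) ^ m i)) has_sum f y) UNIV)"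

definition real_analytic_on :: "(real^'n::finite \<Rightarrow> complex) \<Rightarrow> (real^'n) set \<Rightarrow> bool"
  where "real_analytic_on f S \<longleftrightarrow> (\<forall>x\<in>S. real_analytic_at f x)"

subsection \<open>The potential and its singular locus\<close>

text \<open>
  The potential is given by the constants \<open>Cp i j\<close>, \<open>Cm i j\<close> (used for i < j only), \<open>C i\<close>
  and the function \<open>Rt\<close>. The relation below attaches to each vector its constant; the vectors
  occurring in it are pairwise distinct.
\<close>

definition vector_coeffs ::
    "('n::{finite,linorder} \<Rightarrow> 'n \<Rightarrow> complex) \<Rightarrow> ('n \<Rightarrow> 'n \<Rightarrow> complex) \<Rightarrow> ('n \<Rightarrow> complex)
      \<Rightarrow> ((real, 'n) vec \<times> complex) set"
  where "vector_coeffs Cp Cm C =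
    {(stdvec i + stdvec j, Cp i j) |i j. i < j} \<union>
    {(stdvec i - stdvec j, Cm i j) |i j. i < j} \<union>
    {(stdvec i, C i) |i. True}"

definition singular_vectors ::
    "('n::{finite,linorder} \<Rightarrow> 'n \<Rightarrow> complex) \<Rightarrow> ('n \<Rightarrow> 'n \<Rightarrow> complex) \<Rightarrow> ('n \<Rightarrow> complex)
      \<Rightarrow> (real, 'n) vec set"
  where "singular_vectors Cp Cm C = {\<alpha>. \<exists>c. (\<alpha>, c) \<in> vector_coeffs Cp Cm C \<and> c \<noteq> 0}"

definition generic_potential ::
    "('n::{finite,linorder} \<Rightarrow> 'n \<Rightarrow> complex) \<Rightarrow> ('n \<Rightarrow> 'n \<Rightarrow> complex) \<Rightarrow> ('n \<Rightarrow> complex) \<Rightarrow> bool"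
  where "generic_potential Cp Cm C \<longleftrightarrow>
    (\<forall>(\<alpha>, c) \<in> vector_coeffs Cp Cm C. \<alpha> \<in> singular_vectors Cp Cm C \<longrightarrow>
      (\<forall>k::int. c \<noteq> of_int (k * (k + 1)) * of_real (\<alpha> \<bullet> \<alpha>)))"

definition potential ::
    "('n::{finite,linorder} \<Rightarrow> 'n \<Rightarrow> complex) \<Rightarrow> ('n \<Rightarrow> 'n \<Rightarrow> complex) \<Rightarrow> ('n \<Rightarrow> complex)
      \<Rightarrow> ((real, 'n) vec \<Rightarrow> complex) \<Rightarrow> (real, 'n) vec \<Rightarrow> complex"
  where "potential Cp Cm C Rt x =
    (\<Sum>i\<in>UNIV. \<Sum>j\<in>{i<..}. Cp i j / of_real ((x $ i + x $ j)\<^sup>2)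
                          + Cm i j / of_real ((x $ i - x $ j)\<^sup>2))
    + (\<Sum>i\<in>UNIV. C i / of_real ((x $ i)\<^sup>2)) + Rt x"

definition regular_domain :: "real \<Rightarrow> 'a::real_inner set \<Rightarrow> 'a set"
  where "regular_domain r S = ball 0 r - (\<Union>\<alpha>\<in>S. hyperplane \<alpha>)"

subsection \<open>The differential operators\<close>

definition laplacian :: "(real^'n::finite \<Rightarrow> complex) \<Rightarrow> real^'n \<Rightarrow> complex"
  where "laplacian f x = (\<Sum>i\<in>UNIV. pderiv_at i (pderiv_at i f) x)"

definition schroedinger_op ::
    "(real^'n::finite \<Rightarrow> complex) \<Rightarrow> (real^'n \<Rightarrow> complex) \<Rightarrow> real^'n \<Rightarrow> complex"
  where "schroedinger_op R f x = - laplacian f x + R x * f x"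

definition quartic_op ::
    "('n::{finite,linorder} \<Rightarrow> (real, 'n) vec \<Rightarrow> complex) \<Rightarrow> ('n \<Rightarrow> 'n \<Rightarrow> (real, 'n) vec \<Rightarrow> complex)
      \<Rightarrow> ('n \<Rightarrow> (real, 'n) vec \<Rightarrow> complex) \<Rightarrow> ((real, 'n) vec \<Rightarrow> complex)
      \<Rightarrow> ((real, 'n) vec \<Rightarrow> complex) \<Rightarrow> (real, 'n) vec \<Rightarrow> complex"
  where "quartic_op a2 a11 a1 a0 f x =
    (\<Sum>i\<in>UNIV. \<Sum>j\<in>{i<..}. pderiv_at i (pderiv_at i (pderiv_at j (pderiv_at j f))) x)
    + (\<Sum>i\<in>UNIV. a2 i x * pderiv_at i (pderiv_at i f) x)
    + (\<Sum>i\<in>UNIV. \<Sum>j\<in>{i<..}. a11 i j x * pderiv_at i (pderiv_at j f) x)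
    + (\<Sum>i\<in>UNIV. a1 i x * pderiv_at i f x)
    + a0 x * f x"

text \<open>For differential operators with smooth coefficients on an open set \<open>S\<close>.\<close>

definition commute_on ::
    "(real^'n::finite) set \<Rightarrow> ((real^'n \<Rightarrow> complex) \<Rightarrow> real^'n \<Rightarrow> complex)
      \<Rightarrow> ((real^'n \<Rightarrow> complex) \<Rightarrow> real^'n \<Rightarrow> complex) \<Rightarrow> bool"
  where "commute_on S A B \<longleftrightarrow> (\<forall>f. smooth_function_on S f \<longrightarrow> (\<forall>x\<in>S. A (B f) x = B (A f) x))"

definition even_function :: "(real \<Rightarrow> complex) \<Rightarrow> bool"
  where "even_function u \<longleftrightarrow> (\<forall>t. u (- t) = u t)"

end

theory Submission
  imports Defs "HOL-Complex_Analysis.Complex_Analysis"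
begin

text \<open>
  Testing the commutator on exponential functions turns the hypothesis into differential equations.
  Up to normalisation the second order part \<open>s\<close> of \<open>P\<close> satisfies
  \<open>\<partial>\<^sub>i s\<^sub>j\<^sub>k + \<partial>\<^sub>j s\<^sub>i\<^sub>k + \<partial>\<^sub>k s\<^sub>i\<^sub>j = 6 \<partial>\<^sub>i R\<close> if \<open>i = j = k\<close> and \<open>= 0\<close> otherwise, and the 1-form with components
  \<open>\<Sum>\<^sub>k s\<^sub>j\<^sub>k \<partial>\<^sub>k R\<close> is closed; moreover \<open>\<partial>\<^sub>i \<partial>\<^sub>j (\<partial>\<^sub>i\<^sup>2 - \<partial>\<^sub>j\<^sup>2) R = 0\<close> and \<open>\<partial>\<^sub>l \<partial>\<^sub>i \<partial>\<^sub>j \<partial>\<^sub>k R = 0\<close> for distinct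
  \<open>i, j, k\<close>. On the normal line through a generic point of the wall of \<open>\<alpha> \<in> H\<close> the double pole of \<open>R\<close>
  reduces the closedness to ordinary differential equations \<open>3 g' w' + g w'' + 2 g'' w = 0\<close> for the odd
  part \<open>w\<close> of the regular part of \<open>R\<close>. Hence either \<open>w = 0\<close>, or all \<open>\<partial>\<^sub>\<alpha> \<partial>\<^sub>v R\<close> with \<open>v\<close> orthogonal to
  \<open>\<alpha>\<close> vanish on the line. The latter is impossible, because by irreducibility the line meets the wall of
  a root that is not orthogonal to \<open>\<alpha>\<close>, and there \<open>\<partial>\<^sub>\<alpha> \<partial>\<^sub>v R\<close> has a pole. So \<open>R\<close> is invariant under
  \<open>W\<close>, the coefficients within each orbit of roots agree, and the regular part of \<open>R\<close> is invariant.
  The linear equations and the invariance then give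
  \<open>\<partial>\<^sub>i \<partial>\<^sub>j R = \<phi>(x\<^sub>i + x\<^sub>j) - \<phi>(x\<^sub>i - x\<^sub>j)\<close> for the regular part with one even function \<open>\<phi>\<close>; subtracting the
  contribution of \<open>u\<close> with \<open>u'' = \<phi>\<close> leaves a sum of functions of single coordinates.
\<close>

text \<open>The function g of the overview is the component \<open>S p j\<close> of the second order
  part in an orthogonal frame, where \<open>f p\<close> is the root and \<open>f j\<close> is
  tangential. Along a normal line g' is a constant minus \<mu>_j times the tangential derivative of
  the regular part. In the closedness equation the operator 3 g' w' + g w'' + 2 g'' w acts on all of
  R, and on the pole c/t^2 it gives c (6 g - 6 t g' + 2 t^2 g'')/t^4. The other terms stay bounded,
  so g(0) = g''(0) = 0. The obstacle is that these other terms contain unknown components of the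
  second order part. Parity removes them: g''(0) = 0 holds at all nearby wall points, and the fourth
  order equations trade pairs of normal derivatives for pairs of tangential ones. So the tangential
  derivatives of the regular part are even in t, g is odd, and every unwanted term is odd. The even
  part of the equation contains only w. The numbers \<mu>_j are 1 or -2; what counts is that they
  are not zero.\<close>

subsection \<open>Analytic functions of one real variable\<close>

text \<open>A holomorphic germ is kept instead of a real power series, so that isolated zeros and
  analytic continuation come from complex analysis.\<close>

definition analytic1_at :: "(real \<Rightarrow> complex) \<Rightarrow> real \<Rightarrow> bool"
  where "analytic1_at f t \<longleftrightarrow>
    (\<exists>F. F analytic_on {of_real t} \<and> (\<forall>\<^sub>F s in nhds t. f s = F (of_real s)))"

lemma analytic1_atI:
  assumes "F analytic_on {of_real t}" "\<forall>\<^sub>F s in nhds t. f s = F (of_real s)"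
  shows "analytic1_at f t"
  using assms unfolding analytic1_at_def by blast

lemma analytic1_at_const [intro!]: "analytic1_at (\<lambda>_. c) t"
  by (rule analytic1_atI[of "\<lambda>_. c"]) (auto intro: analytic_intros)

lemma analytic1_at_of_real [intro!]: "analytic1_at (\<lambda>t. of_real t) t"
  by (rule analytic1_atI[of "\<lambda>z. z"]) (auto intro: analytic_intros)

lemma analytic1_at_add [intro!]:
  assumes "analytic1_at f t" "analytic1_at g t"
  shows "analytic1_at (\<lambda>s. f s + g s) t"
proof -
  obtain F G where "F analytic_on {of_real t}" "\<forall>\<^sub>F s in nhds t. f s = F (of_real s)"
    "G analytic_on {of_real t}" "\<forall>\<^sub>F s in nhds t. g s = G (of_real s)"
    using assms unfolding analytic1_at_def by blast
  then show ?thesis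
    by (intro analytic1_atI[of "\<lambda>z. F z + G z"]) (auto intro: analytic_intros elim: eventually_elim2)
qed

lemma analytic1_at_mult [intro!]:
  assumes "analytic1_at f t" "analytic1_at g t"
  shows "analytic1_at (\<lambda>s. f s * g s) t"
proof -
  obtain F G where "F analytic_on {of_real t}" "\<forall>\<^sub>F s in nhds t. f s = F (of_real s)"
    "G analytic_on {of_real t}" "\<forall>\<^sub>F s in nhds t. g s = G (of_real s)"
    using assms unfolding analytic1_at_def by blast
  then show ?thesis
    by (intro analytic1_atI[of "\<lambda>z. F z * G z"]) (auto intro: analytic_intros elim: eventually_elim2)
qed

lemma analytic1_at_minus [intro!]: "analytic1_at f t \<Longrightarrow> analytic1_at (\<lambda>s. - f s) t"
  using analytic1_at_mult[of "\<lambda>_. - 1" t f] by auto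

lemma analytic1_at_diff [intro!]:
  "analytic1_at f t \<Longrightarrow> analytic1_at g t \<Longrightarrow> analytic1_at (\<lambda>s. f s - g s) t"
  using analytic1_at_add[of f t "\<lambda>s. - g s"] by auto

lemma analytic1_at_sum [intro!]:
  "(\<And>i. i \<in> A \<Longrightarrow> analytic1_at (f i) t) \<Longrightarrow> analytic1_at (\<lambda>s. \<Sum>i\<in>A. f i s) t"
  by (induction A rule: infinite_finite_induct) auto

lemma analytic1_at_prod [intro!]:
  "(\<And>i. i \<in> A \<Longrightarrow> analytic1_at (f i) t) \<Longrightarrow> analytic1_at (\<lambda>s. \<Prod>i\<in>A. f i s) t"
  by (induction A rule: infinite_finite_induct) auto

lemma analytic1_at_power [intro!]:
  "analytic1_at f t \<Longrightarrow> analytic1_at (\<lambda>s. f s ^ k) t"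
  by (induction k) auto

lemma analytic1_at_divide [intro!]:
  assumes "analytic1_at f t" "analytic1_at g t" "g t \<noteq> 0"
  shows "analytic1_at (\<lambda>s. f s / g s) t"
proof -
  obtain F G where *: "F analytic_on {of_real t}" "\<forall>\<^sub>F s in nhds t. f s = F (of_real s)"
    "G analytic_on {of_real t}" "\<forall>\<^sub>F s in nhds t. g s = G (of_real s)"
    using assms unfolding analytic1_at_def by blast
  moreover have "G (of_real t) \<noteq> 0"
    using eventually_nhds_x_imp_x[OF *(4)] assms(3) by simp
  ultimately show ?thesis
    by (intro analytic1_atI[of "\<lambda>z. F z / G z"]) (auto intro: analytic_intros elim: eventually_elim2)
qed

lemma analytic1_at_cong:
  assumes "\<forall>\<^sub>F s in nhds t. f s = g s" "analytic1_at g t"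
  shows "analytic1_at f t"
proof -
  obtain G where "G analytic_on {of_real t}" "\<forall>\<^sub>F s in nhds t. g s = G (of_real s)"
    using assms unfolding analytic1_at_def by blast
  with assms(1) show ?thesis
    by (intro analytic1_atI[of G]) (auto elim: eventually_elim2)
qed

lemma analytic1_at_ball:
  assumes "analytic1_at f t"
  obtains F e where "e > 0" "F holomorphic_on ball (of_real t) e"
    "\<And>s. \<bar>s - t\<bar> < e \<Longrightarrow> f s = F (of_real s)"
proof -
  obtain F where F: "F analytic_on {of_real t}" "\<forall>\<^sub>F s in nhds t. f s = F (of_real s)"
    using assms unfolding analytic1_at_def by blast
  obtain e1 where e1: "e1 > 0" "F holomorphic_on ball (of_real t) e1"
    using F(1) analytic_at_ball by blast
  obtain e2 where e2: "e2 > 0" "\<And>s. dist s t < e2 \<Longrightarrow> f s = F (of_real s)"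
    using F(2) unfolding eventually_nhds_metric by blast
  show thesis
  proof
    show "min e1 e2 > 0" using e1 e2 by simp
    show "F holomorphic_on ball (of_real t) (min e1 e2)"
      using e1(2) by (rule holomorphic_on_subset) auto
    show "f s = F (of_real s)" if "\<bar>s - t\<bar> < min e1 e2" for s
      using that e2(2)[of s] by (auto simp: dist_real_def)
  qed
qed

lemma analytic1_at_shift:
  assumes "analytic1_at f (a + b * t)"
  shows "analytic1_at (\<lambda>s. f (a + b * s)) t"
proof -
  obtain F e where F: "e > 0" "F holomorphic_on ball (of_real (a + b * t)) e"
    "\<And>s. \<bar>s - (a + b * t)\<bar> < e \<Longrightarrow> f s = F (of_real s)"
    using analytic1_at_ball[OF assms] by metis
  have "F analytic_on {of_real (a + b * t)}"
    using F(1,2) by (auto simp: analytic_at_ball)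
  then have "(F \<circ> (\<lambda>z. of_real a + of_real b * z)) analytic_on {of_real t}"
    by (intro analytic_on_compose analytic_intros) auto
  moreover have "((\<lambda>s. a + b * s) \<longlongrightarrow> a + b * t) (nhds t)"
    by (intro tendsto_intros filterlim_ident)
  then have "\<forall>\<^sub>F s in nhds t. dist (a + b * s) (a + b * t) < e"
    using F(1) by (rule tendstoD)
  then have "\<forall>\<^sub>F s in nhds t. f (a + b * s) = (F \<circ> (\<lambda>z. of_real a + of_real b * z)) (of_real s)"
    by eventually_elim (use F(3) in \<open>auto simp: dist_real_def\<close>)
  ultimately show ?thesis by (rule analytic1_atI)
qed

text \<open>The interval (0,d) accumulates at the centre of the disc. The form is one-sided because
  the equations at a wall are used on its positive side only.\<close>

lemma holomorphic_zero_of_right_zero: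
  assumes "F holomorphic_on ball 0 e" "e > 0" "d > 0"
    and "\<And>t. 0 < t \<Longrightarrow> t < d \<Longrightarrow> F (of_real t) = 0" and "z \<in> ball 0 e"
  shows "F z = 0"
proof (rule analytic_continuation[of F "ball 0 e" "of_real ` {0<..<min d e}" 0])
  show "of_real ` {0<..<min d e} \<subseteq> ball (0::complex) e" using assms by auto
  show "(0::complex) islimpt of_real ` {0<..<min d e}"
  proof -
    have "\<exists>x'\<in>of_real ` {0<..<min d e}. x' \<noteq> 0 \<and> dist x' (0::complex) < c" if "c > 0" for c
      using assms(2,3) that
      by (intro bexI[of _ "of_real (min c (min d e) / 2)"] image_eqI[of _ _ "min c (min d e) / 2"])
         (auto simp: min_def field_simps)
    then show ?thesis
      unfolding islimpt_approachable by blast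
  qed
qed (use assms in auto)

lemma analytic1_at_eventually_zero:
  assumes "analytic1_at f t" and lim: "t islimpt {s. f s = 0}"
  shows "\<forall>\<^sub>F s in nhds t. f s = 0"
proof -
  obtain F e where F: "e > 0" "F holomorphic_on ball (of_real t) e"
    "\<And>s. \<bar>s - t\<bar> < e \<Longrightarrow> f s = F (of_real s)"
    using analytic1_at_ball[OF assms(1)] by metis
  have lim': "of_real t islimpt {z \<in> ball (of_real t) e. F z = (0::complex)}"
    unfolding islimpt_approachable
  proof (intro allI impI)
    fix d :: real assume "d > 0"
    then obtain s where s: "f s = 0" "s \<noteq> t" "dist s t < min d e"
      using lim F(1) unfolding islimpt_approachable
      by (metis (mono_tags, lifting) mem_Collect_eq min_less_iff_conj)
    then have "of_real s \<in> {z \<in> ball (of_real t) e. F z = (0::complex)}"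
      using F(3)[of s] by (auto simp: dist_real_def dist_commute[of _ "of_real s"] dist_of_real abs_minus_commute)
    with s show "\<exists>x'\<in>{z \<in> ball (of_real t) e. F z = (0::complex)}. x' \<noteq> of_real t \<and> dist x' (of_real t) < d"
      by (intro bexI[of _ "of_real s"]) (auto simp: dist_of_real)
  qed
  have "F z = 0" if "z \<in> ball (of_real t) e" for z
    by (rule analytic_continuation[OF F(2) _ _ _ _ lim' _ that]) (use F(1) in auto)
  then have "f s = 0" if "dist s t < e" for s
    using that F(3)[of s] by (auto simp: dist_real_def dist_of_real abs_minus_commute)
  with F(1) show ?thesis unfolding eventually_nhds_metric by blast
qed

text \<open>The set where f vanishes as a germ is open, and closed in S as well: at a limit point of
  zeros \<open>analytic1_at_eventually_zero\<close> makes the germ vanish.\<close>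

lemma analytic1_identity:
  assumes "\<And>t. t \<in> S \<Longrightarrow> analytic1_at f t" "connected S" "open S" "t0 \<in> S" "\<forall>\<^sub>F s in nhds t0. f s = 0"
    and "t \<in> S"
  shows "f t = 0"
proof -
  define A where "A = {t \<in> S. \<forall>\<^sub>F s in nhds t. f s = 0}"
  have oA: "open A"
  proof -
    have "A = S \<inter> {t. \<forall>\<^sub>F s in nhds t. f s = 0}" by (auto simp: A_def)
    moreover have "open {t. \<forall>\<^sub>F s in nhds t. f s = 0}"
      by (subst open_subopen) (auto simp: eventually_nhds)
    ultimately show ?thesis using assms(3) by auto
  qed
  have "open (S - A)"
  proof (subst open_subopen, intro ballI)
    fix u assume u: "u \<in> S - A"
    then have "\<not> u islimpt {s. f s = 0}"
      using analytic1_at_eventually_zero[OF assms(1)[of u]] by (auto simp: A_def)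
    then have "\<not> u islimpt A" 
      by (metis (mono_tags, lifting) A_def eventually_nhds_x_imp_x islimpt_subset mem_Collect_eq subsetI)
    then obtain T where T: "u \<in> T" "open T" "\<forall>y\<in>A. y \<in> T \<longrightarrow> y = u"
      unfolding islimpt_def by blast
    with u show "\<exists>T. open T \<and> u \<in> T \<and> T \<subseteq> S - A"
      using assms(3) by (intro exI[of _ "T \<inter> S"]) auto
  qed
  moreover have "A \<subseteq> S" by (auto simp: A_def)
  moreover have "t0 \<in> A" using assms by (auto simp: A_def)
  ultimately have "A = S"
    using connectedD[OF assms(2) oA, of "S - A"] by blast
  with \<open>t \<in> S\<close> show ?thesis unfolding A_def using eventually_nhds_x_imp_x by blast
qed

text \<open>From here on \<open>$\<close> means the component of a vector, not a coefficient of a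
  formal power series.\<close>

no_notation fps_nth (infixl "$" 75)

subsection \<open>Power series in several variables\<close>

definition mpow :: "('n::finite \<Rightarrow> nat) \<Rightarrow> real^'n \<Rightarrow> real"
  where "mpow m h = (\<Prod>i\<in>UNIV. (h $ i) ^ m i)"

definition mdeg :: "('n::finite \<Rightarrow> nat) \<Rightarrow> nat"
  where "mdeg m = sum m UNIV"

lemma mpow_bound:
  assumes "\<And>i. \<bar>h $ i\<bar> \<le> \<rho>"
  shows "\<bar>mpow m h\<bar> \<le> \<rho> ^ mdeg m"
proof -
  have "\<bar>mpow m h\<bar> = (\<Prod>i\<in>UNIV. \<bar>h $ i\<bar> ^ m i)"
    by (simp add: mpow_def abs_prod power_abs)
  also have "\<dots> \<le> (\<Prod>i\<in>UNIV. \<rho> ^ m i)"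
    by (intro prod_mono) (auto intro: power_mono assms)
  also have "\<dots> = \<rho> ^ mdeg m" by (simp add: mdeg_def power_sum)
  finally show ?thesis .
qed

lemma mpow_scaleR: "mpow m (t *\<^sub>R v) = t ^ mdeg m * mpow m v"
  by (simp add: mpow_def mdeg_def power_sum power_mult_distrib prod.distrib)

lemma mpow_remove: "mpow m h = (h $ i) ^ m i * (\<Prod>j\<in>UNIV - {i}. (h $ j) ^ m j)"
  unfolding mpow_def by (rule prod.remove) auto

lemma mpow_has_derivative:
  "(mpow m has_derivative (\<lambda>k. \<Sum>i\<in>UNIV. k $ i * (of_nat (m i) * mpow (m(i := m i - 1)) h))) (at h)"
proof -
  have d: "((\<lambda>h. (h $ i) ^ m i) has_derivative (\<lambda>k. of_nat (m i) * (k $ i * (h $ i) ^ (m i - 1)))) (at h)" for i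
    by (rule has_derivative_eq_rhs[OF has_derivative_power[OF bounded_linear_imp_has_derivative[OF bounded_linear_vec_nth]]])
       (simp add: fun_eq_iff mult_ac)
  have "((\<lambda>h. \<Prod>i\<in>UNIV. (h $ i) ^ m i) has_derivative
     (\<lambda>k. \<Sum>i\<in>UNIV. of_nat (m i) * (k $ i * (h $ i) ^ (m i - 1)) * (\<Prod>j\<in>UNIV - {i}. (h $ j) ^ m j))) (at h)"
    by (rule has_derivative_prod) (rule d)
  moreover have "(\<lambda>h. \<Prod>i\<in>UNIV. (h $ i) ^ m i) = mpow m" by (auto simp: mpow_def)
  moreover have "of_nat (m i) * (k $ i * (h $ i) ^ (m i - 1)) * (\<Prod>j\<in>UNIV - {i}. (h $ j) ^ m j)
      = k $ i * (of_nat (m i) * mpow (m(i := m i - 1)) h)" for i k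
  proof -
    have "(\<Prod>j\<in>UNIV - {i}. (h $ j) ^ (m(i := m i - 1)) j) = (\<Prod>j\<in>UNIV - {i}. (h $ j) ^ m j)"
      by (intro prod.cong) auto
    then show ?thesis unfolding mpow_remove[of "m(i := m i - 1)" h i] by simp
  qed
  ultimately show ?thesis by (simp only:)
qed

text \<open>Halving the radius gains a factor 2^k, which absorbs the exponent m_i \<le> k + 1 \<le>
  2^k brought down by differentiation; here k is the degree minus one.\<close>

lemma mpow_pderiv_bound:
  assumes "\<And>i. \<bar>h $ i\<bar> \<le> \<rho> / 2" "\<rho> > 0"
  shows "\<bar>of_nat (m i) * mpow (m(i := m i - 1)) h\<bar> \<le> \<rho> ^ mdeg m / \<rho>"
proof (cases "m i = 0")
  case False
  then obtain k where k: "mdeg m = Suc k"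
    by (metis mdeg_def finite gr0_implies_Suc iso_tuple_UNIV_I neq0_conv sum_eq_0_iff)
  have "mdeg (m(i := m i - 1)) + 1 = mdeg m"
  proof -
    have "mdeg m = m i + sum m (UNIV - {i})"
      unfolding mdeg_def by (rule sum.remove) auto
    moreover have "mdeg (m(i := m i - 1)) = (m i - 1) + sum m (UNIV - {i})"
      unfolding mdeg_def by (subst sum.remove[of _ i]) auto
    ultimately show ?thesis using False by simp
  qed
  then have k': "mdeg (m(i := m i - 1)) = k" using k by simp
  have mi: "m i \<le> Suc k" using k member_le_sum[of i UNIV m] by (simp add: mdeg_def)
  have "real (Suc k) \<le> 2 ^ k"
    by (induction k) auto
  then have "real (m i) \<le> 2 ^ k" using mi by linarith
  have "\<bar>of_nat (m i) * mpow (m(i := m i - 1)) h\<bar> \<le> 2 ^ k * (\<rho> / 2) ^ k"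
    unfolding abs_mult using mpow_bound[of h "\<rho>/2" "m(i := m i - 1)"] assms \<open>real (m i) \<le> 2 ^ k\<close> k'
    by (intro mult_mono) auto
  also have "\<dots> = \<rho> ^ mdeg m / \<rho>" using assms(2) by (simp add: k power_divide)
  finally show ?thesis .
qed (use assms(2) in simp)

text \<open>A box instead of a ball: the series at the corner (\<rho>,...,\<rho>) dominates the
  series at every point of the box.\<close>

definition box_series :: "(real^'n::finite \<Rightarrow> complex) \<Rightarrow> real^'n \<Rightarrow> real \<Rightarrow> (('n \<Rightarrow> nat) \<Rightarrow> complex) \<Rightarrow> bool"
  where "box_series f x \<rho> c \<longleftrightarrow> \<rho> > 0 \<and> (\<lambda>m. norm (c m) * \<rho> ^ mdeg m) summable_on UNIV \<and>
    (\<forall>h. (\<forall>i. \<bar>h $ i\<bar> \<le> \<rho>) \<longrightarrow> ((\<lambda>m. c m * of_real (mpow m h)) has_sum f (x + h)) UNIV)"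

text \<open>For complex terms \<open>has_sum\<close> is absolute convergence, so evaluating the
  series at a corner of a box inside the ball already yields the majorant.\<close>

lemma real_analytic_at_iff_box_series:
  "real_analytic_at f x \<longleftrightarrow> (\<exists>\<rho> c. box_series f x \<rho> c)"
proof
  assume "real_analytic_at f x"
  then obtain r c where r: "r > 0" and
    c: "\<And>y. y \<in> ball x r \<Longrightarrow> ((\<lambda>m. c m * of_real (mpow m (y - x))) has_sum f y) UNIV"
    unfolding real_analytic_at_def mpow_def vector_minus_component by blast
  \<comment> \<open>The sum of the absolute values of the coordinates bounds the norm, so a box of
    this size fits into the ball; the factor 2 makes the inclusion strict.\<close>
  define \<rho> where "\<rho> = r / (2 * of_nat CARD('a))"
  have \<rho>: "\<rho> > 0" using r by (simp add: \<rho>_def)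
  have in_ball: "x + h \<in> ball x r" if "\<And>i. \<bar>h $ i\<bar> \<le> \<rho>" for h
  proof -
    have "norm h \<le> (\<Sum>i\<in>UNIV. \<bar>h $ i\<bar>)" by (rule norm_le_l1_cart)
    also have "\<dots> \<le> (\<Sum>i\<in>(UNIV::'a set). \<rho>)" by (intro sum_mono that)
    also have "\<dots> < r" using r by (simp add: \<rho>_def)
    finally show ?thesis by (simp add: dist_norm)
  qed
  have ser: "((\<lambda>m. c m * of_real (mpow m h)) has_sum f (x + h)) UNIV" if "\<And>i. \<bar>h $ i\<bar> \<le> \<rho>" for h
    using c[OF in_ball[OF that]] by simp
  have "(\<lambda>m. c m * of_real (mpow m (\<chi> i. \<rho>))) summable_on UNIV"
    using ser[of "\<chi> i. \<rho>"] \<rho> by (auto simp: summable_on_def)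
  then have "(\<lambda>m. norm (c m * of_real (mpow m (\<chi> i. \<rho>)))) summable_on UNIV"
    by (simp add: summable_on_iff_abs_summable_on_complex)
  moreover have "norm (c m * of_real (mpow m (\<chi> i. \<rho>))) = norm (c m) * \<rho> ^ mdeg m" for m
    using \<rho> by (simp add: norm_mult mpow_def mdeg_def power_sum prod_norm[symmetric] norm_power)
  ultimately have "box_series f x \<rho> c"
    unfolding box_series_def using \<rho> ser by simp
  then show "\<exists>\<rho> c. box_series f x \<rho> c" by blast
next
  assume "\<exists>\<rho> c. box_series f x \<rho> c"
  then obtain \<rho> c where *: "box_series f x \<rho> c" by blast
  show "real_analytic_at f x"
    unfolding real_analytic_at_def
  proof (intro exI conjI ballI)
    show "\<rho> > 0" using * by (simp add: box_series_def)
    fix y assume "y \<in> ball x \<rho>"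
    then have "\<bar>(y - x) $ i\<bar> \<le> \<rho>" for i
      using component_le_norm_cart[of "y - x" i] by (simp add: dist_norm norm_minus_commute)
    then show "((\<lambda>m. c m * of_real (\<Prod>i\<in>UNIV. (y $ i - x $ i) ^ m i)) has_sum f y) UNIV"
      using * unfolding box_series_def mpow_def by (auto dest!: spec[of _ "y - x"])
  qed
qed

lemma ex_multi_index_enumeration: "\<exists>e :: nat \<Rightarrow> ('n::finite \<Rightarrow> nat). bij e"
proof -
  have "infinite (UNIV :: ('n \<Rightarrow> nat) set)"
  proof
    assume "finite (UNIV :: ('n \<Rightarrow> nat) set)"
    then have "finite (range (\<lambda>k (_::'n). k::nat))" by (rule rev_finite_subset) auto
    then have "finite (UNIV :: nat set)"
      by (rule finite_imageD) (auto simp: inj_on_def fun_eq_iff)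
    then show False by simp
  qed
  then show ?thesis using bij_betw_from_nat_into[of "UNIV :: ('n \<Rightarrow> nat) set"] by auto
qed

lemma has_sum_enumerate_sums:
  assumes "bij (e :: nat \<Rightarrow> 'a)" "(f has_sum s) UNIV"
  shows "(\<lambda>n. f (e n)) sums s"
proof -
  have "((f \<circ> e) has_sum s) UNIV"
    using assms by (subst has_sum_reindex[symmetric]) (auto simp: bij_def)
  then show ?thesis using has_sum_imp_sums by (auto simp: o_def)
qed

lemma sums_tail_le:
  fixes t :: "nat \<Rightarrow> complex"
  assumes "t sums s" "\<And>n. norm (t n) \<le> b n" "summable b"
  shows "norm (sum t {..<N} - s) \<le> (\<Sum>n. b (n + N))"
proof -
  have sb: "summable (\<lambda>n. b (n + N))" using assms(3) by (simp add: summable_iff_shift)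
  have "(\<lambda>n. t (n + N)) sums (s - sum t {..<N})"
    using assms(1) by (rule sums_split_initial_segment)
  then have "norm (s - sum t {..<N}) = norm (\<Sum>n. t (n + N))" by (simp add: sums_iff)
  also have "\<dots> \<le> (\<Sum>n. norm (t (n + N)))"
    by (rule summable_norm, rule summable_comparison_test[OF _ sb]) (use assms(2) in auto)
  also have "\<dots> \<le> (\<Sum>n. b (n + N))"
    by (intro suminf_le summable_comparison_test[OF _ sb] sb) (use assms(2) in auto)
  finally show ?thesis by (simp add: norm_minus_commute)
qed

text \<open>Termwise differentiation through \<open>has_derivative_series\<close>. That theorem
  treats a sequence of functions on a convex set, hence the enumeration \<open>e\<close> of the
  multi-indices and the closed box \<open>S\<close> of half size, on which \<open>b\<close> is a
  uniform majorant of the differentiated terms.\<close>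

lemma box_series_derivative:
  fixes f :: "real^'n::finite \<Rightarrow> complex"
  assumes f: "box_series f x \<rho> c"
  obtains G where
    "\<And>i h. (\<And>j. \<bar>h $ j\<bar> \<le> \<rho> / 2) \<Longrightarrow>
       ((\<lambda>m. c m * of_real (of_nat (m i) * mpow (m(i := m i - 1)) h)) has_sum G i h) UNIV"
    "\<And>h. (\<And>j. \<bar>h $ j\<bar> < \<rho> / 2) \<Longrightarrow>
       (f has_derivative (\<lambda>k. \<Sum>i\<in>UNIV. of_real (k $ i) * G i h)) (at (x + h))"
proof -
  have \<rho>: "\<rho> > 0" and cs: "(\<lambda>m. norm (c m) * \<rho> ^ mdeg m) summable_on UNIV"
    and fs: "\<And>h. (\<And>i. \<bar>h $ i\<bar> \<le> \<rho>) \<Longrightarrow> ((\<lambda>m. c m * of_real (mpow m h)) has_sum f (x + h)) UNIV"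
    using f by (auto simp: box_series_def)
  define T where "T i h m = c m * of_real (of_nat (m i) * mpow (m(i := m i - 1)) h)" for i m and h :: "real^'n"
  define G where "G i h = infsum (T i h) UNIV" for i h
  define b where "b m = norm (c m) * \<rho> ^ mdeg m / \<rho>" for m
  have Tb: "norm (T i h m) \<le> b m" if "\<And>j. \<bar>h $ j\<bar> \<le> \<rho> / 2" for i h m
  proof -
    have "norm (T i h m) = norm (c m) * \<bar>of_nat (m i) * mpow (m(i := m i - 1)) h\<bar>"
      unfolding T_def norm_mult norm_of_real ..
    also have "\<dots> \<le> norm (c m) * (\<rho> ^ mdeg m / \<rho>)"
      by (intro mult_left_mono mpow_pderiv_bound that \<rho>) auto
    finally show ?thesis by (simp add: b_def)
  qed
  have bs: "b summable_on UNIV"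
    unfolding b_def divide_inverse by (intro summable_on_cmult_left cs)
  have Ts: "(T i h has_sum G i h) UNIV" if "\<And>j. \<bar>h $ j\<bar> \<le> \<rho> / 2" for i h
  proof -
    have "(\<lambda>m. norm (T i h m)) summable_on UNIV"
      by (rule summable_on_comparison_test[OF bs]) (use Tb[OF that] in auto)
    then show ?thesis unfolding G_def
      by (intro has_sum_infsum) (simp add: summable_on_iff_abs_summable_on_complex)
  qed
  obtain e :: "nat \<Rightarrow> ('n \<Rightarrow> nat)" where e: "bij e" using ex_multi_index_enumeration by blast
  have bsum: "summable (\<lambda>n. b (e n))"
    using has_sum_enumerate_sums[OF e, of b] has_sum_infsum[OF bs] by (auto simp: sums_iff)
  define S :: "(real^'n) set" where "S = {h. \<forall>j. \<bar>h $ j\<bar> \<le> \<rho> / 2}"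
  define f' where "f' n h k = (\<Sum>i\<in>UNIV. of_real (k $ i) * T i h (e n))" for n and h k :: "real^'n"
  define g' where "g' h k = (\<Sum>i\<in>UNIV. of_real (k $ i) * G i h)" for h k :: "real^'n"
  have convS: "convex S"
    unfolding convex_def
  proof (intro ballI allI impI)
    fix u v and a b' :: real assume *: "u \<in> S" "v \<in> S" "0 \<le> a" "0 \<le> b'" "a + b' = 1"
    have "\<bar>a * u $ j + b' * v $ j\<bar> \<le> \<rho> / 2" for j
    proof -
      have "\<bar>a * u $ j + b' * v $ j\<bar> \<le> a * \<bar>u $ j\<bar> + b' * \<bar>v $ j\<bar>"
        using * by (metis abs_mult abs_of_nonneg abs_triangle_ineq)
      also have "\<dots> \<le> a * (\<rho> / 2) + b' * (\<rho> / 2)"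
        using * by (intro add_mono mult_left_mono) (auto simp: S_def)
      also have "\<dots> = \<rho> / 2" using * by (metis distrib_right mult_1)
      finally show ?thesis .
    qed
    then show "a *\<^sub>R u + b' *\<^sub>R v \<in> S" by (simp add: S_def)
  qed
  have "\<exists>g. \<forall>h\<in>S. (\<lambda>n. c (e n) * of_real (mpow (e n) h)) sums g h \<and> (g has_derivative g' h) (at h within S)"
  proof (rule has_derivative_series[OF convS, where f' = f'])
    fix n h assume "h \<in> S"
    have "((\<lambda>h. c (e n) * of_real (mpow (e n) h)) has_derivative
      (\<lambda>k. c (e n) * of_real (\<Sum>i\<in>UNIV. k $ i * (of_nat (e n i) * mpow ((e n)(i := e n i - 1)) h)))) (at h within S)"
      by (intro has_derivative_mult_right has_derivative_of_real has_derivative_at_withinI[OF mpow_has_derivative])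
    then show "((\<lambda>h. c (e n) * of_real (mpow (e n) h)) has_derivative f' n h) (at h within S)"
      unfolding f'_def T_def by (simp add: sum_distrib_left mult.left_commute mult.assoc)
  next
    fix \<epsilon> :: real assume \<epsilon>: "\<epsilon> > 0"
    define N where "N = real CARD('n)"
    have N: "N > 0" by (simp add: N_def)
    obtain K where K: "\<And>n. n \<ge> K \<Longrightarrow> norm (\<Sum>i. b (e (i + n))) < \<epsilon> / N"
      using suminf_exist_split[OF _ bsum, of "\<epsilon> / N"] \<epsilon> N by auto
    show "\<forall>\<^sub>F n in sequentially. \<forall>h\<in>S. \<forall>k. norm (sum (\<lambda>i. f' i h k) {..<n} - g' h k) \<le> \<epsilon> * norm k"
      unfolding eventually_sequentially
    proof (intro exI[of _ K] allI impI ballI)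
      fix n h k assume n: "K \<le> n" and h: "h \<in> S"
      then have h': "\<And>j. \<bar>h $ j\<bar> \<le> \<rho> / 2" by (auto simp: S_def)
      have tail: "norm (sum (\<lambda>l. T i h (e l)) {..<n} - G i h) \<le> \<epsilon> / N" for i
      proof -
        have "norm (sum (\<lambda>l. T i h (e l)) {..<n} - G i h) \<le> (\<Sum>l. b (e (l + n)))"
          by (rule sums_tail_le[OF has_sum_enumerate_sums[OF e Ts[OF h']] Tb[OF h'] bsum])
        also have "\<dots> \<le> \<epsilon> / N" using K[OF n] by simp
        finally show ?thesis .
      qed
      have "sum (\<lambda>l. f' l h k) {..<n} - g' h k
          = (\<Sum>i\<in>UNIV. of_real (k $ i) * (sum (\<lambda>l. T i h (e l)) {..<n} - G i h))"
        unfolding f'_def g'_def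
        by (subst sum.swap) (simp add: sum_subtractf right_diff_distrib sum_distrib_left)
      also have "norm \<dots> \<le> (\<Sum>i\<in>UNIV. norm (of_real (k $ i) * (sum (\<lambda>l. T i h (e l)) {..<n} - G i h)))"
        by (rule norm_sum)
      also have "\<dots> \<le> (\<Sum>i\<in>(UNIV::'n set). norm k * (\<epsilon> / N))"
        unfolding norm_mult norm_of_real
        by (intro sum_mono mult_mono tail component_le_norm_cart) auto
      also have "\<dots> = \<epsilon> * norm k" using N by (simp add: N_def)
      finally show "norm (sum (\<lambda>i. f' i h k) {..<n} - g' h k) \<le> \<epsilon> * norm k" .
    qed
  next
    show "0 \<in> S" using \<rho> by (simp add: S_def)
    show "(\<lambda>n. c (e n) * of_real (mpow (e n) 0)) sums f (x + 0)"
      by (rule has_sum_enumerate_sums[OF e fs]) (use \<rho> in auto)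
  qed
  then obtain g where g: "\<And>h. h \<in> S \<Longrightarrow> (\<lambda>n. c (e n) * of_real (mpow (e n) h)) sums g h"
    "\<And>h. h \<in> S \<Longrightarrow> (g has_derivative g' h) (at h within S)" by blast
  have gf: "g h = f (x + h)" if "h \<in> S" for h
  proof -
    have "\<bar>h $ i\<bar> \<le> \<rho>" for i using that \<rho> by (auto simp: S_def dest: spec[of _ i])
    then show ?thesis
      using g(1)[OF that] has_sum_enumerate_sums[OF e fs] sums_unique2 by blast
  qed
  show thesis
  proof
    show "((\<lambda>m. c m * of_real (of_nat (m i) * mpow (m(i := m i - 1)) h)) has_sum G i h) UNIV"
      if "\<And>j. \<bar>h $ j\<bar> \<le> \<rho> / 2" for i h
      using Ts[OF that] unfolding T_def .
    fix h :: "real^'n" assume h: "\<And>j. \<bar>h $ j\<bar> < \<rho> / 2"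
    \<comment> \<open>A derivative within the closed box is a full derivative only at interior
      points.\<close>
    define B where "B = {h :: real^'n. \<forall>j. \<bar>h $ j\<bar> < \<rho> / 2}"
    have "open B"
    proof -
      have "B = (\<Inter>j. {h. \<bar>h $ j\<bar> < \<rho> / 2})" by (auto simp: B_def)
      moreover have "open {h :: real^'n. \<bar>h $ j\<bar> < \<rho> / 2}" for j
        by (intro open_Collect_less continuous_intros)
      ultimately show ?thesis by auto
    qed
    moreover have "h \<in> B" "B \<subseteq> S" using h by (auto simp: B_def S_def less_imp_le)
    ultimately have "(g has_derivative g' h) (at h)"
      using g(2)[of h] by (metis at_within_open has_derivative_subset subsetD)
    then have "((\<lambda>h. f (x + h)) has_derivative g' h) (at h)"
      by (rule has_derivative_transform_within_open[OF _ \<open>open B\<close> \<open>h \<in> B\<close>])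
         (use gf \<open>B \<subseteq> S\<close> in auto)
    then have "((\<lambda>h. f (x + h)) \<circ> (\<lambda>y. y - x) has_derivative g' h \<circ> (\<lambda>k. k)) (at (x + h))"
      by (intro diff_chain_at) (auto intro!: derivative_eq_intros)
    then show "(f has_derivative (\<lambda>k. \<Sum>i\<in>UNIV. of_real (k $ i) * G i h)) (at (x + h))"
      by (simp add: o_def g'_def[abs_def])
  qed
qed

text \<open>The coefficients of the series differentiated in direction i, reindexed so that they
  belong to the monomials again.\<close>

definition shift_coeffs :: "'n \<Rightarrow> (('n \<Rightarrow> nat) \<Rightarrow> complex) \<Rightarrow> ('n \<Rightarrow> nat) \<Rightarrow> complex"
  where "shift_coeffs i c m = c (m(i := m i + 1)) * of_nat (m i + 1)"

lemma pderiv_at_eq: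
  assumes "(f has_derivative f') (at x)"
  shows "pderiv_at i f x = f' (stdvec i)"
  using frechet_derivative_at[OF assms] by (simp add: pderiv_at_def)

text \<open>The radius drops to a third because a closed box is wanted inside the open box of radius
  \<rho>/2 on which the derivative is known.\<close>

lemma box_series_pderiv:
  fixes f :: "real^'n::finite \<Rightarrow> complex"
  assumes f: "box_series f x \<rho> c"
  shows "\<And>h. (\<And>j. \<bar>h $ j\<bar> < \<rho> / 2) \<Longrightarrow> f differentiable (at (x + h))"
    and "box_series (pderiv_at i f) x (\<rho> / 3) (shift_coeffs i c)"
proof -
  obtain G where G1: "\<And>i h. (\<And>j. \<bar>h $ j\<bar> \<le> \<rho> / 2) \<Longrightarrow>
       ((\<lambda>m. c m * of_real (of_nat (m i) * mpow (m(i := m i - 1)) h)) has_sum G i h) UNIV"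
    and G2: "\<And>h. (\<And>j. \<bar>h $ j\<bar> < \<rho> / 2) \<Longrightarrow>
       (f has_derivative (\<lambda>k. \<Sum>i\<in>UNIV. of_real (k $ i) * G i h)) (at (x + h))"
    using box_series_derivative[OF f] by blast
  have \<rho>: "\<rho> > 0" using f by (simp add: box_series_def)
  show "f differentiable (at (x + h))" if "\<And>j. \<bar>h $ j\<bar> < \<rho> / 2" for h
    using G2[OF that] by (auto simp: differentiable_def)
  have pd: "pderiv_at i f (x + h) = G i h" if "\<And>j. \<bar>h $ j\<bar> < \<rho> / 2" for h
  proof -
    have "pderiv_at i f (x + h) = (\<Sum>j\<in>UNIV. of_real (stdvec i $ j) * G j h)"
      by (rule pderiv_at_eq[OF G2[OF that]])
    also have "\<dots> = (\<Sum>j\<in>UNIV. if j = i then G j h else 0)"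
      by (intro sum.cong) (auto simp: axis_def)
    finally show ?thesis by simp
  qed
  have inj: "inj (\<lambda>m. m(i := m i + (1::nat)))"
  proof (rule injI)
    fix m m' :: "'n \<Rightarrow> nat" assume eq: "m(i := m i + 1) = m'(i := m' i + 1)"
    have "m j = m' j" for j using fun_cong[OF eq, of j] by (cases "j = i") auto
    then show "m = m'" by auto
  qed
  have img: "range (\<lambda>m. m(i := m i + (1::nat))) = {m. m i \<noteq> 0}"
  proof -
    have "m \<in> range (\<lambda>m. m(i := m i + (1::nat)))" if "m i \<noteq> 0" for m
      using that by (intro image_eqI[of _ _ "m(i := m i - 1)"]) auto
    then show ?thesis by auto
  qed
  have ser: "((\<lambda>m. shift_coeffs i c m * of_real (mpow m h)) has_sum G i h) UNIV"
    if "\<And>j. \<bar>h $ j\<bar> \<le> \<rho> / 2" for h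
  proof -
    have "((\<lambda>m. c m * of_real (of_nat (m i) * mpow (m(i := m i - 1)) h)) has_sum G i h)
            (range (\<lambda>m. m(i := m i + (1::nat))))"
      using G1[OF that] unfolding img
      by (rule has_sum_cong_neutral[THEN iffD1, rotated -1]) auto
    then have "((\<lambda>m. c m * of_real (of_nat (m i) * mpow (m(i := m i - 1)) h)) \<circ> (\<lambda>m. m(i := m i + (1::nat))) has_sum G i h) UNIV"
      by (subst has_sum_reindex[symmetric, OF inj])
    then show ?thesis by (simp add: o_def shift_coeffs_def mult.assoc)
  qed
  have "(\<lambda>m. shift_coeffs i c m * of_real (mpow m (\<chi> j. \<rho> / 3))) summable_on UNIV"
    using ser[of "\<chi> j. \<rho> / 3"] \<rho> by (auto simp: summable_on_def)
  then have "(\<lambda>m. norm (shift_coeffs i c m * of_real (mpow m (\<chi> j. \<rho> / 3)))) summable_on UNIV"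
    by (simp add: summable_on_iff_abs_summable_on_complex)
  moreover have "norm (shift_coeffs i c m * of_real (mpow m (\<chi> j. \<rho> / 3))) = norm (shift_coeffs i c m) * (\<rho> / 3) ^ mdeg m" for m
    using \<rho> by (simp add: norm_mult mpow_def mdeg_def power_sum prod_norm[symmetric] norm_power norm_divide del: power_divide)
  ultimately have "(\<lambda>m. norm (shift_coeffs i c m) * (\<rho> / 3) ^ mdeg m) summable_on UNIV" by simp
  moreover have "((\<lambda>m. shift_coeffs i c m * of_real (mpow m h)) has_sum pderiv_at i f (x + h)) UNIV"
    if "\<And>j. \<bar>h $ j\<bar> \<le> \<rho> / 3" for h
  proof -
    have *: "\<bar>h $ j\<bar> < \<rho> / 2" for j using that[of j] \<rho> by linarith
    show ?thesis using ser[of h] pd[of h] * by (simp add: less_imp_le)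
  qed
  ultimately show "box_series (pderiv_at i f) x (\<rho> / 3) (shift_coeffs i c)"
    unfolding box_series_def using \<rho> by simp
qed

lemma box_series_center:
  assumes "box_series f x \<rho> c"
  shows "f x = c (\<lambda>_. 0)"
proof -
  have "((\<lambda>m. c m * of_real (mpow m 0)) has_sum f (x + 0)) UNIV"
    using assms unfolding box_series_def
    by (elim conjE, elim allE[of _ 0]) auto
  moreover have "mpow m 0 = (if m = (\<lambda>_. 0) then 1 else 0)" for m :: "'a \<Rightarrow> nat"
    by (auto simp: mpow_def fun_eq_iff prod_zero_iff)
  ultimately have "((\<lambda>m. c m * of_real (if m = (\<lambda>_. 0) then 1 else 0)) has_sum f x) UNIV" by simp
  moreover have "((\<lambda>m. c m * of_real (if m = (\<lambda>_. 0) then 1 else 0)) has_sum c (\<lambda>_. 0)) UNIV"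
    by (rule has_sum_finite_neutralI[of "{\<lambda>_. 0}"]) auto
  ultimately show ?thesis by (rule has_sum_unique)
qed

lemma real_analytic_at_differentiable: "real_analytic_at f x \<Longrightarrow> f differentiable (at x)"
  unfolding real_analytic_at_iff_box_series
  using box_series_pderiv(1)[of f x _ _ 0] by (auto simp: box_series_def)

lemma real_analytic_at_pderiv: "real_analytic_at f x \<Longrightarrow> real_analytic_at (pderiv_at i f) x"
  unfolding real_analytic_at_iff_box_series using box_series_pderiv(2) by blast

text \<open>Either mixed derivative at the centre is the constant coefficient of a twice shifted
  series, and shifts in two indices commute.\<close>

lemma real_analytic_at_pderiv_commute:
  assumes "real_analytic_at f x"
  shows "pderiv_at i (pderiv_at j f) x = pderiv_at j (pderiv_at i f) x"
proof -
  obtain \<rho> c where c: "box_series f x \<rho> c"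
    using assms unfolding real_analytic_at_iff_box_series by blast
  have "pderiv_at i (pderiv_at j f) x = shift_coeffs i (shift_coeffs j c) (\<lambda>_. 0)" for i j
    by (rule box_series_center[OF box_series_pderiv(2)[OF box_series_pderiv(2)[OF c]]])
  then show ?thesis by (cases "i = j") (auto simp: shift_coeffs_def fun_upd_twist)
qed

text \<open>Replacing the real parameter by a complex z in every monomial gives a series of
  polynomials in z. The Weierstrass test with the majorant of the box makes its sum
  holomorphic.\<close>

lemma real_analytic_at_line:
  assumes "real_analytic_at f x"
  shows "analytic1_at (\<lambda>t. f (x + t *\<^sub>R v)) 0"
proof -
  obtain \<rho> c where f: "box_series f x \<rho> c"
    using assms unfolding real_analytic_at_iff_box_series by blast
  have \<rho>: "\<rho> > 0" and cs: "(\<lambda>m. norm (c m) * \<rho> ^ mdeg m) summable_on UNIV"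
    and fs: "\<And>h. (\<And>i. \<bar>h $ i\<bar> \<le> \<rho>) \<Longrightarrow> ((\<lambda>m. c m * of_real (mpow m h)) has_sum f (x + h)) UNIV"
    using f by (auto simp: box_series_def)
  \<comment> \<open>The summand 1 covers v = 0.\<close>
  define \<epsilon> where "\<epsilon> = \<rho> / (norm v + 1)"
  have \<epsilon>: "\<epsilon> > 0" using \<rho> by (simp add: \<epsilon>_def add_nonneg_pos)
  have small: "\<bar>(s *\<^sub>R v) $ i\<bar> \<le> \<rho>" if "\<bar>s\<bar> \<le> \<epsilon>" for s i
  proof -
    have "\<bar>s\<bar> * \<bar>v $ i\<bar> \<le> \<epsilon> * (norm v + 1)"
      using that \<epsilon> component_le_norm_cart[of v i] by (intro mult_mono) auto
    also have "\<dots> = \<rho>" by (simp add: \<epsilon>_def add_nonneg_pos less_imp_neq[symmetric])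
    finally show ?thesis by (simp add: abs_mult)
  qed
  obtain e :: "nat \<Rightarrow> ('a \<Rightarrow> nat)" where e: "bij e" using ex_multi_index_enumeration by blast
  have bsum: "summable (\<lambda>n. norm (c (e n)) * \<rho> ^ mdeg (e n))"
    using has_sum_enumerate_sums[OF e has_sum_infsum[OF cs]] by (auto simp: sums_iff)
  define T where "T n z = c (e n) * of_real (mpow (e n) v) * z ^ mdeg (e n)" for n and z :: complex
  have Tb: "norm (T n z) \<le> norm (c (e n)) * \<rho> ^ mdeg (e n)" if "z \<in> ball 0 \<epsilon>" for n z
  proof -
    have "norm (T n z) = norm (c (e n)) * \<bar>mpow (e n) (norm z *\<^sub>R v)\<bar>"
      by (simp add: T_def norm_mult mpow_scaleR norm_power abs_mult)
    also have "\<dots> \<le> norm (c (e n)) * \<rho> ^ mdeg (e n)"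
      using that by (intro mult_left_mono mpow_bound small) auto
    finally show ?thesis .
  qed
  have ul: "uniform_limit (ball 0 \<epsilon>) (\<lambda>n z. \<Sum>i<n. T i z) (\<lambda>z. \<Sum>i. T i z) sequentially"
    by (rule Weierstrass_m_test[OF Tb bsum])
  have "(\<lambda>z. \<Sum>i. T i z) holomorphic_on ball 0 \<epsilon>"
  proof (rule holomorphic_uniform_sequence[OF open_ball])
    show "(\<lambda>z. \<Sum>i<n. T i z) holomorphic_on ball 0 \<epsilon>" for n
      unfolding T_def by (intro holomorphic_intros)
    fix z :: complex assume "z \<in> ball 0 \<epsilon>"
    then obtain d where "d > 0" "cball z d \<subseteq> ball 0 \<epsilon>"
      using open_contains_cball[of "ball (0::complex) \<epsilon>"] open_ball by blast
    then show "\<exists>d>0. cball z d \<subseteq> ball 0 \<epsilon> \<and>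
        uniform_limit (cball z d) (\<lambda>n z. \<Sum>i<n. T i z) (\<lambda>z. \<Sum>i. T i z) sequentially"
      using uniform_limit_on_subset[OF ul] by blast
  qed
  then have "(\<lambda>z. \<Sum>i. T i z) analytic_on {of_real 0}"
    using \<epsilon> by (auto simp: analytic_at_ball)
  moreover have "f (x + s *\<^sub>R v) = (\<Sum>i. T i (of_real s))" if "\<bar>s\<bar> < \<epsilon>" for s
  proof -
    have "(\<lambda>n. c (e n) * of_real (mpow (e n) (s *\<^sub>R v))) sums f (x + s *\<^sub>R v)"
      by (rule has_sum_enumerate_sums[OF e fs]) (use that in \<open>auto intro: small[simplified]\<close>)
    then show ?thesis
      by (simp add: T_def mpow_scaleR sums_iff mult_ac)
  qed
  then have "\<forall>\<^sub>F s in nhds 0. f (x + s *\<^sub>R v) = (\<Sum>i. T i (of_real s))"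
    using \<epsilon> unfolding eventually_nhds_metric by (auto simp: dist_real_def)
  ultimately show ?thesis by (rule analytic1_atI)
qed

subsection \<open>Directional derivatives\<close>

text \<open>Defined through partial derivatives, so that linearity in the direction needs no
  differentiability.\<close>

definition dd :: "real^'n::finite \<Rightarrow> (real^'n \<Rightarrow> complex) \<Rightarrow> real^'n \<Rightarrow> complex"
  where "dd v f x = (\<Sum>i\<in>UNIV. of_real (v $ i) * pderiv_at i f x)"

lemma has_derivative_dd:
  assumes "f differentiable (at x)"
  shows "(f has_derivative (\<lambda>v. dd v f x)) (at x)"
proof -
  obtain f' where f': "(f has_derivative f') (at x)" using assms by (auto simp: differentiable_def)
  interpret linear f' using f' by (rule has_derivative_linear)
  have "f' v = dd v f x" for v
  proof -
    have "f' v = f' (\<Sum>i\<in>UNIV. v $ i *\<^sub>R axis i 1)"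
      using basis_expansion[of v] by (simp add: scalar_mult_eq_scaleR)
    also have "\<dots> = (\<Sum>i\<in>UNIV. of_real (v $ i) * f' (axis i 1))"
      by (simp add: sum scaleR scaleR_conv_of_real[where ?'a = complex])
    finally show ?thesis by (simp add: dd_def pderiv_at_eq[OF f'])
  qed
  then have "f' = (\<lambda>v. dd v f x)" by auto
  with f' show ?thesis by simp
qed

lemma dd_eq:
  assumes "(f has_derivative f') (at x)"
  shows "dd v f x = f' v"
proof -
  have "(f has_derivative (\<lambda>v. dd v f x)) (at x)"
    using assms by (intro has_derivative_dd) (auto simp: differentiable_def)
  then show ?thesis using has_derivative_unique[OF _ assms] by metis
qed

lemma dd_stdvec [simp]: "dd (stdvec i) f x = pderiv_at i f x"
  by (simp add: dd_def axis_def if_distrib[of "\<lambda>a. of_real a * _"] cong: if_cong)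

lemma dd_add_left: "dd (v + w) f x = dd v f x + dd w f x"
  by (simp add: dd_def sum.distrib distrib_right)

lemma dd_scaleR_left: "dd (a *\<^sub>R v) f x = of_real a * dd v f x"
  by (simp add: dd_def sum_distrib_left mult.assoc)

lemma dd_minus_left: "dd (- v) f x = - dd v f x"
  using dd_scaleR_left[of "-1" v f x] by simp

lemma dd_sum_left: "dd (\<Sum>i\<in>A. v i) f x = (\<Sum>i\<in>A. dd (v i) f x)"
  by (induction A rule: infinite_finite_induct) (auto simp: dd_add_left, simp_all add: dd_def)

lemma dd_cong:
  assumes "open \<Omega>" "x \<in> \<Omega>" "\<And>y. y \<in> \<Omega> \<Longrightarrow> f y = g y"
  shows "dd v f x = dd v g x"
proof -
  have "(f has_derivative f') (at x) \<longleftrightarrow> (g has_derivative f') (at x)" for f'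
    using assms has_derivative_transform_within_open by metis
  then have "frechet_derivative f (at x) = frechet_derivative g (at x)"
    unfolding frechet_derivative_def by simp
  then show ?thesis by (simp add: dd_def pderiv_at_def)
qed

lemma pderiv_at_cong:
  assumes "open \<Omega>" "x \<in> \<Omega>" "\<And>y. y \<in> \<Omega> \<Longrightarrow> f y = g y"
  shows "pderiv_at i f x = pderiv_at i g x"
  using dd_cong[OF assms, where v = "stdvec i"] by simp

lemma differentiable_cong_open:
  assumes "open \<Omega>" "x \<in> \<Omega>" "\<And>y. y \<in> \<Omega> \<Longrightarrow> f y = g y" "g differentiable (at x)"
  shows "f differentiable (at x)"
  using assms has_derivative_transform_within_open[of g _ x UNIV \<Omega> f] unfolding differentiable_def by metis

lemma dd_const [simp]: "dd v (\<lambda>_. c) x = 0"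
  by (simp add: dd_eq[OF has_derivative_const])

lemma dd_add:
  "f differentiable (at x) \<Longrightarrow> g differentiable (at x) \<Longrightarrow> dd v (\<lambda>x. f x + g x) x = dd v f x + dd v g x"
  by (rule dd_eq) (intro has_derivative_add has_derivative_dd)

lemma dd_diff:
  "f differentiable (at x) \<Longrightarrow> g differentiable (at x) \<Longrightarrow> dd v (\<lambda>x. f x - g x) x = dd v f x - dd v g x"
  by (rule dd_eq) (intro has_derivative_diff has_derivative_dd)

lemma dd_minus:
  "f differentiable (at x) \<Longrightarrow> dd v (\<lambda>x. - f x) x = - dd v f x"
  by (rule dd_eq) (intro has_derivative_minus has_derivative_dd)

lemma dd_mult:
  "f differentiable (at x) \<Longrightarrow> g differentiable (at x) \<Longrightarrow>
    dd v (\<lambda>x. f x * g x) x = dd v f x * g x + f x * dd v g x"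
  by (subst dd_eq[OF has_derivative_mult[OF has_derivative_dd has_derivative_dd]]) auto

lemma dd_cmult:
  "f differentiable (at x) \<Longrightarrow> dd v (\<lambda>x. c * f x) x = c * dd v f x"
  by (simp add: dd_mult)

lemma dd_sum:
  "(\<And>i. i \<in> A \<Longrightarrow> f i differentiable (at x)) \<Longrightarrow> dd v (\<lambda>x. \<Sum>i\<in>A. f i x) x = (\<Sum>i\<in>A. dd v (f i) x)"
  by (rule dd_eq) (intro has_derivative_sum has_derivative_dd)

lemma has_vector_derivative_line:
  assumes "f differentiable (at (x + t *\<^sub>R v))"
  shows "((\<lambda>s. f (x + s *\<^sub>R v)) has_vector_derivative dd v f (x + t *\<^sub>R v)) (at t)"
proof -
  have "((f \<circ> (\<lambda>s. x + s *\<^sub>R v)) has_derivative (\<lambda>w. dd w f (x + t *\<^sub>R v)) \<circ> (\<lambda>s. s *\<^sub>R v)) (at t)"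
    by (rule diff_chain_at) (auto intro!: derivative_eq_intros has_derivative_dd assms)
  then show ?thesis
    by (simp add: o_def has_vector_derivative_def dd_scaleR_left scaleR_conv_of_real[where ?'a = complex])
qed

subsection \<open>Smooth functions that are analytic along lines\<close>

text \<open>
  Real analytic functions and the singular terms of the potential both belong to this class,
  which spares us the multivariate power series expansion of the latter.
\<close>

coinductive line_analytic :: "(real^'n::finite) set \<Rightarrow> (real^'n \<Rightarrow> complex) \<Rightarrow> bool" for \<Omega>
  where line_analyticI: "\<lbrakk>\<And>x. x \<in> \<Omega> \<Longrightarrow> f differentiable (at x);
    \<And>x i j. x \<in> \<Omega> \<Longrightarrow> pderiv_at i (pderiv_at j f) x = pderiv_at j (pderiv_at i f) x;
    \<And>x v. x \<in> \<Omega> \<Longrightarrow> analytic1_at (\<lambda>t. f (x + t *\<^sub>R v)) 0;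
    \<And>i. line_analytic \<Omega> (pderiv_at i f)\<rbrakk> \<Longrightarrow> line_analytic \<Omega> f"

lemma line_analytic_differentiable: "line_analytic \<Omega> f \<Longrightarrow> x \<in> \<Omega> \<Longrightarrow> f differentiable (at x)"
  by (auto elim: line_analytic.cases)

lemma line_analytic_pderiv: "line_analytic \<Omega> f \<Longrightarrow> line_analytic \<Omega> (pderiv_at i f)"
  by (auto elim: line_analytic.cases)

lemma line_analytic_pderiv_commute:
  "line_analytic \<Omega> f \<Longrightarrow> x \<in> \<Omega> \<Longrightarrow> pderiv_at i (pderiv_at j f) x = pderiv_at j (pderiv_at i f) x"
  by (auto elim: line_analytic.cases)

lemma line_analytic_line0: "line_analytic \<Omega> f \<Longrightarrow> x \<in> \<Omega> \<Longrightarrow> analytic1_at (\<lambda>t. f (x + t *\<^sub>R v)) 0"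
  by (auto elim: line_analytic.cases)

lemma line_analytic_line:
  assumes "line_analytic \<Omega> f" "x + t *\<^sub>R v \<in> \<Omega>"
  shows "analytic1_at (\<lambda>t. f (x + t *\<^sub>R v)) t"
proof -
  have "analytic1_at (\<lambda>s. f ((x + t *\<^sub>R v) + s *\<^sub>R v)) (- t + 1 * t)"
    using line_analytic_line0[OF assms] by simp
  then have "analytic1_at (\<lambda>s. f ((x + t *\<^sub>R v) + (- t + 1 * s) *\<^sub>R v)) t"
    by (rule analytic1_at_shift)
  then show ?thesis by (simp add: algebra_simps)
qed

lemma line_analytic_subset: "line_analytic \<Omega> f \<Longrightarrow> \<Omega>' \<subseteq> \<Omega> \<Longrightarrow> line_analytic \<Omega>' f"
proof (coinduction arbitrary: f)
  case line_analytic
  then show ?case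
    by (auto intro: line_analytic_differentiable line_analytic_pderiv_commute line_analytic_line0 line_analytic_pderiv)
qed

text \<open>The coinduction invariant asks for agreement on \<Omega> only. As \<Omega> is open, the
  agreement passes to partial derivatives, and the case a = 1, b = 0 gives the congruence
  rule.\<close>

lemma line_analytic_lincomb:
  assumes "open \<Omega>" "line_analytic \<Omega> f" "line_analytic \<Omega> g" "\<And>x. x \<in> \<Omega> \<Longrightarrow> h x = a * f x + b * g x"
  shows "line_analytic \<Omega> h"
proof -
  have "\<exists>f g. line_analytic \<Omega> f \<and> line_analytic \<Omega> g \<and> (\<forall>x\<in>\<Omega>. h x = a * f x + b * g x)"
    using assms by blast
  then show ?thesis
  proof (coinduction arbitrary: h)
    case (line_analytic h)
    then obtain f g where f: "line_analytic \<Omega> f" and g: "line_analytic \<Omega> g"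
      and h: "\<And>x. x \<in> \<Omega> \<Longrightarrow> h x = a * f x + b * g x" by blast
    note diff = line_analytic_differentiable
    have pd: "pderiv_at i h x = a * pderiv_at i f x + b * pderiv_at i g x"
      if fg: "line_analytic \<Omega> f" "line_analytic \<Omega> g" and h: "\<And>x. x \<in> \<Omega> \<Longrightarrow> h x = a * f x + b * g x"
        and "x \<in> \<Omega>" for f g h x i
    proof -
      have "dd (stdvec i) h x = dd (stdvec i) (\<lambda>x. a * f x + b * g x) x"
        by (rule dd_cong[OF assms(1) \<open>x \<in> \<Omega>\<close> h])
      also have "\<dots> = a * dd (stdvec i) f x + b * dd (stdvec i) g x"
        using diff[OF fg(1) \<open>x \<in> \<Omega>\<close>] diff[OF fg(2) \<open>x \<in> \<Omega>\<close>] by (simp add: dd_add dd_cmult del: dd_stdvec)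
      finally show ?thesis by simp
    qed
    have pd1: "pderiv_at i h x = a * pderiv_at i f x + b * pderiv_at i g x" if "x \<in> \<Omega>" for x i
      by (rule pd[OF f g h that])
    have pd2: "pderiv_at j (pderiv_at i h) x = a * pderiv_at j (pderiv_at i f) x + b * pderiv_at j (pderiv_at i g) x"
      if "x \<in> \<Omega>" for x i j
      by (rule pd[OF line_analytic_pderiv[OF f] line_analytic_pderiv[OF g] pd1 that])
    have "h differentiable (at x)" if "x \<in> \<Omega>" for x
      by (rule differentiable_cong_open[OF assms(1) that h])
         (use diff[OF f that] diff[OF g that] in \<open>auto intro!: derivative_intros\<close>)
    moreover have "pderiv_at i (pderiv_at j h) x = pderiv_at j (pderiv_at i h) x" if "x \<in> \<Omega>" for x i j
      using that line_analytic_pderiv_commute[OF f] line_analytic_pderiv_commute[OF g] by (simp add: pd2)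
    moreover have "analytic1_at (\<lambda>t. h (x + t *\<^sub>R v)) 0" if "x \<in> \<Omega>" for x v
    proof (rule analytic1_at_cong)
      show "analytic1_at (\<lambda>t. a * f (x + t *\<^sub>R v) + b * g (x + t *\<^sub>R v)) 0"
        using line_analytic_line0[OF f that] line_analytic_line0[OF g that] by auto
      have "((\<lambda>t. x + t *\<^sub>R v) \<longlongrightarrow> x + 0 *\<^sub>R v) (nhds 0)" by (intro tendsto_intros filterlim_ident)
      then have "\<forall>\<^sub>F t in nhds 0. x + t *\<^sub>R v \<in> \<Omega>"
        using assms(1) that topological_tendstoD by fastforce
      then show "\<forall>\<^sub>F t in nhds 0. h (x + t *\<^sub>R v) = a * f (x + t *\<^sub>R v) + b * g (x + t *\<^sub>R v)"
        by eventually_elim (rule h)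
    qed
    moreover have "\<exists>f g. line_analytic \<Omega> f \<and> line_analytic \<Omega> g \<and> (\<forall>x\<in>\<Omega>. pderiv_at i h x = a * f x + b * g x)" for i
      using line_analytic_pderiv[OF f] line_analytic_pderiv[OF g] pd1 by blast
    ultimately show ?case by auto
  qed
qed

lemma line_analytic_cong:
  assumes "open \<Omega>" "line_analytic \<Omega> f" "\<And>x. x \<in> \<Omega> \<Longrightarrow> h x = f x"
  shows "line_analytic \<Omega> h"
  by (rule line_analytic_lincomb[OF assms(1,2,2), of _ 1 0]) (use assms(3) in auto)

lemma real_analytic_imp_line_analytic: "real_analytic_on f \<Omega> \<Longrightarrow> line_analytic \<Omega> f"
proof (coinduction arbitrary: f)
  case line_analytic
  then show ?case
    by (auto simp: real_analytic_on_def intro: real_analytic_at_differentiable real_analytic_at_pderiv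
        real_analytic_at_pderiv_commute real_analytic_at_line)
qed

lemma dd_pole:
  fixes c :: complex
  assumes "\<beta> \<bullet> x \<noteq> 0"
  shows "((\<lambda>x. c / of_real ((\<beta> \<bullet> x) ^ k)) has_derivative
      (\<lambda>v. - of_nat k * c * of_real (\<beta> \<bullet> v) / of_real ((\<beta> \<bullet> x) ^ Suc k))) (at x)"
proof -
  have "((\<lambda>x. inverse (\<beta> \<bullet> x) ^ k) has_derivative
     (\<lambda>v. of_nat k * (- (inverse (\<beta> \<bullet> x) * (\<beta> \<bullet> v) * inverse (\<beta> \<bullet> x)) * inverse (\<beta> \<bullet> x) ^ (k - 1)))) (at x)"
    by (rule has_derivative_eq_rhs[OF has_derivative_power[OF Deriv.has_derivative_inverse[OF assms
          has_derivative_inner_right[OF has_derivative_ident]]]]) (simp add: fun_eq_iff mult_ac)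
  then have "((\<lambda>x. c * of_real (inverse (\<beta> \<bullet> x) ^ k)) has_derivative
     (\<lambda>v. c * of_real (of_nat k * (- (inverse (\<beta> \<bullet> x) * (\<beta> \<bullet> v) * inverse (\<beta> \<bullet> x)) * inverse (\<beta> \<bullet> x) ^ (k - 1))))) (at x)"
    by (intro has_derivative_mult_right has_derivative_of_real)
  moreover have "c * of_real (of_nat k * (- (inverse (\<beta> \<bullet> x) * (\<beta> \<bullet> v) * inverse (\<beta> \<bullet> x)) * inverse (\<beta> \<bullet> x) ^ (k - 1)))
     = - of_nat k * c * of_real (\<beta> \<bullet> v) / of_real ((\<beta> \<bullet> x) ^ Suc k)" for v
    using assms by (cases k) (auto simp: field_simps)
  moreover have "(\<lambda>x. c * of_real (inverse (\<beta> \<bullet> x) ^ k)) = (\<lambda>x. c / of_real ((\<beta> \<bullet> x) ^ k))"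
    by (simp add: fun_eq_iff divide_inverse power_inverse)
  ultimately show ?thesis by simp
qed

text \<open>With c and k free, the functions c/(\<beta> \<bullet> x)^k are closed under partial
  derivatives, which makes them a coinduction invariant.\<close>

lemma line_analytic_pole:
  assumes "open \<Omega>" "\<And>x. x \<in> \<Omega> \<Longrightarrow> \<beta> \<bullet> x \<noteq> 0"
  shows "line_analytic \<Omega> (\<lambda>x. c / of_real ((\<beta> \<bullet> x) ^ k))"
proof -
  define h where "h = (\<lambda>x. c / complex_of_real ((\<beta> \<bullet> x) ^ k))"
  have "\<exists>c k. \<forall>x\<in>\<Omega>. h x = c / of_real ((\<beta> \<bullet> x) ^ k)" unfolding h_def by blast
  then have "line_analytic \<Omega> h"
  proof (coinduction arbitrary: h)
    case (line_analytic h)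
    then obtain c k where h: "\<And>x. x \<in> \<Omega> \<Longrightarrow> h x = c / of_real ((\<beta> \<bullet> x) ^ k)" by blast
    have pd: "pderiv_at i h x = (- of_nat k * c * of_real (\<beta> \<bullet> stdvec i)) / of_real ((\<beta> \<bullet> x) ^ Suc k)"
      if "x \<in> \<Omega>" "\<And>x. x \<in> \<Omega> \<Longrightarrow> h x = c / of_real ((\<beta> \<bullet> x) ^ k)" for x i h c k
      using pderiv_at_cong[OF assms(1) that(1,2), where i = i]
        pderiv_at_eq[OF dd_pole[OF assms(2)[OF that(1)]]] by simp
    have pd2: "pderiv_at j (pderiv_at i h) x
      = (- of_nat (Suc k) * (- of_nat k * c * of_real (\<beta> \<bullet> stdvec i)) * of_real (\<beta> \<bullet> stdvec j)) / of_real ((\<beta> \<bullet> x) ^ Suc (Suc k))"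
      if "x \<in> \<Omega>" for x i j
      by (rule pd[OF that]) (rule pd[OF _ h])
    have "h differentiable (at x)" if "x \<in> \<Omega>" for x
      by (rule differentiable_cong_open[OF assms(1) that h])
         (use dd_pole[OF assms(2)[OF that]] in \<open>auto simp: differentiable_def\<close>)
    moreover have "pderiv_at i (pderiv_at j h) x = pderiv_at j (pderiv_at i h) x" if "x \<in> \<Omega>" for x i j
      unfolding pd2[OF that] by (simp add: mult_ac)
    moreover have "analytic1_at (\<lambda>t. h (x + t *\<^sub>R v)) 0" if "x \<in> \<Omega>" for x v
    proof (rule analytic1_at_cong)
      show "analytic1_at (\<lambda>t. c / (of_real (\<beta> \<bullet> x) + of_real t * of_real (\<beta> \<bullet> v)) ^ k) 0"
        using assms(2)[OF that] by (intro analytic1_at_divide analytic1_at_power analytic1_at_add analytic1_at_mult) auto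
      have "((\<lambda>t. x + t *\<^sub>R v) \<longlongrightarrow> x + 0 *\<^sub>R v) (nhds 0)" by (intro tendsto_intros filterlim_ident)
      then have "\<forall>\<^sub>F t in nhds 0. x + t *\<^sub>R v \<in> \<Omega>"
        using assms(1) that topological_tendstoD by fastforce
      then show "\<forall>\<^sub>F t in nhds 0. h (x + t *\<^sub>R v) = c / (of_real (\<beta> \<bullet> x) + of_real t * of_real (\<beta> \<bullet> v)) ^ k"
        by eventually_elim (simp add: h inner_add_right)
    qed
    moreover have "\<exists>c k. \<forall>x\<in>\<Omega>. pderiv_at i h x = c / of_real ((\<beta> \<bullet> x) ^ k)" for i
      by (rule exI[of _ "- of_nat k * c * of_real (\<beta> \<bullet> stdvec i)"], rule exI[of _ "Suc k"])
         (auto simp: pd[OF _ h])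
    ultimately show ?case by auto
  qed
  then show ?thesis by (simp add: h_def)
qed

lemma line_analytic_const [simp]: "line_analytic \<Omega> (\<lambda>_. c)"
proof (coinduction arbitrary: c)
  case line_analytic
  have "pderiv_at i (\<lambda>_. c) x = 0" for i and c :: complex and x :: "real^'a"
    using dd_const[of "stdvec i" c x] by (simp del: dd_const)
  then have "pderiv_at i (\<lambda>_. c) = (\<lambda>_::real^'a. 0)" for i and c :: complex
    by (simp add: fun_eq_iff)
  then show ?case by auto
qed

context
  fixes \<Omega> :: "(real^'n::finite) set"
  assumes op: "open \<Omega>"
begin

lemma line_analytic_add: "line_analytic \<Omega> f \<Longrightarrow> line_analytic \<Omega> g \<Longrightarrow> line_analytic \<Omega> (\<lambda>x. f x + g x)"
  by (rule line_analytic_lincomb[OF op, of f g _ 1 1]) auto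

lemma line_analytic_diff: "line_analytic \<Omega> f \<Longrightarrow> line_analytic \<Omega> g \<Longrightarrow> line_analytic \<Omega> (\<lambda>x. f x - g x)"
  by (rule line_analytic_lincomb[OF op, of f g _ 1 "-1"]) auto

lemma line_analytic_cmult: "line_analytic \<Omega> f \<Longrightarrow> line_analytic \<Omega> (\<lambda>x. c * f x)"
  by (rule line_analytic_lincomb[OF op, of f f _ c 0]) auto

lemma line_analytic_sum:
  "(\<And>i. i \<in> A \<Longrightarrow> line_analytic \<Omega> (f i)) \<Longrightarrow> line_analytic \<Omega> (\<lambda>x. \<Sum>i\<in>A. f i x)"
  by (induction A rule: infinite_finite_induct) (auto intro: line_analytic_add)

lemma line_analytic_dd: "line_analytic \<Omega> f \<Longrightarrow> line_analytic \<Omega> (dd v f)"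
  unfolding dd_def[abs_def] by (intro line_analytic_sum line_analytic_cmult line_analytic_pderiv)

lemma dd_pderiv_commute:
  assumes "line_analytic \<Omega> f" "x \<in> \<Omega>"
  shows "dd v (dd w f) x = dd w (dd v f) x"
proof -
  have *: "dd v (dd w f) x = (\<Sum>i\<in>UNIV. \<Sum>j\<in>UNIV. of_real (v $ i) * of_real (w $ j) * pderiv_at i (pderiv_at j f) x)" for v w
  proof -
    have d: "pderiv_at j f differentiable (at x)" for j
      using line_analytic_differentiable[OF line_analytic_pderiv[OF assms(1)] assms(2)] .
    have "pderiv_at i (dd w f) x = (\<Sum>j\<in>UNIV. of_real (w $ j) * pderiv_at i (pderiv_at j f) x)" for i
    proof -
      have "dd (stdvec i) (dd w f) x = dd (stdvec i) (\<lambda>x. \<Sum>j\<in>UNIV. of_real (w $ j) * pderiv_at j f x) x"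
        by (simp add: dd_def[abs_def])
      also have "\<dots> = (\<Sum>j\<in>UNIV. of_real (w $ j) * dd (stdvec i) (pderiv_at j f) x)"
        using d by (subst dd_sum) (auto simp: dd_cmult simp del: dd_stdvec)
      finally show ?thesis by simp
    qed
    then show ?thesis by (simp add: dd_def[of v] sum_distrib_left mult_ac)
  qed
  show ?thesis unfolding *
    by (subst sum.swap) (simp add: line_analytic_pderiv_commute[OF assms, of _ _] mult_ac)
qed

end

subsection \<open>Jets\<close>

text \<open>Indexing by multisets builds the symmetry of mixed derivatives into the notation, so
  that the elimination arguments below become linear algebra between jets. The sorted list is one
  choice of order; \<open>foldr_pderiv_mset\<close> shows that every order gives the same on
  \<Omega>.\<close>

definition jet :: "((real, 'n::{finite,linorder}) vec \<Rightarrow> complex) \<Rightarrow> 'n multiset \<Rightarrow> (real, 'n) vec \<Rightarrow> complex"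
  where "jet f M = foldr pderiv_at (sorted_list_of_multiset M) f"

lemma line_analytic_foldr_pderiv:
  "line_analytic \<Omega> f \<Longrightarrow> line_analytic \<Omega> (foldr pderiv_at l f)"
  by (induction l) (auto intro: line_analytic_pderiv)

lemma line_analytic_jet: "line_analytic \<Omega> f \<Longrightarrow> line_analytic \<Omega> (jet f M)"
  unfolding jet_def by (rule line_analytic_foldr_pderiv)

lemma jet_empty [simp]: "jet f {#} = f"
  by (simp add: jet_def)

context
  fixes \<Omega> :: "((real, 'n::{finite,linorder}) vec) set"
  assumes op: "open \<Omega>"
begin

lemma foldr_pderiv_move:
  assumes "line_analytic \<Omega> f" "x \<in> \<Omega>"
  shows "foldr pderiv_at (l @ a # l') f x = foldr pderiv_at (a # l @ l') f x"
  using assms(2)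
proof (induction l arbitrary: x)
  case (Cons b l)
  have "foldr pderiv_at ((b # l) @ a # l') f x = pderiv_at b (foldr pderiv_at (l @ a # l') f) x" by simp
  also have "\<dots> = pderiv_at b (foldr pderiv_at (a # l @ l') f) x"
    by (rule pderiv_at_cong[OF op Cons.prems Cons.IH])
  also have "\<dots> = pderiv_at a (pderiv_at b (foldr pderiv_at (l @ l') f)) x"
    using line_analytic_pderiv_commute[OF line_analytic_foldr_pderiv[OF assms(1), of "l @ l'"] Cons.prems, of b a] by simp
  finally show ?case by simp
qed simp

lemma foldr_pderiv_mset:
  assumes "line_analytic \<Omega> f" "mset l = mset l'" "x \<in> \<Omega>"
  shows "foldr pderiv_at l f x = foldr pderiv_at l' f x"
  using assms(2,3)
proof (induction l arbitrary: l' x)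
  case (Cons a l)
  then have "a \<in> set l'" by (metis list.set_intros(1) set_mset_mset)
  then obtain l1 l2 where l': "l' = l1 @ a # l2" by (meson split_list)
  with Cons.prems have m: "mset l = mset (l1 @ l2)" by auto
  have "foldr pderiv_at (a # l) f x = foldr pderiv_at (a # l1 @ l2) f x"
    using pderiv_at_cong[OF op Cons.prems(2) Cons.IH[OF m]] by simp
  then show ?case using foldr_pderiv_move[OF assms(1) Cons.prems(2)] l' by simp
qed simp

lemma jet_pderiv:
  assumes "line_analytic \<Omega> f" "x \<in> \<Omega>"
  shows "jet (pderiv_at i f) M x = jet f (add_mset i M) x"
proof -
  have "jet (pderiv_at i f) M x = foldr pderiv_at (sorted_list_of_multiset M @ [i]) f x"
    by (simp add: jet_def)
  also have "\<dots> = jet f (add_mset i M) x"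
    unfolding jet_def by (rule foldr_pderiv_mset[OF assms(1) _ assms(2)]) simp
  finally show ?thesis .
qed

lemma pderiv_jet:
  assumes "line_analytic \<Omega> f" "x \<in> \<Omega>"
  shows "pderiv_at i (jet f M) x = jet f (add_mset i M) x"
proof -
  have "pderiv_at i (jet f M) x = foldr pderiv_at (i # sorted_list_of_multiset M) f x"
    by (simp add: jet_def)
  also have "\<dots> = jet f (add_mset i M) x"
    unfolding jet_def by (rule foldr_pderiv_mset[OF assms(1) _ assms(2)]) simp
  finally show ?thesis .
qed

lemma jet_eq_pderiv:
  assumes "line_analytic \<Omega> f" "x \<in> \<Omega>"
  shows "pderiv_at i f x = jet f {#i#} x"
  using pderiv_jet[OF assms, of i "{#}"] by simp

lemma jet_eq_pderiv2:
  assumes "line_analytic \<Omega> f" "x \<in> \<Omega>"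
  shows "pderiv_at i (pderiv_at j f) x = jet f {#i,j#} x"
  using jet_eq_pderiv[OF line_analytic_pderiv[OF assms(1)] assms(2)] jet_pderiv[OF assms] by (simp add: add_mset_commute)

lemma jet_eq_pderiv3:
  assumes "line_analytic \<Omega> f" "x \<in> \<Omega>"
  shows "pderiv_at i (pderiv_at j (pderiv_at k f)) x = jet f {#i,j,k#} x"
  using jet_eq_pderiv2[OF line_analytic_pderiv[OF assms(1)] assms(2)] jet_pderiv[OF assms] by (simp add: add_mset_commute)

lemma jet_eq_pderiv4:
  assumes "line_analytic \<Omega> f" "x \<in> \<Omega>"
  shows "pderiv_at i (pderiv_at j (pderiv_at k (pderiv_at l f))) x = jet f {#i,j,k,l#} x"
  using jet_eq_pderiv3[OF line_analytic_pderiv[OF assms(1)] assms(2)] jet_pderiv[OF assms] by (simp add: add_mset_commute)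

lemma jet_cong:
  assumes "line_analytic \<Omega> f" "\<And>x. x \<in> \<Omega> \<Longrightarrow> f x = g x" "x \<in> \<Omega>"
  shows "jet f M x = jet g M x"
proof -
  have "foldr pderiv_at l f x = foldr pderiv_at l g x" if "x \<in> \<Omega>" for l x
    using that assms(2) by (induction l arbitrary: x) (auto intro: pderiv_at_cong[OF op])
  then show ?thesis using assms(3) by (simp add: jet_def)
qed

lemma jet_sum:
  assumes "\<And>k. k \<in> A \<Longrightarrow> line_analytic \<Omega> (f k)" "x \<in> \<Omega>"
  shows "jet (\<lambda>x. \<Sum>k\<in>A. c k * f k x) M x = (\<Sum>k\<in>A. c k * jet (f k) M x)"
proof -
  have "foldr pderiv_at l (\<lambda>x. \<Sum>k\<in>A. c k * f k x) x = (\<Sum>k\<in>A. c k * foldr pderiv_at l (f k) x)" if "x \<in> \<Omega>" for l x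
    using that
  proof (induction l arbitrary: x)
    case (Cons i l)
    have d: "foldr pderiv_at l (f k) differentiable (at x)" if "k \<in> A" for k
      using line_analytic_differentiable[OF line_analytic_foldr_pderiv[OF assms(1)[OF that]] Cons.prems] .
    have "foldr pderiv_at (i # l) (\<lambda>x. \<Sum>k\<in>A. c k * f k x) x
        = dd (stdvec i) (\<lambda>x. \<Sum>k\<in>A. c k * foldr pderiv_at l (f k) x) x"
      using pderiv_at_cong[OF op Cons.prems Cons.IH] by simp
    also have "\<dots> = (\<Sum>k\<in>A. c k * dd (stdvec i) (foldr pderiv_at l (f k)) x)"
      using d by (subst dd_sum) (auto simp: dd_cmult simp del: dd_stdvec)
    finally show ?case by simp
  qed simp
  then show ?thesis using assms(2) by (simp add: jet_def)
qed

text \<open>Prolongation: every linear equation with constant coefficients may be used in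
  differentiated form.\<close>

lemma jet_relation:
  assumes "\<And>k. k \<in> A \<Longrightarrow> line_analytic \<Omega> (f k)" "\<And>x. x \<in> \<Omega> \<Longrightarrow> (\<Sum>k\<in>A. c k * f k x) = 0" "x \<in> \<Omega>"
  shows "(\<Sum>k\<in>A. c k * jet (f k) M x) = 0"
proof -
  have "(\<Sum>k\<in>A. c k * jet (f k) M x) = jet (\<lambda>x. \<Sum>k\<in>A. c k * f k x) M x"
    using jet_sum[where f = f and A = A and c = c, OF assms(1,3)] by simp
  also have "\<dots> = jet (\<lambda>_. 0) M x"
    by (rule jet_cong[OF _ assms(2,3)]) (auto intro!: line_analytic_sum[OF op] line_analytic_cmult[OF op] assms(1))
  also have "\<dots> = 0"
    using jet_sum[of "{}" "\<lambda>_ _. 0" x "\<lambda>_. 0" M] assms(3) by simp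
  finally show ?thesis .
qed

lemma jet_relation4:
  assumes "line_analytic \<Omega> f1" "line_analytic \<Omega> f2" "line_analytic \<Omega> f3" "line_analytic \<Omega> f4"
    "\<And>x. x \<in> \<Omega> \<Longrightarrow> f1 x + f2 x + f3 x = c * f4 x" "x \<in> \<Omega>"
  shows "jet f1 M x + jet f2 M x + jet f3 M x = c * jet f4 M x"
proof -
  have "(\<Sum>k\<in>{0,1,2,3::nat}. [1,1,1,-c] ! k * jet ([f1,f2,f3,f4] ! k) M x) = 0"
  proof (rule jet_relation[OF _ _ assms(6)])
    show "(\<Sum>k\<in>{0,1,2,3::nat}. [1,1,1,-c] ! k * ([f1,f2,f3,f4] ! k) y) = 0" if "y \<in> \<Omega>" for y
      using assms(5)[OF that] by (simp add: algebra_simps)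
  qed (use assms in auto)
  then show ?thesis by (simp add: algebra_simps)
qed

end

subsection \<open>The equations of a commuting pair\<close>

lemma sum_split_strict:
  fixes u :: "'n::{finite,linorder} \<Rightarrow> 'n \<Rightarrow> 'a::comm_monoid_add"
  shows "(\<Sum>i\<in>UNIV. \<Sum>j\<in>UNIV. u i j) = (\<Sum>i\<in>UNIV. u i i) + (\<Sum>i\<in>UNIV. \<Sum>j\<in>{i<..}. u i j + u j i)"
proof -
  have U: "UNIV = {i} \<union> ({i<..} \<union> {..<i})" for i :: 'n by auto
  have "(\<Sum>j\<in>UNIV. u i j) = u i i + ((\<Sum>j\<in>{i<..}. u i j) + (\<Sum>j\<in>{..<i}. u i j))" for i
    by (subst U[of i], subst sum.union_disjoint, (auto)[3], subst sum.union_disjoint) auto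
  moreover have "(\<Sum>i\<in>UNIV. \<Sum>j\<in>{..<i}. u i j) = (\<Sum>j\<in>UNIV. \<Sum>i\<in>{j<..}. u i j)"
    by (subst sum.Sigma, simp, simp, subst sum.Sigma, simp, simp,
        rule sum.reindex_bij_witness[of _ "\<lambda>(a,b). (b,a)" "\<lambda>(a,b). (b,a)"]) auto
  ultimately show ?thesis by (simp add: sum.distrib)
qed

text \<open>Inclusion and exclusion over the values of the cubic form on a + b + c, the sums of two,
  and a, b, c isolate the terms that are linear in each argument. B need not be symmetric, so all
  six orders appear.\<close>

lemma cubic_form_polarization:
  fixes B :: "'v::ab_group_add \<Rightarrow> 'v \<Rightarrow> 'v \<Rightarrow> complex"
  assumes "\<And>a a' b c. B (a + a') b c = B a b c + B a' b c"
    "\<And>a b b' c. B a (b + b') c = B a b c + B a b' c"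
    "\<And>a b c c'. B a b (c + c') = B a b c + B a b c'"
    "\<And>a. B a a a = 0"
  shows "B a b c + B a c b + B b a c + B b c a + B c a b + B c b a = 0"
proof -
  have "B (a + b + c) (a + b + c) (a + b + c) = 0" "B (a + b) (a + b) (a + b) = 0"
    "B (a + c) (a + c) (a + c) = 0" "B (b + c) (b + c) (b + c) = 0" "B a a a = 0" "B b b b = 0" "B c c c = 0"
    by (rule assms(4))+
  then show ?thesis unfolding assms(1-3) by algebra
qed

definition symform :: "('n::finite \<Rightarrow> 'n \<Rightarrow> (real, 'n) vec \<Rightarrow> complex) \<Rightarrow> (real, 'n) vec \<Rightarrow> (real, 'n) vec \<Rightarrow> (real, 'n) vec \<Rightarrow> complex"
  where "symform s a b x = (\<Sum>i\<in>UNIV. \<Sum>j\<in>UNIV. of_real (a $ i) * of_real (b $ j) * s i j x)"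

text \<open>\<open>eq3\<close>, \<open>eq2\<close> and \<open>eq1\<close> are the parts of degree
  three, two and one in the frequency of the vanishing commutator. Here \<open>s\<close> is the
  Hessian, in the frequency, of the second order symbol of the quartic operator plus 2 R times the
  identity, and \<open>b\<close> holds the first order coefficients.\<close>

locale commuting_system =
  fixes \<Omega> :: "((real, 'n::{finite,linorder}) vec) set"
    and R :: "(real, 'n) vec \<Rightarrow> complex" and s :: "'n \<Rightarrow> 'n \<Rightarrow> (real, 'n) vec \<Rightarrow> complex"
    and b :: "'n \<Rightarrow> (real, 'n) vec \<Rightarrow> complex" and a0 :: "(real, 'n) vec \<Rightarrow> complex"
  assumes op: "open \<Omega>"
    and laR: "line_analytic \<Omega> R" and las: "\<And>i j. line_analytic \<Omega> (s i j)"
    and lab: "\<And>i. line_analytic \<Omega> (b i)" and la0: "line_analytic \<Omega> a0"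
    and s_sym: "\<And>i j. s i j = s j i"
    and eq3: "\<And>i j k x. x \<in> \<Omega> \<Longrightarrow>
      pderiv_at i (s j k) x + pderiv_at j (s i k) x + pderiv_at k (s i j) x
        = (if i = j \<and> j = k then 6 else 0) * pderiv_at i R x"
    and eq2: "\<And>i j x. x \<in> \<Omega> \<Longrightarrow>
      2 * (pderiv_at i (b j) x + pderiv_at j (b i) x) + (\<Sum>m\<in>UNIV. pderiv_at m (pderiv_at m (s i j)) x)
        + 4 * pderiv_at i (pderiv_at j R) x - (if i = j then 6 else 0) * pderiv_at i (pderiv_at j R) x = 0"
    and eq1: "\<And>j x. x \<in> \<Omega> \<Longrightarrow>
      2 * pderiv_at j a0 x + (\<Sum>m\<in>UNIV. pderiv_at m (pderiv_at m (b j)) x)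
        + 2 * (\<Sum>m\<in>UNIV. pderiv_at m (pderiv_at m (pderiv_at j R)) x)
        - 2 * pderiv_at j (pderiv_at j (pderiv_at j R)) x - 2 * (R x * pderiv_at j R x)
        + (\<Sum>k\<in>UNIV. s j k x * pderiv_at k R x) = 0"
begin

lemma jet3:
  assumes "x \<in> \<Omega>"
  shows "jet (s j k) (add_mset i M) x + jet (s i k) (add_mset j M) x + jet (s i j) (add_mset k M) x
     = (if i = j \<and> j = k then 6 else 0) * jet R (add_mset i M) x"
  using jet_relation4[OF op line_analytic_pderiv[OF las] line_analytic_pderiv[OF las] line_analytic_pderiv[OF las]
      line_analytic_pderiv[OF laR] eq3 assms, where M = M] jet_pderiv[OF op las assms] jet_pderiv[OF op laR assms]
  by simp

text \<open>Eliminating the derivatives of \<open>s i i\<close> from \<open>eq3\<close> for (i,i,j)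
  and (i,i,i) shows that the left side is minus the derivative of \<open>s i j\<close> along
  i,i,j,j, an expression symmetric in i and j.\<close>

lemma jet_wave:
  assumes "x \<in> \<Omega>" "i \<noteq> j"
  shows "jet R {#i,j,j,j#} x = jet R {#j,i,i,i#} x"
proof -
  have 1: "2 * jet (s i j) {#i,i,j,j#} x + jet (s i i) {#i,j,j,j#} x = 0"
    using jet3[OF assms(1), of i j i "{#i,j,j#}"] assms(2) by (simp add: s_sym[of j i] add_mset_commute)
  have 2: "jet (s i i) {#i,j,j,j#} x = 2 * jet R {#i,j,j,j#} x"
    using jet3[OF assms(1), of i i i "{#j,j,j#}"] by simp
  have 3: "2 * jet (s i j) {#i,i,j,j#} x + jet (s j j) {#j,i,i,i#} x = 0"
    using jet3[OF assms(1), of j i j "{#j,i,i#}"] assms(2) by (simp add: s_sym[of j i] add_mset_commute)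
  have 4: "jet (s j j) {#j,i,i,i#} x = 2 * jet R {#j,i,i,i#} x"
    using jet3[OF assms(1), of j j j "{#i,i,i#}"] by simp
  show ?thesis using 1 2 3 4 by algebra
qed

text \<open>By \<open>eq3\<close> for (i,i,j), (i,i,k) and (i,i,i), the derivatives of
  \<open>s i j\<close> along i,i,k and of \<open>s i k\<close> along i,i,j are both minus that of R
  along i,j,k. \<open>eq3\<close> for (i,j,k) then determines the third term.\<close>

lemma jet_mixed2:
  assumes "x \<in> \<Omega>" "i \<noteq> j" "j \<noteq> k" "i \<noteq> k"
  shows "2 * jet R (add_mset i (add_mset j (add_mset k M))) x = jet (s j k) (add_mset i (add_mset i (add_mset i M))) x"
proof -
  have 1: "2 * jet (s i j) (add_mset i (add_mset i (add_mset k M))) x + jet (s i i) (add_mset i (add_mset j (add_mset k M))) x = 0"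
    using jet3[OF assms(1), of i j i "add_mset i (add_mset k M)"] assms by (simp add: s_sym[of j i] add_mset_commute)
  have 2: "jet (s i i) (add_mset i (add_mset j (add_mset k M))) x = 2 * jet R (add_mset i (add_mset j (add_mset k M))) x"
    using jet3[OF assms(1), of i i i "add_mset j (add_mset k M)"] by simp
  have 3: "jet (s i j) (add_mset i (add_mset i (add_mset k M))) x + jet (s j k) (add_mset i (add_mset i (add_mset i M))) x
      + jet (s i k) (add_mset i (add_mset i (add_mset j M))) x = 0"
    using jet3[OF assms(1), of k i j "add_mset i (add_mset i M)"] assms by (simp add: s_sym[of k j] s_sym[of k i] s_sym[of j i] add_mset_commute algebra_simps)
  have 4: "2 * jet (s i k) (add_mset i (add_mset i (add_mset j M))) x + jet (s i i) (add_mset i (add_mset j (add_mset k M))) x = 0"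
    using jet3[OF assms(1), of i k i "add_mset i (add_mset j M)"] assms by (simp add: s_sym[of k i] add_mset_commute)
  show ?thesis using 1 2 3 4 by algebra
qed

text \<open>If l repeats an index, a chain of relations leads from the derivative back to a
  different multiple of it. If l is new, three third derivatives of components of \<open>s\<close>
  all equal twice the derivative, while \<open>eq3\<close> makes their sum zero.\<close>

lemma jet_mixed3:
  assumes "x \<in> \<Omega>" "i \<noteq> j" "j \<noteq> k" "i \<noteq> k"
  shows "jet R {#i,j,k,l#} x = 0"
proof -
  have A: "jet R {#i,j,k,j#} x = 0" if "i \<noteq> j" "j \<noteq> k" "i \<noteq> k" for i j k
  proof -
    have 1: "2 * jet R {#i,j,k,j#} x = jet (s j k) {#i,i,i,j#} x"
      by (rule jet_mixed2[OF assms(1) that])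
    have 2: "2 * jet (s j k) {#i,i,i,j#} x + jet (s j j) {#i,i,i,k#} x = 0"
      using jet3[OF assms(1), of j k j "{#i,i,i#}"] that by (simp add: s_sym[of k j] add_mset_commute)
    have 3: "jet (s j j) {#i,i,i,k#} x + 2 * jet (s i j) {#i,i,j,k#} x = 0"
      using jet3[OF assms(1), of j i j "{#i,i,k#}"] that by (simp add: s_sym[of j i] add_mset_commute algebra_simps)
    have 4: "2 * jet (s i j) {#i,i,j,k#} x + jet (s i i) {#i,j,j,k#} x = 0"
      using jet3[OF assms(1), of i j i "{#i,j,k#}"] that by (simp add: s_sym[of j i] add_mset_commute algebra_simps)
    have 5: "jet (s i i) {#i,j,j,k#} x = 2 * jet R {#i,j,k,j#} x"
      using jet3[OF assms(1), of i i i "{#j,j,k#}"] by (simp add: add_mset_commute)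
    \<comment> \<open>The chain reads a = 2 T, b = -2 a, c = a, d = -2 a, so that 2 T = d = -4
      T.\<close>
    have lin: "2 * T = a \<Longrightarrow> 2 * a + b = 0 \<Longrightarrow> b + 2 * c = 0 \<Longrightarrow> 2 * c + d = 0 \<Longrightarrow> d = 2 * T \<Longrightarrow> T = 0"
      for T a b c d :: complex
      by (auto simp: complex_eq_iff)
    show ?thesis by (rule lin[OF 1 2 3 4 5])
  qed
  consider "l = i" | "l = j" | "l = k" | "l \<noteq> i" "l \<noteq> j" "l \<noteq> k" by blast
  then show ?thesis
  proof cases
    case 1 then show ?thesis using A[of j i k] assms by (simp add: add_mset_commute)
  next
    case 2 then show ?thesis using A[of i j k] assms by simp
  next
    case 3 then show ?thesis using A[of i k j] assms by (simp add: add_mset_commute)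
  next
    case 4
    have 1: "2 * jet R {#i,j,k,l#} x = jet (s j k) {#i,i,i,l#} x"
      by (rule jet_mixed2[OF assms])
    have 2: "2 * jet R {#i,j,k,l#} x = jet (s k l) {#i,i,i,j#} x"
      using jet_mixed2[OF assms(1), of i k l "{#j#}"] 4 assms by (simp add: add_mset_commute)
    have 3: "2 * jet R {#i,j,k,l#} x = jet (s j l) {#i,i,i,k#} x"
      using jet_mixed2[OF assms(1), of i j l "{#k#}"] 4 assms by (simp add: add_mset_commute)
    have 5: "jet (s j k) {#i,i,i,l#} x + jet (s k l) {#i,i,i,j#} x + jet (s j l) {#i,i,i,k#} x = 0"
      using jet3[OF assms(1), of l j k "{#i,i,i#}"] assms 4 by (auto simp: s_sym[of l k] s_sym[of l j] s_sym[of k j] add_mset_commute algebra_simps)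
    have lin: "2 * T = a \<Longrightarrow> 2 * T = b \<Longrightarrow> 2 * T = c \<Longrightarrow> a + b + c = 0 \<Longrightarrow> T = 0" for T a b c :: complex
      by (auto simp: complex_eq_iff)
    show ?thesis by (rule lin[OF 1 2 3 5])
  qed
qed

lemma jet2:
  assumes "x \<in> \<Omega>"
  shows "2 * (jet (b j) (add_mset i M) x + jet (b i) (add_mset j M) x)
     + (\<Sum>m\<in>UNIV. jet (s i j) (add_mset m (add_mset m M)) x)
     + (4 - (if i = j then 6 else 0)) * jet R (add_mset i (add_mset j M)) x = 0"
proof -
  define f where "f k = (case k of Inl m \<Rightarrow> pderiv_at m (pderiv_at m (s i j)) |
     Inr n \<Rightarrow> [pderiv_at i (b j), pderiv_at j (b i), pderiv_at i (pderiv_at j R)] ! n)" for k :: "'n + nat"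
  define c :: "'n + nat \<Rightarrow> complex" where "c k = (case k of Inl m \<Rightarrow> 1 | Inr n \<Rightarrow> [2, 2, 4 - (if i = j then 6 else 0)] ! n)" for k
  have A: "(\<Sum>k\<in>UNIV <+> {0,1,2}. g k) = (\<Sum>m\<in>UNIV. g (Inl m)) + (g (Inr 0) + g (Inr 1) + g (Inr 2))" for g :: "'n + nat \<Rightarrow> complex"
    by (subst sum.Plus) auto
  have "(\<Sum>k\<in>UNIV <+> {0,1,2}. c k * jet (f k) M x) = 0"
  proof (rule jet_relation[OF op _ _ assms])
    show "line_analytic \<Omega> (f k)" if "k \<in> UNIV <+> {0, 1, 2}" for k
      using that by (auto simp: f_def intro!: line_analytic_pderiv las lab laR)
    show "(\<Sum>k\<in>UNIV <+> {0, 1, 2}. c k * f k y) = 0" if "y \<in> \<Omega>" for y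
      unfolding A using eq2[OF that, of i j] by (simp add: f_def c_def algebra_simps)
  qed
  then show ?thesis unfolding A
    by (cases "i = j") (simp_all add: add_mset_commute f_def c_def algebra_simps jet_pderiv[OF op las assms] jet_pderiv[OF op lab assms] jet_pderiv[OF op laR assms]
       jet_pderiv[OF op line_analytic_pderiv[OF las] assms] jet_pderiv[OF op line_analytic_pderiv[OF laR] assms])
qed

text \<open>The first order coefficients are not determined by \<open>eq2\<close>, but the curl of
  their Laplacian is. In the difference of \<open>eq2\<close> for (k,j) and (k,i) the derivative of
  \<open>b k\<close> cancels, and after summation over k the remaining terms vanish by the wave
  equation.\<close>

lemma curl_laplacian_b:
  assumes "x \<in> \<Omega>" "i \<noteq> j"
  shows "(\<Sum>k\<in>UNIV. jet (b j) {#i,k,k#} x) = (\<Sum>k\<in>UNIV. jet (b i) {#j,k,k#} x)"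
proof -
  define A where "A k = (\<Sum>m\<in>UNIV. jet (s k j) {#m,m,i,k#} x) - (\<Sum>m\<in>UNIV. jet (s k i) {#m,m,j,k#} x)" for k
  have 1: "2 * (jet (b j) {#i,k,k#} x - jet (b i) {#j,k,k#} x)
      = - A k + ((if k = j then 6 * jet R {#j,i,j,j#} x else 0) - (if k = i then 6 * jet R {#i,i,i,j#} x else 0))" for k
  proof -
    have "2 * (jet (b j) {#i,k,k#} x + jet (b k) {#i,j,k#} x) + (\<Sum>m\<in>UNIV. jet (s k j) {#m,m,i,k#} x)
        + (4 - (if k = j then 6 else 0)) * jet R {#i,j,k,k#} x = 0"
      using jet2[OF assms(1), of j k "{#i,k#}"] by (simp add: add_mset_commute)
    moreover have "2 * (jet (b i) {#j,k,k#} x + jet (b k) {#i,j,k#} x) + (\<Sum>m\<in>UNIV. jet (s k i) {#m,m,j,k#} x)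
        + (4 - (if k = i then 6 else 0)) * jet R {#i,j,k,k#} x = 0"
      using jet2[OF assms(1), of i k "{#j,k#}"] by (simp add: add_mset_commute)
    ultimately have "2 * (jet (b j) {#i,k,k#} x - jet (b i) {#j,k,k#} x)
      = - A k + ((if k = j then 6 else 0) * jet R {#i,j,k,k#} x - (if k = i then 6 else 0) * jet R {#i,j,k,k#} x)"
      unfolding A_def by algebra
    then show ?thesis by (auto simp: add_mset_commute)
  qed
  \<comment> \<open>\<open>eq3\<close> for (k,k,j) and for (k,k,i) share the derivative of
    \<open>s k k\<close>, which cancels in the difference.\<close>
  have 2: "A k = (\<Sum>m\<in>UNIV. (if k = j then 3 * jet R {#m,m,i,j#} x else 0) - (if k = i then 3 * jet R {#m,m,i,j#} x else 0))" for k
    unfolding A_def sum_subtractf[symmetric]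
  proof (rule sum.cong[OF refl])
    fix m
    have "2 * jet (s k j) {#m,m,i,k#} x + jet (s k k) {#m,m,i,j#} x = (if k = j then 6 * jet R {#m,m,i,j#} x else 0)"
      using jet3[OF assms(1), of k k j "{#m,m,i#}"] by (auto simp: s_sym[of j k] add_mset_commute)
    moreover have "2 * jet (s k i) {#m,m,j,k#} x + jet (s k k) {#m,m,i,j#} x = (if k = i then 6 * jet R {#m,m,i,j#} x else 0)"
      using jet3[OF assms(1), of k k i "{#m,m,j#}"] by (auto simp: s_sym[of i k] add_mset_commute)
    moreover have lin: "2 * X + Z = P \<Longrightarrow> 2 * Y + Z = Q \<Longrightarrow> 2 * (X - Y) = P - Q" for X Y Z P Q :: complex
      by (simp add: complex_eq_iff)
    ultimately have "2 * (jet (s k j) {#m,m,i,k#} x - jet (s k i) {#m,m,j,k#} x)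
       = (if k = j then 6 * jet R {#m,m,i,j#} x else 0) - (if k = i then 6 * jet R {#m,m,i,j#} x else 0)"
      by blast
    also have "\<dots> = 2 * ((if k = j then 3 * jet R {#m,m,i,j#} x else 0) - (if k = i then 3 * jet R {#m,m,i,j#} x else 0))"
      by simp
    finally show "jet (s k j) {#m,m,i,k#} x - jet (s k i) {#m,m,j,k#} x
       = (if k = j then 3 * jet R {#m,m,i,j#} x else 0) - (if k = i then 3 * jet R {#m,m,i,j#} x else 0)"
      by (subst (asm) mult_left_cancel) simp
  qed
  have "(\<Sum>k\<in>UNIV. A k) = 0"
    unfolding 2 by (subst sum.swap) (simp add: sum_subtractf)
  then have "(\<Sum>k\<in>UNIV. 2 * (jet (b j) {#i,k,k#} x - jet (b i) {#j,k,k#} x))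
     = 6 * jet R {#j,i,j,j#} x - 6 * jet R {#i,i,i,j#} x"
    unfolding 1 by (simp add: sum.distrib sum_negf sum_subtractf)
  also have "\<dots> = 0" using jet_wave[OF assms] by (simp add: add_mset_commute)
  finally show ?thesis by (simp add: sum_distrib_left[symmetric] sum_subtractf)
qed

text \<open>Antisymmetrise the derivative of \<open>eq1\<close>. The gradients of \<open>a0\<close>,
  of the Laplacian of R and of R^2 drop out, the Laplacian of b has no curl, and the pure third
  derivatives of R cancel by the wave equation.\<close>

lemma closed_form:
  assumes "x \<in> \<Omega>"
  shows "(\<Sum>k\<in>UNIV. pderiv_at i (\<lambda>x. s j k x * pderiv_at k R x) x) = (\<Sum>k\<in>UNIV. pderiv_at j (\<lambda>x. s i k x * pderiv_at k R x) x)"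
proof (cases "i = j")
  case False
  note d = line_analytic_differentiable[OF _ assms]
  have dp: "(\<lambda>x. s j k x * pderiv_at k R x) differentiable (at x)" for j k
    by (intro derivative_intros d las line_analytic_pderiv laR)
  have comb: "dd v (\<lambda>x. 2 * f1 x + f2 x + 2 * f3 x - 2 * f4 x - 2 * f5 x + f6 x) x
      = 2 * dd v f1 x + dd v f2 x + 2 * dd v f3 x - 2 * dd v f4 x - 2 * dd v f5 x + dd v f6 x"
    if "f1 differentiable (at x)" "f2 differentiable (at x)" "f3 differentiable (at x)"
      "f4 differentiable (at x)" "f5 differentiable (at x)" "f6 differentiable (at x)" for v f1 f2 f3 f4 f5 f6
    using that by (simp add: dd_add dd_diff dd_cmult derivative_intros)
  have dR: "(\<lambda>x. R x * pderiv_at j R x) differentiable (at x)" for j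
    by (intro derivative_intros d line_analytic_pderiv laR)
  note la = line_analytic_pderiv las lab laR la0
  have E: "2 * jet a0 {#i,j#} x + (\<Sum>m\<in>UNIV. jet (b j) {#i,m,m#} x) + 2 * (\<Sum>m\<in>UNIV. jet R {#i,m,m,j#} x)
        - 2 * jet R {#i,j,j,j#} x - 2 * (pderiv_at i R x * pderiv_at j R x + R x * jet R {#i,j#} x)
        + (\<Sum>k\<in>UNIV. pderiv_at i (\<lambda>x. s j k x * pderiv_at k R x) x) = 0" for i j
  proof -
    have "0 = dd (stdvec i) (\<lambda>_. 0) x" by (simp del: dd_stdvec)
    also have "\<dots> = dd (stdvec i) (\<lambda>x. 2 * pderiv_at j a0 x + (\<Sum>m\<in>UNIV. pderiv_at m (pderiv_at m (b j)) x)
        + 2 * (\<Sum>m\<in>UNIV. pderiv_at m (pderiv_at m (pderiv_at j R)) x)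
        - 2 * pderiv_at j (pderiv_at j (pderiv_at j R)) x - 2 * (R x * pderiv_at j R x)
        + (\<Sum>k\<in>UNIV. s j k x * pderiv_at k R x)) x"
      by (rule dd_cong[OF op assms]) (simp add: eq1)
    also have "\<dots> = 2 * dd (stdvec i) (pderiv_at j a0) x + dd (stdvec i) (\<lambda>x. \<Sum>m\<in>UNIV. pderiv_at m (pderiv_at m (b j)) x) x
        + 2 * dd (stdvec i) (\<lambda>x. \<Sum>m\<in>UNIV. pderiv_at m (pderiv_at m (pderiv_at j R)) x) x
        - 2 * dd (stdvec i) (pderiv_at j (pderiv_at j (pderiv_at j R))) x - 2 * dd (stdvec i) (\<lambda>x. R x * pderiv_at j R x) x
        + dd (stdvec i) (\<lambda>x. \<Sum>k\<in>UNIV. s j k x * pderiv_at k R x) x"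
      by (rule comb) (rule d la d[OF line_analytic_sum[OF op]] dR differentiable_sum ballI dp | simp)+
    also have "dd (stdvec i) (\<lambda>x. \<Sum>m\<in>UNIV. pderiv_at m (pderiv_at m (b j)) x) x = (\<Sum>m\<in>UNIV. jet (b j) {#i,m,m#} x)"
      by (subst dd_sum, intro d la) (simp add: jet_eq_pderiv3[OF op lab assms])
    also have "dd (stdvec i) (\<lambda>x. \<Sum>m\<in>UNIV. pderiv_at m (pderiv_at m (pderiv_at j R)) x) x = (\<Sum>m\<in>UNIV. jet R {#i,m,m,j#} x)"
      by (subst dd_sum, intro d la) (simp add: jet_eq_pderiv4[OF op laR assms])
    also have "dd (stdvec i) (\<lambda>x. R x * pderiv_at j R x) x = pderiv_at i R x * pderiv_at j R x + R x * jet R {#i,j#} x"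
      by (subst dd_mult, intro d la, intro d la) (simp add: jet_eq_pderiv2[OF op laR assms])
    also have "dd (stdvec i) (\<lambda>x. \<Sum>k\<in>UNIV. s j k x * pderiv_at k R x) x = (\<Sum>k\<in>UNIV. pderiv_at i (\<lambda>x. s j k x * pderiv_at k R x) x)"
      by (subst dd_sum, rule dp) simp
    finally show ?thesis
      by (simp add: jet_eq_pderiv2[OF op la0 assms] jet_eq_pderiv4[OF op laR assms])
  qed
  have lin: "2 * A + B + 2 * C - 2 * D - 2 * E + F = 0 \<Longrightarrow> 2 * A + B' + 2 * C - 2 * D' - 2 * E + F' = 0 \<Longrightarrow> B = B' \<Longrightarrow> D = D' \<Longrightarrow> F = F'"
    for A B B' C D D' E F F' :: complex
    by (auto simp: complex_eq_iff)
  have E': "2 * jet a0 {#i,j#} x + (\<Sum>m\<in>UNIV. jet (b i) {#j,m,m#} x) + 2 * (\<Sum>m\<in>UNIV. jet R {#i,m,m,j#} x)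
        - 2 * jet R {#j,i,i,i#} x - 2 * (pderiv_at i R x * pderiv_at j R x + R x * jet R {#i,j#} x)
        + (\<Sum>k\<in>UNIV. pderiv_at j (\<lambda>x. s i k x * pderiv_at k R x) x) = 0"
    using E[of j i] by (simp add: add_mset_commute mult.commute[of "pderiv_at j R x"])
  show ?thesis by (rule lin[OF E E' curl_laplacian_b[OF assms False] jet_wave[OF assms False]])
qed simp

end

subsection \<open>The symbol calculus\<close>

text \<open>Exponentials with real frequency suffice as test functions: conjugation by one of them
  turns a differential operator into its full symbol, a polynomial in the frequency.\<close>

definition expvec :: "real^'n::finite \<Rightarrow> real^'n \<Rightarrow> complex"
  where "expvec \<xi> x = of_real (exp (\<xi> \<bullet> x))"

lemma expvec_nonzero [simp]: "expvec \<xi> x \<noteq> 0"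
  by (simp add: expvec_def)

lemma has_derivative_expvec:
  "(expvec \<xi> has_derivative (\<lambda>v. of_real (\<xi> \<bullet> v) * expvec \<xi> x)) (at x)"
proof -
  have "((\<lambda>x. exp (\<xi> \<bullet> x)) has_derivative (\<lambda>v. (\<xi> \<bullet> v) * exp (\<xi> \<bullet> x))) (at x)"
    by (auto intro!: derivative_eq_intros)
  from has_derivative_of_real[OF this, where 'a = complex]
  show ?thesis by (simp add: expvec_def[abs_def])
qed

lemma pderiv_expvec: "pderiv_at i (\<lambda>x. c * expvec \<xi> x) = (\<lambda>x. (of_real (\<xi> $ i) * c) * expvec \<xi> x)"
proof
  fix x
  show "pderiv_at i (\<lambda>x. c * expvec \<xi> x) x = (of_real (\<xi> $ i) * c) * expvec \<xi> x"
    by (subst pderiv_at_eq[OF has_derivative_mult_right[OF has_derivative_expvec]]) (simp add: inner_axis)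
qed

lemma pderiv_expvec1: "pderiv_at i (expvec \<xi>) = (\<lambda>x. of_real (\<xi> $ i) * expvec \<xi> x)"
  using pderiv_expvec[of i 1 \<xi>] by simp

lemma smooth_expvec: "smooth_function_on S (expvec \<xi>)"
proof -
  have "\<exists>c. foldr pderiv_at l (expvec \<xi>) = (\<lambda>x. c * expvec \<xi> x)" for l
  proof (induction l)
    case Nil then show ?case by (intro exI[of _ 1]) auto
  next
    case (Cons i l) then show ?case using pderiv_expvec by fastforce
  qed
  then show ?thesis unfolding smooth_function_on_def
    using has_derivative_mult_right[OF has_derivative_expvec] unfolding differentiable_def by metis
qed

context
  fixes \<Omega> :: "((real, 'n::{finite,linorder}) vec) set"
  assumes op: "open \<Omega>"
begin

lemma jet_add:
  assumes "line_analytic \<Omega> f" "line_analytic \<Omega> g" "x \<in> \<Omega>"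
  shows "jet (\<lambda>x. f x + g x) M x = jet f M x + jet g M x"
proof -
  have "jet (\<lambda>x. \<Sum>k\<in>{0,1::nat}. 1 * ([f, g] ! k) x) M x = (\<Sum>k\<in>{0,1::nat}. 1 * jet ([f, g] ! k) M x)"
    by (rule jet_sum[OF op _ assms(3)]) (use assms in auto)
  then show ?thesis by simp
qed

lemma jet_cmult:
  assumes "line_analytic \<Omega> f" "x \<in> \<Omega>"
  shows "jet (\<lambda>x. c * f x) M x = c * jet f M x"
  using jet_sum[OF op _ assms(2), of "{0::nat}" "\<lambda>_. f" "\<lambda>_. c" M] assms(1) by simp

lemma jet_sum1:
  assumes "\<And>k. k \<in> A \<Longrightarrow> line_analytic \<Omega> (f k)" "x \<in> \<Omega>"
  shows "jet (\<lambda>x. \<Sum>k\<in>A. f k x) M x = (\<Sum>k\<in>A. jet (f k) M x)"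
  using jet_sum[OF op assms(1) assms(2), where c = "\<lambda>_. 1" and A = A] by simp

lemma jet_const_add_mset:
  assumes "x \<in> \<Omega>" shows "jet (\<lambda>_. c) (add_mset i M) x = 0"
proof -
  have "jet (\<lambda>_. c) (add_mset i M) x = jet (pderiv_at i (\<lambda>_. c)) M x"
    by (rule jet_pderiv[OF op _ assms, symmetric]) simp
  also have "pderiv_at i (\<lambda>_. c) = (\<lambda>_. 0 * c)"
    using dd_const[of "stdvec i" c] by (simp add: fun_eq_iff del: dd_const)
  also have "jet (\<lambda>_::(real, 'n) vec. 0 * c) M x = 0 * jet (\<lambda>_. c) M x"
    by (rule jet_cmult[OF _ assms]) simp
  finally show ?thesis by simp
qed

text \<open>The partial derivative conjugated by the exponential with frequency \<xi>.\<close>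

definition twisted_pderiv :: "(real, 'n) vec \<Rightarrow> 'n \<Rightarrow> ((real, 'n) vec \<Rightarrow> complex) \<Rightarrow> (real, 'n) vec \<Rightarrow> complex"
  where "twisted_pderiv \<xi> i g x = pderiv_at i g x + of_real (\<xi> $ i) * g x"

lemma line_analytic_twisted_pderiv:
  "line_analytic \<Omega> g \<Longrightarrow> line_analytic \<Omega> (twisted_pderiv \<xi> i g)"
  unfolding twisted_pderiv_def[abs_def]
  by (intro line_analytic_add[OF op] line_analytic_cmult[OF op] line_analytic_pderiv)

lemma jet_twisted_pderiv:
  assumes "line_analytic \<Omega> g" "x \<in> \<Omega>"
  shows "jet (twisted_pderiv \<xi> i g) M x = jet g (add_mset i M) x + of_real (\<xi> $ i) * jet g M x"
proof -
  have "jet (twisted_pderiv \<xi> i g) M x = jet (pderiv_at i g) M x + jet (\<lambda>x. of_real (\<xi> $ i) * g x) M x"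
    unfolding twisted_pderiv_def[abs_def]
    by (rule jet_add[OF line_analytic_pderiv[OF assms(1)] line_analytic_cmult[OF op assms(1)] assms(2)])
  then show ?thesis using assms by (simp add: jet_pderiv[OF op] jet_cmult)
qed

lemma pderiv_mult_expvec:
  assumes "line_analytic \<Omega> g" "x \<in> \<Omega>" "\<And>y. y \<in> \<Omega> \<Longrightarrow> h y = g y * expvec \<xi> y"
  shows "pderiv_at i h x = twisted_pderiv \<xi> i g x * expvec \<xi> x"
proof -
  have "pderiv_at i h x = pderiv_at i (\<lambda>y. g y * expvec \<xi> y) x"
    by (rule pderiv_at_cong[OF op assms(2,3)])
  also have "\<dots> = dd (stdvec i) g x * expvec \<xi> x + g x * dd (stdvec i) (expvec \<xi>) x"
    using dd_mult[OF line_analytic_differentiable[OF assms(1,2)], of "expvec \<xi>" "stdvec i"] has_derivative_expvec[of \<xi> x]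
    by (auto simp: differentiable_def)
  also have "dd (stdvec i) (expvec \<xi>) x = of_real (\<xi> $ i) * expvec \<xi> x"
    by (subst dd_eq[OF has_derivative_expvec]) (simp add: inner_axis)
  finally show ?thesis by (simp add: twisted_pderiv_def algebra_simps)
qed

end

section \<open>The commutator applied to exponentials, graded by the frequency\<close>

context
  fixes \<Omega> :: "((real, 'n::{finite,linorder}) vec) set" and R a0 :: "(real, 'n) vec \<Rightarrow> complex"
    and a2 a1 :: "'n \<Rightarrow> (real, 'n) vec \<Rightarrow> complex" and a11 :: "'n \<Rightarrow> 'n \<Rightarrow> (real, 'n) vec \<Rightarrow> complex"
  assumes op: "open \<Omega>" and laR: "line_analytic \<Omega> R"
    and la2: "\<And>i. line_analytic \<Omega> (a2 i)" and la11: "\<And>i j. i < j \<Longrightarrow> line_analytic \<Omega> (a11 i j)"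
    and la1: "\<And>i. line_analytic \<Omega> (a1 i)" and la0: "line_analytic \<Omega> a0"
    and comm: "commute_on \<Omega> (schroedinger_op R) (quartic_op a2 a11 a1 a0)"
begin

abbreviation (input) cc :: "(real, 'n) vec \<Rightarrow> 'n \<Rightarrow> complex" where "cc \<xi> i \<equiv> complex_of_real (\<xi> $ i)"

definition symbol :: "(real, 'n) vec \<Rightarrow> (real, 'n) vec \<Rightarrow> complex"
  where "symbol \<xi> x = (\<Sum>i\<in>UNIV. \<Sum>j\<in>{i<..}. (cc \<xi> i)\<^sup>2 * (cc \<xi> j)\<^sup>2)
    + ((\<Sum>i\<in>UNIV. (cc \<xi> i)\<^sup>2 * a2 i x) + ((\<Sum>i\<in>UNIV. \<Sum>j\<in>{i<..}. (cc \<xi> i * cc \<xi> j) * a11 i j x)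
    + ((\<Sum>i\<in>UNIV. cc \<xi> i * a1 i x) + a0 x)))"

text \<open>The quadratic part of the symbol with its coefficients differentiated along M;
  \<open>symbol1\<close> does the same for the linear part.\<close>

definition symbol2 :: "(real, 'n) vec \<Rightarrow> 'n multiset \<Rightarrow> (real, 'n) vec \<Rightarrow> complex"
  where "symbol2 \<xi> M x = (\<Sum>i\<in>UNIV. (cc \<xi> i)\<^sup>2 * jet (a2 i) M x) + (\<Sum>i\<in>UNIV. \<Sum>j\<in>{i<..}. (cc \<xi> i * cc \<xi> j) * jet (a11 i j) M x)"

definition symbol1 :: "(real, 'n) vec \<Rightarrow> 'n multiset \<Rightarrow> (real, 'n) vec \<Rightarrow> complex"
  where "symbol1 \<xi> M x = (\<Sum>i\<in>UNIV. cc \<xi> i * jet (a1 i) M x)"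

lemma la_symbol: "line_analytic \<Omega> (symbol \<xi>)"
  unfolding symbol_def[abs_def]
  by (intro line_analytic_add[OF op] line_analytic_sum[OF op] line_analytic_cmult[OF op] la2 la11 la1 la0 line_analytic_const) auto

lemma jet_symbol:
  assumes "x \<in> \<Omega>"
  shows "jet (symbol \<xi>) (add_mset m M) x = symbol2 \<xi> (add_mset m M) x + symbol1 \<xi> (add_mset m M) x + jet a0 (add_mset m M) x"
proof -
  note la = line_analytic_add[OF op] line_analytic_sum[OF op] line_analytic_cmult[OF op] la2 la11 la1 la0 line_analytic_const
  have 2: "jet (\<lambda>x. \<Sum>i\<in>UNIV. (cc \<xi> i)\<^sup>2 * a2 i x) M x = (\<Sum>i\<in>UNIV. (cc \<xi> i)\<^sup>2 * jet (a2 i) M x)" for M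
    using jet_sum[OF op, where A = UNIV and f = a2 and c = "\<lambda>i. (cc \<xi> i)\<^sup>2"] la2 assms by blast
  have 1: "jet (\<lambda>x. \<Sum>i\<in>UNIV. cc \<xi> i * a1 i x) M x = (\<Sum>i\<in>UNIV. cc \<xi> i * jet (a1 i) M x)" for M
    using jet_sum[OF op, where A = UNIV and f = a1 and c = "\<lambda>i. cc \<xi> i"] la1 assms by blast
  have 11: "jet (\<lambda>x. \<Sum>i\<in>UNIV. \<Sum>j\<in>{i<..}. (cc \<xi> i * cc \<xi> j) * a11 i j x) M x
      = (\<Sum>i\<in>UNIV. \<Sum>j\<in>{i<..}. (cc \<xi> i * cc \<xi> j) * jet (a11 i j) M x)" for M
  proof -
    have "jet (\<lambda>x. \<Sum>i\<in>UNIV. \<Sum>j\<in>{i<..}. (cc \<xi> i * cc \<xi> j) * a11 i j x) M x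
      = (\<Sum>i\<in>UNIV. jet (\<lambda>x. \<Sum>j\<in>{i<..}. (cc \<xi> i * cc \<xi> j) * a11 i j x) M x)"
      by (rule jet_sum1[OF op _ assms]) (intro la, auto)
    also have "\<dots> = (\<Sum>i\<in>UNIV. \<Sum>j\<in>{i<..}. (cc \<xi> i * cc \<xi> j) * jet (a11 i j) M x)"
      using jet_sum[OF op _ assms, where A = "{i<..}" and f = "a11 i" and c = "\<lambda>j. cc \<xi> i * cc \<xi> j" for i] la11
      by (intro sum.cong) auto
    finally show ?thesis .
  qed
  show ?thesis
    unfolding symbol_def[abs_def]
    apply (subst jet_add[OF op _ _ assms], (intro la; auto)[1], (intro la; auto)[1])
    apply (subst jet_add[OF op _ _ assms], (intro la; auto)[1], (intro la; auto)[1])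
    apply (subst jet_add[OF op _ _ assms], (intro la; auto)[1], (intro la; auto)[1])
    apply (subst jet_add[OF op _ _ assms], (intro la; auto)[1], (intro la; auto)[1])
    by (simp add: 1 2 11 symbol2_def symbol1_def jet_const_add_mset[OF op assms])
qed

lemma quartic_op_expvec: "quartic_op a2 a11 a1 a0 (expvec \<xi>) x = symbol \<xi> x * expvec \<xi> x"
proof -
  have "quartic_op a2 a11 a1 a0 (expvec \<xi>) x =
    (\<Sum>i\<in>UNIV. \<Sum>j\<in>{i<..}. (cc \<xi> i)\<^sup>2 * (cc \<xi> j)\<^sup>2 * expvec \<xi> x)
    + (\<Sum>i\<in>UNIV. (cc \<xi> i)\<^sup>2 * a2 i x * expvec \<xi> x) + (\<Sum>i\<in>UNIV. \<Sum>j\<in>{i<..}. (cc \<xi> i * cc \<xi> j) * a11 i j x * expvec \<xi> x)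
    + (\<Sum>i\<in>UNIV. cc \<xi> i * a1 i x * expvec \<xi> x) + a0 x * expvec \<xi> x"
    unfolding quartic_op_def pderiv_expvec1 pderiv_expvec
    by (simp add: power2_eq_square mult_ac)
  then show ?thesis
    by (simp add: symbol_def sum_distrib_left algebra_simps)
qed

lemma schroedinger_op_expvec: "schroedinger_op R (expvec \<xi>) x = (R x - (\<Sum>i\<in>UNIV. (cc \<xi> i)\<^sup>2)) * expvec \<xi> x"
  unfolding schroedinger_op_def laplacian_def pderiv_expvec1 pderiv_expvec
  by (simp add: sum_distrib_left algebra_simps power2_eq_square)

lemma pderiv2_mult_expvec:
  assumes "line_analytic \<Omega> g" "x \<in> \<Omega>"
  shows "pderiv_at i (pderiv_at j (\<lambda>y. g y * expvec \<xi> y)) x = twisted_pderiv \<xi> i (twisted_pderiv \<xi> j g) x * expvec \<xi> x"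
  by (rule pderiv_mult_expvec[OF op line_analytic_twisted_pderiv[OF op assms(1)] assms(2)], rule pderiv_mult_expvec[OF op assms(1)]) auto

lemma pderiv4_mult_expvec:
  assumes "line_analytic \<Omega> g" "x \<in> \<Omega>"
  shows "pderiv_at i (pderiv_at i (pderiv_at j (pderiv_at j (\<lambda>y. g y * expvec \<xi> y)))) x
    = twisted_pderiv \<xi> i (twisted_pderiv \<xi> i (twisted_pderiv \<xi> j (twisted_pderiv \<xi> j g))) x * expvec \<xi> x"
proof -
  note la = line_analytic_twisted_pderiv[OF op]
  show ?thesis
    by (rule pderiv_mult_expvec[OF op _ assms(2)], intro la assms(1), rule pderiv_mult_expvec[OF op], intro la assms(1), assumption,
        rule pderiv2_mult_expvec[OF assms(1)])
qed

text \<open>This definition and the next three are the homogeneous parts, in the frequency, of the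
  commutator on an exponential. There is no part of degree four or more because the quartic part of
  the operator has constant coefficients.\<close>

definition grade3 :: "(real, 'n) vec \<Rightarrow> (real, 'n) vec \<Rightarrow> complex"
  where "grade3 \<xi> x = (\<Sum>i\<in>UNIV. 2 * cc \<xi> i * symbol2 \<xi> {#i#} x)
    + (\<Sum>i\<in>UNIV. \<Sum>j\<in>{i<..}. 2 * cc \<xi> i * (cc \<xi> j)\<^sup>2 * jet R {#i#} x + 2 * cc \<xi> j * (cc \<xi> i)\<^sup>2 * jet R {#j#} x)"

definition grade2 :: "(real, 'n) vec \<Rightarrow> (real, 'n) vec \<Rightarrow> complex"
  where "grade2 \<xi> x = (\<Sum>i\<in>UNIV. symbol2 \<xi> {#i,i#} x) + (\<Sum>i\<in>UNIV. 2 * cc \<xi> i * symbol1 \<xi> {#i#} x)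
    + (\<Sum>i\<in>UNIV. \<Sum>j\<in>{i<..}. (cc \<xi> j)\<^sup>2 * jet R {#i,i#} x + 4 * (cc \<xi> i * cc \<xi> j) * jet R {#i,j#} x + (cc \<xi> i)\<^sup>2 * jet R {#j,j#} x)"

definition grade1 :: "(real, 'n) vec \<Rightarrow> (real, 'n) vec \<Rightarrow> complex"
  where "grade1 \<xi> x = (\<Sum>i\<in>UNIV. symbol1 \<xi> {#i,i#} x) + (\<Sum>i\<in>UNIV. 2 * cc \<xi> i * jet a0 {#i#} x)
    + (\<Sum>i\<in>UNIV. \<Sum>j\<in>{i<..}. 2 * cc \<xi> j * jet R {#i,i,j#} x + 2 * cc \<xi> i * jet R {#i,j,j#} x)
    + (\<Sum>i\<in>UNIV. 2 * cc \<xi> i * (a2 i x * jet R {#i#} x))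
    + (\<Sum>i\<in>UNIV. \<Sum>j\<in>{i<..}. a11 i j x * (cc \<xi> j * jet R {#i#} x + cc \<xi> i * jet R {#j#} x))"

definition grade0 :: "(real, 'n) vec \<Rightarrow> complex"
  where "grade0 x = (\<Sum>i\<in>UNIV. jet a0 {#i,i#} x) + (\<Sum>i\<in>UNIV. \<Sum>j\<in>{i<..}. jet R {#i,i,j,j#} x)
    + (\<Sum>i\<in>UNIV. a2 i x * jet R {#i,i#} x) + (\<Sum>i\<in>UNIV. \<Sum>j\<in>{i<..}. a11 i j x * jet R {#i,j#} x)
    + (\<Sum>i\<in>UNIV. a1 i x * jet R {#i#} x)"

text \<open>Both products of operators are expanded in twisted derivatives of \<open>symbol\<close>
  and of \<rho>. The terms in which neither is differentiated are the same product on both sides and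
  cancel, and with them everything of degree above three.\<close>

lemma grades_sum:
  assumes x: "x \<in> \<Omega>"
  shows "grade3 \<xi> x + grade2 \<xi> x + grade1 \<xi> x + grade0 x = 0"
proof -
  \<comment> \<open>On the exponential the Schroedinger operator multiplies by \<rho> = R - K, where
    K is the squared length of the frequency.\<close>
  define K where "K = (\<Sum>i\<in>UNIV. (cc \<xi> i)\<^sup>2)"
  define \<rho> where "\<rho> = (\<lambda>y. R y - K)"
  let ?T = "twisted_pderiv \<xi>"
  have la\<rho>: "line_analytic \<Omega> \<rho>" unfolding \<rho>_def by (intro line_analytic_diff[OF op] laR) simp
  have jet\<rho>: "jet \<rho> (add_mset i M) x = jet R (add_mset i M) x" for i M
  proof -
    have "jet \<rho> (add_mset i M) x = jet (\<lambda>y. R y + (-K)) (add_mset i M) x" by (simp add: \<rho>_def)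
    also have "\<dots> = jet R (add_mset i M) x + jet (\<lambda>_. -K) (add_mset i M) x"
      by (rule jet_add[OF op laR _ x]) simp
    finally show ?thesis by (simp add: jet_const_add_mset[OF op x])
  qed
  note laT = line_analytic_twisted_pderiv[OF op]
  note jT = jet_twisted_pderiv[OF op _ x]
  have T1: "?T i g x = jet g {#i#} x + cc \<xi> i * g x" if "line_analytic \<Omega> g" for g i
    using jT[OF that, of \<xi> i "{#}"] by simp
  have T2: "?T i (?T j g) x = jet g {#i,j#} x + cc \<xi> j * jet g {#i#} x + cc \<xi> i * jet g {#j#} x + cc \<xi> i * cc \<xi> j * g x"
    if "line_analytic \<Omega> g" for g i j
    using T1[OF laT[OF that]] T1[OF that] jT[OF that] by (simp add: algebra_simps add_mset_commute)
  have T4: "?T i (?T i (?T j (?T j g))) x = jet g {#i,i,j,j#} x + 2 * cc \<xi> j * jet g {#i,i,j#} x + (cc \<xi> j)\<^sup>2 * jet g {#i,i#} x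
     + 2 * cc \<xi> i * jet g {#i,j,j#} x + 4 * (cc \<xi> i * cc \<xi> j) * jet g {#i,j#} x + 2 * cc \<xi> i * (cc \<xi> j)\<^sup>2 * jet g {#i#} x
     + (cc \<xi> i)\<^sup>2 * jet g {#j,j#} x + 2 * cc \<xi> j * (cc \<xi> i)\<^sup>2 * jet g {#j#} x + (cc \<xi> i)\<^sup>2 * (cc \<xi> j)\<^sup>2 * g x"
    if "line_analytic \<Omega> g" for g i j
    using T2[OF laT[OF laT[OF that]], of i i \<xi> j \<xi> j] jT[OF laT[OF that]] jT[OF that] T2[OF that]
    by (simp add: algebra_simps add_mset_commute power2_eq_square)
  have "schroedinger_op R (quartic_op a2 a11 a1 a0 (expvec \<xi>)) x = quartic_op a2 a11 a1 a0 (schroedinger_op R (expvec \<xi>)) x"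
    using comm x smooth_expvec unfolding commute_on_def by blast
  also have "schroedinger_op R (quartic_op a2 a11 a1 a0 (expvec \<xi>)) x
     = (- (\<Sum>i\<in>UNIV. ?T i (?T i (symbol \<xi>)) x) + R x * symbol \<xi> x) * expvec \<xi> x"
    unfolding schroedinger_op_def laplacian_def quartic_op_expvec[abs_def] pderiv2_mult_expvec[OF la_symbol x]
    by (simp add: sum_distrib_left algebra_simps)
  also have "quartic_op a2 a11 a1 a0 (schroedinger_op R (expvec \<xi>)) x =
      ((\<Sum>i\<in>UNIV. \<Sum>j\<in>{i<..}. ?T i (?T i (?T j (?T j \<rho>))) x)
    + (\<Sum>i\<in>UNIV. a2 i x * ?T i (?T i \<rho>) x) + (\<Sum>i\<in>UNIV. \<Sum>j\<in>{i<..}. a11 i j x * ?T i (?T j \<rho>) x)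
    + (\<Sum>i\<in>UNIV. a1 i x * ?T i \<rho> x) + a0 x * \<rho> x) * expvec \<xi> x"
  proof -
    have e: "schroedinger_op R (expvec \<xi>) = (\<lambda>y. \<rho> y * expvec \<xi> y)"
      by (auto simp: schroedinger_op_expvec \<rho>_def K_def)
    show ?thesis unfolding quartic_op_def e pderiv2_mult_expvec[OF la\<rho> x] pderiv4_mult_expvec[OF la\<rho> x]
        pderiv_mult_expvec[OF op la\<rho> x refl]
      by (simp add: sum_distrib_right distrib_right mult.assoc)
  qed
  finally have main: "- (\<Sum>i\<in>UNIV. ?T i (?T i (symbol \<xi>)) x) + R x * symbol \<xi> x =
      (\<Sum>i\<in>UNIV. \<Sum>j\<in>{i<..}. ?T i (?T i (?T j (?T j \<rho>))) x)
    + (\<Sum>i\<in>UNIV. a2 i x * ?T i (?T i \<rho>) x) + (\<Sum>i\<in>UNIV. \<Sum>j\<in>{i<..}. a11 i j x * ?T i (?T j \<rho>) x)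
    + (\<Sum>i\<in>UNIV. a1 i x * ?T i \<rho> x) + a0 x * \<rho> x"
    by simp
  have A: "(\<Sum>i\<in>UNIV. ?T i (?T i (symbol \<xi>)) x) = (\<Sum>i\<in>UNIV. symbol2 \<xi> {#i,i#} x) + (\<Sum>i\<in>UNIV. symbol1 \<xi> {#i,i#} x) + (\<Sum>i\<in>UNIV. jet a0 {#i,i#} x)
     + (\<Sum>i\<in>UNIV. 2 * cc \<xi> i * symbol2 \<xi> {#i#} x) + (\<Sum>i\<in>UNIV. 2 * cc \<xi> i * symbol1 \<xi> {#i#} x) + (\<Sum>i\<in>UNIV. 2 * cc \<xi> i * jet a0 {#i#} x)
     + K * symbol \<xi> x"
    unfolding T2[OF la_symbol] jet_symbol[OF x] K_def sum_distrib_right sum.distrib[symmetric]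
    by (intro sum.cong) (simp_all add: algebra_simps power2_eq_square)
  have B: "(\<Sum>i\<in>UNIV. \<Sum>j\<in>{i<..}. ?T i (?T i (?T j (?T j \<rho>))) x) =
     (\<Sum>i\<in>UNIV. \<Sum>j\<in>{i<..}. jet R {#i,i,j,j#} x)
   + (\<Sum>i\<in>UNIV. \<Sum>j\<in>{i<..}. 2 * cc \<xi> j * jet R {#i,i,j#} x + 2 * cc \<xi> i * jet R {#i,j,j#} x)
   + (\<Sum>i\<in>UNIV. \<Sum>j\<in>{i<..}. (cc \<xi> j)\<^sup>2 * jet R {#i,i#} x + 4 * (cc \<xi> i * cc \<xi> j) * jet R {#i,j#} x + (cc \<xi> i)\<^sup>2 * jet R {#j,j#} x)
   + (\<Sum>i\<in>UNIV. \<Sum>j\<in>{i<..}. 2 * cc \<xi> i * (cc \<xi> j)\<^sup>2 * jet R {#i#} x + 2 * cc \<xi> j * (cc \<xi> i)\<^sup>2 * jet R {#j#} x)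
   + (\<Sum>i\<in>UNIV. \<Sum>j\<in>{i<..}. (cc \<xi> i)\<^sup>2 * (cc \<xi> j)\<^sup>2) * \<rho> x"
    unfolding T4[OF la\<rho>] jet\<rho> sum_distrib_right sum.distrib[symmetric]
    by (intro sum.cong) (simp_all add: algebra_simps)
  have C: "(\<Sum>i\<in>UNIV. a2 i x * ?T i (?T i \<rho>) x) = (\<Sum>i\<in>UNIV. a2 i x * jet R {#i,i#} x)
     + (\<Sum>i\<in>UNIV. 2 * cc \<xi> i * (a2 i x * jet R {#i#} x)) + (\<Sum>i\<in>UNIV. (cc \<xi> i)\<^sup>2 * a2 i x) * \<rho> x"
    unfolding T2[OF la\<rho>] jet\<rho> sum_distrib_right sum.distrib[symmetric]
    by (intro sum.cong) (simp_all add: algebra_simps power2_eq_square)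
  have D: "(\<Sum>i\<in>UNIV. \<Sum>j\<in>{i<..}. a11 i j x * ?T i (?T j \<rho>) x) = (\<Sum>i\<in>UNIV. \<Sum>j\<in>{i<..}. a11 i j x * jet R {#i,j#} x)
     + (\<Sum>i\<in>UNIV. \<Sum>j\<in>{i<..}. a11 i j x * (cc \<xi> j * jet R {#i#} x + cc \<xi> i * jet R {#j#} x))
     + (\<Sum>i\<in>UNIV. \<Sum>j\<in>{i<..}. (cc \<xi> i * cc \<xi> j) * a11 i j x) * \<rho> x"
    unfolding T2[OF la\<rho>] jet\<rho> sum_distrib_right sum.distrib[symmetric]
    by (intro sum.cong) (simp_all add: algebra_simps)
  have E: "(\<Sum>i\<in>UNIV. a1 i x * ?T i \<rho> x) = (\<Sum>i\<in>UNIV. a1 i x * jet R {#i#} x) + (\<Sum>i\<in>UNIV. cc \<xi> i * a1 i x) * \<rho> x"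
    unfolding T1[OF la\<rho>] jet\<rho> sum_distrib_right sum.distrib[symmetric]
    by (intro sum.cong) (simp_all add: algebra_simps)
  have rx: "\<rho> x = R x - K" by (simp add: \<rho>_def)
  show ?thesis
    using main unfolding A B C D E grade3_def grade2_def grade1_def grade0_def rx
    unfolding symbol_def by (simp add: algebra_simps)
qed

lemma grades_zero:
  assumes x: "x \<in> \<Omega>"
  shows "grade3 \<xi> x = 0" "grade2 \<xi> x = 0" "grade1 \<xi> x = 0"
proof -
  have s2: "symbol2 (t *\<^sub>R \<xi>) M x = of_real t ^ 2 * symbol2 \<xi> M x" for t M
    by (simp add: symbol2_def sum_distrib_left distrib_left power2_eq_square mult_ac)
  have s1: "symbol1 (t *\<^sub>R \<xi>) M x = of_real t * symbol1 \<xi> M x" for t M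
    by (simp add: symbol1_def sum_distrib_left mult_ac)
  have g3: "grade3 (t *\<^sub>R \<xi>) x = of_real t ^ 3 * grade3 \<xi> x" for t
    by (simp add: grade3_def s2 sum_distrib_left distrib_left power2_eq_square power3_eq_cube mult_ac)
  have g2: "grade2 (t *\<^sub>R \<xi>) x = of_real t ^ 2 * grade2 \<xi> x" for t
    by (simp add: grade2_def s2 s1 sum_distrib_left distrib_left power2_eq_square mult_ac)
  have g1: "grade1 (t *\<^sub>R \<xi>) x = of_real t * grade1 \<xi> x" for t
    by (simp add: grade1_def s1 sum_distrib_left distrib_left mult_ac)
  have *: "of_real t ^ 3 * grade3 \<xi> x + of_real t ^ 2 * grade2 \<xi> x + of_real t * grade1 \<xi> x + grade0 x = 0" for t
    using grades_sum[OF x, of "t *\<^sub>R \<xi>"] unfolding g3 g2 g1 .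
  \<comment> \<open>A polynomial of degree three in the scaling factor t vanishes at t = 0, 1, -1,
    2, so all its coefficients are zero.\<close>
  have "grade0 x = 0" "grade3 \<xi> x + grade2 \<xi> x + grade1 \<xi> x + grade0 x = 0"
    "- grade3 \<xi> x + grade2 \<xi> x - grade1 \<xi> x + grade0 x = 0" "8 * grade3 \<xi> x + 4 * grade2 \<xi> x + 2 * grade1 \<xi> x + grade0 x = 0"
    using *[of 0] *[of 1] *[of "-1"] *[of 2] by simp_all
  then show "grade3 \<xi> x = 0" "grade2 \<xi> x = 0" "grade1 \<xi> x = 0"
    by (auto simp: complex_eq_iff)
qed

text \<open>The summand 2 R absorbs the part of \<open>grade3\<close> that carries the squared
  length of the frequency. Only the cubes of the single frequencies remain, which is why the right
  side of \<open>eq3\<close> is zero unless i = j = k.\<close>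

definition sym_coeff :: "'n \<Rightarrow> 'n \<Rightarrow> (real, 'n) vec \<Rightarrow> complex"
  where "sym_coeff i j = (if i = j then (\<lambda>x. 2 * a2 i x + 2 * R x) else if i < j then a11 i j else a11 j i)"

lemma sym_coeff_sym: "sym_coeff i j = sym_coeff j i"
  by (auto simp: sym_coeff_def)

lemma la_sym_coeff: "line_analytic \<Omega> (sym_coeff i j)"
  using la11 by (auto simp: sym_coeff_def not_less intro!: line_analytic_add[OF op] line_analytic_cmult[OF op] la2 laR)

lemma jet_sym_coeff_diag:
  assumes "x \<in> \<Omega>" shows "jet (sym_coeff i i) M x = 2 * jet (a2 i) M x + 2 * jet R M x"
  using assms by (simp add: sym_coeff_def jet_add[OF op] line_analytic_cmult[OF op] la2 laR jet_cmult[OF op])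

lemma symbol2_sym_coeff:
  assumes "x \<in> \<Omega>"
  shows "(\<Sum>i\<in>UNIV. cc \<xi> i * (\<Sum>j\<in>UNIV. cc \<xi> j * jet (sym_coeff i j) M x)) = 2 * symbol2 \<xi> M x + 2 * (\<Sum>i\<in>UNIV. (cc \<xi> i)\<^sup>2) * jet R M x"
proof -
  have "(\<Sum>i\<in>UNIV. cc \<xi> i * (\<Sum>j\<in>UNIV. cc \<xi> j * jet (sym_coeff i j) M x)) = (\<Sum>i\<in>UNIV. cc \<xi> i * (cc \<xi> i * jet (sym_coeff i i) M x))
     + (\<Sum>i\<in>UNIV. \<Sum>j\<in>{i<..}. cc \<xi> i * (cc \<xi> j * jet (sym_coeff i j) M x) + cc \<xi> j * (cc \<xi> i * jet (sym_coeff j i) M x))"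
    unfolding sum_distrib_left by (rule sum_split_strict)
  also have "(\<Sum>i\<in>UNIV. \<Sum>j\<in>{i<..}. cc \<xi> i * (cc \<xi> j * jet (sym_coeff i j) M x) + cc \<xi> j * (cc \<xi> i * jet (sym_coeff j i) M x))
      = 2 * (\<Sum>i\<in>UNIV. \<Sum>j\<in>{i<..}. (cc \<xi> i * cc \<xi> j) * jet (a11 i j) M x)"
    unfolding sum_distrib_left
    by (intro sum.cong refl) (auto simp: sym_coeff_def)
  also have "(\<Sum>i\<in>UNIV. cc \<xi> i * (cc \<xi> i * jet (sym_coeff i i) M x)) = 2 * (\<Sum>i\<in>UNIV. (cc \<xi> i)\<^sup>2 * jet (a2 i) M x) + 2 * (\<Sum>i\<in>UNIV. (cc \<xi> i)\<^sup>2) * jet R M x"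
    unfolding jet_sym_coeff_diag[OF assms] sum_distrib_left sum_distrib_right sum.distrib[symmetric]
    by (intro sum.cong) (simp_all add: algebra_simps power2_eq_square)
  finally show ?thesis by (simp add: symbol2_def algebra_simps)
qed

lemma delta_mult: "complex_of_real (stdvec i $ k) * z = (if k = i then z else 0)"
  by (simp add: axis_def)

lemma eq3_sym_coeff:
  assumes x: "x \<in> \<Omega>"
  shows "jet (sym_coeff j k) {#i#} x + jet (sym_coeff i k) {#j#} x + jet (sym_coeff i j) {#k#} x = (if i = j \<and> j = k then 6 else 0) * jet R {#i#} x"
proof -
  \<comment> \<open>A trilinear form whose diagonal is \<open>grade3\<close>; polarisation at basis
    vectors extracts its symmetric part.\<close>
  define B where "B a b c = (\<Sum>k\<in>UNIV. cc a k * (\<Sum>i\<in>UNIV. cc b i * (\<Sum>j\<in>UNIV. cc c j * jet (sym_coeff i j) {#k#} x)))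
     - 2 * (\<Sum>i\<in>UNIV. cc a i * (cc b i * (cc c i * jet R {#i#} x)))" for a b c
  have B0: "B \<xi> \<xi> \<xi> = 0" for \<xi>
  proof -
    define K where "K = (\<Sum>i\<in>UNIV. (cc \<xi> i)\<^sup>2)"
    have "(\<Sum>i\<in>UNIV. \<Sum>j\<in>UNIV. 2 * cc \<xi> i * (cc \<xi> j)\<^sup>2 * jet R {#i#} x) = (\<Sum>i\<in>UNIV. 2 * cc \<xi> i * (cc \<xi> i)\<^sup>2 * jet R {#i#} x)
      + (\<Sum>i\<in>UNIV. \<Sum>j\<in>{i<..}. 2 * cc \<xi> i * (cc \<xi> j)\<^sup>2 * jet R {#i#} x + 2 * cc \<xi> j * (cc \<xi> i)\<^sup>2 * jet R {#j#} x)"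
      by (rule sum_split_strict)
    moreover have "(\<Sum>i\<in>UNIV. \<Sum>j\<in>UNIV. 2 * cc \<xi> i * (cc \<xi> j)\<^sup>2 * jet R {#i#} x) = (\<Sum>i\<in>UNIV. cc \<xi> i * (2 * K * jet R {#i#} x))"
      unfolding K_def sum_distrib_left sum_distrib_right
      by (intro sum.cong refl) (simp add: mult_ac)
    moreover have "(\<Sum>i\<in>UNIV. 2 * cc \<xi> i * symbol2 \<xi> {#i#} x) = (\<Sum>k\<in>UNIV. cc \<xi> k * (2 * symbol2 \<xi> {#k#} x + 2 * K * jet R {#k#} x)) - (\<Sum>i\<in>UNIV. cc \<xi> i * (2 * K * jet R {#i#} x))"
      by (simp add: sum_subtractf[symmetric] algebra_simps)
    moreover have "(\<Sum>i\<in>UNIV. 2 * cc \<xi> i * (cc \<xi> i)\<^sup>2 * jet R {#i#} x) = 2 * (\<Sum>i\<in>UNIV. cc \<xi> i * (cc \<xi> i * (cc \<xi> i * jet R {#i#} x)))"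
      by (simp add: sum_distrib_left power2_eq_square mult_ac)
    ultimately have "B \<xi> \<xi> \<xi> = grade3 \<xi> x"
      unfolding B_def grade3_def symbol2_sym_coeff[OF x] K_def[symmetric] by (simp add: algebra_simps)
    then show ?thesis using grades_zero[OF x] by simp
  qed
  have Be: "B (stdvec i) (stdvec j) (stdvec k) = jet (sym_coeff j k) {#i#} x - (if i = j \<and> j = k then 2 * jet R {#i#} x else 0)" for i j k
    unfolding B_def delta_mult by (auto simp: if_distrib[of "\<lambda>z. _ * z"] cong: if_cong)
  have "B (stdvec i) (stdvec j) (stdvec k) + B (stdvec i) (stdvec k) (stdvec j) + B (stdvec j) (stdvec i) (stdvec k)
     + B (stdvec j) (stdvec k) (stdvec i) + B (stdvec k) (stdvec i) (stdvec j) + B (stdvec k) (stdvec j) (stdvec i) = 0"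
    by (rule cubic_form_polarization[OF _ _ _ B0])
       (simp_all add: B_def distrib_right distrib_left sum.distrib algebra_simps)
  then show ?thesis
    unfolding Be sym_coeff_sym[of k j] sym_coeff_sym[of k i] sym_coeff_sym[of j i] 
    by (auto simp: complex_eq_iff split: if_splits)
qed

lemma eq2_sym_coeff:
  assumes x: "x \<in> \<Omega>"
  shows "2 * (jet (a1 j) {#i#} x + jet (a1 i) {#j#} x) + (\<Sum>m\<in>UNIV. jet (sym_coeff i j) {#m,m#} x)
     + (4 - (if i = j then 6 else 0)) * jet R {#i,j#} x = 0"
proof -
  \<comment> \<open>M is not symmetric because of the derivative of \<open>a1\<close>; the vanishing
    of the quadratic form gives only M i j + M j i = 0, which is the equation sought, twice.\<close>
  define M where "M k l = (\<Sum>m\<in>UNIV. jet (sym_coeff k l) {#m,m#} x) + 4 * jet (a1 l) {#k#} x + 4 * jet R {#k,l#} x - (if k = l then 6 * jet R {#k,k#} x else 0)" for k l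
  define Q where "Q a b = (\<Sum>k\<in>UNIV. cc a k * (\<Sum>l\<in>UNIV. cc b l * M k l))" for a b
  have Q0: "Q \<xi> \<xi> = 0" for \<xi>
  proof -
    define K where "K = (\<Sum>i\<in>UNIV. (cc \<xi> i)\<^sup>2)"
    have 1: "(\<Sum>k\<in>UNIV. cc \<xi> k * (\<Sum>l\<in>UNIV. cc \<xi> l * (\<Sum>m\<in>UNIV. jet (sym_coeff k l) {#m,m#} x)))
       = 2 * (\<Sum>m\<in>UNIV. symbol2 \<xi> {#m,m#} x) + 2 * K * (\<Sum>m\<in>UNIV. jet R {#m,m#} x)"
    proof -
      have "(\<Sum>k\<in>UNIV. cc \<xi> k * (\<Sum>l\<in>UNIV. cc \<xi> l * (\<Sum>m\<in>UNIV. jet (sym_coeff k l) {#m,m#} x)))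
        = (\<Sum>k\<in>UNIV. \<Sum>l\<in>UNIV. \<Sum>m\<in>UNIV. cc \<xi> k * (cc \<xi> l * jet (sym_coeff k l) {#m,m#} x))"
        by (simp add: sum_distrib_left)
      also have "\<dots> = (\<Sum>k\<in>UNIV. \<Sum>m\<in>UNIV. \<Sum>l\<in>UNIV. cc \<xi> k * (cc \<xi> l * jet (sym_coeff k l) {#m,m#} x))"
        by (intro sum.cong refl sum.swap)
      also have "\<dots> = (\<Sum>m\<in>UNIV. \<Sum>k\<in>UNIV. \<Sum>l\<in>UNIV. cc \<xi> k * (cc \<xi> l * jet (sym_coeff k l) {#m,m#} x))"
        by (rule sum.swap)
      also have "\<dots> = (\<Sum>m\<in>UNIV. 2 * symbol2 \<xi> {#m,m#} x + 2 * K * jet R {#m,m#} x)"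
        using symbol2_sym_coeff[OF x] by (simp add: sum_distrib_left K_def)
      finally show ?thesis by (simp add: sum.distrib sum_distrib_left)
    qed
    have 2: "(\<Sum>k\<in>UNIV. cc \<xi> k * (\<Sum>l\<in>UNIV. cc \<xi> l * (4 * jet (a1 l) {#k#} x))) = 2 * (\<Sum>i\<in>UNIV. 2 * cc \<xi> i * symbol1 \<xi> {#i#} x)"
      by (simp add: symbol1_def sum_distrib_left mult_ac)
    have 3: "(\<Sum>k\<in>UNIV. cc \<xi> k * (\<Sum>l\<in>UNIV. cc \<xi> l * (4 * jet R {#k,l#} x))) = 4 * (\<Sum>i\<in>UNIV. (cc \<xi> i)\<^sup>2 * jet R {#i,i#} x)
       + 2 * (\<Sum>i\<in>UNIV. \<Sum>j\<in>{i<..}. 4 * (cc \<xi> i * cc \<xi> j) * jet R {#i,j#} x)"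
      unfolding sum_distrib_left sum_split_strict
      by (intro arg_cong2[of _ _ _ _ "(+)"] sum.cong refl) (simp_all add: add_mset_commute power2_eq_square algebra_simps)
    have 4: "(\<Sum>k\<in>UNIV. cc \<xi> k * (\<Sum>l\<in>UNIV. cc \<xi> l * (if k = l then 6 * jet R {#k,k#} x else 0))) = 6 * (\<Sum>i\<in>UNIV. (cc \<xi> i)\<^sup>2 * jet R {#i,i#} x)"
      by (simp add: if_distrib[of "\<lambda>z. _ * z"] sum_distrib_left power2_eq_square mult_ac cong: if_cong)
    have 5: "K * (\<Sum>m\<in>UNIV. jet R {#m,m#} x) = (\<Sum>i\<in>UNIV. (cc \<xi> i)\<^sup>2 * jet R {#i,i#} x)
       + (\<Sum>i\<in>UNIV. \<Sum>j\<in>{i<..}. (cc \<xi> i)\<^sup>2 * jet R {#j,j#} x + (cc \<xi> j)\<^sup>2 * jet R {#i,i#} x)"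
      unfolding K_def sum_product by (rule sum_split_strict)
    have 6: "(\<Sum>i\<in>UNIV. \<Sum>j\<in>{i<..}. (cc \<xi> j)\<^sup>2 * jet R {#i,i#} x + 4 * (cc \<xi> i * cc \<xi> j) * jet R {#i,j#} x + (cc \<xi> i)\<^sup>2 * jet R {#j,j#} x)
       = (\<Sum>i\<in>UNIV. \<Sum>j\<in>{i<..}. (cc \<xi> i)\<^sup>2 * jet R {#j,j#} x + (cc \<xi> j)\<^sup>2 * jet R {#i,i#} x) + (\<Sum>i\<in>UNIV. \<Sum>j\<in>{i<..}. 4 * (cc \<xi> i * cc \<xi> j) * jet R {#i,j#} x)"
      unfolding sum.distrib[symmetric] by (intro sum.cong refl) (simp add: algebra_simps)
    have "Q \<xi> \<xi> = (\<Sum>k\<in>UNIV. cc \<xi> k * (\<Sum>l\<in>UNIV. cc \<xi> l * (\<Sum>m\<in>UNIV. jet (sym_coeff k l) {#m,m#} x)))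
      + (\<Sum>k\<in>UNIV. cc \<xi> k * (\<Sum>l\<in>UNIV. cc \<xi> l * (4 * jet (a1 l) {#k#} x)))
      + (\<Sum>k\<in>UNIV. cc \<xi> k * (\<Sum>l\<in>UNIV. cc \<xi> l * (4 * jet R {#k,l#} x)))
      - (\<Sum>k\<in>UNIV. cc \<xi> k * (\<Sum>l\<in>UNIV. cc \<xi> l * (if k = l then 6 * jet R {#k,k#} x else 0)))"
      unfolding Q_def M_def distrib_left right_diff_distrib sum.distrib sum_subtractf ..
    also have "\<dots> = 2 * grade2 \<xi> x"
      unfolding 1 2 3 4 grade2_def 6 using arg_cong[OF 5, of "\<lambda>z. 2 * z"] by (simp add: algebra_simps)
    finally show ?thesis using grades_zero[OF x] by simp
  qed
  have Qe: "Q (stdvec k) (stdvec l) = M k l" for k l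
    unfolding Q_def delta_mult by simp
  have "Q (stdvec i + stdvec j) (stdvec i + stdvec j) = Q (stdvec i) (stdvec i) + Q (stdvec i) (stdvec j) + Q (stdvec j) (stdvec i) + Q (stdvec j) (stdvec j)"
    by (simp add: Q_def distrib_right distrib_left sum.distrib algebra_simps)
  then have "M i j + M j i = 0" unfolding Q0 Qe[symmetric] by simp
  then have "2 * (2 * (jet (a1 j) {#i#} x + jet (a1 i) {#j#} x) + (\<Sum>m\<in>UNIV. jet (sym_coeff i j) {#m,m#} x)
     + (4 - (if i = j then 6 else 0)) * jet R {#i,j#} x) = 0"
    unfolding M_def sym_coeff_sym[of j i] by (cases "i = j") (simp_all add: add_mset_commute algebra_simps)
  moreover have "2 * z = 0 \<Longrightarrow> z = 0" for z :: complex by simp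
  ultimately show ?thesis by blast
qed

lemma eq1_sym_coeff:
  assumes x: "x \<in> \<Omega>"
  shows "2 * jet a0 {#j#} x + (\<Sum>m\<in>UNIV. jet (a1 j) {#m,m#} x) + 2 * (\<Sum>m\<in>UNIV. jet R {#m,m,j#} x)
        - 2 * jet R {#j,j,j#} x - 2 * (R x * jet R {#j#} x) + (\<Sum>k\<in>UNIV. sym_coeff j k x * jet R {#k#} x) = 0"
proof -
  define G where "G j = 2 * jet a0 {#j#} x + (\<Sum>m\<in>UNIV. jet (a1 j) {#m,m#} x) + 2 * (\<Sum>m\<in>UNIV. jet R {#m,m,j#} x)
        - 2 * jet R {#j,j,j#} x - 2 * (R x * jet R {#j#} x) + (\<Sum>k\<in>UNIV. sym_coeff j k x * jet R {#k#} x)" for j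
  have "(\<Sum>i\<in>UNIV. cc \<xi> i * G i) = 0" for \<xi>
  proof -
    have 1: "(\<Sum>i\<in>UNIV. cc \<xi> i * (\<Sum>m\<in>UNIV. jet (a1 i) {#m,m#} x)) = (\<Sum>i\<in>UNIV. symbol1 \<xi> {#i,i#} x)"
      unfolding symbol1_def sum_distrib_left by (rule sum.swap)
    have 2: "(\<Sum>i\<in>UNIV. cc \<xi> i * (2 * (\<Sum>m\<in>UNIV. jet R {#m,m,i#} x))) = (\<Sum>i\<in>UNIV. cc \<xi> i * (2 * jet R {#i,i,i#} x))
       + (\<Sum>i\<in>UNIV. \<Sum>j\<in>{i<..}. 2 * cc \<xi> j * jet R {#i,i,j#} x + 2 * cc \<xi> i * jet R {#i,j,j#} x)"
      unfolding sum_distrib_left sum_split_strict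
      by (rule arg_cong2[of _ _ _ _ "(+)"]; intro sum.cong refl; simp add: add_mset_commute)
    have 3: "(\<Sum>i\<in>UNIV. cc \<xi> i * (\<Sum>k\<in>UNIV. sym_coeff i k x * jet R {#k#} x)) = (\<Sum>i\<in>UNIV. 2 * cc \<xi> i * (a2 i x * jet R {#i#} x))
       + (\<Sum>i\<in>UNIV. cc \<xi> i * (2 * (R x * jet R {#i#} x)))
       + (\<Sum>i\<in>UNIV. \<Sum>j\<in>{i<..}. a11 i j x * (cc \<xi> j * jet R {#i#} x + cc \<xi> i * jet R {#j#} x))"
      unfolding sum_distrib_left sum_split_strict sum.distrib[symmetric]
      by (intro arg_cong2[of _ _ _ _ "(+)"] sum.cong refl) (auto simp: sym_coeff_def algebra_simps)
    have "(\<Sum>i\<in>UNIV. cc \<xi> i * G i) = (\<Sum>i\<in>UNIV. cc \<xi> i * (2 * jet a0 {#i#} x)) + (\<Sum>i\<in>UNIV. cc \<xi> i * (\<Sum>m\<in>UNIV. jet (a1 i) {#m,m#} x))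
       + (\<Sum>i\<in>UNIV. cc \<xi> i * (2 * (\<Sum>m\<in>UNIV. jet R {#m,m,i#} x))) - (\<Sum>i\<in>UNIV. cc \<xi> i * (2 * jet R {#i,i,i#} x))
       - (\<Sum>i\<in>UNIV. cc \<xi> i * (2 * (R x * jet R {#i#} x))) + (\<Sum>i\<in>UNIV. cc \<xi> i * (\<Sum>k\<in>UNIV. sym_coeff i k x * jet R {#k#} x))"
      unfolding G_def distrib_left right_diff_distrib sum.distrib sum_subtractf ..
    also have "\<dots> = grade1 \<xi> x" unfolding 1 2 3 grade1_def by (simp add: algebra_simps)
    finally show ?thesis using grades_zero[OF x] by simp
  qed
  \<comment> \<open>\<open>grade1\<close> is linear in the frequency, so a basis vector reads off
    one component.\<close>
  from this[of "stdvec j"] show ?thesis unfolding delta_mult G_def by simp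
qed

lemma commuting_system_sym_coeff: "commuting_system \<Omega> R sym_coeff a1 a0"
proof
  note J = jet_eq_pderiv[OF op _ ] jet_eq_pderiv2[OF op] jet_eq_pderiv3[OF op]
  show "pderiv_at i (sym_coeff j k) x + pderiv_at j (sym_coeff i k) x + pderiv_at k (sym_coeff i j) x
        = (if i = j \<and> j = k then 6 else 0) * pderiv_at i R x" if "x \<in> \<Omega>" for i j k x
    using eq3_sym_coeff[OF that] by (simp add: J[OF la_sym_coeff that] J[OF laR that])
  show "2 * (pderiv_at i (a1 j) x + pderiv_at j (a1 i) x) + (\<Sum>m\<in>UNIV. pderiv_at m (pderiv_at m (sym_coeff i j)) x)
        + 4 * pderiv_at i (pderiv_at j R) x - (if i = j then 6 else 0) * pderiv_at i (pderiv_at j R) x = 0" if "x \<in> \<Omega>" for i j x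
    using eq2_sym_coeff[OF that, of j i] by (simp add: J[OF la_sym_coeff that] J[OF laR that] J[OF la1 that] algebra_simps)
  show "2 * pderiv_at j a0 x + (\<Sum>m\<in>UNIV. pderiv_at m (pderiv_at m (a1 j)) x)
        + 2 * (\<Sum>m\<in>UNIV. pderiv_at m (pderiv_at m (pderiv_at j R)) x)
        - 2 * pderiv_at j (pderiv_at j (pderiv_at j R)) x - 2 * (R x * pderiv_at j R x)
        + (\<Sum>k\<in>UNIV. sym_coeff j k x * pderiv_at k R x) = 0" if "x \<in> \<Omega>" for j x
    using eq1_sym_coeff[OF that] by (simp add: J[OF laR that] J[OF la1 that] J[OF la0 that])
qed (auto intro: op laR la_sym_coeff la1 la0 sym_coeff_sym)

end

subsection \<open>Ordinary differential equations at a double pole\<close>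

text \<open>The function h lives on the positive side of a wall. It extends holomorphically across
  the wall as soon as its derivative does, since it differs from a primitive by a constant.\<close>

lemma primitive_extension:
  assumes H: "H holomorphic_on ball 0 d" and d: "d > 0"
    and h: "\<And>t. 0 < t \<Longrightarrow> t < d \<Longrightarrow> (h has_vector_derivative H (of_real t)) (at t)"
  obtains G where "G holomorphic_on ball 0 d" "\<And>z. z \<in> ball 0 d \<Longrightarrow> (G has_field_derivative H z) (at z)"
    "\<And>t. 0 < t \<Longrightarrow> t < d \<Longrightarrow> h t = G (of_real t)"
proof -
  obtain G0 where G0: "\<And>z. z \<in> ball 0 d \<Longrightarrow> (G0 has_field_derivative H z) (at z within ball 0 d)"
    using holomorphic_convex_primitive[of "ball 0 d" "{}" H] H holomorphic_on_imp_continuous_on[OF H]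
      holomorphic_on_imp_differentiable_at[OF H open_ball] by auto
  have G0': "(G0 has_field_derivative H z) (at z)" if "z \<in> ball 0 d" for z
    using G0[OF that] at_within_open[OF that open_ball] by simp
  have "\<exists>c. \<forall>t\<in>{0<..<d}. h t - G0 (of_real t) = c"
  proof (rule has_derivative_zero_constant)
    fix t assume t: "t \<in> {0<..<d}"
    then have "((\<lambda>t. G0 (of_real t)) has_vector_derivative H (of_real t)) (at t)"
      using has_vector_derivative_real_field[OF G0'[of "of_real t"]] by simp
    with h t have "((\<lambda>t. h t - G0 (of_real t)) has_vector_derivative H (of_real t) - H (of_real t)) (at t)"
      by (intro has_vector_derivative_diff) auto
    then show "((\<lambda>t. h t - G0 (of_real t)) has_derivative (\<lambda>h. 0)) (at t within {0<..<d})"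
      unfolding has_vector_derivative_def by (rule has_derivative_at_withinI[OF has_derivative_eq_rhs]) simp
  qed auto
  then obtain c where c: "\<And>t. 0 < t \<Longrightarrow> t < d \<Longrightarrow> h t - G0 (of_real t) = c" by auto
  show thesis
  proof
    show D: "((\<lambda>z. G0 z + c) has_field_derivative H z) (at z)" if "z \<in> ball 0 d" for z
      using G0'[OF that] by (auto intro!: derivative_eq_intros)
    show "(\<lambda>z. G0 z + c) holomorphic_on ball 0 d"
      using D by (intro holomorphic_onI) (auto simp: field_differentiable_def intro: has_field_derivative_at_within)
    show "h t = G0 (of_real t) + c" if "0 < t" "t < d" for t
      using c[OF that] by (simp add: algebra_simps)
  qed
qed

text \<open>The operator on the left multiplies z^k by 2 (k - 1) (k - 3). A right side of order four
  therefore kills the coefficients of 1 and z^2, and leaves those of z and z^3 free.\<close>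

lemma double_pole_constraint:
  fixes G N :: "complex \<Rightarrow> complex"
  assumes G: "G holomorphic_on ball 0 d" and N: "N holomorphic_on ball 0 d" and d: "d > 0" and c: "c \<noteq> 0"
    and eq: "\<And>z. z \<in> ball 0 d \<Longrightarrow> c * (6 * G z - 6 * z * deriv G z + 2 * z\<^sup>2 * deriv (deriv G) z) = z ^ 4 * N z"
  shows "G 0 = 0" "deriv (deriv G) 0 = 0"
proof -
  have G1: "deriv G holomorphic_on ball 0 d" and G2: "deriv (deriv G) holomorphic_on ball 0 d"
    using G by (auto intro: holomorphic_deriv)
  show "G 0 = 0" using eq[of 0] d c by simp
  have D: "(F has_field_derivative deriv F z) (at z)" if "F holomorphic_on ball 0 d" "z \<in> ball 0 d" for F z
    using that by (intro holomorphic_derivI[OF that(1) open_ball]) auto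
  \<comment> \<open>The equation differentiated once and divided by z; the terms with the first
    derivative of G cancel, so that M 0 is -2 times the second derivative of G at 0.\<close>
  define M where "M z = - 2 * deriv (deriv G) z + 2 * z * deriv (deriv (deriv G)) z - (4 * z\<^sup>2 * N z + z ^ 3 * deriv N z) / c" for z
  have zM: "z * M z = 0" if z: "z \<in> ball 0 d" for z
  proof -
    let ?L = "\<lambda>z. c * (6 * G z - 6 * z * deriv G z + 2 * z\<^sup>2 * deriv (deriv G) z)"
    have "(?L has_field_derivative c * (- 2 * z * deriv (deriv G) z + 2 * z\<^sup>2 * deriv (deriv (deriv G)) z)) (at z)"
      using D[OF G z] D[OF G1 z] D[OF G2 z]
      by (auto intro!: derivative_eq_intros simp: algebra_simps)
    moreover have "(?L has_field_derivative 4 * z ^ 3 * N z + z ^ 4 * deriv N z) (at z)"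
    proof (rule has_field_derivative_transform_within_open[of "\<lambda>z. z ^ 4 * N z" _ _ "ball 0 d"])
      show "((\<lambda>z. z ^ 4 * N z) has_field_derivative 4 * z ^ 3 * N z + z ^ 4 * deriv N z) (at z)"
        using D[OF N z] by (auto intro!: derivative_eq_intros simp: algebra_simps)
    qed (use z eq in auto)
    ultimately have "c * (- 2 * z * deriv (deriv G) z + 2 * z\<^sup>2 * deriv (deriv (deriv G)) z) = 4 * z ^ 3 * N z + z ^ 4 * deriv N z"
      by (rule DERIV_unique)
    then show ?thesis using c unfolding M_def by (simp add: field_simps power2_eq_square power3_eq_cube power4_eq_xxxx)
  qed
  have "deriv (deriv (deriv G)) holomorphic_on ball 0 d" "deriv N holomorphic_on ball 0 d"
    using G2 N by (auto intro: holomorphic_deriv)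
  then have "M holomorphic_on ball 0 d" unfolding M_def[abs_def]
    using G G2 N c by (intro holomorphic_intros) auto
  moreover have "M (of_real t) = 0" if "0 < t" "t < d" for t
    using zM[of "of_real t"] that by auto
  ultimately have "M 0 = 0"
    using holomorphic_zero_of_right_zero[of M d d 0] d by auto
  then show "deriv (deriv G) 0 = 0" by (simp add: M_def)
qed

lemma odd_of_even_derivative:
  fixes G H :: "complex \<Rightarrow> complex"
  assumes "\<And>z. z \<in> ball 0 d \<Longrightarrow> (G has_field_derivative H z) (at z)" "\<And>z. z \<in> ball 0 d \<Longrightarrow> H (- z) = H z"
    "G 0 = 0" "z \<in> ball 0 d"
  shows "G (- z) = - G z"
proof -
  have "\<exists>c. \<forall>z\<in>ball 0 d. G z + G (- z) = c"
  proof (rule has_field_derivative_zero_constant)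
    fix z :: complex assume z: "z \<in> ball 0 d"
    have "((\<lambda>z. G z + G (- z)) has_field_derivative H z + H (- z) * (- 1)) (at z)"
      using z by (auto intro!: derivative_eq_intros assms(1) DERIV_chain2[of G "H (- z)" uminus z "-1" UNIV])
    then show "((\<lambda>z. G z + G (- z)) has_field_derivative 0) (at z within ball 0 d)"
      using assms(2)[OF z] by (simp add: has_field_derivative_at_within)
  qed simp
  then obtain c where c: "\<And>z. z \<in> ball 0 d \<Longrightarrow> G z + G (- z) = c" by blast
  have "0 \<in> ball (0::complex) d" using assms(4) by (auto intro: le_less_trans[OF norm_ge_zero])
  then have "c = 0" using c[of 0] assms(3) by simp
  then show ?thesis using c[OF assms(4)] by (simp add: eq_neg_iff_add_eq_0 add.commute)
qed

lemma even_of_odd_derivative: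
  fixes G H :: "complex \<Rightarrow> complex"
  assumes "\<And>z. z \<in> ball 0 d \<Longrightarrow> (G has_field_derivative H z) (at z)" "\<And>z. z \<in> ball 0 d \<Longrightarrow> H (- z) = - H z"
    "z \<in> ball 0 d"
  shows "G (- z) = G z"
proof -
  have "\<exists>c. \<forall>z\<in>ball 0 d. G z - G (- z) = c"
  proof (rule has_field_derivative_zero_constant)
    fix z :: complex assume z: "z \<in> ball 0 d"
    have "((\<lambda>z. G z - G (- z)) has_field_derivative H z - H (- z) * (- 1)) (at z)"
      using z by (auto intro!: derivative_eq_intros assms(1) DERIV_chain2[of G "H (- z)" uminus z "-1" UNIV])
    then show "((\<lambda>z. G z - G (- z)) has_field_derivative 0) (at z within ball 0 d)"
      using assms(2)[OF z] by (simp add: has_field_derivative_at_within)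
  qed simp
  then obtain c where c: "\<And>z. z \<in> ball 0 d \<Longrightarrow> G z - G (- z) = c" by blast
  have "0 \<in> ball (0::complex) d" using assms(3) by (auto intro: le_less_trans[OF norm_ge_zero])
  then have "c = 0" using c[of 0] by simp
  then show ?thesis using c[OF assms(3)] by simp
qed

lemma deriv_reflect:
  fixes F :: "complex \<Rightarrow> complex"
  assumes "F holomorphic_on ball 0 d" "\<And>z. z \<in> ball 0 d \<Longrightarrow> F (- z) = s * F z" "z \<in> ball 0 d"
  shows "deriv F (- z) = - s * deriv F z"
proof -
  have 1: "((\<lambda>z. F (- z)) has_field_derivative deriv F (- z) * (- 1)) (at z)"
    by (rule DERIV_chain2[of F]) (use assms(3) in \<open>auto intro!: derivative_eq_intros holomorphic_derivI[OF assms(1) open_ball]\<close>)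
  have "((\<lambda>z. s * F z) has_field_derivative s * deriv F z) (at z)"
    using assms(3) by (auto intro!: derivative_eq_intros holomorphic_derivI[OF assms(1) open_ball])
  then have "((\<lambda>z. F (- z)) has_field_derivative s * deriv F z) (at z)"
    by (rule has_field_derivative_transform_within_open[of _ _ _ "ball 0 d"]) (use assms in auto)
  then have "- deriv F (- z) = s * deriv F z"
    using DERIV_unique[OF 1] by simp
  then show ?thesis by (simp add: minus_equation_iff[of _ "s * _"])
qed

text \<open>F(z) and F(-z) have the same Taylor coefficients at 0.\<close>

lemma even_of_odd_derivs:
  fixes F :: "complex \<Rightarrow> complex"
  assumes F: "F holomorphic_on ball 0 d" and odd0: "\<And>n. odd n \<Longrightarrow> (deriv ^^ n) F 0 = 0" and z: "z \<in> ball 0 d"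
  shows "F (- z) = F z"
proof -
  have d: "d > 0" using z by (auto intro: le_less_trans[OF norm_ge_zero])
  have h: "(\<lambda>w. F (- w)) holomorphic_on ball 0 d"
    using holomorphic_on_compose_gen[of "\<lambda>z. - z" "ball 0 d" F "ball 0 d", OF holomorphic_on_minus[OF holomorphic_on_ident] F]
    by (simp add: o_def image_subset_iff)
  have "(deriv ^^ n) (\<lambda>w. F (- 1 * w)) 0 = (- 1) ^ n * (deriv ^^ n) F (- 1 * 0)" for n
    by (rule higher_deriv_compose_linear[OF F, where S = "ball 0 d"]) (use d in auto)
  then have "(deriv ^^ n) (\<lambda>w. F (- w)) 0 = (deriv ^^ n) F 0" for n
    using odd0[of n] by (cases "even n") auto
  then show ?thesis
    by (intro holomorphic_fun_eq_on_ball[OF h F z]) auto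
qed

text \<open>
  Comparing the lowest order terms of \<open>G\<close> (order k) and \<open>W\<close> (order l) gives
  2k(k-1) + 3kl + l(l-1) = 0, which is impossible for positive k and l.
\<close>

lemma odd_ode_alternative:
  fixes G W :: "complex \<Rightarrow> complex"
  assumes G: "G holomorphic_on ball 0 d" and W: "W holomorphic_on ball 0 d" and d: "d > 0"
    and G0: "G 0 = 0" and W0: "W 0 = 0"
    and ode: "\<And>z. z \<in> ball 0 d \<Longrightarrow> 3 * deriv G z * deriv W z + G z * deriv (deriv W) z + 2 * deriv (deriv G) z * W z = 0"
  shows "(\<forall>z\<in>ball 0 d. W z = 0) \<or> (\<forall>z\<in>ball 0 d. G z = 0)"
proof (rule ccontr)
  assume "\<not> ?thesis"
  moreover have "F z = 0" if "F constant_on ball 0 d" "F 0 = 0" "z \<in> ball 0 d" for F :: "complex \<Rightarrow> complex" and z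
    using that d unfolding constant_on_def by (metis centre_in_ball)
  \<comment> \<open>G and W vanish at 0, so functions that violate the claim are not constant and
    have zeros of finite order there.\<close>
  ultimately have nc: "\<not> G constant_on ball 0 d" "\<not> W constant_on ball 0 d"
    using G0 W0 by blast+
  obtain a r1 k where a: "0 < k" "0 < r1" "ball 0 r1 \<subseteq> ball (0::complex) d" "a holomorphic_on ball 0 r1"
    "\<And>z. z \<in> ball 0 r1 \<Longrightarrow> G z = (z - 0) ^ k * a z" "\<And>z. z \<in> ball 0 r1 \<Longrightarrow> a z \<noteq> 0"
    by (rule holomorphic_factor_zero_nonconstant[OF G open_ball connected_ball _ G0 nc(1)], use d in simp, rule that)
  obtain b r2 l where b: "0 < l" "0 < r2" "ball 0 r2 \<subseteq> ball (0::complex) d" "b holomorphic_on ball 0 r2"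
    "\<And>z. z \<in> ball 0 r2 \<Longrightarrow> W z = (z - 0) ^ l * b z" "\<And>z. z \<in> ball 0 r2 \<Longrightarrow> b z \<noteq> 0"
    by (rule holomorphic_factor_zero_nonconstant[OF W open_ball connected_ball _ W0 nc(2)], use d in simp, rule that)
  define r where "r = min r1 r2"
  have r: "r > 0" using a b by (simp add: r_def)
  have D: "(F has_field_derivative deriv F z) (at z)" if "F holomorphic_on ball 0 r" "z \<in> ball 0 r" for F z
    using that by (intro holomorphic_derivI[OF that(1) open_ball]) auto
  have factor: "z * deriv F z = z ^ n * (of_nat n * f z + z * deriv f z)"
    "z\<^sup>2 * deriv (deriv F) z = z ^ n * (of_nat (n * (n - 1)) * f z + 2 * of_nat n * z * deriv f z + z\<^sup>2 * deriv (deriv f) z)"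
    if f: "f holomorphic_on ball 0 r" and F: "\<And>z. z \<in> ball 0 r \<Longrightarrow> F z = z ^ n * f z" and n: "0 < n" and z: "z \<in> ball 0 r" "z \<noteq> 0"
    for F f n z
  proof -
    have f1: "deriv f holomorphic_on ball 0 r" using f by (intro holomorphic_deriv) auto
    have 1: "deriv F z = of_nat n * z ^ (n - 1) * f z + z ^ n * deriv f z" if "z \<in> ball 0 r" for z
    proof (rule DERIV_imp_deriv, rule has_field_derivative_transform_within_open[of "\<lambda>z. z ^ n * f z" _ _ "ball 0 r"])
      show "((\<lambda>z. z ^ n * f z) has_field_derivative of_nat n * z ^ (n - 1) * f z + z ^ n * deriv f z) (at z)"
        using D[OF f that] by (auto intro!: derivative_eq_intros)
    qed (use F that in auto)
    have 2: "deriv (deriv F) z = of_nat n * of_nat (n - 1) * z ^ (n - 1 - 1) * f z + 2 * of_nat n * z ^ (n - 1) * deriv f z + z ^ n * deriv (deriv f) z"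
    proof (rule DERIV_imp_deriv, rule has_field_derivative_transform_within_open[of "\<lambda>z. of_nat n * z ^ (n - 1) * f z + z ^ n * deriv f z" _ _ "ball 0 r"])
      show "((\<lambda>z. of_nat n * z ^ (n - 1) * f z + z ^ n * deriv f z) has_field_derivative
         of_nat n * of_nat (n - 1) * z ^ (n - 1 - 1) * f z + 2 * of_nat n * z ^ (n - 1) * deriv f z + z ^ n * deriv (deriv f) z) (at z)"
        using D[OF f z(1)] D[OF f1 z(1)] by (auto intro!: derivative_eq_intros simp: algebra_simps)
    qed (use z 1 in auto)
    show "z * deriv F z = z ^ n * (of_nat n * f z + z * deriv f z)"
      using n unfolding 1[OF z(1)] by (cases n) (auto simp: algebra_simps)
    show "z\<^sup>2 * deriv (deriv F) z = z ^ n * (of_nat (n * (n - 1)) * f z + 2 * of_nat n * z * deriv f z + z\<^sup>2 * deriv (deriv f) z)"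
    proof (cases "n = 1")
      case True then show ?thesis unfolding 2 by (simp add: algebra_simps power2_eq_square)
    next
      case False
      then obtain m where "n = Suc (Suc m)" using n False by (intro that[of "n - 2"]) auto
      then show ?thesis unfolding 2 by (simp add: algebra_simps power2_eq_square)
    qed
  qed
  have ha: "a holomorphic_on ball 0 r" and hb: "b holomorphic_on ball 0 r"
    using a(4) b(4) by (auto simp: r_def intro: holomorphic_on_subset)
  \<comment> \<open>The equation times z^2, divided by z^k z^l. Its value at 0 is the quadratic
    expression in k and l times the two leading coefficients.\<close>
  define M where "M z = 3 * (of_nat k * a z + z * deriv a z) * (of_nat l * b z + z * deriv b z)
     + a z * (of_nat (l * (l - 1)) * b z + 2 * of_nat l * z * deriv b z + z\<^sup>2 * deriv (deriv b) z)
     + 2 * (of_nat (k * (k - 1)) * a z + 2 * of_nat k * z * deriv a z + z\<^sup>2 * deriv (deriv a) z) * b z" for z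
  have M0: "M z = 0" if z: "z \<in> ball 0 r" "z \<noteq> 0" for z
  proof -
    have zd: "z \<in> ball 0 d" using z a(3) by (auto simp: r_def)
    have comb: "G = zk * a \<Longrightarrow> W = zl * b \<Longrightarrow> G1 = zk * A1 \<Longrightarrow> G2 = zk * A2 \<Longrightarrow> W1 = zl * B1 \<Longrightarrow> W2 = zl * B2
        \<Longrightarrow> 3 * G1 * W1 + G * W2 + 2 * G2 * W = 0 \<Longrightarrow> zk * zl * (3 * A1 * B1 + a * B2 + 2 * A2 * b) = 0"
      for G W zk zl a b G1 G2 W1 W2 A1 A2 B1 B2 :: complex
      by (simp add: algebra_simps)
    note fa = factor[OF ha _ a(1) z, of G] and fb = factor[OF hb _ b(1) z, of W]
    have "G z = z ^ k * a z" "W z = z ^ l * b z" using a(5)[of z] b(5)[of z] z by (auto simp: r_def)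
    moreover have "z * deriv G z = z ^ k * (of_nat k * a z + z * deriv a z)"
      "z\<^sup>2 * deriv (deriv G) z = z ^ k * (of_nat (k * (k - 1)) * a z + 2 * of_nat k * z * deriv a z + z\<^sup>2 * deriv (deriv a) z)"
      "z * deriv W z = z ^ l * (of_nat l * b z + z * deriv b z)"
      "z\<^sup>2 * deriv (deriv W) z = z ^ l * (of_nat (l * (l - 1)) * b z + 2 * of_nat l * z * deriv b z + z\<^sup>2 * deriv (deriv b) z)"
      using fa fb a(5) b(5) by (auto simp: r_def)
    moreover have "3 * (z * deriv G z) * (z * deriv W z) + G z * (z\<^sup>2 * deriv (deriv W) z) + 2 * (z\<^sup>2 * deriv (deriv G) z) * W z = 0"
      using arg_cong[OF ode[OF zd], of "\<lambda>u. z\<^sup>2 * u"] by (simp add: algebra_simps power2_eq_square)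
    ultimately have "z ^ k * z ^ l * M z = 0" unfolding M_def by (rule comb)
    then show ?thesis using z by simp
  qed
  have "deriv a holomorphic_on ball 0 r" "deriv b holomorphic_on ball 0 r"
    "deriv (deriv a) holomorphic_on ball 0 r" "deriv (deriv b) holomorphic_on ball 0 r"
    using ha hb by (auto intro: holomorphic_deriv)
  then have "M holomorphic_on ball 0 r" unfolding M_def[abs_def]
    using ha hb by (intro holomorphic_intros) auto
  moreover have "M (of_real t) = 0" if "0 < t" "t < r" for t
    using M0[of "of_real t"] that by auto
  ultimately have "M 0 = 0"
    using holomorphic_zero_of_right_zero[of M r r 0] r by auto
  then have "of_nat (3 * k * l + l * (l - 1) + 2 * (k * (k - 1))) * (a 0 * b 0) = 0"
    unfolding M_def of_nat_add of_nat_mult of_nat_numeral by (simp add: algebra_simps)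
  moreover have "a 0 \<noteq> 0" "b 0 \<noteq> 0" using a(6)[of 0] b(6)[of 0] a(2) b(2) by auto
  ultimately have "3 * k * l + l * (l - 1) + 2 * (k * (k - 1)) = 0"
    by (simp only: mult_eq_0_iff of_nat_eq_0_iff simp_thms)
  then show False using a(1) b(1) by simp
qed

text \<open>The equations on one normal line, freed from geometry; t > 0 is the distance parameter.
  P, \<open>Q j\<close> and \<open>QQ j m\<close> extend the regular part of R and its tangential
  first and second derivatives. The constants s, sj, sjm are the values of \<open>S p p\<close> and
  of its tangential derivatives, \<open>g j\<close> is \<open>S p j\<close>, \<open>e j m\<close> is
  the derivative of \<open>S p m\<close> along j, and \<open>k j m\<close> is \<open>S j m\<close>
  plus the multiple of R that cancels its pole. The factor \<kappa> is the weight of the normal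
  vector.\<close>

locale pole_system =
  fixes I :: "'i set" and d :: real and \<kappa> c s :: complex and \<omega> \<mu> sj :: "'i \<Rightarrow> complex" and sjm :: "'i \<Rightarrow> 'i \<Rightarrow> complex"
    and g :: "'i \<Rightarrow> real \<Rightarrow> complex" and e k :: "'i \<Rightarrow> 'i \<Rightarrow> real \<Rightarrow> complex"
    and P :: "complex \<Rightarrow> complex" and Q :: "'i \<Rightarrow> complex \<Rightarrow> complex" and QQ :: "'i \<Rightarrow> 'i \<Rightarrow> complex \<Rightarrow> complex"
  assumes finI: "finite I" and d: "d > 0" and \<kappa>: "\<kappa> \<noteq> 0" and c: "c \<noteq> 0" and \<mu>: "\<And>j. j \<in> I \<Longrightarrow> \<mu> j \<noteq> 0"
    and hP: "P holomorphic_on ball 0 d" and hQ: "\<And>j. j \<in> I \<Longrightarrow> Q j holomorphic_on ball 0 d"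
    and hQQ: "\<And>j m. j \<in> I \<Longrightarrow> m \<in> I \<Longrightarrow> QQ j m holomorphic_on ball 0 d"
    and g': "\<And>j t. j \<in> I \<Longrightarrow> 0 < t \<Longrightarrow> t < d \<Longrightarrow>
      (g j has_vector_derivative (- sj j / 2 - \<mu> j * Q j (of_real t))) (at t)"
    and e': "\<And>j m t. j \<in> I \<Longrightarrow> m \<in> I \<Longrightarrow> 0 < t \<Longrightarrow> t < d \<Longrightarrow>
      (e j m has_vector_derivative (- sjm j m / 2 - \<mu> m * QQ j m (of_real t))) (at t)"
    and k': "\<And>j m t. j \<in> I \<Longrightarrow> m \<in> I \<Longrightarrow> 0 < t \<Longrightarrow> t < d \<Longrightarrow>
      (k j m has_vector_derivative (- e j m t - e m j t)) (at t)"
    and eq: "\<And>j t. j \<in> I \<Longrightarrow> 0 < t \<Longrightarrow> t < d \<Longrightarrow>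
      \<kappa> * (3 * (- sj j / 2 - \<mu> j * Q j (of_real t)) * (- 2 * c / of_real t ^ 3 + deriv P (of_real t))
         + g j t * (6 * c / of_real t ^ 4 + deriv (deriv P) (of_real t))
         + 2 * (- \<mu> j * deriv (Q j) (of_real t)) * (c / of_real t ^ 2 + P (of_real t)))
      = \<kappa> * s * deriv (Q j) (of_real t)
        + (\<Sum>m\<in>I. \<omega> m * (2 * e j m t * Q m (of_real t) + e m j t * Q m (of_real t)
              + g m t * QQ j m (of_real t) - k j m t * deriv (Q m) (of_real t)))"
begin

text \<open>All coefficient functions are primitives of holomorphic ones: g and e of Q and QQ, and k
  of e. They extend across t = 0, and multiplication by t^4 turns the equation into an identity on
  the whole disc.\<close>

lemma extension:
  obtains G E K where
    "\<And>j. j \<in> I \<Longrightarrow> G j holomorphic_on ball 0 d" "\<And>j t. j \<in> I \<Longrightarrow> 0 < t \<Longrightarrow> t < d \<Longrightarrow> g j t = G j (of_real t)"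
    "\<And>j z. j \<in> I \<Longrightarrow> z \<in> ball 0 d \<Longrightarrow> (G j has_field_derivative (- sj j / 2 - \<mu> j * Q j z)) (at z)"
    "\<And>j m. j \<in> I \<Longrightarrow> m \<in> I \<Longrightarrow> E j m holomorphic_on ball 0 d"
    "\<And>j m t. j \<in> I \<Longrightarrow> m \<in> I \<Longrightarrow> 0 < t \<Longrightarrow> t < d \<Longrightarrow> e j m t = E j m (of_real t)"
    "\<And>j m z. j \<in> I \<Longrightarrow> m \<in> I \<Longrightarrow> z \<in> ball 0 d \<Longrightarrow> (E j m has_field_derivative (- sjm j m / 2 - \<mu> m * QQ j m z)) (at z)"
    "\<And>j m. j \<in> I \<Longrightarrow> m \<in> I \<Longrightarrow> K j m holomorphic_on ball 0 d"
    "\<And>j m z. j \<in> I \<Longrightarrow> m \<in> I \<Longrightarrow> z \<in> ball 0 d \<Longrightarrow> (K j m has_field_derivative (- E j m z - E m j z)) (at z)"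
    "\<And>j z. j \<in> I \<Longrightarrow> z \<in> ball 0 d \<Longrightarrow>
      \<kappa> * c * (6 * G j z - 6 * z * deriv (G j) z + 2 * z\<^sup>2 * deriv (deriv (G j)) z)
       = z ^ 4 * (\<kappa> * s * deriv (Q j) z
         + (\<Sum>m\<in>I. \<omega> m * (2 * E j m z * Q m z + E m j z * Q m z + G m z * QQ j m z - K j m z * deriv (Q m) z))
         - \<kappa> * (3 * deriv (G j) z * deriv P z + G j z * deriv (deriv P) z + 2 * deriv (deriv (G j)) z * P z))"
proof -
  have "\<exists>G. G holomorphic_on ball 0 d \<and> (\<forall>t. 0 < t \<longrightarrow> t < d \<longrightarrow> g j t = G (of_real t)) \<and>
     (\<forall>z\<in>ball 0 d. (G has_field_derivative (- sj j / 2 - \<mu> j * Q j z)) (at z))" if "j \<in> I" for j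
    by (rule primitive_extension[of "\<lambda>z. - sj j / 2 - \<mu> j * Q j z" d "g j"])
       (use hQ[OF that] g'[OF that] d in \<open>auto intro!: holomorphic_intros\<close>)
  then obtain G where G: "\<And>j. j \<in> I \<Longrightarrow> G j holomorphic_on ball 0 d" "\<And>j t. j \<in> I \<Longrightarrow> 0 < t \<Longrightarrow> t < d \<Longrightarrow> g j t = G j (of_real t)"
    "\<And>j z. j \<in> I \<Longrightarrow> z \<in> ball 0 d \<Longrightarrow> (G j has_field_derivative (- sj j / 2 - \<mu> j * Q j z)) (at z)"
    by metis
  have "\<exists>E. E holomorphic_on ball 0 d \<and> (\<forall>t. 0 < t \<longrightarrow> t < d \<longrightarrow> e j m t = E (of_real t)) \<and>
     (\<forall>z\<in>ball 0 d. (E has_field_derivative (- sjm j m / 2 - \<mu> m * QQ j m z)) (at z))" if "j \<in> I" "m \<in> I" for j m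
    by (rule primitive_extension[of "\<lambda>z. - sjm j m / 2 - \<mu> m * QQ j m z" d "e j m"])
       (use hQQ[OF that] e'[OF that] d in \<open>auto intro!: holomorphic_intros\<close>)
  then obtain E where E: "\<And>j m. j \<in> I \<Longrightarrow> m \<in> I \<Longrightarrow> E j m holomorphic_on ball 0 d"
    "\<And>j m t. j \<in> I \<Longrightarrow> m \<in> I \<Longrightarrow> 0 < t \<Longrightarrow> t < d \<Longrightarrow> e j m t = E j m (of_real t)"
    "\<And>j m z. j \<in> I \<Longrightarrow> m \<in> I \<Longrightarrow> z \<in> ball 0 d \<Longrightarrow> (E j m has_field_derivative (- sjm j m / 2 - \<mu> m * QQ j m z)) (at z)"
    by metis
  have "\<exists>K. K holomorphic_on ball 0 d \<and> (\<forall>t. 0 < t \<longrightarrow> t < d \<longrightarrow> k j m t = K (of_real t)) \<and>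
     (\<forall>z\<in>ball 0 d. (K has_field_derivative (- E j m z - E m j z)) (at z))" if "j \<in> I" "m \<in> I" for j m
    by (rule primitive_extension[of "\<lambda>z. - E j m z - E m j z" d "k j m"])
       (use E(1) E(2)[OF that] E(2)[OF that(2,1)] that k'[OF that] d in \<open>auto intro!: holomorphic_intros\<close>)
  then obtain K where K: "\<And>j m. j \<in> I \<Longrightarrow> m \<in> I \<Longrightarrow> K j m holomorphic_on ball 0 d"
    "\<And>j m t. j \<in> I \<Longrightarrow> m \<in> I \<Longrightarrow> 0 < t \<Longrightarrow> t < d \<Longrightarrow> k j m t = K j m (of_real t)"
    "\<And>j m z. j \<in> I \<Longrightarrow> m \<in> I \<Longrightarrow> z \<in> ball 0 d \<Longrightarrow> (K j m has_field_derivative (- E j m z - E m j z)) (at z)"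
    by metis
  have dG: "deriv (G j) z = - sj j / 2 - \<mu> j * Q j z" if "j \<in> I" "z \<in> ball 0 d" for j z
    using G(3)[OF that] by (rule DERIV_imp_deriv)
  have ddG: "deriv (deriv (G j)) z = - \<mu> j * deriv (Q j) z" if "j \<in> I" "z \<in> ball 0 d" for j z
  proof (rule DERIV_imp_deriv, rule has_field_derivative_transform_within_open[of "\<lambda>z. - sj j / 2 - \<mu> j * Q j z" _ _ "ball 0 d"])
    show "((\<lambda>z. - sj j / 2 - \<mu> j * Q j z) has_field_derivative - \<mu> j * deriv (Q j) z) (at z)"
      using holomorphic_derivI[OF hQ[OF that(1)] open_ball that(2)] by (auto intro!: derivative_eq_intros)
  qed (use that dG in auto)
  have main: "\<kappa> * c * (6 * G j z - 6 * z * deriv (G j) z + 2 * z\<^sup>2 * deriv (deriv (G j)) z)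
       = z ^ 4 * (\<kappa> * s * deriv (Q j) z
         + (\<Sum>m\<in>I. \<omega> m * (2 * E j m z * Q m z + E m j z * Q m z + G m z * QQ j m z - K j m z * deriv (Q m) z))
         - \<kappa> * (3 * deriv (G j) z * deriv P z + G j z * deriv (deriv P) z + 2 * deriv (deriv (G j)) z * P z))"
    if j: "j \<in> I" and z: "z \<in> ball 0 d" for j z
  proof -
    define N where "N z = \<kappa> * s * deriv (Q j) z
         + (\<Sum>m\<in>I. \<omega> m * (2 * E j m z * Q m z + E m j z * Q m z + G m z * QQ j m z - K j m z * deriv (Q m) z))
         - \<kappa> * (3 * deriv (G j) z * deriv P z + G j z * deriv (deriv P) z + 2 * deriv (deriv (G j)) z * P z)" for z
    \<comment> \<open>The difference of the two sides after clearing the pole: holomorphic on the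
      disc and zero for t > 0.\<close>
    define F where "F z = \<kappa> * c * (6 * G j z - 6 * z * deriv (G j) z + 2 * z\<^sup>2 * deriv (deriv (G j)) z) - z ^ 4 * N z" for z
    have hd: "deriv f holomorphic_on ball 0 d" if "f holomorphic_on ball 0 d" for f
      using that by (rule holomorphic_deriv) simp
    have "F holomorphic_on ball 0 d" unfolding F_def[abs_def] N_def[abs_def]
      by (intro holomorphic_on_diff holomorphic_on_mult holomorphic_on_add holomorphic_on_sum holomorphic_on_power
          holomorphic_on_const holomorphic_on_ident hd G(1) E(1) K(1) hQ hQQ hP j)
    moreover have "F (of_real t) = 0" if t: "0 < t" "t < d" for t
    proof -
      let ?z = "of_real t :: complex"
      have zb: "?z \<in> ball 0 d" and z0: "?z \<noteq> 0" using t by auto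
      have "\<kappa> * (3 * deriv (G j) ?z * (- 2 * c / ?z ^ 3 + deriv P ?z) + G j ?z * (6 * c / ?z ^ 4 + deriv (deriv P) ?z)
         + 2 * deriv (deriv (G j)) ?z * (c / ?z ^ 2 + P ?z))
        = \<kappa> * s * deriv (Q j) ?z
         + (\<Sum>m\<in>I. \<omega> m * (2 * E j m ?z * Q m ?z + E m j ?z * Q m ?z + G m ?z * QQ j m ?z - K j m ?z * deriv (Q m) ?z))"
        using eq[OF j t] unfolding dG[OF j zb] ddG[OF j zb]
        using G(2)[OF j t] E(2)[OF j _ t] E(2)[OF _ j t] G(2)[OF _ t] K(2)[OF j _ t] by (simp cong: sum.cong)
      then have "N ?z = \<kappa> * (3 * deriv (G j) ?z * (- 2 * c / ?z ^ 3) + G j ?z * (6 * c / ?z ^ 4) + 2 * deriv (deriv (G j)) ?z * (c / ?z ^ 2))"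
        unfolding N_def by (simp add: algebra_simps)
      moreover have "N = \<kappa> * (3 * g1 * a3 + g0 * a4 + 2 * g2 * a2) \<Longrightarrow> z4 * a3 = - 2 * c * z \<Longrightarrow> z4 * a4 = 6 * c \<Longrightarrow> z4 * a2 = c * z\<^sup>2
          \<Longrightarrow> \<kappa> * c * (6 * g0 - 6 * z * g1 + 2 * z\<^sup>2 * g2) - z4 * N = 0" for N g0 g1 g2 a2 a3 a4 z4 z :: complex
      proof -
        assume *: "N = \<kappa> * (3 * g1 * a3 + g0 * a4 + 2 * g2 * a2)" "z4 * a3 = - 2 * c * z" "z4 * a4 = 6 * c" "z4 * a2 = c * z\<^sup>2"
        have "z4 * N = \<kappa> * (3 * g1 * (z4 * a3) + g0 * (z4 * a4) + 2 * g2 * (z4 * a2))"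
          unfolding *(1) by (simp add: algebra_simps)
        then show ?thesis unfolding *(2-4) by (simp add: algebra_simps)
      qed
      moreover have "?z ^ 4 * (- 2 * c / ?z ^ 3) = - 2 * c * ?z" using z0 by (simp add: field_simps power4_eq_xxxx power3_eq_cube)
      moreover have "?z ^ 4 * (6 * c / ?z ^ 4) = 6 * c" using z0 by simp
      moreover have "?z ^ 4 * (c / ?z ^ 2) = c * ?z\<^sup>2" using z0 by (simp add: field_simps power4_eq_xxxx power2_eq_square)
      ultimately show ?thesis unfolding F_def by blast
    qed
    ultimately have "F z = 0" using holomorphic_zero_of_right_zero[of F d d z] d z by blast
    then show ?thesis unfolding F_def N_def by simp
  qed
  show thesis by (rule that[OF G E K(1,3) main])
qed

lemma holomorphic_rhs:
  assumes "\<And>j. j \<in> I \<Longrightarrow> G j holomorphic_on ball 0 d" "\<And>j m. j \<in> I \<Longrightarrow> m \<in> I \<Longrightarrow> E j m holomorphic_on ball 0 d"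
    "\<And>j m. j \<in> I \<Longrightarrow> m \<in> I \<Longrightarrow> K j m holomorphic_on ball 0 d" "j \<in> I"
  shows "(\<lambda>z. \<kappa> * s * deriv (Q j) z
         + (\<Sum>m\<in>I. \<omega> m * (2 * E j m z * Q m z + E m j z * Q m z + G m z * QQ j m z - K j m z * deriv (Q m) z))
         - \<kappa> * (3 * deriv (G j) z * deriv P z + G j z * deriv (deriv P) z + 2 * deriv (deriv (G j)) z * P z)) holomorphic_on ball 0 d"
proof -
  have hd: "deriv f holomorphic_on ball 0 d" if "f holomorphic_on ball 0 d" for f
    using that by (rule holomorphic_deriv) simp
  show ?thesis
    by (intro holomorphic_on_diff holomorphic_on_mult holomorphic_on_add holomorphic_on_sum
          holomorphic_on_const hd assms hQ hQQ hP)
qed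

text \<open>The double pole forces g(0) = g''(0) = 0, and g'' is -\<mu>_j times the derivative of
  \<open>Q j\<close>.\<close>

lemma deriv_Q_zero:
  assumes j: "j \<in> I"
  shows "deriv (Q j) 0 = 0" "(g j \<longlongrightarrow> 0) (at_right 0)"
proof -
  obtain G E K where G: "\<And>j. j \<in> I \<Longrightarrow> G j holomorphic_on ball 0 d" "\<And>j t. j \<in> I \<Longrightarrow> 0 < t \<Longrightarrow> t < d \<Longrightarrow> g j t = G j (of_real t)"
    "\<And>j z. j \<in> I \<Longrightarrow> z \<in> ball 0 d \<Longrightarrow> (G j has_field_derivative (- sj j / 2 - \<mu> j * Q j z)) (at z)"
    and E: "\<And>j m. j \<in> I \<Longrightarrow> m \<in> I \<Longrightarrow> E j m holomorphic_on ball 0 d"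
    and K: "\<And>j m. j \<in> I \<Longrightarrow> m \<in> I \<Longrightarrow> K j m holomorphic_on ball 0 d"
    and main: "\<And>j z. j \<in> I \<Longrightarrow> z \<in> ball 0 d \<Longrightarrow>
      \<kappa> * c * (6 * G j z - 6 * z * deriv (G j) z + 2 * z\<^sup>2 * deriv (deriv (G j)) z)
       = z ^ 4 * (\<kappa> * s * deriv (Q j) z
         + (\<Sum>m\<in>I. \<omega> m * (2 * E j m z * Q m z + E m j z * Q m z + G m z * QQ j m z - K j m z * deriv (Q m) z))
         - \<kappa> * (3 * deriv (G j) z * deriv P z + G j z * deriv (deriv P) z + 2 * deriv (deriv (G j)) z * P z))"
    by (rule extension) blast
  have "G j 0 = 0 \<and> deriv (deriv (G j)) 0 = 0"
    using double_pole_constraint[OF G(1)[OF j] holomorphic_rhs[where G = G and E = E and K = K, OF G(1) E K j] d _ main[OF j]] \<kappa> c by auto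
  moreover have "deriv (deriv (G j)) 0 = - \<mu> j * deriv (Q j) 0"
  proof (rule DERIV_imp_deriv, rule has_field_derivative_transform_within_open[of "\<lambda>z. - sj j / 2 - \<mu> j * Q j z" _ _ "ball 0 d"])
    show "((\<lambda>z. - sj j / 2 - \<mu> j * Q j z) has_field_derivative - \<mu> j * deriv (Q j) 0) (at 0)"
      using holomorphic_derivI[OF hQ[OF j] open_ball, of 0] d by (auto intro!: derivative_eq_intros)
  qed (use j d DERIV_imp_deriv[OF G(3)] in auto)
  ultimately show "deriv (Q j) 0 = 0" using \<mu>[OF j] by simp
  have "isCont (G j) 0" using G(3)[OF j, of 0] d by (auto intro: DERIV_isCont)
  then have "((\<lambda>t. G j (of_real t)) \<longlongrightarrow> G j (of_real 0)) (at_right 0)"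
    by (intro isCont_tendsto_compose[of _ "G j"] tendsto_intros) auto
  moreover have "\<forall>\<^sub>F t in at_right 0. G j (of_real t) = g j t"
    using eventually_at_right_real[OF d] by eventually_elim (use G(2)[OF j] in auto)
  ultimately show "(g j \<longlongrightarrow> 0) (at_right 0)"
    using \<open>G j 0 = 0 \<and> _\<close> by (auto intro: Lim_transform_eventually)
qed

text \<open>If Q and QQ are even and E vanishes at 0, then G and E are odd and K is even. Every term
  of the equation is then odd except the bilinear expression in G and P, whose even part must
  vanish. This even part is the differential equation for W, the odd part of P up to the factor
  2.\<close>

lemma even_alternative:
  assumes evQ: "\<And>j z. j \<in> I \<Longrightarrow> z \<in> ball 0 d \<Longrightarrow> Q j (- z) = Q j z"
    and evQQ: "\<And>j m z. j \<in> I \<Longrightarrow> m \<in> I \<Longrightarrow> z \<in> ball 0 d \<Longrightarrow> QQ j m (- z) = QQ j m z"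
    and e0: "\<And>j m. j \<in> I \<Longrightarrow> m \<in> I \<Longrightarrow> (e j m \<longlongrightarrow> 0) (at_right 0)"
  shows "(\<forall>z\<in>ball 0 d. P (- z) = P z) \<or> (\<forall>j\<in>I. \<forall>z\<in>ball 0 d. deriv (Q j) z = 0)"
proof -
  obtain G E K where G: "\<And>j. j \<in> I \<Longrightarrow> G j holomorphic_on ball 0 d" "\<And>j t. j \<in> I \<Longrightarrow> 0 < t \<Longrightarrow> t < d \<Longrightarrow> g j t = G j (of_real t)"
    "\<And>j z. j \<in> I \<Longrightarrow> z \<in> ball 0 d \<Longrightarrow> (G j has_field_derivative (- sj j / 2 - \<mu> j * Q j z)) (at z)"
    and E: "\<And>j m. j \<in> I \<Longrightarrow> m \<in> I \<Longrightarrow> E j m holomorphic_on ball 0 d"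
    "\<And>j m t. j \<in> I \<Longrightarrow> m \<in> I \<Longrightarrow> 0 < t \<Longrightarrow> t < d \<Longrightarrow> e j m t = E j m (of_real t)"
    "\<And>j m z. j \<in> I \<Longrightarrow> m \<in> I \<Longrightarrow> z \<in> ball 0 d \<Longrightarrow> (E j m has_field_derivative (- sjm j m / 2 - \<mu> m * QQ j m z)) (at z)"
    and K: "\<And>j m. j \<in> I \<Longrightarrow> m \<in> I \<Longrightarrow> K j m holomorphic_on ball 0 d"
    "\<And>j m z. j \<in> I \<Longrightarrow> m \<in> I \<Longrightarrow> z \<in> ball 0 d \<Longrightarrow> (K j m has_field_derivative (- E j m z - E m j z)) (at z)"
    and main: "\<And>j z. j \<in> I \<Longrightarrow> z \<in> ball 0 d \<Longrightarrow>
      \<kappa> * c * (6 * G j z - 6 * z * deriv (G j) z + 2 * z\<^sup>2 * deriv (deriv (G j)) z)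
       = z ^ 4 * (\<kappa> * s * deriv (Q j) z
         + (\<Sum>m\<in>I. \<omega> m * (2 * E j m z * Q m z + E m j z * Q m z + G m z * QQ j m z - K j m z * deriv (Q m) z))
         - \<kappa> * (3 * deriv (G j) z * deriv P z + G j z * deriv (deriv P) z + 2 * deriv (deriv (G j)) z * P z))"
    by (rule extension) blast
  have mb: "- z \<in> ball 0 d" if "z \<in> ball (0::complex) d" for z using that by simp
  have G0: "G j 0 = 0" if "j \<in> I" for j
    using double_pole_constraint[OF G(1)[OF that] holomorphic_rhs[where G = G and E = E and K = K, OF G(1) E(1) K(1) that] d _ main[OF that]] \<kappa> c that by auto
  have E0: "E j m 0 = 0" if "j \<in> I" "m \<in> I" for j m
  proof -
    have "isCont (E j m) 0" using E(3)[OF that, of 0] d by (auto intro: DERIV_isCont)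
    then have "((\<lambda>t. E j m (of_real t)) \<longlongrightarrow> E j m (of_real 0)) (at_right 0)"
      by (intro isCont_tendsto_compose[of _ "E j m"] tendsto_intros) auto
    moreover have "\<forall>\<^sub>F t in at_right 0. E j m (of_real t) = e j m t"
      using eventually_at_right_real[OF d] by eventually_elim (use E(2)[OF that] in auto)
    ultimately have "(e j m \<longlongrightarrow> E j m 0) (at_right 0)" by (auto intro: Lim_transform_eventually)
    then show ?thesis using tendsto_unique[OF _ _ e0[OF that]] by simp
  qed
  have oG: "G j (- z) = - G j z" if "j \<in> I" "z \<in> ball 0 d" for j z
    by (rule odd_of_even_derivative[OF G(3)[OF that(1)] _ G0[OF that(1)] that(2)]) (simp_all add: evQ[OF that(1)])
  have oE: "E j m (- z) = - E j m z" if "j \<in> I" "m \<in> I" "z \<in> ball 0 d" for j m z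
    by (rule odd_of_even_derivative[OF E(3)[OF that(1,2)] _ E0[OF that(1,2)] that(3)]) (simp_all add: evQQ[OF that(1,2)])
  have eK: "K j m (- z) = K j m z" if "j \<in> I" "m \<in> I" "z \<in> ball 0 d" for j m z
    by (rule even_of_odd_derivative[OF K(2)[OF that(1,2)] _ that(3)]) (simp_all add: oE that(1,2))
  have oQ': "deriv (Q j) (- z) = - deriv (Q j) z" if "j \<in> I" "z \<in> ball 0 d" for j z
    using deriv_reflect[OF hQ[OF that(1)], of 1 z] evQ[OF that(1)] that(2) by simp
  have hd: "deriv f holomorphic_on ball 0 d" if "f holomorphic_on ball 0 d" for f
    using that by (rule holomorphic_deriv) simp
  have eG': "deriv (G j) (- z) = deriv (G j) z" if "j \<in> I" "z \<in> ball 0 d" for j z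
    using deriv_reflect[OF G(1)[OF that(1)], of "- 1" z] oG[OF that(1)] that(2) by simp
  have oG'': "deriv (deriv (G j)) (- z) = - deriv (deriv (G j)) z" if "j \<in> I" "z \<in> ball 0 d" for j z
    using deriv_reflect[OF hd[OF G(1)[OF that(1)]], of 1 z] eG'[OF that(1)] that(2) by simp
  define W where "W z = P z - P (- z)" for z
  have hPm: "(\<lambda>z. P (- z)) holomorphic_on ball 0 d"
    using holomorphic_on_compose_gen[of "\<lambda>z. - z" "ball 0 d" P "ball 0 d", OF holomorphic_on_minus[OF holomorphic_on_ident] hP]
    by (simp add: o_def image_subset_iff)
  have hW: "W holomorphic_on ball 0 d" unfolding W_def[abs_def] using hP hPm by (intro holomorphic_intros)
  have DP: "(F has_field_derivative deriv F z) (at z)" if "F holomorphic_on ball 0 d" "z \<in> ball 0 d" for F z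
    by (rule holomorphic_derivI[OF that(1) open_ball that(2)])
  have W': "deriv W z = deriv P z + deriv P (- z)" if "z \<in> ball 0 d" for z
  proof (rule DERIV_imp_deriv)
    have "((\<lambda>z. P (- z)) has_field_derivative deriv P (- z) * (- 1)) (at z)"
      by (rule DERIV_chain2[of P _ "\<lambda>z. - z", OF DP[OF hP mb[OF that]]]) (auto intro!: derivative_eq_intros)
    then show "(W has_field_derivative deriv P z + deriv P (- z)) (at z)"
      using DERIV_diff[OF DP[OF hP that]] unfolding W_def[abs_def] by fastforce
  qed
  have W'': "deriv (deriv W) z = deriv (deriv P) z - deriv (deriv P) (- z)" if z: "z \<in> ball 0 d" for z
  proof (rule DERIV_imp_deriv, rule has_field_derivative_transform_within_open[of "\<lambda>z. deriv P z + deriv P (- z)" _ _ "ball 0 d"])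
    have "((\<lambda>z. deriv P (- z)) has_field_derivative deriv (deriv P) (- z) * (- 1)) (at z)"
      by (rule DERIV_chain2[of "deriv P" _ "\<lambda>z. - z", OF DP[OF hd[OF hP] mb[OF z]]]) (auto intro!: derivative_eq_intros)
    then show "((\<lambda>z. deriv P z + deriv P (- z)) has_field_derivative deriv (deriv P) z - deriv (deriv P) (- z)) (at z)"
      using DERIV_add[OF DP[OF hd[OF hP] z]] by fastforce
  qed (use z W' in auto)
  have ode: "3 * deriv (G j) z * deriv W z + G j z * deriv (deriv W) z + 2 * deriv (deriv (G j)) z * W z = 0"
    if j: "j \<in> I" and z: "z \<in> ball 0 d" for j z
  proof (rule holomorphic_zero_of_right_zero[of "\<lambda>z. 3 * deriv (G j) z * deriv W z + G j z * deriv (deriv W) z + 2 * deriv (deriv (G j)) z * W z" d d])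
    show "(\<lambda>z. 3 * deriv (G j) z * deriv W z + G j z * deriv (deriv W) z + 2 * deriv (deriv (G j)) z * W z) holomorphic_on ball 0 d"
      by (intro holomorphic_on_mult holomorphic_on_add holomorphic_on_const hd hW G(1) j)
    fix t assume t: "0 < t" "t < d"
    define z where "z = complex_of_real t"
    have z: "z \<in> ball 0 d" and z0: "z \<noteq> 0" using t by (auto simp: z_def)
    \<comment> \<open>S collects the terms in which P does not occur; T is the bilinear operator
      applied to P.\<close>
    define S where "S z = \<kappa> * s * deriv (Q j) z
         + (\<Sum>m\<in>I. \<omega> m * (2 * E j m z * Q m z + E m j z * Q m z + G m z * QQ j m z - K j m z * deriv (Q m) z))" for z
    define T where "T z = 3 * deriv (G j) z * deriv P z + G j z * deriv (deriv P) z + 2 * deriv (deriv (G j)) z * P z" for z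
    have "(\<Sum>m\<in>I. \<omega> m * (2 * E j m (- z) * Q m (- z) + E m j (- z) * Q m (- z) + G m (- z) * QQ j m (- z) - K j m (- z) * deriv (Q m) (- z)))
       = (\<Sum>m\<in>I. - (\<omega> m * (2 * E j m z * Q m z + E m j z * Q m z + G m z * QQ j m z - K j m z * deriv (Q m) z)))"
      using j z by (intro sum.cong) (simp_all add: oE evQ oG evQQ eK oQ' algebra_simps)
    then have S: "S (- z) = - S z" unfolding S_def using j z by (simp add: oQ' sum_negf)
    have 1: "\<kappa> * c * (6 * G j z - 6 * z * deriv (G j) z + 2 * z\<^sup>2 * deriv (deriv (G j)) z) = z ^ 4 * (S z - \<kappa> * T z)"
      using main[OF j z] by (simp add: S_def T_def)
    have 2: "\<kappa> * c * (6 * G j (- z) - 6 * (- z) * deriv (G j) (- z) + 2 * (- z)\<^sup>2 * deriv (deriv (G j)) (- z)) = (- z) ^ 4 * (S (- z) - \<kappa> * T (- z))"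
      using main[OF j mb[OF z]] by (simp add: S_def T_def)
    have 3: "- (\<kappa> * c * (6 * G j z - 6 * z * deriv (G j) z + 2 * z\<^sup>2 * deriv (deriv (G j)) z)) = z ^ 4 * (- S z - \<kappa> * T (- z))"
      using 2 unfolding S oG[OF j z] eG'[OF j z] oG''[OF j z] by (simp add: algebra_simps)
    have "z ^ 4 * (\<kappa> * (T z + T (- z))) = - (z ^ 4 * (S z - \<kappa> * T z) + z ^ 4 * (- S z - \<kappa> * T (- z)))"
      by (simp add: algebra_simps)
    also have "\<dots> = 0" unfolding 1[symmetric] 3[symmetric] by simp
    finally have "z ^ 4 * (\<kappa> * (T z + T (- z))) = 0" .
    then have "T z + T (- z) = 0" using z0 \<kappa> by simp
    then have "3 * deriv (G j) z * deriv W z + G j z * deriv (deriv W) z + 2 * deriv (deriv (G j)) z * W z = 0"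
      unfolding T_def oG[OF j z] eG'[OF j z] oG''[OF j z] W'[OF z] W''[OF z] W_def by (simp add: algebra_simps)
    then show "3 * deriv (G j) (of_real t) * deriv W (of_real t) + G j (of_real t) * deriv (deriv W) (of_real t) + 2 * deriv (deriv (G j)) (of_real t) * W (of_real t) = 0"
      by (simp add: z_def)
  qed (use d z in auto)
  show ?thesis
  proof (cases "\<forall>z\<in>ball 0 d. W z = 0")
    case True
    have "P (- z) = P z" if "z \<in> ball 0 d" for z
      using bspec[OF True that] unfolding W_def by (rule eq_iff_diff_eq_0[THEN iffD2, symmetric])
    then show ?thesis by blast
  next
    case False
    have "deriv (Q j) z = 0" if j: "j \<in> I" and z: "z \<in> ball 0 d" for j z
    proof -
      \<comment> \<open>If W is not zero, every \<open>G j\<close> is, and its derivative, a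
        constant minus \<mu>_j times \<open>Q j\<close>, makes \<open>Q j\<close> constant.\<close>
      have "\<forall>z\<in>ball 0 d. G j z = 0"
        using odd_ode_alternative[OF G(1)[OF j] hW d G0[OF j] _ ode[OF j]] False W_def[of 0] by simp
      then have "deriv (G j) z = 0" if "z \<in> ball 0 d" for z
        using that by (intro DERIV_imp_deriv has_field_derivative_transform_within_open[OF DERIV_const[of 0] open_ball that]) auto
      then have Qc: "- \<mu> j * Q j z = sj j / 2" if "z \<in> ball 0 d" for z
        using that DERIV_imp_deriv[OF G(3)[OF j that]] by (auto simp: field_simps)
      have "Q j w = - sj j / 2 / \<mu> j" if "w \<in> ball 0 d" for w
        using arg_cong[OF Qc[OF that], of "\<lambda>u. - u / \<mu> j"] \<mu>[OF j] by simp
      then show ?thesis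
        by (intro DERIV_imp_deriv has_field_derivative_transform_within_open[OF DERIV_const[of "- sj j / 2 / \<mu> j"] open_ball z]) auto
    qed
    then show ?thesis by blast
  qed
qed

end

subsection \<open>The potential near a generic point of a singular hyperplane\<close>

lemma higher_deriv_line:
  fixes E :: "complex \<Rightarrow> complex"
  assumes op: "open V" and la: "line_analytic V F" and E: "E holomorphic_on ball 0 d"
    and eq: "\<And>t. \<bar>t\<bar> < d \<Longrightarrow> y + t *\<^sub>R v \<in> V \<and> F (y + t *\<^sub>R v) = E (of_real t)" and t: "\<bar>t\<bar> < d"
  shows "(deriv ^^ n) E (of_real t) = ((dd v) ^^ n) F (y + t *\<^sub>R v)"
  using t
proof (induction n arbitrary: t)
  case 0 then show ?case using eq by simp
next
  case (Suc n)
  have laF: "line_analytic V (((dd v) ^^ n) F)" for n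
    by (induction n) (auto intro: la line_analytic_dd[OF op])
  have tb: "of_real t \<in> ball (0::complex) d" using Suc.prems by simp
  have "((deriv ^^ n) E has_field_derivative deriv ((deriv ^^ n) E) (of_real t)) (at (of_real t))"
    by (rule holomorphic_derivI[OF holomorphic_higher_deriv[OF E open_ball] open_ball tb])
  then have 1: "((\<lambda>t. (deriv ^^ n) E (of_real t)) has_vector_derivative deriv ((deriv ^^ n) E) (of_real t)) (at t)"
    by (rule has_vector_derivative_real_field)
  have "((\<lambda>t. ((dd v) ^^ n) F (y + t *\<^sub>R v)) has_vector_derivative dd v (((dd v) ^^ n) F) (y + t *\<^sub>R v)) (at t)"
    by (rule has_vector_derivative_line, rule line_analytic_differentiable[OF laF]) (use eq Suc.prems in auto)
  then have 2: "((\<lambda>t. (deriv ^^ n) E (of_real t)) has_vector_derivative dd v (((dd v) ^^ n) F) (y + t *\<^sub>R v)) (at t)"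
    by (rule has_vector_derivative_transform_within_open[of _ _ _ "{-d<..<d}"])
       (use Suc in \<open>auto simp: abs_less_iff\<close>)
  show ?case using vector_derivative_unique_at[OF 1 2] by simp
qed

lemma line_extension:
  assumes op: "open V" and la: "line_analytic V F" and y: "y \<in> V"
  shows "\<exists>d E. d > 0 \<and> E holomorphic_on ball 0 d \<and> (\<forall>t. \<bar>t\<bar> < d \<longrightarrow> y + t *\<^sub>R v \<in> V \<and> F (y + t *\<^sub>R v) = E (of_real t))"
proof -
  obtain E e where E: "e > 0" "E holomorphic_on ball (of_real 0) e" "\<And>s. \<bar>s - 0\<bar> < e \<Longrightarrow> F (y + s *\<^sub>R v) = E (of_real s)"
    using analytic1_at_ball[OF line_analytic_line0[OF la y, of v]] by metis
  have "((\<lambda>t. y + t *\<^sub>R v) \<longlongrightarrow> y + 0 *\<^sub>R v) (nhds 0)" by (intro tendsto_intros filterlim_ident)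
  then have "\<forall>\<^sub>F t in nhds 0. y + t *\<^sub>R v \<in> V"
    using op y topological_tendstoD by fastforce
  then obtain e' where e': "e' > 0" "\<And>t. \<bar>t\<bar> < e' \<Longrightarrow> y + t *\<^sub>R v \<in> V"
    unfolding eventually_nhds_metric by (auto simp: dist_real_def)
  show ?thesis
    using E e' by (intro exI[of _ "min e e'"] exI[of _ E]) (auto intro: holomorphic_on_subset)
qed

text \<open>The frame vector \<open>f p\<close> is normal to the wall, the others are tangential,
  and \<omega> j is meant as the inverse square length of \<open>f j\<close>. \<open>Rh\<close> is
  analytic on the full ball V; R and the components S are only used on the half W, where the pole is
  absent. \<open>E1\<close> to \<open>E3\<close> are \<open>eq3\<close> in the frame,
  \<open>E4\<close> is the closedness of the 1-form for the pair (p,j).\<close>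

locale wall_system =
  fixes x0 :: "(real, 'n::finite) vec" and \<delta> :: real and f :: "'n \<Rightarrow> (real, 'n) vec" and p :: 'n
    and \<omega> \<mu> :: "'n \<Rightarrow> real" and S :: "'n \<Rightarrow> 'n \<Rightarrow> (real, 'n) vec \<Rightarrow> complex"
    and R Rh :: "(real, 'n) vec \<Rightarrow> complex" and c :: complex and V W :: "(real, 'n) vec set"
  defines "V \<equiv> ball x0 \<delta>" and "W \<equiv> {x \<in> ball x0 \<delta>. f p \<bullet> x > 0}"
  assumes \<delta>: "\<delta> > 0" and x0: "f p \<bullet> x0 = 0" and \<omega>p: "\<omega> p * (f p \<bullet> f p) = 1" "\<omega> p > 0"
    and orth: "\<And>j. j \<noteq> p \<Longrightarrow> f p \<bullet> f j = 0" and \<omega>: "\<And>j. \<omega> j \<noteq> 0" and \<mu>: "\<And>j. j \<noteq> p \<Longrightarrow> \<mu> j \<noteq> 0" and c: "c \<noteq> 0"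
    and S_sym: "\<And>i j. S i j = S j i" and laS: "\<And>i j. line_analytic W (S i j)" and laRh: "line_analytic V Rh"
    and R: "\<And>x. x \<in> W \<Longrightarrow> R x = c / of_real ((\<omega> p * (f p \<bullet> x))\<^sup>2) + Rh x"
    and E1: "\<And>x. x \<in> W \<Longrightarrow> dd (f p) (S p p) x = 0"
    and E2: "\<And>x j. x \<in> W \<Longrightarrow> j \<noteq> p \<Longrightarrow> 2 * dd (f p) (S p j) x + dd (f j) (S p p) x = - 2 * of_real (\<mu> j) * dd (f j) R x"
    and E3: "\<And>x j k. x \<in> W \<Longrightarrow> j \<noteq> p \<Longrightarrow> k \<noteq> p \<Longrightarrow>
      dd (f p) (S j k) x + dd (f j) (S p k) x + dd (f k) (S p j) x
        = (if j = k then - 2 * of_real (\<mu> j * \<omega> p / \<omega> j) * dd (f p) R x else 0)"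
    and E4: "\<And>x j. x \<in> W \<Longrightarrow> j \<noteq> p \<Longrightarrow>
      (\<Sum>m\<in>UNIV. of_real (\<omega> m) * dd (f p) (\<lambda>x. S j m x * dd (f m) R x) x)
      = (\<Sum>m\<in>UNIV. of_real (\<omega> m) * dd (f j) (\<lambda>x. S p m x * dd (f m) R x) x)"
begin

lemma opV: "open V" and opW: "open W" and WV: "W \<subseteq> V"
proof -
  show "open V" by (simp add: V_def)
  have "W = ball x0 \<delta> \<inter> {x. 0 < f p \<bullet> x}" by (auto simp: W_def)
  moreover have "open {x. 0 < f p \<bullet> x}" by (intro open_Collect_less continuous_intros)
  ultimately show "open W" by auto
  show "W \<subseteq> V" by (auto simp: V_def W_def)
qed

lemma laRhW: "line_analytic W Rh"
  using laRh WV by (rule line_analytic_subset)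

text \<open>The covector dual to \<open>f p\<close>: on y + t \<open>f p\<close> with y on the wall
  its value is t, so the pole is exactly c/t^2.\<close>

abbreviation (input) \<beta> where "\<beta> \<equiv> \<omega> p *\<^sub>R f p"

lemma \<beta>_nonzero: "x \<in> W \<Longrightarrow> \<beta> \<bullet> x \<noteq> 0"
  using \<omega>p(2) by (auto simp: W_def)

lemma laR: "line_analytic W R"
  by (rule line_analytic_cong[OF opW line_analytic_add[OF opW line_analytic_pole[OF opW \<beta>_nonzero] laRhW], of R c 2])
     (auto simp: R)

lemma dd_R:
  assumes "x \<in> W"
  shows "dd v R x = - 2 * c * of_real (\<beta> \<bullet> v) / of_real ((\<beta> \<bullet> x) ^ 3) + dd v Rh x"
proof -
  have "dd v R x = dd v (\<lambda>x. c / of_real ((\<beta> \<bullet> x) ^ 2) + Rh x) x"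
    by (rule dd_cong[OF opW assms]) (simp add: R)
  also have "\<dots> = - 2 * c * of_real (\<beta> \<bullet> v) / of_real ((\<beta> \<bullet> x) ^ 3) + dd v Rh x"
    using dd_eq[OF has_derivative_add[OF dd_pole[OF \<beta>_nonzero[OF assms], of c 2] has_derivative_dd[OF line_analytic_differentiable[OF laRhW assms]]], of v]
    by (simp add: eval_nat_numeral)
  finally show ?thesis .
qed

lemma dd_dd_R:
  assumes "x \<in> W"
  shows "dd u (dd v R) x = 6 * c * of_real (\<beta> \<bullet> v) * of_real (\<beta> \<bullet> u) / of_real ((\<beta> \<bullet> x) ^ 4) + dd u (dd v Rh) x"
proof -
  have "dd u (dd v R) x = dd u (\<lambda>x. (- 2 * c * of_real (\<beta> \<bullet> v)) / of_real ((\<beta> \<bullet> x) ^ 3) + dd v Rh x) x"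
    by (rule dd_cong[OF opW assms]) (simp add: dd_R)
  also have "\<dots> = - 3 * (- 2 * c * of_real (\<beta> \<bullet> v)) * of_real (\<beta> \<bullet> u) / of_real ((\<beta> \<bullet> x) ^ 4) + dd u (dd v Rh) x"
    using dd_eq[OF has_derivative_add[OF dd_pole[OF \<beta>_nonzero[OF assms], of "- 2 * c * of_real (\<beta> \<bullet> v)" 3]
        has_derivative_dd[OF line_analytic_differentiable[OF line_analytic_dd[OF opW laRhW] assms]]], of u]
    by (simp add: eval_nat_numeral)
  finally show ?thesis by simp
qed

lemma \<beta>_p: "\<beta> \<bullet> f p = 1" and \<beta>_j: "j \<noteq> p \<Longrightarrow> \<beta> \<bullet> f j = 0"
  using \<omega>p orth by auto

lemma has_vector_derivative_lineW:
  assumes "line_analytic W F" "y + t *\<^sub>R f p \<in> W"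
  shows "((\<lambda>t. F (y + t *\<^sub>R f p)) has_vector_derivative dd (f p) F (y + t *\<^sub>R f p)) (at t)"
  by (rule has_vector_derivative_line[OF line_analytic_differentiable[OF assms]])

lemma const_on_line:
  assumes F: "line_analytic W F" "\<And>x. x \<in> W \<Longrightarrow> dd (f p) F x = 0"
    and W: "\<And>t. 0 < t \<Longrightarrow> t < d \<Longrightarrow> y + t *\<^sub>R f p \<in> W"
  shows "\<exists>C. \<forall>t. 0 < t \<longrightarrow> t < d \<longrightarrow> F (y + t *\<^sub>R f p) = C"
proof -
  have "\<exists>C. \<forall>t\<in>{0<..<d}. F (y + t *\<^sub>R f p) = C"
  proof (rule has_derivative_zero_constant)
    fix t assume t: "t \<in> {0<..<d}"
    then have "((\<lambda>t. F (y + t *\<^sub>R f p)) has_vector_derivative 0) (at t)"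
      using has_vector_derivative_lineW[OF F(1), of y t] F(2) W by auto
    then show "((\<lambda>t. F (y + t *\<^sub>R f p)) has_derivative (\<lambda>h. 0)) (at t within {0<..<d})"
      unfolding has_vector_derivative_def by (auto intro: has_derivative_at_withinI)
  qed auto
  then show ?thesis by auto
qed

lemma dd_p_S_pp:
  assumes "x \<in> W"
  shows "dd (f p) (dd v (S p p)) x = 0" "dd (f p) (dd u (dd v (S p p))) x = 0"
proof -
  have 1: "dd (f p) (dd v (S p p)) x = 0" if "x \<in> W" for x v
  proof -
    have "dd (f p) (dd v (S p p)) x = dd v (dd (f p) (S p p)) x" by (rule dd_pderiv_commute[OF opW laS that])
    also have "\<dots> = dd v (\<lambda>_. 0) x" by (rule dd_cong[OF opW that E1])
    finally show ?thesis by simp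
  qed
  show "dd (f p) (dd v (S p p)) x = 0" by (rule 1[OF assms])
  have "dd (f p) (dd u (dd v (S p p))) x = dd u (dd (f p) (dd v (S p p))) x"
    by (rule dd_pderiv_commute[OF opW line_analytic_dd[OF opW laS] assms])
  also have "\<dots> = dd u (\<lambda>_. 0) x" by (rule dd_cong[OF opW assms 1])
  finally show "dd (f p) (dd u (dd v (S p p))) x = 0" by simp
qed

text \<open>The pole is constant in tangential directions, so only the regular part enters
  \<open>E2\<close>.\<close>

lemma dd_p_S_pj:
  assumes "x \<in> W" "j \<noteq> p"
  shows "dd (f p) (S p j) x = - dd (f j) (S p p) x / 2 - of_real (\<mu> j) * dd (f j) Rh x"
proof -
  have "dd (f j) R x = dd (f j) Rh x" using dd_R[OF assms(1), of "f j"] \<beta>_j[OF assms(2)] by simp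
  with E2[OF assms] show ?thesis by (simp add: complex_eq_iff)
qed

lemma dd_p_dd_S_pm:
  assumes "x \<in> W" "j \<noteq> p" "m \<noteq> p"
  shows "dd (f p) (dd (f j) (S p m)) x = - dd (f j) (dd (f m) (S p p)) x / 2 - of_real (\<mu> m) * dd (f j) (dd (f m) Rh) x"
proof -
  have "dd (f p) (dd (f j) (S p m)) x = dd (f j) (dd (f p) (S p m)) x"
    by (rule dd_pderiv_commute[OF opW laS assms(1)])
  also have "\<dots> = dd (f j) (\<lambda>x. (- 1 / 2) * dd (f m) (S p p) x - of_real (\<mu> m) * dd (f m) Rh x) x"
    by (rule dd_cong[OF opW assms(1)]) (simp add: dd_p_S_pj[OF _ assms(3)])
  also have "\<dots> = dd (f j) (\<lambda>x. (- 1 / 2) * dd (f m) (S p p) x) x - dd (f j) (\<lambda>x. of_real (\<mu> m) * dd (f m) Rh x) x"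
    by (rule dd_diff; rule line_analytic_differentiable[OF line_analytic_cmult[OF opW line_analytic_dd[OF opW]] assms(1)];
        rule laS laRhW)
  also have "dd (f j) (\<lambda>x. (- 1 / 2) * dd (f m) (S p p) x) x = (- 1 / 2) * dd (f j) (dd (f m) (S p p)) x"
    by (rule dd_cmult[OF line_analytic_differentiable[OF line_analytic_dd[OF opW laS] assms(1)]])
  also have "dd (f j) (\<lambda>x. of_real (\<mu> m) * dd (f m) Rh x) x = of_real (\<mu> m) * dd (f j) (dd (f m) Rh) x"
    by (rule dd_cmult[OF line_analytic_differentiable[OF line_analytic_dd[OF opW laRhW] assms(1)]])
  finally show ?thesis by simp
qed

text \<open>This is \<open>E4\<close> after \<open>E2\<close> and \<open>E3\<close> have removed the
  normal derivatives of \<open>S p j\<close> and \<open>S j m\<close>. Adding the R-term to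
  \<open>S j m\<close> gives \<open>K\<close>, whose normal derivative no longer contains R; this
  produces the last term 2 g'' R on the left.\<close>

lemma wall_equation:
  assumes x: "x \<in> W" and j: "j \<noteq> p"
  defines "t \<equiv> complex_of_real (\<beta> \<bullet> x)"
  defines "K m \<equiv> S j m x + (if j = m then 2 * of_real (\<mu> j * \<omega> p / \<omega> j) else 0) * R x"
  shows "of_real (\<omega> p) * (3 * (- dd (f j) (S p p) x / 2 - of_real (\<mu> j) * dd (f j) Rh x) * (- 2 * c / t ^ 3 + dd (f p) Rh x)
         + S p j x * (6 * c / t ^ 4 + dd (f p) (dd (f p) Rh) x)
         + 2 * (- of_real (\<mu> j) * dd (f p) (dd (f j) Rh) x) * (c / t ^ 2 + Rh x))
      = of_real (\<omega> p) * S p p x * dd (f p) (dd (f j) Rh) x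
        + (\<Sum>m\<in>UNIV - {p}. of_real (\<omega> m) * (2 * dd (f j) (S p m) x * dd (f m) Rh x + dd (f m) (S p j) x * dd (f m) Rh x
              + S p m x * dd (f j) (dd (f m) Rh) x - K m * dd (f p) (dd (f m) Rh) x))"
proof -
  define R1 R2 where "R1 = dd (f p) R x" and "R2 = dd (f p) (dd (f p) R) x"
  define q q' where "q m = dd (f m) Rh x" and "q' m = dd (f p) (dd (f m) Rh) x" for m
  define a where "a m = dd (f j) (dd (f m) Rh) x" for m
  define \<nu> where "\<nu> = 2 * complex_of_real (\<mu> j * \<omega> p / \<omega> j)"
  have R0: "R x = c / t ^ 2 + Rh x" using R[OF x] by (simp add: t_def)
  have R1: "R1 = - 2 * c / t ^ 3 + dd (f p) Rh x" unfolding R1_def dd_R[OF x] \<beta>_p by (simp add: t_def)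
  have R2: "R2 = 6 * c / t ^ 4 + dd (f p) (dd (f p) Rh) x" unfolding R2_def dd_dd_R[OF x] \<beta>_p by (simp add: t_def)
  have ddm: "dd (f m) R x = q m" if "m \<noteq> p" for m using dd_R[OF x, of "f m"] \<beta>_j[OF that] by (simp add: q_def)
  have ddpm: "dd (f p) (dd (f m) R) x = q' m" if "m \<noteq> p" for m
    using dd_dd_R[OF x, of "f p" "f m"] \<beta>_j[OF that] by (simp add: q'_def)
  have ddjp: "dd (f j) (dd (f p) R) x = q' j"
    using dd_pderiv_commute[OF opW laR x, of "f j" "f p"] ddpm[OF j] by simp
  have ddjm: "dd (f j) (dd (f m) R) x = a m" if "m \<noteq> p" for m
    using dd_dd_R[OF x, of "f j" "f m"] \<beta>_j[OF that] by (simp add: a_def)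
  have prod: "dd v (\<lambda>x. S i m x * dd w R x) x = dd v (S i m) x * dd w R x + S i m x * dd v (dd w R) x" for v w i m
    by (rule dd_mult[OF line_analytic_differentiable[OF laS x] line_analytic_differentiable[OF line_analytic_dd[OF opW laR] x]])
  have spl: "(\<Sum>m\<in>UNIV. F m) = F p + (\<Sum>m\<in>UNIV - {p}. F m)" for F :: "'n \<Rightarrow> complex"
    by (rule sum.remove) auto
  have 1: "(\<Sum>m\<in>UNIV. of_real (\<omega> m) * dd (f p) (\<lambda>x. S j m x * dd (f m) R x) x)
     = of_real (\<omega> p) * (dd (f p) (S p j) x * R1 + S p j x * R2)
      + (\<Sum>m\<in>UNIV - {p}. of_real (\<omega> m) * (dd (f p) (S j m) x * q m + S j m x * q' m))"
    unfolding spl prod by (rule arg_cong2[of _ _ _ _ "(+)"]; (rule sum.cong)?) (auto simp: R1_def R2_def S_sym[of j p] ddm ddpm)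
  have 2: "(\<Sum>m\<in>UNIV. of_real (\<omega> m) * dd (f j) (\<lambda>x. S p m x * dd (f m) R x) x)
     = of_real (\<omega> p) * (dd (f j) (S p p) x * R1 + S p p x * q' j)
      + (\<Sum>m\<in>UNIV - {p}. of_real (\<omega> m) * (dd (f j) (S p m) x * q m + S p m x * a m))"
    unfolding spl prod by (rule arg_cong2[of _ _ _ _ "(+)"]; (rule sum.cong)?) (auto simp: R1_def ddm ddjm ddjp)
  define G' where "G' = - dd (f j) (S p p) x / 2 - of_real (\<mu> j) * q j"
  have G': "dd (f p) (S p j) x = G'" unfolding G'_def q_def by (rule dd_p_S_pj[OF x j])
  have Sjm: "dd (f p) (S j m) x = - dd (f j) (S p m) x - dd (f m) (S p j) x - (if j = m then \<nu> * R1 else 0)" if "m \<noteq> p" for m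
    using E3[OF x j that] unfolding \<nu>_def R1_def by (auto simp: complex_eq_iff)
  have K: "S j m x = K m - (if j = m then \<nu> * R x else 0)" for m by (simp add: K_def \<nu>_def)
  have \<nu>\<omega>: "of_real (\<omega> j) * \<nu> = 2 * of_real (\<omega> p) * of_real (\<mu> j)" using \<omega>[of j] by (simp add: \<nu>_def)
  have "(\<Sum>m\<in>UNIV - {p}. of_real (\<omega> m) * (dd (f p) (S j m) x * q m + S j m x * q' m))
     = (\<Sum>m\<in>UNIV - {p}. of_real (\<omega> m) * (- dd (f j) (S p m) x * q m - dd (f m) (S p j) x * q m + K m * q' m)
           - (if j = m then of_real (\<omega> j) * \<nu> * (R1 * q j + R x * q' j) else 0))"
    by (rule sum.cong[OF refl]) (simp add: Sjm K algebra_simps)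
  also have "\<dots> = (\<Sum>m\<in>UNIV - {p}. of_real (\<omega> m) * (- dd (f j) (S p m) x * q m - dd (f m) (S p j) x * q m + K m * q' m))
      - of_real (\<omega> j) * \<nu> * (R1 * q j + R x * q' j)"
    using j by (simp add: sum_subtractf)
  finally have sm: "(\<Sum>m\<in>UNIV - {p}. of_real (\<omega> m) * (dd (f p) (S j m) x * q m + S j m x * q' m))
     = (\<Sum>m\<in>UNIV - {p}. of_real (\<omega> m) * (- dd (f j) (S p m) x * q m - dd (f m) (S p j) x * q m + K m * q' m))
      - of_real (\<omega> j) * \<nu> * (R1 * q j + R x * q' j)" .
  have 3: "of_real (\<omega> p) * (G' * R1 + S p j x * R2)
      + (\<Sum>m\<in>UNIV - {p}. of_real (\<omega> m) * (- dd (f j) (S p m) x * q m - dd (f m) (S p j) x * q m + K m * q' m))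
      - 2 * of_real (\<omega> p) * of_real (\<mu> j) * (R1 * q j + R x * q' j)
     = of_real (\<omega> p) * (dd (f j) (S p p) x * R1 + S p p x * q' j)
      + (\<Sum>m\<in>UNIV - {p}. of_real (\<omega> m) * (dd (f j) (S p m) x * q m + S p m x * a m))"
    using E4[OF x j] unfolding 1 2 G' sm \<nu>\<omega> by (simp only: add_diff_eq)
  have 4: "(\<Sum>m\<in>UNIV - {p}. of_real (\<omega> m) * (2 * dd (f j) (S p m) x * q m + dd (f m) (S p j) x * q m + S p m x * a m - K m * q' m))
     = (\<Sum>m\<in>UNIV - {p}. of_real (\<omega> m) * (dd (f j) (S p m) x * q m + S p m x * a m))
      - (\<Sum>m\<in>UNIV - {p}. of_real (\<omega> m) * (- dd (f j) (S p m) x * q m - dd (f m) (S p j) x * q m + K m * q' m))"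
    unfolding sum_subtractf[symmetric] by (rule sum.cong[OF refl]) (simp add: algebra_simps)
  have sj: "dd (f j) (S p p) x = - 2 * G' - 2 * of_real (\<mu> j) * q j" by (simp add: G'_def)
  \<comment> \<open>The 3 is 1 + 2: once from the normal derivative of \<open>S p j\<close>, twice
    from the tangential derivative of \<open>S p p\<close>, which \<open>sj\<close> expresses
    through it. The products of R1 with q cancel.\<close>
  have lin: "w * (3 * G * R1 + g * R2 + 2 * (- m * q') * r) = w * s * q' + (B - A)"
    if "w * (G * R1 + g * R2) + A - 2 * w * m * (R1 * q + r * q') = w * ((- 2 * G - 2 * m * q) * R1 + s * q') + B"
    for w G R1 R2 g A B m q q' r s :: complex
    using that by (simp add: algebra_simps)
  show ?thesis
    unfolding R0[symmetric] R1[symmetric] R2[symmetric]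
    unfolding q_def[symmetric] q'_def[symmetric] a_def[symmetric] G'_def[symmetric] 4
    by (rule lin[OF 3[unfolded sj]])
qed

lemma pole_system_at:
  assumes y: "y \<in> V" "f p \<bullet> y = 0"
  shows "\<exists>d s sj sjm P Q QQ.
    pole_system (UNIV - {p}) d (of_real (\<omega> p)) c s (\<lambda>m. of_real (\<omega> m)) (\<lambda>m. of_real (\<mu> m)) sj sjm
      (\<lambda>j t. S p j (y + t *\<^sub>R f p)) (\<lambda>j m t. dd (f j) (S p m) (y + t *\<^sub>R f p))
      (\<lambda>j m t. S j m (y + t *\<^sub>R f p) + (if j = m then 2 * of_real (\<mu> j * \<omega> p / \<omega> j) else 0) * R (y + t *\<^sub>R f p)) P Q QQ
    \<and> (\<forall>t. \<bar>t\<bar> < d \<longrightarrow> y + t *\<^sub>R f p \<in> V \<and> Rh (y + t *\<^sub>R f p) = P (of_real t))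
    \<and> (\<forall>j t. \<bar>t\<bar> < d \<longrightarrow> dd (f j) Rh (y + t *\<^sub>R f p) = Q j (of_real t))
    \<and> (\<forall>j m t. \<bar>t\<bar> < d \<longrightarrow> dd (f j) (dd (f m) Rh) (y + t *\<^sub>R f p) = QQ j m (of_real t))"
proof -
  note laD = line_analytic_dd[OF opV]
  note laDW = line_analytic_dd[OF opW]
  obtain d0 P where P: "d0 > 0" "P holomorphic_on ball 0 d0"
    "\<And>t. \<bar>t\<bar> < d0 \<Longrightarrow> y + t *\<^sub>R f p \<in> V \<and> Rh (y + t *\<^sub>R f p) = P (of_real t)"
    using line_extension[OF opV laRh y(1), of "f p"] by blast
  have "\<exists>d E. d > 0 \<and> E holomorphic_on ball 0 d \<and> (\<forall>t. \<bar>t\<bar> < d \<longrightarrow> y + t *\<^sub>R f p \<in> V \<and> dd (f j) Rh (y + t *\<^sub>R f p) = E (of_real t))" for j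
    by (rule line_extension[OF opV laD[OF laRh] y(1)])
  then obtain d1 Q where Q: "\<And>j. d1 j > 0" "\<And>j. Q j holomorphic_on ball 0 (d1 j)"
    "\<And>j t. \<bar>t\<bar> < d1 j \<Longrightarrow> y + t *\<^sub>R f p \<in> V \<and> dd (f j) Rh (y + t *\<^sub>R f p) = Q j (of_real t)"
    by metis
  have "\<exists>d E. d > 0 \<and> E holomorphic_on ball 0 d \<and> (\<forall>t. \<bar>t\<bar> < d \<longrightarrow> y + t *\<^sub>R f p \<in> V \<and> dd (f j) (dd (f m) Rh) (y + t *\<^sub>R f p) = E (of_real t))" for j m
    by (rule line_extension[OF opV laD[OF laD[OF laRh]] y(1)])
  then obtain d2 QQ where QQ: "\<And>j m. d2 j m > 0" "\<And>j m. QQ j m holomorphic_on ball 0 (d2 j m)"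
    "\<And>j m t. \<bar>t\<bar> < d2 j m \<Longrightarrow> y + t *\<^sub>R f p \<in> V \<and> dd (f j) (dd (f m) Rh) (y + t *\<^sub>R f p) = QQ j m (of_real t)"
    by metis
  \<comment> \<open>One radius for the finitely many holomorphic extensions.\<close>
  define D where "D = {d0} \<union> range d1 \<union> range (\<lambda>(j, m). d2 j m)"
  define d where "d = Min D"
  have fD: "finite D" "D \<noteq> {}" by (auto simp: D_def)
  have d: "d > 0" unfolding d_def using P(1) Q(1) QQ(1) by (subst Min_gr_iff[OF fD]) (auto simp: D_def)
  have dle: "d \<le> d0" "d \<le> d1 j" "d \<le> d2 j m" for j m
    unfolding d_def by (rule Min_le[OF fD(1)], force simp: D_def)+
  have inV: "y + t *\<^sub>R f p \<in> V" if "\<bar>t\<bar> < d" for t using P(3)[of t] dle(1) that by auto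
  have fpp: "f p \<bullet> f p > 0" using \<omega>p by (metis inner_ge_zero less_eq_real_def mult_zero_right zero_neq_one)
  have inW: "y + t *\<^sub>R f p \<in> W" if "0 < t" "t < d" for t
    using inV[of t] that y(2) fpp by (auto simp: W_def V_def inner_add_right)
  have \<beta>t: "\<beta> \<bullet> (y + t *\<^sub>R f p) = t" for t using y(2) \<omega>p(1) by (simp add: inner_add_right mult.left_commute)
  have eP: "Rh (y + t *\<^sub>R f p) = P (of_real t)" if "\<bar>t\<bar> < d" for t using P(3)[of t] dle(1) that by auto
  have eQ: "dd (f j) Rh (y + t *\<^sub>R f p) = Q j (of_real t)" if "\<bar>t\<bar> < d" for j t using Q(3)[of t j] dle(2)[of j] that by auto
  have eQQ: "dd (f j) (dd (f m) Rh) (y + t *\<^sub>R f p) = QQ j m (of_real t)" if "\<bar>t\<bar> < d" for j m t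
    using QQ(3)[of t j m] dle(3)[of j m] that by auto
  have sub: "ball (0::complex) d \<subseteq> ball 0 d0" "ball (0::complex) d \<subseteq> ball 0 (d1 j)" "ball (0::complex) d \<subseteq> ball 0 (d2 j m)" for j m
    using dle by (auto simp: subset_iff intro: less_le_trans)
  have hP: "P holomorphic_on ball 0 d" and hQ: "Q j holomorphic_on ball 0 d" and hQQ: "QQ j m holomorphic_on ball 0 d" for j m
    using holomorphic_on_subset[OF P(2) sub(1)] holomorphic_on_subset[OF Q(2) sub(2)] holomorphic_on_subset[OF QQ(2) sub(3)] by auto
  obtain s where s: "\<And>t. 0 < t \<Longrightarrow> t < d \<Longrightarrow> S p p (y + t *\<^sub>R f p) = s"
    using const_on_line[OF laS E1 inW] by blast
  have "\<exists>C. \<forall>t. 0 < t \<longrightarrow> t < d \<longrightarrow> dd (f j) (S p p) (y + t *\<^sub>R f p) = C" for j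
    by (rule const_on_line[OF laDW[OF laS] dd_p_S_pp(1) inW])
  then obtain sj where sj: "\<And>j t. 0 < t \<Longrightarrow> t < d \<Longrightarrow> dd (f j) (S p p) (y + t *\<^sub>R f p) = sj j" by metis
  have "\<exists>C. \<forall>t. 0 < t \<longrightarrow> t < d \<longrightarrow> dd (f j) (dd (f m) (S p p)) (y + t *\<^sub>R f p) = C" for j m
    by (rule const_on_line[OF laDW[OF laDW[OF laS]] dd_p_S_pp(2) inW])
  then obtain sjm where sjm: "\<And>j m t. 0 < t \<Longrightarrow> t < d \<Longrightarrow> dd (f j) (dd (f m) (S p p)) (y + t *\<^sub>R f p) = sjm j m" by metis
  have drv: "deriv E (of_real t) = dd (f p) F (y + t *\<^sub>R f p)" "deriv (deriv E) (of_real t) = dd (f p) (dd (f p) F) (y + t *\<^sub>R f p)"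
    if "line_analytic V F" "E holomorphic_on ball 0 d" "\<And>t. \<bar>t\<bar> < d \<Longrightarrow> F (y + t *\<^sub>R f p) = E (of_real t)" "\<bar>t\<bar> < d" for E F t
    using higher_deriv_line[OF opV that(1,2) _ that(4), of y "f p" 1] higher_deriv_line[OF opV that(1,2) _ that(4), of y "f p" 2] inV that(3)
    by (auto simp: eval_nat_numeral)
  have dP: "deriv P (of_real t) = dd (f p) Rh (y + t *\<^sub>R f p)" "deriv (deriv P) (of_real t) = dd (f p) (dd (f p) Rh) (y + t *\<^sub>R f p)"
    if "\<bar>t\<bar> < d" for t
    by (rule drv[OF laRh hP eP that], assumption)+
  have dQ: "deriv (Q j) (of_real t) = dd (f p) (dd (f j) Rh) (y + t *\<^sub>R f p)" if "\<bar>t\<bar> < d" for j t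
    by (rule drv(1)[OF laD[OF laRh] hQ eQ that], assumption)
  have "pole_system (UNIV - {p}) d (of_real (\<omega> p)) c s (\<lambda>m. of_real (\<omega> m)) (\<lambda>m. of_real (\<mu> m)) sj sjm
      (\<lambda>j t. S p j (y + t *\<^sub>R f p)) (\<lambda>j m t. dd (f j) (S p m) (y + t *\<^sub>R f p))
      (\<lambda>j m t. S j m (y + t *\<^sub>R f p) + (if j = m then 2 * of_real (\<mu> j * \<omega> p / \<omega> j) else 0) * R (y + t *\<^sub>R f p)) P Q QQ"
  proof
    show "finite (UNIV - {p})" "0 < d" "complex_of_real (\<omega> p) \<noteq> 0" "c \<noteq> 0" using d c \<omega> by auto
    show "complex_of_real (\<mu> j) \<noteq> 0" if "j \<in> UNIV - {p}" for j using \<mu> that by auto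
    show "P holomorphic_on ball 0 d" "Q j holomorphic_on ball 0 d" "QQ j m holomorphic_on ball 0 d" for j m
      by (rule hP hQ hQQ)+
    fix j t assume j: "j \<in> UNIV - {p}" and t: "0 < t" "t < d"
    have ta: "\<bar>t\<bar> < d" using t by simp
    note w = inW[OF t]
    show "((\<lambda>t. S p j (y + t *\<^sub>R f p)) has_vector_derivative - sj j / 2 - complex_of_real (\<mu> j) * Q j (complex_of_real t)) (at t)"
      using has_vector_derivative_lineW[OF laS w, of p j] dd_p_S_pj[OF w, of j] j sj[OF t] eQ[OF ta] by simp
    show "complex_of_real (\<omega> p) * (3 * (- sj j / 2 - complex_of_real (\<mu> j) * Q j (complex_of_real t)) *
         (- 2 * c / complex_of_real t ^ 3 + deriv P (complex_of_real t)) +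
         S p j (y + t *\<^sub>R f p) * (6 * c / complex_of_real t ^ 4 + deriv (deriv P) (complex_of_real t)) +
         2 * (- complex_of_real (\<mu> j) * deriv (Q j) (complex_of_real t)) * (c / (complex_of_real t)\<^sup>2 + P (complex_of_real t))) =
        complex_of_real (\<omega> p) * s * deriv (Q j) (complex_of_real t) +
        (\<Sum>m\<in>UNIV - {p}. complex_of_real (\<omega> m) *
           (2 * dd (f j) (S p m) (y + t *\<^sub>R f p) * Q m (complex_of_real t) +
            dd (f m) (S p j) (y + t *\<^sub>R f p) * Q m (complex_of_real t) +
            S p m (y + t *\<^sub>R f p) * QQ j m (complex_of_real t) -
            (S j m (y + t *\<^sub>R f p) + (if j = m then 2 * of_real (\<mu> j * \<omega> p / \<omega> j) else 0) * R (y + t *\<^sub>R f p)) * deriv (Q m) (complex_of_real t)))"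
      unfolding dP[OF ta] dQ[OF ta] eP[OF ta, symmetric] eQ[OF ta, symmetric] eQQ[OF ta, symmetric] s[OF t, symmetric] sj[OF t, symmetric]
      using wall_equation[OF w, of j] j unfolding \<beta>t by simp
    fix m assume m: "m \<in> UNIV - {p}"
    show "((\<lambda>t. dd (f j) (S p m) (y + t *\<^sub>R f p)) has_vector_derivative - sjm j m / 2 - complex_of_real (\<mu> m) * QQ j m (complex_of_real t)) (at t)"
      using has_vector_derivative_lineW[OF laDW[OF laS] w, of "f j" p m] dd_p_dd_S_pm[OF w, of j m] j m sjm[OF t] eQQ[OF ta] by simp
    define \<nu> where "\<nu> = (if j = m then 2 * complex_of_real (\<mu> j * \<omega> p / \<omega> j) else 0)"
    have "((\<lambda>t. S j m (y + t *\<^sub>R f p) + \<nu> * R (y + t *\<^sub>R f p)) has_vector_derivative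
       dd (f p) (S j m) (y + t *\<^sub>R f p) + \<nu> * dd (f p) R (y + t *\<^sub>R f p)) (at t)"
      by (intro has_vector_derivative_add has_vector_derivative_mult_right has_vector_derivative_lineW laS laR w)
    moreover have "dd (f p) (S j m) (y + t *\<^sub>R f p) + \<nu> * dd (f p) R (y + t *\<^sub>R f p) = - dd (f j) (S p m) (y + t *\<^sub>R f p) - dd (f m) (S p j) (y + t *\<^sub>R f p)"
      using E3[OF w, of j m] j m unfolding \<nu>_def by (auto simp: complex_eq_iff)
    ultimately show "((\<lambda>t. S j m (y + t *\<^sub>R f p) + (if j = m then 2 * of_real (\<mu> j * \<omega> p / \<omega> j) else 0) * R (y + t *\<^sub>R f p)) has_vector_derivative
        - dd (f j) (S p m) (y + t *\<^sub>R f p) - dd (f m) (S p j) (y + t *\<^sub>R f p)) (at t)"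
      by (simp add: \<nu>_def)
  qed
  then show ?thesis using inV eP eQ eQQ by blast
qed

end

section \<open>Limits at the wall and the local alternative\<close>

lemma norm_increment_le:
  fixes g :: "real \<Rightarrow> complex"
  assumes "a \<le> b" "\<And>t. a \<le> t \<Longrightarrow> t \<le> b \<Longrightarrow> (g has_vector_derivative g' t) (at t)"
    "\<And>t. a \<le> t \<Longrightarrow> t \<le> b \<Longrightarrow> norm (g' t) \<le> B"
  shows "norm (g b - g a) \<le> B * (b - a)"
proof -
  have "norm (g b - g a) \<le> B * norm (b - a)"
  proof (rule differentiable_bound[of "{a..b}" g "\<lambda>t h. h *\<^sub>R g' t"])
    fix t assume t: "t \<in> {a..b}"
    then show "(g has_derivative (\<lambda>h. h *\<^sub>R g' t)) (at t within {a..b})"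
      using assms(2)[of t] by (auto simp: has_vector_derivative_def intro: has_derivative_at_withinI)
    show "onorm (\<lambda>h. h *\<^sub>R g' t) \<le> B"
      using assms(3)[of t] t by (intro onorm_le) (auto simp: mult.commute[of B] intro!: mult_left_mono)
  qed (use assms(1) in auto)
  then show ?thesis using assms(1) by simp
qed

lemma norm_derivative_le:
  fixes g :: "real \<Rightarrow> complex"
  assumes g: "(g has_vector_derivative E) (at 0)" and s0: "s0 > 0"
    and b: "\<And>s. 0 < s \<Longrightarrow> s < s0 \<Longrightarrow> norm (g s - g 0) \<le> K * s"
  shows "norm E \<le> K"
proof (rule field_le_epsilon)
  fix e :: real assume "e > 0"
  then obtain d where d: "d > 0" "\<And>y. norm (y - 0) < d \<Longrightarrow> norm (g y - g 0 - (y - 0) *\<^sub>R E) \<le> e * norm (y - 0)"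
    using g unfolding has_vector_derivative_def has_derivative_within_alt by blast
  define s where "s = min d s0 / 2"
  have s: "s > 0" "s < d" "s < s0" using d(1) s0 by (auto simp: s_def)
  have "norm (s *\<^sub>R E) \<le> norm (g s - g 0) + norm (g s - g 0 - s *\<^sub>R E)"
    by (metis norm_triangle_ineq4 diff_diff_eq2 add_diff_cancel_left' diff_add_cancel)
  also have "\<dots> \<le> K * s + e * s"
    using b[OF s(1,3)] d(2)[of s] s by (intro add_mono) auto
  finally have "s * norm E \<le> s * (K + e)" using s(1) by (simp add: algebra_simps)
  then show "norm E \<le> K + e" using s(1) by simp
qed

lemma dd_funpow_cong:
  assumes "open V" "\<And>x. x \<in> V \<Longrightarrow> F x = G x" "x \<in> V"
  shows "((dd v) ^^ n) F x = ((dd v) ^^ n) G x"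
  using assms(3) by (induction n arbitrary: x) (auto intro: dd_cong[OF assms(1)] assms(2))

context wall_system
begin

text \<open>Stated for every wall point y in V and not only for the centre \<open>x0\<close>, so
  that the relation can be differentiated along the wall.\<close>

lemma dd_pj_zero:
  assumes y: "y \<in> V" "f p \<bullet> y = 0" and j: "j \<noteq> p"
  shows "dd (f p) (dd (f j) Rh) y = 0" "((\<lambda>t. S p j (y + t *\<^sub>R f p)) \<longlongrightarrow> 0) (at_right 0)"
proof -
  obtain d s sj sjm P Q QQ where ps: "pole_system (UNIV - {p}) d (of_real (\<omega> p)) c s (\<lambda>m. of_real (\<omega> m)) (\<lambda>m. of_real (\<mu> m)) sj sjm
      (\<lambda>j t. S p j (y + t *\<^sub>R f p)) (\<lambda>j m t. dd (f j) (S p m) (y + t *\<^sub>R f p))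
      (\<lambda>j m t. S j m (y + t *\<^sub>R f p) + (if j = m then 2 * of_real (\<mu> j * \<omega> p / \<omega> j) else 0) * R (y + t *\<^sub>R f p)) P Q QQ"
    and V: "\<And>t. \<bar>t\<bar> < d \<Longrightarrow> y + t *\<^sub>R f p \<in> V"
    and Q: "\<And>j t. \<bar>t\<bar> < d \<Longrightarrow> dd (f j) Rh (y + t *\<^sub>R f p) = Q j (of_real t)"
    using pole_system_at[OF y] by blast
  interpret ps: pole_system "UNIV - {p}" d "of_real (\<omega> p)" c s "\<lambda>m. of_real (\<omega> m)" "\<lambda>m. of_real (\<mu> m)" sj sjm
      "\<lambda>j t. S p j (y + t *\<^sub>R f p)" "\<lambda>j m t. dd (f j) (S p m) (y + t *\<^sub>R f p)"
      "\<lambda>j m t. S j m (y + t *\<^sub>R f p) + (if j = m then 2 * of_real (\<mu> j * \<omega> p / \<omega> j) else 0) * R (y + t *\<^sub>R f p)" P Q QQ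
    by (rule ps)
  have j': "j \<in> UNIV - {p}" using j by simp
  have "(deriv ^^ 1) (Q j) (of_real 0) = ((dd (f p)) ^^ 1) (dd (f j) Rh) (y + 0 *\<^sub>R f p)"
    by (rule higher_deriv_line[OF opV line_analytic_dd[OF opV laRh] ps.hQ[OF j']]) (use V Q ps.d in auto)
  then show "dd (f p) (dd (f j) Rh) y = 0" using ps.deriv_Q_zero(1)[OF j'] by simp
  show "((\<lambda>t. S p j (y + t *\<^sub>R f p)) \<longlongrightarrow> 0) (at_right 0)" by (rule ps.deriv_Q_zero(2)[OF j'])
qed

text \<open>\<open>S p m\<close> tends to 0 along each normal line, but this does not yet control
  its tangential derivative. Its normal derivative is smooth up to the wall apart from a term that
  is constant along normals. Integrating from the wall bounds the difference between two normal
  lines at distance s by a constant times t s, and dividing by s gives a bound of order t.\<close>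

lemma dd_S_pm_limit:
  assumes y: "y \<in> V" "f p \<bullet> y = 0" and j: "j \<noteq> p" and m: "m \<noteq> p"
  shows "((\<lambda>t. dd (f j) (S p m) (y + t *\<^sub>R f p)) \<longlongrightarrow> 0) (at_right 0)"
proof -
  define D where "D = dd (f m) (S p p)"
  have laD: "line_analytic W D" unfolding D_def by (rule line_analytic_dd[OF opW laS])
  define h where "h = dd (f m) Rh"
  have lah: "line_analytic V h" unfolding h_def by (rule line_analytic_dd[OF opV laRh])
  obtain \<eta> where \<eta>: "\<eta> > 0" "cball y \<eta> \<subseteq> V" using opV y(1) open_contains_cball by blast
  have "continuous_on (cball y \<eta>) (dd (f j) h)"
    using \<eta>(2) line_analytic_differentiable[OF line_analytic_dd[OF opV lah]]
    by (intro continuous_at_imp_continuous_on ballI differentiable_imp_continuous_within) auto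
  then have "bounded (dd (f j) h ` cball y \<eta>)"
    by (intro compact_imp_bounded compact_continuous_image) auto
  then obtain M where M: "\<And>x. x \<in> cball y \<eta> \<Longrightarrow> norm (dd (f j) h x) \<le> M" unfolding bounded_iff by blast
  have fpp: "f p \<bullet> f p > 0" using \<omega>p by (metis inner_ge_zero less_eq_real_def mult_zero_right zero_neq_one)
  define A where "A = norm (f p) + norm (f j) + 1"
  have A: "A > 0" by (simp add: A_def add_nonneg_pos)
  define d where "d = \<eta> / A"
  have d: "d > 0" using \<eta> A by (simp add: d_def)
  have inB: "y + \<tau> *\<^sub>R f p + s *\<^sub>R f j \<in> cball y \<eta>" if "\<bar>\<tau>\<bar> \<le> d" "\<bar>s\<bar> \<le> d" for \<tau> s
  proof -
    have "norm (\<tau> *\<^sub>R f p + s *\<^sub>R f j) \<le> \<bar>\<tau>\<bar> * norm (f p) + \<bar>s\<bar> * norm (f j)"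
      by (rule order_trans[OF norm_triangle_ineq]) simp
    also have "\<dots> \<le> d * norm (f p) + d * norm (f j)"
      using that by (intro add_mono mult_right_mono) auto
    also have "\<dots> \<le> d * A" using d by (simp add: A_def algebra_simps)
    also have "\<dots> = \<eta>" using A by (simp add: d_def)
    finally have "norm (\<tau> *\<^sub>R f p + s *\<^sub>R f j) \<le> \<eta>" .
    moreover have "dist y (y + \<tau> *\<^sub>R f p + s *\<^sub>R f j) = norm (\<tau> *\<^sub>R f p + s *\<^sub>R f j)"
      by (simp add: dist_norm norm_minus_commute add.assoc) (simp add: add.commute)
    ultimately show ?thesis by simp
  qed
  have inW: "y + \<tau> *\<^sub>R f p + s *\<^sub>R f j \<in> W" if "0 < \<tau>" "\<tau> \<le> d" "\<bar>s\<bar> \<le> d" for \<tau> s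
    using inB[of \<tau> s] that \<eta>(2) fpp y(2) orth[OF j] by (auto simp: W_def V_def inner_add_right)
  obtain C where C: "\<And>t. 0 < t \<Longrightarrow> t < d \<Longrightarrow> dd (f j) D (y + t *\<^sub>R f p) = C"
  proof -
    have "\<exists>C. \<forall>t. 0 < t \<longrightarrow> t < d \<longrightarrow> dd (f j) D (y + t *\<^sub>R f p) = C"
      by (rule const_on_line[OF line_analytic_dd[OF opW laD]]) (use inW[of _ 0] d dd_p_S_pp(2) in \<open>auto simp: D_def\<close>)
    then show ?thesis using that by blast
  qed
  define B where "B = \<bar>\<mu> m\<bar> * M"
  have bound: "norm (dd (f j) (S p m) (y + t *\<^sub>R f p)) \<le> (B + norm C / 2) * t" if t: "0 < t" "t < d" for t
  proof -
    \<comment> \<open>The added term cancels -D/2 in the normal derivative of \<open>S p m\<close>;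
      D is constant along normals.\<close>
    define \<Phi> where "\<Phi> s \<tau> = S p m (y + \<tau> *\<^sub>R f p + s *\<^sub>R f j) + of_real (\<tau> / 2) * D (y + \<tau> *\<^sub>R f p + s *\<^sub>R f j)" for s \<tau>
    have inc: "norm (\<Phi> s t - \<Phi> 0 t) \<le> B * t * s" if s: "0 < s" "s < d" for s
    proof -
      define \<Delta> where "\<Delta> \<tau> = \<Phi> s \<tau> - \<Phi> 0 \<tau>" for \<tau>
      have \<Phi>': "(\<Phi> \<sigma> has_vector_derivative - of_real (\<mu> m) * h (y + \<tau> *\<^sub>R f p + \<sigma> *\<^sub>R f j)) (at \<tau>)"
        if \<tau>: "0 < \<tau>" "\<tau> \<le> d" and \<sigma>: "\<bar>\<sigma>\<bar> \<le> d" for \<sigma> \<tau>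
      proof -
        let ?x = "y + \<sigma> *\<^sub>R f j + \<tau> *\<^sub>R f p"
        have w: "?x \<in> W" using inW[OF \<tau> \<sigma>] by (simp add: algebra_simps)
        have e: "\<Phi> \<sigma> = (\<lambda>\<tau>. S p m (y + \<sigma> *\<^sub>R f j + \<tau> *\<^sub>R f p) + of_real (\<tau> / 2) * D (y + \<sigma> *\<^sub>R f j + \<tau> *\<^sub>R f p))"
          by (auto simp: \<Phi>_def algebra_simps)
        have "((\<lambda>\<tau>. complex_of_real (\<tau> / 2)) has_vector_derivative (1 / 2)) (at \<tau>)"
          by (auto intro!: derivative_eq_intros simp: has_vector_derivative_def scaleR_conv_of_real)
        then have "(\<Phi> \<sigma> has_vector_derivative dd (f p) (S p m) ?x + (of_real (\<tau> / 2) * dd (f p) D ?x + (1 / 2) * D ?x)) (at \<tau>)"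
          unfolding e by (intro has_vector_derivative_add has_vector_derivative_mult has_vector_derivative_lineW laS laD w)
        moreover have "dd (f p) (S p m) ?x + (of_real (\<tau> / 2) * dd (f p) D ?x + (1 / 2) * D ?x) = - of_real (\<mu> m) * h ?x"
          using dd_p_S_pj[OF w m] dd_p_S_pp(1)[OF w, of "f m"] by (simp add: D_def h_def)
        ultimately show ?thesis by (simp add: algebra_simps)
      qed
      have lip: "norm (h (y + \<tau> *\<^sub>R f p + s *\<^sub>R f j) - h (y + \<tau> *\<^sub>R f p + 0 *\<^sub>R f j)) \<le> M * (s - 0)" if \<tau>: "0 < \<tau>" "\<tau> \<le> d" for \<tau>
      proof (rule norm_increment_le[where g' = "\<lambda>\<sigma>. dd (f j) h (y + \<tau> *\<^sub>R f p + \<sigma> *\<^sub>R f j)"])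
        fix \<sigma> assume \<sigma>: "0 \<le> \<sigma>" "\<sigma> \<le> s"
        have x: "y + \<tau> *\<^sub>R f p + \<sigma> *\<^sub>R f j \<in> cball y \<eta>" using inB[of \<tau> \<sigma>] \<tau> \<sigma> s by auto
        show "((\<lambda>\<sigma>. h (y + \<tau> *\<^sub>R f p + \<sigma> *\<^sub>R f j)) has_vector_derivative dd (f j) h (y + \<tau> *\<^sub>R f p + \<sigma> *\<^sub>R f j)) (at \<sigma>)"
          by (rule has_vector_derivative_line[OF line_analytic_differentiable[OF lah]]) (use x \<eta>(2) in auto)
        show "norm (dd (f j) h (y + \<tau> *\<^sub>R f p + \<sigma> *\<^sub>R f j)) \<le> M" by (rule M[OF x])
      qed (use s in simp)
      \<comment> \<open>The integration starts at \<epsilon> > 0 because \<open>S p m\<close> is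
        controlled off the wall only; afterwards \<epsilon> tends to 0 by
        \<open>lim\<close>.\<close>
      have incr: "norm (\<Delta> t - \<Delta> \<epsilon>) \<le> B * s * (t - \<epsilon>)" if \<epsilon>: "0 < \<epsilon>" "\<epsilon> \<le> t" for \<epsilon>
      proof (rule norm_increment_le[where g' = "\<lambda>\<tau>. - of_real (\<mu> m) * h (y + \<tau> *\<^sub>R f p + s *\<^sub>R f j) - - of_real (\<mu> m) * h (y + \<tau> *\<^sub>R f p + 0 *\<^sub>R f j)"])
        fix \<tau> assume \<tau>: "\<epsilon> \<le> \<tau>" "\<tau> \<le> t"
        show "(\<Delta> has_vector_derivative - of_real (\<mu> m) * h (y + \<tau> *\<^sub>R f p + s *\<^sub>R f j) - - of_real (\<mu> m) * h (y + \<tau> *\<^sub>R f p + 0 *\<^sub>R f j)) (at \<tau>)"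
          unfolding \<Delta>_def[abs_def] by (intro has_vector_derivative_diff \<Phi>') (use \<tau> \<epsilon> t s d in auto)
        have "norm (- of_real (\<mu> m) * h (y + \<tau> *\<^sub>R f p + s *\<^sub>R f j) - - of_real (\<mu> m) * h (y + \<tau> *\<^sub>R f p + 0 *\<^sub>R f j))
           = \<bar>\<mu> m\<bar> * norm (h (y + \<tau> *\<^sub>R f p + s *\<^sub>R f j) - h (y + \<tau> *\<^sub>R f p + 0 *\<^sub>R f j))"
        proof -
          have e: "- complex_of_real (\<mu> m) * u - - of_real (\<mu> m) * v = - (of_real (\<mu> m) * (u - v))" for u v by (simp add: algebra_simps)
          show ?thesis unfolding e norm_minus_cancel norm_mult norm_of_real ..
        qed
        also have "\<dots> \<le> \<bar>\<mu> m\<bar> * (M * (s - 0))"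
          by (intro mult_left_mono lip) (use \<tau> \<epsilon> t in auto)
        finally show "norm (- of_real (\<mu> m) * h (y + \<tau> *\<^sub>R f p + s *\<^sub>R f j) - - of_real (\<mu> m) * h (y + \<tau> *\<^sub>R f p + 0 *\<^sub>R f j)) \<le> B * s"
          by (simp add: B_def mult.assoc)
      qed (use \<epsilon> in simp)
      have lim: "(\<Delta> \<longlongrightarrow> 0) (at_right 0)"
      proof -
        have \<Phi>0: "(\<Phi> \<sigma> \<longlongrightarrow> 0) (at_right 0)" if \<sigma>: "\<bar>\<sigma>\<bar> \<le> d" for \<sigma>
        proof -
          let ?Y = "y + \<sigma> *\<^sub>R f j"
          have Y: "?Y \<in> V" "f p \<bullet> ?Y = 0" using inB[of 0 \<sigma>] d \<sigma> \<eta>(2) y(2) orth[OF j] by (auto simp: inner_add_right)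
          have e: "y + \<tau> *\<^sub>R f p + \<sigma> *\<^sub>R f j = ?Y + \<tau> *\<^sub>R f p" for \<tau> by (simp add: algebra_simps)
          obtain C' where C': "\<And>t. 0 < t \<Longrightarrow> t < d \<Longrightarrow> D (?Y + t *\<^sub>R f p) = C'"
          proof -
            have "\<exists>C. \<forall>t. 0 < t \<longrightarrow> t < d \<longrightarrow> D (?Y + t *\<^sub>R f p) = C"
              by (rule const_on_line[OF laD]) (use inW[OF _ _ \<sigma>] dd_p_S_pp(1) in \<open>auto simp: D_def e\<close>)
            then show ?thesis using that by blast
          qed
          have "((\<lambda>\<tau>. S p m (?Y + \<tau> *\<^sub>R f p) + of_real (\<tau> / 2) * C') \<longlongrightarrow> 0 + of_real (0 / 2) * C') (at_right 0)"
            by (intro tendsto_intros dd_pj_zero(2)[OF Y m]) auto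
          moreover have "\<forall>\<^sub>F \<tau> in at_right 0. S p m (?Y + \<tau> *\<^sub>R f p) + of_real (\<tau> / 2) * C' = \<Phi> \<sigma> \<tau>"
            using eventually_at_right_real[OF d] by eventually_elim (use C' in \<open>auto simp: \<Phi>_def e\<close>)
          ultimately show ?thesis by (auto intro: Lim_transform_eventually)
        qed
        show ?thesis unfolding \<Delta>_def[abs_def] using tendsto_diff[OF \<Phi>0[of s] \<Phi>0[of 0]] s by simp
      qed
      have "((\<lambda>\<epsilon>. norm (\<Delta> t - \<Delta> \<epsilon>)) \<longlongrightarrow> norm (\<Delta> t - 0)) (at_right 0)" by (intro tendsto_intros lim)
      moreover have "((\<lambda>\<epsilon>. B * s * (t - \<epsilon>)) \<longlongrightarrow> B * s * (t - 0)) (at_right 0)" by (intro tendsto_intros)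
      moreover have "\<forall>\<^sub>F \<epsilon> in at_right 0. norm (\<Delta> t - \<Delta> \<epsilon>) \<le> B * s * (t - \<epsilon>)"
        using eventually_at_right_real[OF t(1)] by eventually_elim (rule incr, auto)
      ultimately have "norm (\<Delta> t - 0) \<le> B * s * (t - 0)"
        by (intro tendsto_le[of "at_right 0"]) auto
      then show ?thesis by (simp add: \<Delta>_def mult_ac)
    qed
    have w: "y + t *\<^sub>R f p \<in> W" using inW[of t 0] t d by simp
    have "((\<lambda>s. \<Phi> s t) has_vector_derivative dd (f j) (S p m) (y + t *\<^sub>R f p + 0 *\<^sub>R f j) + of_real (t / 2) * dd (f j) D (y + t *\<^sub>R f p + 0 *\<^sub>R f j)) (at 0)"
      unfolding \<Phi>_def by (intro has_vector_derivative_add has_vector_derivative_mult_right has_vector_derivative_line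
          line_analytic_differentiable[OF laS] line_analytic_differentiable[OF laD]) (use w in auto)
    then have "norm (dd (f j) (S p m) (y + t *\<^sub>R f p) + of_real (t / 2) * C) \<le> B * t"
      using norm_derivative_le[of "\<lambda>s. \<Phi> s t" _ d "B * t"] d inc C[OF t] by simp
    then have "norm (dd (f j) (S p m) (y + t *\<^sub>R f p)) \<le> B * t + norm (of_real (t / 2) * C)"
      using norm_triangle_ineq4[of "dd (f j) (S p m) (y + t *\<^sub>R f p) + of_real (t / 2) * C" "of_real (t / 2) * C"] by simp
    then show ?thesis using t by (simp add: norm_mult algebra_simps)
  qed
  show ?thesis
  proof (rule Lim_null_comparison)
    have "((\<lambda>t. (B + norm C / 2) * t) \<longlongrightarrow> (B + norm C / 2) * 0) (at_right 0)"
      by (intro tendsto_intros)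
    then show "((\<lambda>t. (B + norm C / 2) * t) \<longlongrightarrow> 0) (at_right 0)" by simp
    show "\<forall>\<^sub>F t in at_right 0. norm (dd (f j) (S p m) (y + t *\<^sub>R f p)) \<le> (B + norm C / 2) * t"
      using eventually_at_right_real[OF d] by eventually_elim (use bound in auto)
  qed
qed

lemma dd_tangential_zero:
  assumes h: "line_analytic V h" "\<And>y. y \<in> V \<Longrightarrow> f p \<bullet> y = 0 \<Longrightarrow> h y = 0" and k: "k \<noteq> p"
    and y: "y \<in> V" "f p \<bullet> y = 0"
  shows "dd (f k) h y = 0"
proof -
  have 1: "((\<lambda>s. h (y + s *\<^sub>R f k)) has_vector_derivative dd (f k) h (y + 0 *\<^sub>R f k)) (at 0)"
    by (rule has_vector_derivative_line[OF line_analytic_differentiable[OF h(1)]]) (use y in simp)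
  have "((\<lambda>t. y + t *\<^sub>R f k) \<longlongrightarrow> y + 0 *\<^sub>R f k) (nhds 0)" by (intro tendsto_intros filterlim_ident)
  then have "\<forall>\<^sub>F t in nhds 0. y + t *\<^sub>R f k \<in> V" using opV y topological_tendstoD by fastforce
  then obtain e where e: "e > 0" "\<And>t. \<bar>t\<bar> < e \<Longrightarrow> y + t *\<^sub>R f k \<in> V"
    unfolding eventually_nhds_metric by (auto simp: dist_real_def)
  have "((\<lambda>s. h (y + s *\<^sub>R f k)) has_vector_derivative 0) (at 0)"
    by (rule has_vector_derivative_transform_within_open[of "\<lambda>_. 0" _ _ "{-e<..<e}"])
       (use e orth[OF k] y in \<open>auto simp: h(2) inner_add_right abs_less_iff\<close>)
  from vector_derivative_unique_at[OF 1 this] show ?thesis by simp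
qed

lemma dd_comm: "line_analytic V h \<Longrightarrow> x \<in> V \<Longrightarrow> dd u (dd v h) x = dd v (dd u h) x"
  by (rule dd_pderiv_commute[OF opV])

lemma dd_comm3:
  assumes "line_analytic V h" "x \<in> V"
  shows "dd u (dd u (dd v h)) x = dd v (dd u (dd u h)) x"
proof -
  have "dd u (dd u (dd v h)) x = dd u (dd v (dd u h)) x"
    by (rule dd_cong[OF opV assms(2)]) (rule dd_comm[OF assms(1)])
  also have "\<dots> = dd v (dd u (dd u h)) x" by (rule dd_comm[OF line_analytic_dd[OF opV assms(1)] assms(2)])
  finally show ?thesis .
qed

lemma dd_pde_tangential:
  assumes h: "line_analytic V h" and eq: "\<And>x. x \<in> V \<Longrightarrow> dd (f p) (dd (f p) h) x = dd (f k) (dd (f k) h) x" and x: "x \<in> V"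
  shows "dd (f p) (dd (f p) (dd v h)) x = dd (f k) (dd (f k) (dd v h)) x"
proof -
  have "dd (f p) (dd (f p) (dd v h)) x = dd v (dd (f p) (dd (f p) h)) x" by (rule dd_comm3[OF h x])
  also have "\<dots> = dd v (dd (f k) (dd (f k) h)) x" by (rule dd_cong[OF opV x eq])
  also have "\<dots> = dd (f k) (dd (f k) (dd v h)) x" by (rule dd_comm3[OF h x, symmetric])
  finally show ?thesis .
qed

text \<open>The equation trades two normal derivatives for two tangential ones, and tangential
  derivatives of a function that vanishes on the wall vanish there too.\<close>

lemma normal_even_derivatives_zero:
  assumes "line_analytic V h" "\<And>y. y \<in> V \<Longrightarrow> f p \<bullet> y = 0 \<Longrightarrow> h y = 0" and k: "k \<noteq> p"
    and "\<And>x. x \<in> V \<Longrightarrow> dd (f p) (dd (f p) h) x = dd (f k) (dd (f k) h) x"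
    and y: "y \<in> V" "f p \<bullet> y = 0"
  shows "((dd (f p)) ^^ (2 * n)) h y = 0"
  using assms(1,2,4)
proof (induction n arbitrary: h)
  case 0 then show ?case using y by simp
next
  case (Suc n)
  note la = line_analytic_dd[OF opV]
  have "((dd (f p)) ^^ (2 * Suc n)) h y = ((dd (f p)) ^^ (2 * n)) (dd (f p) (dd (f p) h)) y"
    by (simp add: funpow_swap1)
  also have "\<dots> = ((dd (f p)) ^^ (2 * n)) (dd (f k) (dd (f k) h)) y"
    by (rule dd_funpow_cong[OF opV Suc.prems(3) y(1)])
  also have "\<dots> = 0"
  proof (rule Suc.IH)
    show "line_analytic V (dd (f k) (dd (f k) h))" by (intro la Suc.prems)
    show "dd (f k) (dd (f k) h) y = 0" if "y \<in> V" "f p \<bullet> y = 0" for y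
      by (rule dd_tangential_zero[OF la[OF Suc.prems(1)] dd_tangential_zero[OF Suc.prems(1,2) k] k that])
    show "dd (f p) (dd (f p) (dd (f k) (dd (f k) h))) x = dd (f k) (dd (f k) (dd (f k) (dd (f k) h))) x" if "x \<in> V" for x
      by (rule dd_pde_tangential[OF la[OF Suc.prems(1)] dd_pde_tangential[OF Suc.prems(1,3)] that])
  qed
  finally show ?case .
qed

text \<open>The parity required by \<open>even_alternative\<close> comes from the wall: the
  derivative of \<open>Rh\<close> along p and j vanishes at all wall points, hence by the previous
  lemma so do all its even normal derivatives, which are the odd derivatives of \<open>Q j\<close>.
  For \<open>QQ\<close> the same is applied after one tangential derivative.\<close>

theorem local_alternative:
  assumes pde: "\<And>j. j \<noteq> p \<Longrightarrow> \<exists>k. k \<noteq> p \<and> (\<forall>x\<in>V. dd (f p) (dd (f p) (dd (f p) (dd (f j) Rh))) x = dd (f k) (dd (f k) (dd (f p) (dd (f j) Rh))) x)"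
  shows "(\<exists>d>0. \<forall>t. \<bar>t\<bar> < d \<longrightarrow> Rh (x0 - t *\<^sub>R f p) = Rh (x0 + t *\<^sub>R f p)) \<or>
    (\<exists>d>0. \<forall>j t. j \<noteq> p \<longrightarrow> \<bar>t\<bar> < d \<longrightarrow> dd (f p) (dd (f j) Rh) (x0 + t *\<^sub>R f p) = 0)"
proof -
  have y: "x0 \<in> V" "f p \<bullet> x0 = 0" using \<delta> x0 by (auto simp: V_def)
  note la = line_analytic_dd[OF opV]
  obtain d s sj sjm P Q QQ where ps: "pole_system (UNIV - {p}) d (of_real (\<omega> p)) c s (\<lambda>m. of_real (\<omega> m)) (\<lambda>m. of_real (\<mu> m)) sj sjm
      (\<lambda>j t. S p j (x0 + t *\<^sub>R f p)) (\<lambda>j m t. dd (f j) (S p m) (x0 + t *\<^sub>R f p))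
      (\<lambda>j m t. S j m (x0 + t *\<^sub>R f p) + (if j = m then 2 * of_real (\<mu> j * \<omega> p / \<omega> j) else 0) * R (x0 + t *\<^sub>R f p)) P Q QQ"
    and V: "\<And>t. \<bar>t\<bar> < d \<Longrightarrow> x0 + t *\<^sub>R f p \<in> V"
    and P: "\<And>t. \<bar>t\<bar> < d \<Longrightarrow> Rh (x0 + t *\<^sub>R f p) = P (of_real t)"
    and Q: "\<And>j t. \<bar>t\<bar> < d \<Longrightarrow> dd (f j) Rh (x0 + t *\<^sub>R f p) = Q j (of_real t)"
    and QQ: "\<And>j m t. \<bar>t\<bar> < d \<Longrightarrow> dd (f j) (dd (f m) Rh) (x0 + t *\<^sub>R f p) = QQ j m (of_real t)"
    using pole_system_at[OF y] by blast
  interpret ps: pole_system "UNIV - {p}" d "of_real (\<omega> p)" c s "\<lambda>m. of_real (\<omega> m)" "\<lambda>m. of_real (\<mu> m)" sj sjm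
      "\<lambda>j t. S p j (x0 + t *\<^sub>R f p)" "\<lambda>j m t. dd (f j) (S p m) (x0 + t *\<^sub>R f p)"
      "\<lambda>j m t. S j m (x0 + t *\<^sub>R f p) + (if j = m then 2 * of_real (\<mu> j * \<omega> p / \<omega> j) else 0) * R (x0 + t *\<^sub>R f p)" P Q QQ
    by (rule ps)
  have evQ: "Q j (- z) = Q j z" if j: "j \<in> UNIV - {p}" and z: "z \<in> ball 0 d" for j z
  proof (rule even_of_odd_derivs[OF ps.hQ[OF j] _ z])
    fix n :: nat assume "odd n"
    then obtain i where n: "n = Suc (2 * i)" by (auto elim: oddE)
    have jp: "j \<noteq> p" using j by simp
    obtain k where k: "k \<noteq> p" "\<And>x. x \<in> V \<Longrightarrow> dd (f p) (dd (f p) (dd (f p) (dd (f j) Rh))) x = dd (f k) (dd (f k) (dd (f p) (dd (f j) Rh))) x"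
      using pde[OF jp] by blast
    have "(deriv ^^ n) (Q j) (of_real 0) = ((dd (f p)) ^^ n) (dd (f j) Rh) (x0 + 0 *\<^sub>R f p)"
      by (rule higher_deriv_line[OF opV la[OF laRh] ps.hQ[OF j]]) (use V Q ps.d in auto)
    also have "\<dots> = ((dd (f p)) ^^ (2 * i)) (dd (f p) (dd (f j) Rh)) x0" by (simp add: n funpow_swap1)
    also have "\<dots> = 0"
      by (rule normal_even_derivatives_zero[OF la[OF la[OF laRh]] dd_pj_zero(1)[OF _ _ jp] k y])
    finally show "(deriv ^^ n) (Q j) 0 = 0" by simp
  qed
  have evQQ: "QQ j m (- z) = QQ j m z" if j: "j \<in> UNIV - {p}" and m: "m \<in> UNIV - {p}" and z: "z \<in> ball 0 d" for j m z
  proof (rule even_of_odd_derivs[OF ps.hQQ[OF j m] _ z])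
    fix n :: nat assume "odd n"
    then obtain i where n: "n = Suc (2 * i)" by (auto elim: oddE)
    have jp: "j \<noteq> p" "m \<noteq> p" using j m by auto
    obtain k where k: "k \<noteq> p" "\<And>x. x \<in> V \<Longrightarrow> dd (f p) (dd (f p) (dd (f p) (dd (f m) Rh))) x = dd (f k) (dd (f k) (dd (f p) (dd (f m) Rh))) x"
      using pde[OF jp(2)] by blast
    have "(deriv ^^ n) (QQ j m) (of_real 0) = ((dd (f p)) ^^ n) (dd (f j) (dd (f m) Rh)) (x0 + 0 *\<^sub>R f p)"
      by (rule higher_deriv_line[OF opV la[OF la[OF laRh]] ps.hQQ[OF j m]]) (use V QQ ps.d in auto)
    also have "\<dots> = ((dd (f p)) ^^ (2 * i)) (dd (f p) (dd (f j) (dd (f m) Rh))) x0" by (simp add: n funpow_swap1)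
    also have "\<dots> = ((dd (f p)) ^^ (2 * i)) (dd (f j) (dd (f p) (dd (f m) Rh))) x0"
      by (rule dd_funpow_cong[OF opV dd_comm[OF la[OF laRh]] y(1)])
    also have "\<dots> = 0"
      by (rule normal_even_derivatives_zero[OF la[OF la[OF la[OF laRh]]] dd_tangential_zero[OF la[OF la[OF laRh]] dd_pj_zero(1)[OF _ _ jp(2)] jp(1)] k(1)
            dd_pde_tangential[OF la[OF la[OF laRh]] k(2)] y])
    finally show "(deriv ^^ n) (QQ j m) 0 = 0" by simp
  qed
  have e0: "((\<lambda>t. dd (f j) (S p m) (x0 + t *\<^sub>R f p)) \<longlongrightarrow> 0) (at_right 0)" if "j \<in> UNIV - {p}" "m \<in> UNIV - {p}" for j m
    using dd_S_pm_limit[OF y] that by auto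
  from ps.even_alternative[OF evQ evQQ e0]
  show ?thesis
  proof
    assume ev: "\<forall>z\<in>ball 0 d. P (- z) = P z"
    have "Rh (x0 - t *\<^sub>R f p) = Rh (x0 + t *\<^sub>R f p)" if t: "\<bar>t\<bar> < d" for t
    proof -
      have "Rh (x0 + (- t) *\<^sub>R f p) = P (- of_real t)" using P[of "- t"] t by simp
      also have "\<dots> = Rh (x0 + t *\<^sub>R f p)" using P[OF t] ev t by simp
      finally show ?thesis by simp
    qed
    then show ?thesis using ps.d by blast
  next
    assume z: "\<forall>j\<in>UNIV - {p}. \<forall>z\<in>ball 0 d. deriv (Q j) z = 0"
    have "dd (f p) (dd (f j) Rh) (x0 + t *\<^sub>R f p) = 0" if "j \<noteq> p" "\<bar>t\<bar> < d" for j t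
    proof -
      have j: "j \<in> UNIV - {p}" using that by simp
      have "(deriv ^^ 1) (Q j) (of_real t) = ((dd (f p)) ^^ 1) (dd (f j) Rh) (x0 + t *\<^sub>R f p)"
        by (rule higher_deriv_line[OF opV la[OF laRh] ps.hQ[OF j] _ that(2)]) (use V Q in auto)
      then show ?thesis using z j that(2) by simp
    qed
    then show ?thesis using ps.d by blast
  qed
qed

end

subsection \<open>The roots of type B\<close>

lemma stdvec_nth: "stdvec i $ k = (if k = i then 1 else 0)"
  by (simp add: axis_def)

lemma inner_stdvec [simp]: "stdvec i \<bullet> x = x $ i" "x \<bullet> stdvec i = x $ i"
  by (simp_all add: inner_axis inner_commute[of "axis i 1"])

lemma vec_nth_cong: "v = w \<Longrightarrow> v $ a = w $ a"
  by simp

lemma root_distinct: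
  fixes i j k l m :: "'n::{finite,linorder}"
  shows "k < l \<Longrightarrow> stdvec i + stdvec j \<noteq> stdvec k - stdvec l"
    and "i < j \<Longrightarrow> stdvec i + stdvec j \<noteq> stdvec m"
    and "i < j \<Longrightarrow> stdvec i - stdvec j \<noteq> stdvec m"
proof -
  show "stdvec i + stdvec j \<noteq> stdvec k - stdvec l" if "k < l"
  proof
    assume eq: "stdvec i + stdvec j = stdvec k - stdvec l"
    show False using vec_nth_cong[OF eq, of l] that by (auto simp: stdvec_nth split: if_splits)
  qed
  show "stdvec i + stdvec j \<noteq> stdvec m" if "i < j"
  proof
    assume eq: "stdvec i + stdvec j = stdvec m"
    show False using vec_nth_cong[OF eq, of i] vec_nth_cong[OF eq, of j] that
      by (auto simp: stdvec_nth split: if_splits)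
  qed
  show "stdvec i - stdvec j \<noteq> stdvec m" if "i < j"
  proof
    assume eq: "stdvec i - stdvec j = stdvec m"
    show False using vec_nth_cong[OF eq, of j] that by (auto simp: stdvec_nth split: if_splits)
  qed
qed

lemmas root_distinct' = root_distinct[THEN not_sym]

lemma root_eq_iffs:
  fixes i j k l :: "'n::{finite,linorder}"
  assumes "i < j" "k < l"
  shows "stdvec i + stdvec j = stdvec k + stdvec l \<longleftrightarrow> i = k \<and> j = l"
    and "stdvec i - stdvec j = stdvec k - stdvec l \<longleftrightarrow> i = k \<and> j = l"
proof -
  have "i = k \<and> j = l" if eq: "stdvec i + stdvec j = stdvec k + stdvec l"
    using vec_nth_cong[OF eq, of i] vec_nth_cong[OF eq, of j] vec_nth_cong[OF eq, of k] assms
    by (auto simp: stdvec_nth split: if_splits)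
  then show "stdvec i + stdvec j = stdvec k + stdvec l \<longleftrightarrow> i = k \<and> j = l" by auto
  have "i = k \<and> j = l" if eq: "stdvec i - stdvec j = stdvec k - stdvec l"
    using vec_nth_cong[OF eq, of i] vec_nth_cong[OF eq, of j] assms
    by (auto simp: stdvec_nth split: if_splits)
  then show "stdvec i - stdvec j = stdvec k - stdvec l \<longleftrightarrow> i = k \<and> j = l" by auto
qed

lemma stdvec_eq_iff [simp]: "stdvec i = (stdvec k :: real^'n::finite) \<longleftrightarrow> i = k"
  by (simp add: axis_eq_axis)

lemma finite_roots_B: "finite (roots_B :: (real, 'n::{finite,linorder}) vec set)"
proof -
  have "{stdvec i + stdvec j |i j. i < j} \<subseteq> range (\<lambda>(i, j). stdvec i + (stdvec j :: (real, 'n) vec))"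
    "{stdvec i - stdvec j |i j. i < j} \<subseteq> range (\<lambda>(i, j). stdvec i - (stdvec j :: (real, 'n) vec))" by auto
  from this[THEN finite_subset] show ?thesis unfolding roots_B_def roots_D_def by simp
qed

lemma roots_B_cases:
  assumes "\<beta> \<in> roots_B"
  obtains (plus) i j where "i < j" "\<beta> = stdvec i + stdvec j" | (minus) i j where "i < j" "\<beta> = stdvec i - stdvec j"
    | (single) i where "\<beta> = stdvec i"
  using assms unfolding roots_B_def roots_D_def by auto

text \<open>This normalisation shows that distinct elements of \<open>roots_B\<close> are never
  proportional and that no element occurs with its negative.\<close>

lemma roots_B_leading:
  assumes "\<beta> \<in> roots_B"
  shows "\<exists>k. \<beta> $ k = 1 \<and> (\<forall>l<k. \<beta> $ l = 0)"
  using assms by (cases rule: roots_B_cases) (auto simp: stdvec_nth intro!: exI)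

lemma roots_B_nonparallel:
  assumes "\<beta> \<in> roots_B" "\<gamma> \<in> roots_B" "\<beta> = s *\<^sub>R \<gamma>"
  shows "\<beta> = \<gamma>"
proof -
  obtain k where k: "\<beta> $ k = 1" "\<And>l. l < k \<Longrightarrow> \<beta> $ l = 0" using roots_B_leading[OF assms(1)] by blast
  obtain l where l: "\<gamma> $ l = 1" "\<And>m. m < l \<Longrightarrow> \<gamma> $ m = 0" using roots_B_leading[OF assms(2)] by blast
  have c: "\<beta> $ m = s * \<gamma> $ m" for m using assms(3) by simp
  have "s \<noteq> 0" using c[of k] k by auto
  then have "k = l"
    using k l c by (metis linorder_cases mult_eq_0_iff mult_cancel_left2 zero_neq_one mult.right_neutral)
  then have "s = 1" using c[of k] k l by simp
  then show ?thesis using assms(3) by simp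
qed

lemma roots_B_nonzero: "\<beta> \<in> roots_B \<Longrightarrow> \<beta> \<noteq> 0"
  using roots_B_leading[of \<beta>] by auto

lemma roots_B_not_both_signs: "\<beta> \<in> roots_B \<Longrightarrow> - \<beta> \<notin> roots_B"
proof
  assume "\<beta> \<in> roots_B" "- \<beta> \<in> roots_B"
  then have eq: "- \<beta> = \<beta>" by (intro roots_B_nonparallel[of "- \<beta>" \<beta> "- 1"]) simp_all
  obtain k where "\<beta> $ k = 1" using roots_B_leading[OF \<open>\<beta> \<in> roots_B\<close>] by blast
  then show False using vec_nth_cong[OF eq, of k] by simp
qed

text \<open>Makes a function of the coefficient relation, so that the singular part of the potential
  becomes one sum over \<open>roots_B\<close>; outside H the coefficient is zero.\<close>

definition root_coeff ::
    "('n::{finite,linorder} \<Rightarrow> 'n \<Rightarrow> complex) \<Rightarrow> ('n \<Rightarrow> 'n \<Rightarrow> complex) \<Rightarrow> ('n \<Rightarrow> complex) \<Rightarrow> (real, 'n) vec \<Rightarrow> complex"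
  where "root_coeff Cp Cm C \<beta> = (THE c. (\<beta>, c) \<in> vector_coeffs Cp Cm C)"

lemma root_coeff_simps:
  "i < j \<Longrightarrow> root_coeff Cp Cm C (stdvec i + stdvec j) = Cp i j"
  "i < j \<Longrightarrow> root_coeff Cp Cm C (stdvec i - stdvec j) = Cm i j"
  "root_coeff Cp Cm C (stdvec i) = C i"
  unfolding root_coeff_def
  by (rule the_equality; auto simp: vector_coeffs_def root_distinct root_distinct' root_eq_iffs)+

lemma singular_vectors_eq: "singular_vectors Cp Cm C = {\<beta> \<in> roots_B. root_coeff Cp Cm C \<beta> \<noteq> 0}"
proof -
  have "(\<beta>, c) \<in> vector_coeffs Cp Cm C \<longleftrightarrow> \<beta> \<in> roots_B \<and> c = root_coeff Cp Cm C \<beta>" for \<beta> c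
  proof
    assume "(\<beta>, c) \<in> vector_coeffs Cp Cm C"
    then show "\<beta> \<in> roots_B \<and> c = root_coeff Cp Cm C \<beta>"
      unfolding vector_coeffs_def by (auto simp: root_coeff_simps roots_B_def roots_D_def)
  next
    assume "\<beta> \<in> roots_B \<and> c = root_coeff Cp Cm C \<beta>"
    then have b: "\<beta> \<in> roots_B" and c: "c = root_coeff Cp Cm C \<beta>" by auto
    from b show "(\<beta>, c) \<in> vector_coeffs Cp Cm C"
      by (cases rule: roots_B_cases) (auto simp: c root_coeff_simps vector_coeffs_def)
  qed
  then show ?thesis unfolding singular_vectors_def by auto
qed

lemma sum_strict_pairs:
  "(\<Sum>i\<in>UNIV. \<Sum>j\<in>{i<..}. F i j) = (\<Sum>(i,j)\<in>{(i,j). i < (j::'n::{finite,linorder})}. F i j)"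
  by (subst sum.Sigma) (auto intro!: sum.cong simp: Sigma_def)

lemma sum_roots_B:
  fixes F :: "(real, 'n::{finite,linorder}) vec \<Rightarrow> 'a::comm_monoid_add"
  shows "(\<Sum>\<beta>\<in>roots_B. F \<beta>) = (\<Sum>i\<in>UNIV. \<Sum>j\<in>{i<..}. F (stdvec i + stdvec j) + F (stdvec i - stdvec j)) + (\<Sum>i\<in>UNIV. F (stdvec i))"
proof -
  define A where "A = {(i,j). i < (j::'n)}"
  let ?p = "\<lambda>(i,j). stdvec i + (stdvec j :: (real, 'n) vec)" and ?m = "\<lambda>(i,j). stdvec i - (stdvec j :: (real, 'n) vec)"
  have B: "(roots_B :: (real, 'n) vec set) = (?p ` A \<union> ?m ` A) \<union> range stdvec"
    by (auto simp: roots_B_def roots_D_def A_def)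
  have d1: "(?p ` A \<union> ?m ` A) \<inter> range stdvec = {}"
    by (auto simp: A_def root_distinct root_distinct')
  have d2: "?p ` A \<inter> ?m ` A = {}" by (auto simp: A_def root_distinct root_distinct')
  have ip: "inj_on ?p A"
  proof (rule inj_onI, clarify)
    fix i j k l assume "(i, j) \<in> A" "(k, l) \<in> A" "stdvec i + (stdvec j :: (real, 'n) vec) = stdvec k + stdvec l"
    then show "i = k \<and> j = l" using root_eq_iffs(1)[of i j k l] by (simp only: A_def mem_Collect_eq case_prod_conv)
  qed
  have im: "inj_on ?m A"
  proof (rule inj_onI, clarify)
    fix i j k l assume "(i, j) \<in> A" "(k, l) \<in> A" "stdvec i - (stdvec j :: (real, 'n) vec) = stdvec k - stdvec l"
    then show "i = k \<and> j = l" using root_eq_iffs(2)[of i j k l] by (simp only: A_def mem_Collect_eq case_prod_conv)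
  qed
  have is_inj: "inj (stdvec :: 'n \<Rightarrow> (real, 'n) vec)" by (rule injI) simp
  have fA: "finite (?p ` A)" "finite (?m ` A)" "finite (range (stdvec :: 'n \<Rightarrow> (real, 'n) vec))" by simp_all
  have "(\<Sum>\<beta>\<in>roots_B. F \<beta>) = (\<Sum>\<beta>\<in>?p ` A \<union> ?m ` A. F \<beta>) + (\<Sum>\<beta>\<in>range stdvec. F \<beta>)"
    unfolding B by (rule sum.union_disjoint[OF _ fA(3) d1]) (use fA in simp)
  also have "(\<Sum>\<beta>\<in>?p ` A \<union> ?m ` A. F \<beta>) = (\<Sum>\<beta>\<in>?p ` A. F \<beta>) + (\<Sum>\<beta>\<in>?m ` A. F \<beta>)"
    by (rule sum.union_disjoint[OF fA(1,2) d2])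
  also have "(\<Sum>\<beta>\<in>?p ` A. F \<beta>) = (\<Sum>(i,j)\<in>A. F (stdvec i + stdvec j))"
    unfolding sum.reindex[OF ip] by (simp add: case_prod_unfold)
  also have "(\<Sum>\<beta>\<in>?m ` A. F \<beta>) = (\<Sum>(i,j)\<in>A. F (stdvec i - stdvec j))"
    unfolding sum.reindex[OF im] by (simp add: case_prod_unfold)
  also have "(\<Sum>\<beta>\<in>range stdvec. F \<beta>) = (\<Sum>i\<in>UNIV. F (stdvec i))"
    unfolding sum.reindex[OF is_inj] by simp
  finally show ?thesis unfolding sum_strict_pairs A_def by (simp add: sum.distrib case_prod_unfold)
qed

lemma potential_eq_sum_roots:
  "potential Cp Cm C Rt x = (\<Sum>\<beta>\<in>roots_B. root_coeff Cp Cm C \<beta> / of_real ((\<beta> \<bullet> x)\<^sup>2)) + Rt x"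
proof -
  have 1: "(\<Sum>i\<in>UNIV. \<Sum>j\<in>{i<..}. Cp i j / of_real ((x $ i + x $ j)\<^sup>2) + Cm i j / of_real ((x $ i - x $ j)\<^sup>2))
    = (\<Sum>i\<in>UNIV. \<Sum>j\<in>{i<..}. root_coeff Cp Cm C (stdvec i + stdvec j) / of_real (((stdvec i + stdvec j) \<bullet> x)\<^sup>2)
        + root_coeff Cp Cm C (stdvec i - stdvec j) / of_real (((stdvec i - stdvec j) \<bullet> x)\<^sup>2))"
    by (intro sum.cong refl) (simp only: root_coeff_simps greaterThan_iff inner_add_left inner_diff_left inner_stdvec)
  have 2: "(\<Sum>i\<in>UNIV. C i / of_real ((x $ i)\<^sup>2)) = (\<Sum>i\<in>UNIV. root_coeff Cp Cm C (stdvec i) / of_real ((stdvec i \<bullet> x)\<^sup>2))"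
    by (simp only: root_coeff_simps inner_stdvec)
  show ?thesis unfolding potential_def sum_roots_B 1 2 ..
qed

subsection \<open>Reflections permute the roots\<close>

text \<open>\<open>roots_B\<close> holds one root of each opposite pair, whereas reflections permute
  the roots only up to sign.\<close>

definition signed_roots :: "(real, 'n::{finite,linorder}) vec set"
  where "signed_roots = roots_B \<union> uminus ` roots_B"

lemma neg_signed_roots: "v \<in> signed_roots \<Longrightarrow> - v \<in> signed_roots"
  by (force simp: signed_roots_def image_iff)

lemma signed_roots_single: "a \<in> {1, -1} \<Longrightarrow> a *\<^sub>R stdvec i \<in> signed_roots"
  by (auto simp: signed_roots_def roots_B_def)

lemma signed_roots_pair:
  assumes "i \<noteq> j" "a \<in> {1, -1}" "b \<in> {1, -1}"
  shows "a *\<^sub>R stdvec i + b *\<^sub>R stdvec j \<in> signed_roots"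
proof -
  have "a *\<^sub>R stdvec i + b *\<^sub>R stdvec j \<in> signed_roots" if "i < j" "a \<in> {1, -1}" "b \<in> {1, -1}" for i j :: 'a and a b
  proof -
    have "stdvec i + stdvec j \<in> roots_B" "stdvec i - stdvec j \<in> roots_B"
      using that by (auto simp: roots_B_def roots_D_def)
    moreover from this have "- stdvec i - stdvec j \<in> uminus ` roots_B" "- stdvec i + stdvec j \<in> uminus ` roots_B"
      by (auto intro: image_eqI[of _ _ "stdvec i + stdvec j"] image_eqI[of _ _ "stdvec i - stdvec j"])
    ultimately show ?thesis using that(2,3) unfolding signed_roots_def by auto
  qed
  from this[of i j a b] this[of j i b a] assms show ?thesis by (cases i j rule: linorder_cases) (auto simp: add.commute)
qed

lemma reflection_linear: "linear (reflection \<alpha>)"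
  unfolding reflection_def by (intro linearI) (simp_all add: inner_add_right algebra_simps add_divide_distrib)

lemma reflection_reflection: "\<alpha> \<noteq> 0 \<Longrightarrow> reflection \<alpha> (reflection \<alpha> x) = x"
  unfolding reflection_def by (simp add: inner_diff_right algebra_simps)

lemma inner_reflection: "x \<bullet> reflection \<alpha> y = reflection \<alpha> x \<bullet> y"
  unfolding reflection_def by (simp add: inner_diff_right inner_diff_left inner_commute algebra_simps)

lemma norm_reflection: "\<alpha> \<noteq> 0 \<Longrightarrow> norm (reflection \<alpha> x) = norm x"
  by (simp add: norm_eq_sqrt_inner inner_reflection reflection_reflection)

lemma reflection_stdvec:
  assumes "\<alpha> \<in> roots_B"
  shows "\<exists>\<pi> s. inj \<pi> \<and> (\<forall>k. s k \<in> {1, -1}) \<and> (\<forall>k. reflection \<alpha> (stdvec k) = s k *\<^sub>R stdvec (\<pi> k))"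
  using assms
proof (cases rule: roots_B_cases)
  case (plus i j)
  define \<pi> where "\<pi> k = (if k = i then j else if k = j then i else k)" for k
  define s :: "'a \<Rightarrow> real" where "s k = (if k = i \<or> k = j then -1 else 1)" for k
  have "\<alpha> \<bullet> \<alpha> = 2" using plus by (simp add: inner_add_left inner_add_right stdvec_nth)
  then have "reflection \<alpha> (stdvec k) = s k *\<^sub>R stdvec (\<pi> k)" for k
    using plus by (auto simp: reflection_def s_def \<pi>_def stdvec_nth)
  moreover have "inj \<pi>" by (auto simp: inj_def \<pi>_def split: if_splits)
  moreover have "\<forall>k. s k \<in> {1, -1}" by (simp add: s_def)
  ultimately show ?thesis by blast
next
  case (minus i j)
  define \<pi> where "\<pi> k = (if k = i then j else if k = j then i else k)" for k
  have "\<alpha> \<bullet> \<alpha> = 2" using minus by (simp add: inner_diff_left inner_diff_right stdvec_nth)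
  then have "reflection \<alpha> (stdvec k) = 1 *\<^sub>R stdvec (\<pi> k)" for k
    using minus by (auto simp: reflection_def \<pi>_def stdvec_nth)
  moreover have "inj \<pi>" by (auto simp: inj_def \<pi>_def split: if_splits)
  ultimately show ?thesis by (intro exI[of _ \<pi>] exI[of _ "\<lambda>_. 1"]) auto
next
  case (single i)
  define s :: "'a \<Rightarrow> real" where "s k = (if k = i then -1 else 1)" for k
  have "\<alpha> \<bullet> \<alpha> = 1" using single by (simp add: stdvec_nth)
  then have "reflection \<alpha> (stdvec k) = s k *\<^sub>R stdvec k" for k
    using single by (auto simp: reflection_def s_def stdvec_nth scaleR_2)
  then show ?thesis by (intro exI[of _ "\<lambda>k. k"] exI[of _ s]) (auto simp: s_def)
qed

lemma reflection_signed_roots: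
  assumes "\<alpha> \<in> roots_B" "\<beta> \<in> signed_roots"
  shows "reflection \<alpha> \<beta> \<in> signed_roots"
proof -
  interpret linear "reflection \<alpha>" by (rule reflection_linear)
  obtain \<pi> s where \<pi>: "inj \<pi>" "\<And>k. s k \<in> {1, -1}" "\<And>k. reflection \<alpha> (stdvec k) = s k *\<^sub>R stdvec (\<pi> k)"
    using reflection_stdvec[OF assms(1)] by blast
  have "reflection \<alpha> \<beta> \<in> signed_roots" if "\<beta> \<in> roots_B" for \<beta>
    using that
  proof (cases rule: roots_B_cases)
    case (plus i j)
    then have "reflection \<alpha> \<beta> = s i *\<^sub>R stdvec (\<pi> i) + s j *\<^sub>R stdvec (\<pi> j)" by (simp add: add \<pi>(3))
    then show ?thesis using signed_roots_pair[OF _ \<pi>(2) \<pi>(2)] plus \<pi>(1) by (metis injD less_irrefl)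
  next
    case (minus i j)
    then have "reflection \<alpha> \<beta> = s i *\<^sub>R stdvec (\<pi> i) + (- s j) *\<^sub>R stdvec (\<pi> j)" by (simp add: diff \<pi>(3))
    moreover have "- s j \<in> {1, -1}" using \<pi>(2)[of j] by auto
    ultimately show ?thesis using signed_roots_pair[OF _ \<pi>(2)] minus \<pi>(1) by (metis injD less_irrefl)
  next
    case (single i)
    then show ?thesis using signed_roots_single[OF \<pi>(2)] \<pi>(3) by metis
  qed
  moreover have "reflection \<alpha> (- \<gamma>) \<in> signed_roots" if "\<gamma> \<in> roots_B" for \<gamma>
    unfolding neg using neg_signed_roots calculation[OF that] by blast
  ultimately show ?thesis using assms(2) unfolding signed_roots_def by blast
qed

subsection \<open>Generic points\<close>

lemma exists_generic_point:
  fixes N :: "'a::real_inner set"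
  assumes "finite N" "0 \<notin> N" "open B" "B \<noteq> {}"
  shows "\<exists>x\<in>B. \<forall>v\<in>N. v \<bullet> x \<noteq> 0"
  using assms
proof (induction N arbitrary: B rule: finite_induct)
  case (insert v N)
  obtain x where x: "x \<in> B" using insert.prems by blast
  have "\<exists>y\<in>B. v \<bullet> y \<noteq> 0"
  proof (cases "v \<bullet> x = 0")
    case True
    have "((\<lambda>t. x + t *\<^sub>R v) \<longlongrightarrow> x + 0 *\<^sub>R v) (nhds 0)" by (intro tendsto_intros filterlim_ident)
    then have "\<forall>\<^sub>F t in nhds 0. x + t *\<^sub>R v \<in> B" using insert.prems x topological_tendstoD by fastforce
    then obtain e where e: "e > 0" "\<And>t. \<bar>t\<bar> < e \<Longrightarrow> x + t *\<^sub>R v \<in> B"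
      unfolding eventually_nhds_metric by (auto simp: dist_real_def)
    have "x + (e / 2) *\<^sub>R v \<in> B" using e by simp
    moreover have "v \<bullet> (x + (e / 2) *\<^sub>R v) \<noteq> 0" using True e insert.prems by (auto simp: inner_add_right)
    ultimately show ?thesis by blast
  qed (use x in blast)
  then have "B \<inter> {y. v \<bullet> y \<noteq> 0} \<noteq> {}" by blast
  moreover have "open {y. v \<bullet> y \<noteq> 0}" by (intro open_Collect_neq continuous_intros)
  ultimately have "\<exists>x\<in>B \<inter> {y. v \<bullet> y \<noteq> 0}. \<forall>v\<in>N. v \<bullet> x \<noteq> 0"
    using insert.prems by (intro insert.IH) auto
  then show ?case by auto
qed auto

lemma continuous_zero_of_generic_zero:
  fixes F :: "'a::real_inner \<Rightarrow> complex"
  assumes "finite N" "0 \<notin> N" "open B" "continuous_on B F" "\<And>x. x \<in> B \<Longrightarrow> \<forall>v\<in>N. v \<bullet> x \<noteq> 0 \<Longrightarrow> F x = 0" "x \<in> B"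
  shows "F x = 0"
proof (rule ccontr)
  assume "F x \<noteq> 0"
  have "open (B \<inter> F -` (- {0}))"
    using assms(3,4) continuous_on_open_vimage by (metis Int_commute open_Compl closed_singleton)
  moreover have "x \<in> B \<inter> F -` (- {0})" using assms(6) \<open>F x \<noteq> 0\<close> by auto
  ultimately obtain y where "y \<in> B \<inter> F -` (- {0})" "\<forall>v\<in>N. v \<bullet> y \<noteq> 0"
    using exists_generic_point[OF assms(1,2)] by blast
  then show False using assms(5) by auto
qed

text \<open>Take a generic point for the orthogonal projections of the other roots and project it to
  the hyperplane. Those projections are nonzero because distinct roots are not parallel, and
  projecting does not increase the norm.\<close>

lemma exists_generic_point_on_hyperplane:
  assumes r: "r > 0" and \<beta>: "\<beta> \<in> roots_B"
  shows "\<exists>z\<in>ball 0 r. \<beta> \<bullet> z = 0 \<and> (\<forall>\<gamma>\<in>roots_B - {\<beta>}. \<gamma> \<bullet> z \<noteq> 0)"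
proof -
  have bb: "\<beta> \<bullet> \<beta> > 0" using roots_B_nonzero[OF \<beta>] by simp
  define q where "q v = v - ((v \<bullet> \<beta>) / (\<beta> \<bullet> \<beta>)) *\<^sub>R \<beta>" for v
  have q0: "q \<gamma> \<noteq> 0" if "\<gamma> \<in> roots_B - {\<beta>}" for \<gamma>
    using roots_B_nonparallel[of \<gamma> \<beta> "(\<gamma> \<bullet> \<beta>) / (\<beta> \<bullet> \<beta>)"] that \<beta> by (auto simp: q_def)
  have "0 \<notin> q ` (roots_B - {\<beta>})" using q0 by (metis imageE)
  then have "\<exists>x\<in>ball 0 r. \<forall>v\<in>q ` (roots_B - {\<beta>}). v \<bullet> x \<noteq> 0"
    by (intro exists_generic_point) (use finite_roots_B r in auto)
  then obtain x where x: "x \<in> ball 0 r" "\<And>\<gamma>. \<gamma> \<in> roots_B - {\<beta>} \<Longrightarrow> q \<gamma> \<bullet> x \<noteq> 0" by auto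
  have qq: "v \<bullet> q x = q v \<bullet> x" for v by (simp add: q_def inner_diff_left inner_diff_right inner_commute)
  have bq: "\<beta> \<bullet> q x = 0" using bb by (simp add: q_def inner_diff_right inner_commute)
  have "norm (q x) \<le> norm x"
  proof -
    have "q x \<bullet> q x = q x \<bullet> x" using bq by (simp add: q_def[of x] inner_diff_right inner_commute)
    then have "norm (q x) * norm (q x) \<le> norm (q x) * norm x"
      by (metis norm_cauchy_schwarz power2_norm_eq_inner power2_eq_square)
    then show ?thesis by (cases "norm (q x) = 0") auto
  qed
  then have "q x \<in> ball 0 r" using x(1) by simp
  then show ?thesis using bq x(2) qq by metis
qed

text \<open>Near a point that lies on the wall of \<beta> and on no other, all terms but one stay
  bounded along the normal line.\<close>

lemma pole_coefficients_zero:
  fixes c :: "(real, 'n::{finite,linorder}) vec \<Rightarrow> complex"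
  assumes r: "r > 0" and h: "continuous_on (ball 0 r) h"
    and eq: "\<And>x. x \<in> ball 0 r \<Longrightarrow> \<forall>\<beta>\<in>roots_B. \<beta> \<bullet> x \<noteq> 0 \<Longrightarrow> (\<Sum>\<beta>\<in>roots_B. c \<beta> / of_real ((\<beta> \<bullet> x)\<^sup>2)) + h x = 0"
    and \<beta>: "\<beta> \<in> roots_B"
  shows "c \<beta> = 0"
proof -
  obtain z where z: "z \<in> ball 0 r" "\<beta> \<bullet> z = 0" "\<And>\<gamma>. \<gamma> \<in> roots_B - {\<beta>} \<Longrightarrow> \<gamma> \<bullet> z \<noteq> 0"
    using exists_generic_point_on_hyperplane[OF r \<beta>] by blast
  have bb: "\<beta> \<bullet> \<beta> > 0" using roots_B_nonzero[OF \<beta>] by simp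
  \<comment> \<open>The left side of the hypothesis at z + t \<beta>, times t^2.\<close>
  define F where "F t = c \<beta> / of_real ((\<beta> \<bullet> \<beta>)\<^sup>2) + of_real (t\<^sup>2) * ((\<Sum>\<gamma>\<in>roots_B - {\<beta>}. c \<gamma> / of_real ((\<gamma> \<bullet> (z + t *\<^sub>R \<beta>))\<^sup>2)) + h (z + t *\<^sub>R \<beta>))" for t
  have L: "((\<lambda>t. z + t *\<^sub>R \<beta>) \<longlongrightarrow> z + 0 *\<^sub>R \<beta>) (at_right 0)" by (intro tendsto_intros)
  have L1: "((\<lambda>t. h (z + t *\<^sub>R \<beta>)) \<longlongrightarrow> h z) (at_right 0)"
  proof -
    have "isCont h z" using h z(1) by (meson continuous_on_eq_continuous_at open_ball)
    then show ?thesis using isCont_tendsto_compose[OF _ L, of h] by simp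
  qed
  have L2: "((\<lambda>t. \<Sum>\<gamma>\<in>roots_B - {\<beta>}. c \<gamma> / of_real ((\<gamma> \<bullet> (z + t *\<^sub>R \<beta>))\<^sup>2)) \<longlongrightarrow> (\<Sum>\<gamma>\<in>roots_B - {\<beta>}. c \<gamma> / of_real ((\<gamma> \<bullet> (z + 0 *\<^sub>R \<beta>))\<^sup>2))) (at_right 0)"
    by (intro tendsto_intros L) (use z(3) in auto)
  have "(F \<longlongrightarrow> c \<beta> / of_real ((\<beta> \<bullet> \<beta>)\<^sup>2) + of_real (0\<^sup>2) * ((\<Sum>\<gamma>\<in>roots_B - {\<beta>}. c \<gamma> / of_real ((\<gamma> \<bullet> (z + 0 *\<^sub>R \<beta>))\<^sup>2)) + h z)) (at_right 0)"
    unfolding F_def[abs_def] by (rule tendsto_add[OF tendsto_const tendsto_mult[OF _ tendsto_add[OF L2 L1]]]) (intro tendsto_intros)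
  then have 1: "(F \<longlongrightarrow> c \<beta> / of_real ((\<beta> \<bullet> \<beta>)\<^sup>2)) (at_right 0)" by simp
  have "\<forall>\<^sub>F t in at_right 0. z + t *\<^sub>R \<beta> \<in> ball 0 r"
    using topological_tendstoD[OF L open_ball, of 0 r] z(1) by simp
  moreover have "\<forall>\<^sub>F t in at_right 0. \<forall>\<gamma>\<in>roots_B - {\<beta>}. \<gamma> \<bullet> (z + t *\<^sub>R \<beta>) \<noteq> 0"
  proof (rule eventually_ball_finite)
    show "\<forall>\<gamma>\<in>roots_B - {\<beta>}. \<forall>\<^sub>F t in at_right 0. \<gamma> \<bullet> (z + t *\<^sub>R \<beta>) \<noteq> 0"
    proof
      fix \<gamma> assume "\<gamma> \<in> roots_B - {\<beta>}"
      then have "\<gamma> \<bullet> (z + 0 *\<^sub>R \<beta>) \<noteq> 0" using z(3) by simp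
      then show "\<forall>\<^sub>F t in at_right 0. \<gamma> \<bullet> (z + t *\<^sub>R \<beta>) \<noteq> 0"
        by (rule tendsto_imp_eventually_ne[OF tendsto_inner[OF tendsto_const L, of \<gamma>]])
    qed
  qed (simp add: finite_roots_B)
  moreover have "\<forall>\<^sub>F t in at_right 0. t > (0::real)" by (rule eventually_at_right_less)
  ultimately have "\<forall>\<^sub>F t in at_right 0. F t = 0"
  proof eventually_elim
    case (elim t)
    have bt: "\<beta> \<bullet> (z + t *\<^sub>R \<beta>) = t * (\<beta> \<bullet> \<beta>)" using z(2) by (simp add: inner_add_right)
    have "(\<Sum>\<gamma>\<in>roots_B. c \<gamma> / of_real ((\<gamma> \<bullet> (z + t *\<^sub>R \<beta>))\<^sup>2)) + h (z + t *\<^sub>R \<beta>) = 0"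
      by (rule eq) (use elim bt bb in auto)
    then have "c \<beta> / of_real ((t * (\<beta> \<bullet> \<beta>))\<^sup>2) + ((\<Sum>\<gamma>\<in>roots_B - {\<beta>}. c \<gamma> / of_real ((\<gamma> \<bullet> (z + t *\<^sub>R \<beta>))\<^sup>2)) + h (z + t *\<^sub>R \<beta>)) = 0"
      by (subst (asm) sum.remove[OF finite_roots_B \<beta>]) (simp add: bt add.assoc)
    then have "of_real (t\<^sup>2) * (c \<beta> / of_real ((t * (\<beta> \<bullet> \<beta>))\<^sup>2)) + of_real (t\<^sup>2) * ((\<Sum>\<gamma>\<in>roots_B - {\<beta>}. c \<gamma> / of_real ((\<gamma> \<bullet> (z + t *\<^sub>R \<beta>))\<^sup>2)) + h (z + t *\<^sub>R \<beta>)) = 0"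
      unfolding distrib_left[symmetric] by simp
    moreover have "complex_of_real (t\<^sup>2) * (c \<beta> / of_real ((t * (\<beta> \<bullet> \<beta>))\<^sup>2)) = c \<beta> / of_real ((\<beta> \<bullet> \<beta>)\<^sup>2)"
      using elim(3) by (simp add: power_mult_distrib)
    ultimately show "F t = 0" by (simp add: F_def)
  qed
  then have "(F \<longlongrightarrow> 0) (at_right 0)" by (rule tendsto_eventually)
  then have "c \<beta> / of_real ((\<beta> \<bullet> \<beta>)\<^sup>2) = 0" using tendsto_unique[OF _ 1] by auto
  then show ?thesis using bb by simp
qed

subsection \<open>Orthogonal frames adapted to a wall\<close>

text \<open>The frame is orthogonal but not normalised, so that \<open>f p\<close> can be the root
  itself. The last conditions diagonalise the cubic form of \<open>eq3\<close> with
  \<open>f p\<close> inserted: multiplication by the squared entries of \<open>f p\<close> has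
  \<open>f j\<close> as an eigenvector with eigenvalue (1 - \<mu> j)/3.\<close>

locale wall_frame =
  fixes f :: "'n::{finite,linorder} \<Rightarrow> (real, 'n) vec" and p :: 'n and \<omega> \<mu> :: "'n \<Rightarrow> real"
  assumes \<omega>: "\<omega> j > 0" and orthogonal_frame: "j \<noteq> k \<Longrightarrow> f j \<bullet> f k = 0" and norm_frame: "\<omega> j * (f j \<bullet> f j) = 1"
    and complete_frame: "(\<Sum>m\<in>UNIV. \<omega> m * (f m $ i * f m $ k)) = (if i = k then 1 else 0)"
    and \<mu>: "j \<noteq> p \<Longrightarrow> \<mu> j \<noteq> 0"
    and cube_frame: "f p $ i * f p $ i * f p $ i = f p $ i"
    and square_frame: "j \<noteq> p \<Longrightarrow> 3 * (f p $ i * f p $ i * f j $ i) = (1 - \<mu> j) * f j $ i"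
    and mixed_frame: "j \<noteq> p \<Longrightarrow> k \<noteq> p \<Longrightarrow>
      3 * (f p $ i * f j $ i * f k $ i) = (if j = k then \<omega> p * (1 - \<mu> j) / \<omega> j * f p $ i else 0)"
begin

lemma frame_expansion: "(\<Sum>m\<in>UNIV. (\<omega> m * (f m \<bullet> v)) *\<^sub>R f m) = v"
proof (rule vec_eq_iff[THEN iffD2], rule allI)
  fix i
  have "(\<Sum>m\<in>UNIV. (\<omega> m * (f m \<bullet> v)) *\<^sub>R f m) $ i = (\<Sum>m\<in>UNIV. \<Sum>k\<in>UNIV. \<omega> m * (f m $ i * f m $ k) * v $ k)"
    by (simp add: inner_vec_def sum_distrib_left sum_distrib_right mult_ac)
  also have "\<dots> = (\<Sum>k\<in>UNIV. (\<Sum>m\<in>UNIV. \<omega> m * (f m $ i * f m $ k)) * v $ k)"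
    by (subst sum.swap) (simp add: sum_distrib_right)
  also have "\<dots> = v $ i" by (simp add: complete_frame if_distrib[of "\<lambda>a. a * _"] cong: if_cong)
  finally show "(\<Sum>m\<in>UNIV. (\<omega> m * (f m \<bullet> v)) *\<^sub>R f m) $ i = v $ i" .
qed

lemma dd_frame_expansion:
  "(\<Sum>m\<in>UNIV. of_real (\<omega> m) * (of_real (f m \<bullet> v) * dd (f m) F x)) = dd v F x"
proof -
  have "dd v F x = dd (\<Sum>m\<in>UNIV. (\<omega> m * (f m \<bullet> v)) *\<^sub>R f m) F x" by (simp only: frame_expansion)
  also have "\<dots> = (\<Sum>m\<in>UNIV. of_real (\<omega> m) * (of_real (f m \<bullet> v) * dd (f m) F x))"
    unfolding dd_sum_left dd_scaleR_left by (simp add: mult.assoc)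
  finally show ?thesis ..
qed

lemma orthogonal_combination:
  assumes "f p \<bullet> v = 0"
  shows "dd v F x = (\<Sum>m\<in>UNIV - {p}. of_real (\<omega> m * (f m \<bullet> v)) * dd (f m) F x)"
  using dd_frame_expansion[of v F x, symmetric] assms
  by (simp add: sum.remove[of UNIV p] mult.assoc)

end

section \<open>The equations of the commuting pair in an orthogonal frame\<close>

context commuting_system
begin

lemma la_symform: "line_analytic \<Omega> (symform s a c)"
  unfolding symform_def[abs_def] by (intro line_analytic_sum[OF op] line_analytic_cmult[OF op] las)

lemma dd_symform:
  assumes "x \<in> \<Omega>"
  shows "dd v (symform s a c) x = (\<Sum>i\<in>UNIV. \<Sum>j\<in>UNIV. \<Sum>k\<in>UNIV. of_real (v $ i) * of_real (a $ j) * of_real (c $ k) * pderiv_at i (s j k) x)"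
proof -
  note d = line_analytic_differentiable[OF _ assms]
  have "dd v (symform s a c) x = (\<Sum>j\<in>UNIV. \<Sum>k\<in>UNIV. of_real (a $ j) * of_real (c $ k) * dd v (s j k) x)"
    unfolding symform_def[abs_def]
    by (simp add: dd_sum dd_cmult d[OF las] d line_analytic_sum[OF op] line_analytic_cmult[OF op] las)
  also have "\<dots> = (\<Sum>j\<in>UNIV. \<Sum>k\<in>UNIV. \<Sum>i\<in>UNIV. of_real (v $ i) * of_real (a $ j) * of_real (c $ k) * pderiv_at i (s j k) x)"
    unfolding dd_def sum_distrib_left by (intro sum.cong refl) (simp add: mult_ac)
  also have "\<dots> = (\<Sum>j\<in>UNIV. \<Sum>i\<in>UNIV. \<Sum>k\<in>UNIV. of_real (v $ i) * of_real (a $ j) * of_real (c $ k) * pderiv_at i (s j k) x)"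
    by (rule sum.cong[OF refl sum.swap])
  also have "\<dots> = (\<Sum>i\<in>UNIV. \<Sum>j\<in>UNIV. \<Sum>k\<in>UNIV. of_real (v $ i) * of_real (a $ j) * of_real (c $ k) * pderiv_at i (s j k) x)"
    by (rule sum.swap)
  finally show ?thesis .
qed

lemma symform_cyclic:
  assumes "x \<in> \<Omega>"
  shows "dd u (symform s v w) x + dd v (symform s u w) x + dd w (symform s u v) x
    = 6 * (\<Sum>i\<in>UNIV. of_real (u $ i * v $ i * w $ i) * pderiv_at i R x)"
proof -
  define T where "T i j k = complex_of_real (u $ i) * of_real (v $ j) * of_real (w $ k)" for i j k
  have 1: "dd u (symform s v w) x = (\<Sum>i\<in>UNIV. \<Sum>j\<in>UNIV. \<Sum>k\<in>UNIV. T i j k * pderiv_at i (s j k) x)"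
    unfolding dd_symform[OF assms] T_def ..
  have "dd v (symform s u w) x = (\<Sum>j\<in>UNIV. \<Sum>i\<in>UNIV. \<Sum>k\<in>UNIV. T i j k * pderiv_at j (s i k) x)"
    unfolding dd_symform[OF assms] T_def by (simp add: mult_ac)
  also have "\<dots> = (\<Sum>i\<in>UNIV. \<Sum>j\<in>UNIV. \<Sum>k\<in>UNIV. T i j k * pderiv_at j (s i k) x)" by (rule sum.swap)
  finally have 2: "dd v (symform s u w) x = (\<Sum>i\<in>UNIV. \<Sum>j\<in>UNIV. \<Sum>k\<in>UNIV. T i j k * pderiv_at j (s i k) x)" .
  have "dd w (symform s u v) x = (\<Sum>k\<in>UNIV. \<Sum>i\<in>UNIV. \<Sum>j\<in>UNIV. T i j k * pderiv_at k (s i j) x)"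
    unfolding dd_symform[OF assms] T_def by (simp add: mult_ac)
  also have "\<dots> = (\<Sum>i\<in>UNIV. \<Sum>k\<in>UNIV. \<Sum>j\<in>UNIV. T i j k * pderiv_at k (s i j) x)" by (rule sum.swap)
  also have "\<dots> = (\<Sum>i\<in>UNIV. \<Sum>j\<in>UNIV. \<Sum>k\<in>UNIV. T i j k * pderiv_at k (s i j) x)"
    by (rule sum.cong[OF refl sum.swap])
  finally have 3: "dd w (symform s u v) x = (\<Sum>i\<in>UNIV. \<Sum>j\<in>UNIV. \<Sum>k\<in>UNIV. T i j k * pderiv_at k (s i j) x)" .
  have "dd u (symform s v w) x + dd v (symform s u w) x + dd w (symform s u v) x
    = (\<Sum>i\<in>UNIV. \<Sum>j\<in>UNIV. \<Sum>k\<in>UNIV. T i j k * (pderiv_at i (s j k) x + pderiv_at j (s i k) x + pderiv_at k (s i j) x))"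
    unfolding 1 2 3 by (simp add: sum.distrib distrib_left)
  also have "\<dots> = (\<Sum>i\<in>UNIV. \<Sum>j\<in>UNIV. \<Sum>k\<in>UNIV. if j = k then (if i = j then 6 * T i i i * pderiv_at i R x else 0) else 0)"
    unfolding eq3[OF assms] by (intro sum.cong refl) auto
  also have "\<dots> = (\<Sum>i\<in>UNIV. 6 * T i i i * pderiv_at i R x)" by simp
  finally show ?thesis by (simp add: T_def sum_distrib_left mult_ac)
qed

lemma dd_weighted_sum:
  assumes "\<And>i. of_real (w i) = (of_real c * of_real (v $ i) :: complex)"
  shows "(\<Sum>i\<in>UNIV. of_real (w i) * pderiv_at i F x) = of_real c * dd v F x"
  unfolding assms dd_def sum_distrib_left by (simp add: mult.assoc)

text \<open>The closed 1-form of \<open>closed_form\<close>, evaluated on a constant vector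
  field.\<close>

definition flux :: "(real, 'n) vec \<Rightarrow> (real, 'n) vec \<Rightarrow> complex"
  where "flux v x = (\<Sum>j\<in>UNIV. of_real (v $ j) * (\<Sum>k\<in>UNIV. s j k x * pderiv_at k R x))"

lemma d_flux_term:
  assumes "x \<in> \<Omega>"
  shows "(\<lambda>x. s j k x * pderiv_at k R x) differentiable (at x)"
  using line_analytic_differentiable[OF las assms] line_analytic_differentiable[OF line_analytic_pderiv[OF laR] assms]
  by (intro derivative_intros)

lemma d_flux: "x \<in> \<Omega> \<Longrightarrow> flux v differentiable (at x)"
  unfolding flux_def[abs_def]
  by (intro differentiable_sum ballI differentiable_mult differentiable_const d_flux_term) auto

lemma flux_closed:
  assumes "x \<in> \<Omega>"
  shows "dd v (flux w) x = dd w (flux v) x"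
proof -
  note d = d_flux_term[OF assms]
  have *: "dd v (flux w) x = (\<Sum>i\<in>UNIV. \<Sum>j\<in>UNIV. of_real (v $ i) * of_real (w $ j) * (\<Sum>k\<in>UNIV. pderiv_at i (\<lambda>x. s j k x * pderiv_at k R x) x))" for v w
  proof -
    have "dd v (flux w) x = (\<Sum>j\<in>UNIV. of_real (w $ j) * (\<Sum>k\<in>UNIV. dd v (\<lambda>x. s j k x * pderiv_at k R x) x))"
      unfolding flux_def[abs_def] using d
      by (simp add: dd_sum dd_cmult differentiable_sum differentiable_mult)
    also have "\<dots> = (\<Sum>j\<in>UNIV. \<Sum>k\<in>UNIV. \<Sum>i\<in>UNIV. of_real (v $ i) * of_real (w $ j) * pderiv_at i (\<lambda>x. s j k x * pderiv_at k R x) x)"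
      unfolding dd_def sum_distrib_left by (simp add: mult_ac)
    also have "\<dots> = (\<Sum>j\<in>UNIV. \<Sum>i\<in>UNIV. \<Sum>k\<in>UNIV. of_real (v $ i) * of_real (w $ j) * pderiv_at i (\<lambda>x. s j k x * pderiv_at k R x) x)"
      by (rule sum.cong[OF refl sum.swap])
    also have "\<dots> = (\<Sum>i\<in>UNIV. \<Sum>j\<in>UNIV. \<Sum>k\<in>UNIV. of_real (v $ i) * of_real (w $ j) * pderiv_at i (\<lambda>x. s j k x * pderiv_at k R x) x)"
      by (rule sum.swap)
    finally show ?thesis by (simp add: sum_distrib_left)
  qed
  have "dd v (flux w) x = (\<Sum>j\<in>UNIV. \<Sum>i\<in>UNIV. of_real (v $ i) * of_real (w $ j) * (\<Sum>k\<in>UNIV. pderiv_at i (\<lambda>x. s j k x * pderiv_at k R x) x))"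
    unfolding * by (rule sum.swap)
  also have "\<dots> = dd w (flux v) x"
    unfolding *[of w v] by (intro sum.cong refl) (rule arg_cong2[where f = "(*)", OF mult.commute closed_form[OF assms]])
  finally show ?thesis .
qed

end

locale framed_system = commuting_system \<Omega> R s b a0 + wall_frame f p \<omega> \<mu>
  for \<Omega> :: "((real, 'n::{finite,linorder}) vec) set" and R s b a0 and f :: "'n \<Rightarrow> (real, 'n) vec" and p \<omega> \<mu>
begin

text \<open>The multiple of R is chosen to make \<open>S p p\<close> constant along the normal
  direction, and it leaves a term in R in the other frame equations only through \<mu>.\<close>

definition S :: "'n \<Rightarrow> 'n \<Rightarrow> (real, 'n) vec \<Rightarrow> complex"
  where "S j k x = symform s (f j) (f k) x - of_real (2 * \<omega> p * (f j \<bullet> f k)) * R x"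

lemma S_sym: "S j k = S k j"
proof
  fix x
  have "symform s (f j) (f k) x = (\<Sum>b\<in>UNIV. \<Sum>a\<in>UNIV. of_real (f j $ a) * of_real (f k $ b) * s a b x)"
    unfolding symform_def by (rule sum.swap)
  also have "\<dots> = symform s (f k) (f j) x"
    unfolding symform_def by (intro sum.cong refl) (simp only: s_sym mult.commute)
  finally show "S j k x = S k j x" by (simp add: S_def inner_commute)
qed

lemma la_S: "line_analytic \<Omega> (S j k)"
  unfolding S_def[abs_def] by (intro line_analytic_diff[OF op] line_analytic_cmult[OF op] la_symform laR)

lemma dd_S: "x \<in> \<Omega> \<Longrightarrow> dd v (S j k) x = dd v (symform s (f j) (f k)) x - of_real (2 * \<omega> p * (f j \<bullet> f k)) * dd v R x"
  unfolding S_def[abs_def] using line_analytic_differentiable[OF la_symform] line_analytic_differentiable[OF laR]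
    line_analytic_differentiable[OF line_analytic_cmult[OF op laR]]
  by (simp add: dd_diff dd_cmult)

lemma eq_third_of_triple: "3 * X = Y * Z \<Longrightarrow> X = Y / 3 * (Z :: real)"
  by simp

lemma six_times_third: "6 * (of_real ((1 - m) / 3) * X) = 2 * X - 2 * of_real m * (X :: complex)"
  by (simp add: field_simps)

lemma norm_frame_p: "2 * \<omega> p * (f p \<bullet> f p) = 2"
  using norm_frame[of p] by simp

lemma E1:
  assumes "x \<in> \<Omega>" shows "dd (f p) (S p p) x = 0"
proof -
  have "3 * dd (f p) (symform s (f p) (f p)) x = 6 * (\<Sum>i\<in>UNIV. of_real (f p $ i * f p $ i * f p $ i) * pderiv_at i R x)"
    using symform_cyclic[OF assms, of "f p" "f p" "f p"] by simp
  also have "(\<Sum>i\<in>UNIV. of_real (f p $ i * f p $ i * f p $ i) * pderiv_at i R x) = of_real 1 * dd (f p) R x"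
    by (rule dd_weighted_sum) (simp only: cube_frame, simp)
  finally show ?thesis by (simp add: dd_S[OF assms] norm_frame_p)
qed

lemma E2:
  assumes "x \<in> \<Omega>" "j \<noteq> p"
  shows "2 * dd (f p) (S p j) x + dd (f j) (S p p) x = - 2 * of_real (\<mu> j) * dd (f j) R x"
proof -
  have "2 * dd (f p) (symform s (f p) (f j)) x + dd (f j) (symform s (f p) (f p)) x
    = 6 * (\<Sum>i\<in>UNIV. of_real (f p $ i * f p $ i * f j $ i) * pderiv_at i R x)"
    using symform_cyclic[OF assms(1), of "f p" "f p" "f j"] by simp
  also have "(\<Sum>i\<in>UNIV. of_real (f p $ i * f p $ i * f j $ i) * pderiv_at i R x) = of_real ((1 - \<mu> j) / 3) * dd (f j) R x"
  proof (rule dd_weighted_sum)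
    fix i
    have "f p $ i * f p $ i * f j $ i = (1 - \<mu> j) / 3 * f j $ i" by (rule eq_third_of_triple) (rule square_frame[OF assms(2)])
    then show "of_real (f p $ i * f p $ i * f j $ i) = (of_real ((1 - \<mu> j) / 3) * of_real (f j $ i) :: complex)"
      by (simp only: of_real_mult)
  qed
  finally have "2 * dd (f p) (symform s (f p) (f j)) x + dd (f j) (symform s (f p) (f p)) x
    = 2 * dd (f j) R x - 2 * of_real (\<mu> j) * dd (f j) R x" by (simp only: six_times_third)
  moreover have "of_real (2 * \<omega> p * (f p \<bullet> f p)) = (2 :: complex)" by (simp only: norm_frame_p of_real_numeral)
  moreover have "f p \<bullet> f j = 0" using assms(2) by (intro orthogonal_frame) simp
  ultimately show ?thesis by (simp add: dd_S[OF assms(1)] algebra_simps del: of_real_mult)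
qed

lemma E3:
  assumes "x \<in> \<Omega>" "j \<noteq> p" "k \<noteq> p"
  shows "dd (f p) (S j k) x + dd (f j) (S p k) x + dd (f k) (S p j) x
        = (if j = k then - 2 * of_real (\<mu> j * \<omega> p / \<omega> j) * dd (f p) R x else 0)"
proof -
  define c where "c = (if j = k then \<omega> p * (1 - \<mu> j) / \<omega> j else 0)"
  have "dd (f p) (symform s (f j) (f k)) x + dd (f j) (symform s (f p) (f k)) x + dd (f k) (symform s (f p) (f j)) x
    = 6 * (\<Sum>i\<in>UNIV. of_real (f p $ i * f j $ i * f k $ i) * pderiv_at i R x)"
    by (rule symform_cyclic[OF assms(1)])
  also have "(\<Sum>i\<in>UNIV. of_real (f p $ i * f j $ i * f k $ i) * pderiv_at i R x) = of_real (c / 3) * dd (f p) R x"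
  proof (rule dd_weighted_sum)
    fix i
    have "3 * (f p $ i * f j $ i * f k $ i) = c * f p $ i"
      unfolding mixed_frame[OF assms(2,3)] by (simp add: c_def)
    then have "f p $ i * f j $ i * f k $ i = c / 3 * f p $ i" by (rule eq_third_of_triple)
    then show "of_real (f p $ i * f j $ i * f k $ i) = (of_real (c / 3) * of_real (f p $ i) :: complex)"
      by (simp only: of_real_mult)
  qed
  finally have 1: "dd (f p) (symform s (f j) (f k)) x + dd (f j) (symform s (f p) (f k)) x + dd (f k) (symform s (f p) (f j)) x
    = of_real (2 * c) * dd (f p) R x" by simp
  have 2: "2 * c - 2 * \<omega> p * (f j \<bullet> f k) = (if j = k then - 2 * (\<mu> j * \<omega> p / \<omega> j) else 0)"
  proof (cases "j = k")
    case True
    have "f j \<bullet> f j = 1 / \<omega> j" using norm_frame[of j] \<omega>[of j] by (simp add: field_simps)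
    then show ?thesis using True \<omega>[of j] by (simp add: c_def field_simps)
  qed (simp add: c_def orthogonal_frame)
  have "dd (f p) (S j k) x + dd (f j) (S p k) x + dd (f k) (S p j) x = of_real (2 * c) * dd (f p) R x - of_real (2 * \<omega> p * (f j \<bullet> f k)) * dd (f p) R x"
    unfolding 1[symmetric] using assms(2,3) by (simp add: dd_S[OF assms(1)] orthogonal_frame)
  also have "\<dots> = of_real (2 * c - 2 * \<omega> p * (f j \<bullet> f k)) * dd (f p) R x" by (simp add: algebra_simps)
  finally show ?thesis unfolding 2 by simp
qed

lemma flux_frame:
  "(\<Sum>m\<in>UNIV. of_real (\<omega> m) * (S j m x * dd (f m) R x)) = flux (f j) x - of_real (2 * \<omega> p) * (R x * dd (f j) R x)"
proof -
  have "(\<Sum>m\<in>UNIV. of_real (\<omega> m) * (symform s (f j) (f m) x * dd (f m) R x))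
    = (\<Sum>a\<in>UNIV. \<Sum>b\<in>UNIV. of_real (f j $ a) * (s a b x * (\<Sum>m\<in>UNIV. of_real (\<omega> m) * (of_real (f m \<bullet> stdvec b) * dd (f m) R x))))"
  proof -
    have "(\<Sum>m\<in>UNIV. of_real (\<omega> m) * (symform s (f j) (f m) x * dd (f m) R x))
      = (\<Sum>m\<in>UNIV. \<Sum>a\<in>UNIV. \<Sum>b\<in>UNIV. of_real (f j $ a) * (s a b x * (of_real (\<omega> m) * (of_real (f m \<bullet> stdvec b) * dd (f m) R x))))"
      unfolding symform_def sum_distrib_left sum_distrib_right by (intro sum.cong refl) (simp add: mult_ac)
    also have "\<dots> = (\<Sum>a\<in>UNIV. \<Sum>m\<in>UNIV. \<Sum>b\<in>UNIV. of_real (f j $ a) * (s a b x * (of_real (\<omega> m) * (of_real (f m \<bullet> stdvec b) * dd (f m) R x))))"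
      by (rule sum.swap)
    also have "\<dots> = (\<Sum>a\<in>UNIV. \<Sum>b\<in>UNIV. \<Sum>m\<in>UNIV. of_real (f j $ a) * (s a b x * (of_real (\<omega> m) * (of_real (f m \<bullet> stdvec b) * dd (f m) R x))))"
      by (rule sum.cong[OF refl sum.swap])
    finally show ?thesis by (simp only: sum_distrib_left)
  qed
  also have "\<dots> = flux (f j) x"
    unfolding dd_frame_expansion dd_stdvec flux_def by (simp only: sum_distrib_left)
  finally have 1: "(\<Sum>m\<in>UNIV. of_real (\<omega> m) * (symform s (f j) (f m) x * dd (f m) R x)) = flux (f j) x" .
  have "(\<Sum>m\<in>UNIV. of_real (\<omega> m) * (of_real (2 * \<omega> p * (f j \<bullet> f m)) * R x * dd (f m) R x))
    = of_real (2 * \<omega> p) * (R x * (\<Sum>m\<in>UNIV. of_real (\<omega> m) * (of_real (f m \<bullet> f j) * dd (f m) R x)))"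
    unfolding sum_distrib_left by (intro sum.cong refl) (simp add: mult_ac inner_commute)
  also have "\<dots> = of_real (2 * \<omega> p) * (R x * dd (f j) R x)" by (simp only: dd_frame_expansion)
  finally show ?thesis unfolding S_def left_diff_distrib right_diff_distrib sum_subtractf 1 by simp
qed

text \<open>By \<open>flux_frame\<close> the correction in \<open>S\<close> changes the closed
  1-form by the differential of \<omega> p times R^2, so closedness survives.\<close>

lemma E4:
  assumes x: "x \<in> \<Omega>"
  shows "(\<Sum>m\<in>UNIV. of_real (\<omega> m) * dd (f p) (\<lambda>x. S j m x * dd (f m) R x) x)
    = (\<Sum>m\<in>UNIV. of_real (\<omega> m) * dd (f j) (\<lambda>x. S p m x * dd (f m) R x) x)"
proof -
  note d = line_analytic_differentiable[OF _ x]
  have dR: "dd v R differentiable (at x)" "R differentiable (at x)" for v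
    by (intro d line_analytic_dd[OF op] laR)+
  have *: "(\<Sum>m\<in>UNIV. of_real (\<omega> m) * dd v (\<lambda>x. S j m x * dd (f m) R x) x)
    = dd v (flux (f j)) x - of_real (2 * \<omega> p) * (dd v R x * dd (f j) R x + R x * dd v (dd (f j) R) x)" for v j
  proof -
    have dS: "(\<lambda>x. S j m x * dd (f m) R x) differentiable (at x)" for m
      by (intro derivative_intros dR d[OF la_S])
    have "(\<Sum>m\<in>UNIV. of_real (\<omega> m) * dd v (\<lambda>x. S j m x * dd (f m) R x) x)
      = dd v (\<lambda>x. \<Sum>m\<in>UNIV. of_real (\<omega> m) * (S j m x * dd (f m) R x)) x"
      using dS by (subst dd_sum) (auto intro!: derivative_intros simp: dd_cmult)
    also have "\<dots> = dd v (\<lambda>x. flux (f j) x - of_real (2 * \<omega> p) * (R x * dd (f j) R x)) x" unfolding flux_frame ..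
    also have "\<dots> = dd v (flux (f j)) x - of_real (2 * \<omega> p) * (dd v R x * dd (f j) R x + R x * dd v (dd (f j) R) x)"
      by (subst dd_diff) (auto intro!: derivative_intros d_flux x dR simp: dd_cmult dd_mult dR)
    finally show ?thesis .
  qed
  show ?thesis unfolding * flux_closed[OF x, of "f p" "f j"] dd_pderiv_commute[OF op laR x, of "f p" "f j"]
    by (simp add: mult_ac)
qed

end

section \<open>Frames for the individual roots\<close>

lemma wall_frame_stdvec: "wall_frame stdvec p (\<lambda>_. 1) (\<lambda>_. 1)"
  by unfold_locales (auto simp: stdvec_nth if_distrib[of "\<lambda>a. a * _"] cong: if_cong)

definition pair_frame :: "'n::{finite,linorder} \<Rightarrow> 'n \<Rightarrow> real \<Rightarrow> 'n \<Rightarrow> (real, 'n) vec"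
  where "pair_frame p q \<epsilon> j = (if j = p then stdvec p + \<epsilon> *\<^sub>R stdvec q else if j = q then stdvec p + (- \<epsilon>) *\<^sub>R stdvec q else stdvec j)"

lemma pair_frame_simps [simp]:
  "pair_frame p q \<epsilon> p = stdvec p + \<epsilon> *\<^sub>R stdvec q"
  "q \<noteq> p \<Longrightarrow> pair_frame p q \<epsilon> q = stdvec p + (- \<epsilon>) *\<^sub>R stdvec q"
  "j \<noteq> p \<Longrightarrow> j \<noteq> q \<Longrightarrow> pair_frame p q \<epsilon> j = stdvec j"
  by (auto simp: pair_frame_def)

text \<open>On the support of the mirror vector with index q the squared entries of
  \<open>f p\<close> are 1, so the eigenvalue is 1 and \<mu> q = -2. The other tangential vectors
  have disjoint support, eigenvalue 0 and \<mu> = 1. The weight 1/2 is the inverse square length of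
  the two pair vectors.\<close>

lemma wall_frame_pair:
  assumes "p \<noteq> q" "\<epsilon> \<in> {1, -1}"
  shows "wall_frame (pair_frame p q \<epsilon>) p (\<lambda>m. if m = p \<or> m = q then 1 / 2 else 1) (\<lambda>m. if m = q then -2 else 1)"
proof
  let ?\<omega> = "\<lambda>m. if m = p \<or> m = q then 1 / 2 else (1::real)"
  have e2: "\<epsilon> * \<epsilon> = 1" using assms(2) by auto
  show "?\<omega> j > 0" for j by simp
  show "pair_frame p q \<epsilon> j \<bullet> pair_frame p q \<epsilon> k = 0" if "j \<noteq> k" for j k
    using that assms by (auto simp: pair_frame_def stdvec_nth inner_add_left inner_add_right)
  show "?\<omega> j * (pair_frame p q \<epsilon> j \<bullet> pair_frame p q \<epsilon> j) = 1" for j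
    using assms by (auto simp: pair_frame_def stdvec_nth inner_add_left inner_add_right inner_diff_left inner_diff_right)
  show "(\<Sum>m\<in>UNIV. ?\<omega> m * (pair_frame p q \<epsilon> m $ i * pair_frame p q \<epsilon> m $ k)) = (if i = k then 1 else 0)" for i k
  proof -
    have "(\<Sum>m\<in>UNIV. ?\<omega> m * (pair_frame p q \<epsilon> m $ i * pair_frame p q \<epsilon> m $ k))
      = 1 / 2 * (pair_frame p q \<epsilon> p $ i * pair_frame p q \<epsilon> p $ k) + (1 / 2 * (pair_frame p q \<epsilon> q $ i * pair_frame p q \<epsilon> q $ k)
        + (\<Sum>m\<in>UNIV - {p} - {q}. ?\<omega> m * (pair_frame p q \<epsilon> m $ i * pair_frame p q \<epsilon> m $ k)))"
      using assms(1) by (subst sum.remove[of UNIV p], simp, simp, subst sum.remove[of "UNIV - {p}" q]) auto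
    also have "(\<Sum>m\<in>UNIV - {p} - {q}. ?\<omega> m * (pair_frame p q \<epsilon> m $ i * pair_frame p q \<epsilon> m $ k))
      = (\<Sum>m\<in>UNIV - {p} - {q}. if m = i then (if m = k then 1 else 0) else 0)"
      by (intro sum.cong refl) (auto simp: pair_frame_def stdvec_nth)
    also have "\<dots> = (if i \<noteq> p \<and> i \<noteq> q \<and> i = k then 1 else 0)" by (auto simp: sum.delta)
    finally show ?thesis using assms(1) e2 by (auto simp: stdvec_nth)
  qed
  show "(if j = q then - 2 else (1::real)) \<noteq> 0" for j by simp
  show "pair_frame p q \<epsilon> p $ i * pair_frame p q \<epsilon> p $ i * pair_frame p q \<epsilon> p $ i = pair_frame p q \<epsilon> p $ i" for i
    using assms by (auto simp: stdvec_nth)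
  show "3 * (pair_frame p q \<epsilon> p $ i * pair_frame p q \<epsilon> p $ i * pair_frame p q \<epsilon> j $ i)
      = (1 - (if j = q then - 2 else 1)) * pair_frame p q \<epsilon> j $ i" if "j \<noteq> p" for i j
    using that assms by (cases "j = q") (auto simp: stdvec_nth)
  show "3 * (pair_frame p q \<epsilon> p $ i * pair_frame p q \<epsilon> j $ i * pair_frame p q \<epsilon> k $ i)
      = (if j = k then ?\<omega> p * (1 - (if j = q then - 2 else 1)) / ?\<omega> j * pair_frame p q \<epsilon> p $ i else 0)" if "j \<noteq> p" "k \<noteq> p" for i j k
    using that assms by (cases "j = q"; cases "k = q") (auto simp: stdvec_nth)
qed

context commuting_system
begin

lemma dd_pair:
  assumes "line_analytic \<Omega> g" "x \<in> \<Omega>"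
  shows "dd (stdvec p + a *\<^sub>R stdvec q) (dd (stdvec p + c *\<^sub>R stdvec q) g) x
    = jet g {#p,p#} x + of_real (a + c) * jet g {#p,q#} x + of_real (a * c) * jet g {#q,q#} x"
proof -
  have d: "pderiv_at i g differentiable (at x)" for i
    by (rule line_analytic_differentiable[OF line_analytic_pderiv[OF assms(1)] assms(2)])
  have "dd (stdvec p + c *\<^sub>R stdvec q) g = (\<lambda>x. pderiv_at p g x + of_real c * pderiv_at q g x)"
    by (simp add: fun_eq_iff dd_add_left dd_scaleR_left)
  then have *: "dd v (dd (stdvec p + c *\<^sub>R stdvec q) g) x = dd v (pderiv_at p g) x + of_real c * dd v (pderiv_at q g) x" for v
    using d by (simp add: dd_add dd_cmult differentiable_mult)
  show ?thesis unfolding * dd_add_left dd_scaleR_left dd_stdvec jet_eq_pderiv2[OF op assms]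
    by (simp add: algebra_simps add_mset_commute)
qed

lemma wave_stdvec:
  assumes "x \<in> \<Omega>" "j \<noteq> p"
  shows "dd (stdvec p) (dd (stdvec p) (dd (stdvec p) (dd (stdvec j) R))) x = dd (stdvec j) (dd (stdvec j) (dd (stdvec p) (dd (stdvec j) R))) x"
proof -
  have "dd (stdvec i) = pderiv_at i" for i :: 'n by (simp add: fun_eq_iff)
  then show ?thesis using jet_wave[OF assms]
    by (simp add: jet_eq_pderiv4[OF op laR assms(1)] add_mset_commute)
qed

lemma jet_comb:
  assumes "line_analytic \<Omega> g" "line_analytic \<Omega> h" "line_analytic \<Omega> k" "\<And>x. x \<in> \<Omega> \<Longrightarrow> g x = h x + c * k x" "x \<in> \<Omega>"
  shows "jet g M x = jet h M x + c * jet k M x"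
proof -
  have "jet g M x = jet (\<lambda>x. h x + c * k x) M x" using assms(4) by (rule jet_cong[OF op assms(1) _ assms(5)])
  then show ?thesis
    by (simp only: jet_add[OF op assms(2) line_analytic_cmult[OF op assms(3)] assms(5)] jet_cmult[OF op assms(3,5)])
qed

text \<open>The second derivatives along \<open>f p\<close> and \<open>f q\<close> differ by 4
  \<epsilon> times the mixed derivative along the coordinates p and q. On the derivative of R along
  \<open>f p\<close> and \<open>f j\<close> this mixed derivative vanishes: by
  \<open>jet_wave\<close> if j = q, and by \<open>jet_mixed3\<close> otherwise.\<close>

lemma wave_pair:
  assumes x: "x \<in> \<Omega>" and pq: "p \<noteq> q" and \<epsilon>: "\<epsilon> \<in> {1, -1}" and j: "j \<noteq> p"
  shows "dd (pair_frame p q \<epsilon> p) (dd (pair_frame p q \<epsilon> p) (dd (pair_frame p q \<epsilon> p) (dd (pair_frame p q \<epsilon> j) R))) x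
    = dd (pair_frame p q \<epsilon> q) (dd (pair_frame p q \<epsilon> q) (dd (pair_frame p q \<epsilon> p) (dd (pair_frame p q \<epsilon> j) R))) x"
proof -
  have e2: "\<epsilon> * \<epsilon> = 1" using \<epsilon> by auto
  define g where "g = dd (pair_frame p q \<epsilon> p) (dd (pair_frame p q \<epsilon> j) R)"
  have lag: "line_analytic \<Omega> g" unfolding g_def by (intro line_analytic_dd[OF op] laR)
  have lap: "line_analytic \<Omega> (pderiv_at i (pderiv_at k R))" for i k
    by (intro line_analytic_pderiv laR)
  have jp: "jet (pderiv_at i (pderiv_at k R)) M x = jet R (add_mset k (add_mset i M)) x" for i k M
    by (simp add: jet_pderiv[OF op line_analytic_pderiv[OF laR] x] jet_pderiv[OF op laR x])
  have "jet g {#p,q#} x = 0"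
  proof (cases "j = q")
    case True
    have "g x = pderiv_at p (pderiv_at p R) x + (- 1) * pderiv_at q (pderiv_at q R) x" if "x \<in> \<Omega>" for x
      unfolding g_def True using pq e2 by (simp add: dd_pair[OF laR that] jet_eq_pderiv2[OF op laR that] del: scaleR_minus_left)
    from jet_comb[OF lag lap lap this x] show ?thesis
      using jet_wave[OF x pq] by (simp add: jp add_mset_commute)
  next
    case False
    have dj: "dd (stdvec j) R = pderiv_at j R" by (simp add: fun_eq_iff)
    have "g x = pderiv_at p (pderiv_at j R) x + of_real \<epsilon> * pderiv_at q (pderiv_at j R) x" for x
      unfolding g_def using False j by (simp add: dd_add_left dd_scaleR_left dj)
    from jet_comb[OF lag lap lap this x] show ?thesis
      using jet_mixed3[OF x, of j p q p] jet_mixed3[OF x, of j p q q] pq j False by (simp add: jp add_mset_commute)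
  qed
  then have "dd (pair_frame p q \<epsilon> p) (dd (pair_frame p q \<epsilon> p) g) x = dd (pair_frame p q \<epsilon> q) (dd (pair_frame p q \<epsilon> q) g) x"
    unfolding pair_frame_simps(1) pair_frame_simps(2)[OF pq[symmetric]]
    by (simp add: dd_pair[OF lag x] e2 del: scaleR_minus_left)
  then show ?thesis by (simp only: g_def)
qed

end

text \<open>The fourth order identity is bundled with the frame because the tangential direction k
  depends on its type: k = j for a coordinate root, k = q for a pair.\<close>

lemma root_frame:
  fixes \<alpha> :: "(real, 'n::{finite,linorder}) vec"
  assumes "\<alpha> \<in> roots_B"
  shows "\<exists>f p \<omega> \<mu>. wall_frame f p \<omega> \<mu> \<and> f p = \<alpha> \<and>
    (\<forall>\<Omega> R s b a0 j. commuting_system \<Omega> R s b a0 \<longrightarrow> j \<noteq> p \<longrightarrow> (\<exists>k. k \<noteq> p \<and>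
      (\<forall>x\<in>\<Omega>. dd (f p) (dd (f p) (dd (f p) (dd (f j) R))) x = dd (f k) (dd (f k) (dd (f p) (dd (f j) R))) x)))"
proof -
  have pair: ?thesis if pq: "p \<noteq> q" "\<epsilon> \<in> {1, -1}" and eq: "\<alpha> = stdvec p + \<epsilon> *\<^sub>R stdvec q" for p q \<epsilon>
  proof -
    let ?f = "pair_frame p q \<epsilon>"
    have "\<exists>k. k \<noteq> p \<and> (\<forall>x\<in>\<Omega>. dd (?f p) (dd (?f p) (dd (?f p) (dd (?f j) R))) x = dd (?f k) (dd (?f k) (dd (?f p) (dd (?f j) R))) x)"
      if "commuting_system \<Omega> R s b a0" "j \<noteq> p" for \<Omega> and R :: "(real, 'n) vec \<Rightarrow> complex" and s b a0 and j :: 'n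
      using commuting_system.wave_pair[OF that(1) _ pq that(2)] pq(1) by (intro exI[of _ q]) blast
    then show ?thesis using wall_frame_pair[OF pq] pair_frame_simps(1)[of p q \<epsilon>] eq by (intro exI[of _ ?f]) blast
  qed
  from assms show ?thesis
  proof (cases rule: roots_B_cases)
    case (plus i j)
    then show ?thesis by (intro pair[of i j 1]) auto
  next
    case (minus i j)
    then show ?thesis by (intro pair[of i j "- 1"]) auto
  next
    case (single i)
    show ?thesis
    proof (intro exI conjI allI impI ballI)
      show "wall_frame stdvec i (\<lambda>_. 1) (\<lambda>_. 1)" by (rule wall_frame_stdvec)
      show "stdvec i = \<alpha>" by (simp add: single)
      fix \<Omega> s b a0 x and j :: 'n and R :: "(real, 'n) vec \<Rightarrow> complex" assume "commuting_system \<Omega> R s b a0" "j \<noteq> i" "x \<in> \<Omega>"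
      then show "dd (stdvec i) (dd (stdvec i) (dd (stdvec i) (dd (stdvec j) R))) x = dd (stdvec j) (dd (stdvec j) (dd (stdvec i) (dd (stdvec j) R))) x"
        using commuting_system.wave_stdvec by blast
    qed
  qed
qed

subsection \<open>The alternative at a wall\<close>

text \<open>\<open>coef\<close> may vanish at some roots, so sums run over all of
  \<open>roots_B\<close>, while the domain of the operators excludes only the walls with nonzero
  coefficient.\<close>

locale quartic_potential =
  commuting_system "regular_domain r {\<beta> \<in> roots_B. coef \<beta> \<noteq> 0}" R s b a0
  for r :: real and coef :: "(real, 'n::{finite,linorder}) vec \<Rightarrow> complex" and Rt R s b a0 +
  assumes r: "r > 0" and laRt: "line_analytic (ball 0 r) Rt"
    and R_eq: "R x = (\<Sum>\<beta>\<in>roots_B. coef \<beta> / of_real ((\<beta> \<bullet> x)\<^sup>2)) + Rt x"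
begin

definition regular_part :: "(real, 'n) vec \<Rightarrow> (real, 'n) vec \<Rightarrow> complex"
  where "regular_part \<alpha> x = (\<Sum>\<beta>\<in>roots_B - {\<alpha>}. coef \<beta> / of_real ((\<beta> \<bullet> x)\<^sup>2)) + Rt x"

lemma R_regular_part: "\<alpha> \<in> roots_B \<Longrightarrow> R x = coef \<alpha> / of_real ((\<alpha> \<bullet> x)\<^sup>2) + regular_part \<alpha> x"
  unfolding R_eq regular_part_def by (subst sum.remove[OF finite_roots_B]) (auto simp: add.assoc)

lemma la_regular_part:
  assumes "open V" "V \<subseteq> ball 0 r" "\<And>x \<beta>. x \<in> V \<Longrightarrow> \<beta> \<in> roots_B - {\<alpha>} \<Longrightarrow> \<beta> \<bullet> x \<noteq> 0"
  shows "line_analytic V (regular_part \<alpha>)"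
  unfolding regular_part_def[abs_def]
  by (intro line_analytic_add[OF assms(1)] line_analytic_sum[OF assms(1)] line_analytic_pole[OF assms(1)]
      line_analytic_subset[OF laRt assms(2)] assms(3))

text \<open>\<open>local_alternative\<close> in invariant form: the frame vectors of its second case
  are replaced by all v orthogonal to the root.\<close>

lemma wall_alternative:
  assumes \<alpha>: "\<alpha> \<in> roots_B" "coef \<alpha> \<noteq> 0" and x0: "x0 \<in> ball 0 r" "\<alpha> \<bullet> x0 = 0" "\<And>\<beta>. \<beta> \<in> roots_B - {\<alpha>} \<Longrightarrow> \<beta> \<bullet> x0 \<noteq> 0"
  shows "(\<exists>d>0. \<forall>t. \<bar>t\<bar> < d \<longrightarrow> regular_part \<alpha> (x0 - t *\<^sub>R \<alpha>) = regular_part \<alpha> (x0 + t *\<^sub>R \<alpha>)) \<or>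
    (\<exists>d>0. \<forall>v t. \<alpha> \<bullet> v = 0 \<longrightarrow> \<bar>t\<bar> < d \<longrightarrow> dd \<alpha> (dd v (regular_part \<alpha>)) (x0 + t *\<^sub>R \<alpha>) = 0)"
proof -
  obtain f p \<omega> \<mu> where wf: "wall_frame f p \<omega> \<mu>" and fp: "f p = \<alpha>"
    and "\<forall>\<Omega> R s b a0 j. commuting_system \<Omega> R s b a0 \<longrightarrow> j \<noteq> p \<longrightarrow> (\<exists>k. k \<noteq> p \<and>
      (\<forall>x\<in>\<Omega>. dd (f p) (dd (f p) (dd (f p) (dd (f j) R))) x = dd (f k) (dd (f k) (dd (f p) (dd (f j) R))) x))"
    using root_frame[OF \<alpha>(1)] by metis
  let ?D = "regular_domain r {\<beta> \<in> roots_B. coef \<beta> \<noteq> 0}"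
  have wave: "\<exists>k. k \<noteq> p \<and> (\<forall>x\<in>?D. dd (f p) (dd (f p) (dd (f p) (dd (f j) R))) x = dd (f k) (dd (f k) (dd (f p) (dd (f j) R))) x)"
    if "j \<noteq> p" for j
    using \<open>\<forall>\<Omega> R s b a0 j. _\<close> commuting_system_axioms that by blast
  interpret wall_frame f p \<omega> \<mu> by (rule wf)
  interpret framed_system ?D R s b a0 f p \<omega> \<mu>
    by unfold_locales
  define G where "G = {x \<in> ball 0 r. \<forall>\<beta>\<in>roots_B - {\<alpha>}. \<beta> \<bullet> x \<noteq> 0}"
  have "open G"
  proof -
    have "open (ball 0 r \<inter> (\<Inter>\<beta>\<in>roots_B - {\<alpha>}. {x. \<beta> \<bullet> x \<noteq> 0}))"
      by (intro open_Int open_INT open_ball ballI open_Collect_neq continuous_intros) (simp add: finite_roots_B)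
    also have "ball 0 r \<inter> (\<Inter>\<beta>\<in>roots_B - {\<alpha>}. {x. \<beta> \<bullet> x \<noteq> 0}) = G" by (auto simp: G_def)
    finally show ?thesis .
  qed
  moreover have "x0 \<in> G" using x0 by (simp add: G_def)
  ultimately obtain \<delta> where \<delta>: "\<delta> > 0" "ball x0 \<delta> \<subseteq> G" by (meson open_contains_ball)
  define V W where "V = ball x0 \<delta>" and "W = {x \<in> ball x0 \<delta>. f p \<bullet> x > 0}"
  have VD: "x \<in> ?D" if "x \<in> V" "\<alpha> \<bullet> x \<noteq> 0" for x
    using that \<delta>(2) by (auto simp: V_def G_def regular_domain_def hyperplane_def)
  have WD: "x \<in> ?D" if "x \<in> W" for x using that VD by (simp add: W_def V_def fp)
  have opV: "open V" by (simp add: V_def)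
  have laV: "line_analytic V (regular_part \<alpha>)"
    using \<delta>(2) by (intro la_regular_part opV) (auto simp: V_def G_def)
  have orth: "\<alpha> \<bullet> f j = 0" if "j \<noteq> p" for j using orthogonal_frame[of p j] that fp by auto
  \<comment> \<open>In the wall system the pole is written in the dual covector \<omega> p times
    \<alpha>, which accounts for the square of \<omega> p in the coefficient.\<close>
  have ws: "wall_system x0 \<delta> f p \<omega> \<mu> S R (regular_part \<alpha>) (coef \<alpha> * of_real ((\<omega> p)\<^sup>2))"
  proof (unfold_locales, fold V_def W_def)
    show "R x = coef \<alpha> * of_real ((\<omega> p)\<^sup>2) / of_real ((\<omega> p * (f p \<bullet> x))\<^sup>2) + regular_part \<alpha> x" if "x \<in> W" for x
      using \<omega>[of p] unfolding fp R_regular_part[OF \<alpha>(1)] by (simp add: power_mult_distrib)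
    show "line_analytic W (S i j)" for i j by (rule line_analytic_subset[OF la_S]) (use WD in blast)
  qed (use \<delta> x0 \<alpha> norm_frame[of p] \<omega> \<mu> laV WD E1 E2 E3 E4 orth S_sym in \<open>auto simp: fp V_def less_imp_neq[THEN not_sym] simp del: of_real_mult of_real_divide\<close>)
  \<comment> \<open>The identity is known for R on its domain. Tangential derivatives do not see the
    pole of \<alpha>, so off the wall it holds for the regular part, and on the wall by
    continuity.\<close>
  have pde: "\<exists>k. k \<noteq> p \<and> (\<forall>x\<in>V. dd (f p) (dd (f p) (dd (f p) (dd (f j) (regular_part \<alpha>)))) x
      = dd (f k) (dd (f k) (dd (f p) (dd (f j) (regular_part \<alpha>)))) x)" if j: "j \<noteq> p" for j
  proof -
    obtain k where k: "k \<noteq> p" "\<And>x. x \<in> ?D \<Longrightarrow> dd (f p) (dd (f p) (dd (f p) (dd (f j) R))) x = dd (f k) (dd (f k) (dd (f p) (dd (f j) R))) x"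
      using wave[OF j] by blast
    define V' where "V' = V \<inter> {x. \<alpha> \<bullet> x \<noteq> 0}"
    have opV': "open V'" unfolding V'_def by (intro open_Int opV open_Collect_neq continuous_intros)
    have V'D: "V' \<subseteq> ?D" using VD by (auto simp: V'_def)
    have c1: "dd (f j) (regular_part \<alpha>) x = dd (f j) R x" if "x \<in> V'" for x
    proof -
      have ax: "\<alpha> \<bullet> x \<noteq> 0" "x \<in> V" using that by (auto simp: V'_def)
      note dp = dd_pole[OF ax(1), of "coef \<alpha>" 2]
      have dpd: "(\<lambda>x. coef \<alpha> / of_real ((\<alpha> \<bullet> x)\<^sup>2)) differentiable (at x)"
        using dp by (rule differentiableI)
      have "R = (\<lambda>x. coef \<alpha> / of_real ((\<alpha> \<bullet> x)\<^sup>2) + regular_part \<alpha> x)"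
        using R_regular_part[OF \<alpha>(1)] by blast
      then have "dd (f j) R x = dd (f j) (\<lambda>x. coef \<alpha> / of_real ((\<alpha> \<bullet> x)\<^sup>2)) x + dd (f j) (regular_part \<alpha>) x"
        using dd_add[OF dpd line_analytic_differentiable[OF laV ax(2)]] by simp
      moreover have "dd (f j) (\<lambda>x. coef \<alpha> / of_real ((\<alpha> \<bullet> x)\<^sup>2)) x = 0"
        unfolding dd_eq[OF dp] by (simp add: orth[OF j])
      ultimately show ?thesis by (simp only: add_0)
    qed
    note c2 = dd_cong[OF opV' _ c1]
    note c3 = dd_cong[OF opV' _ c2]
    note c4 = dd_cong[OF opV' _ c3]
    let ?F = "\<lambda>x. dd (f p) (dd (f p) (dd (f p) (dd (f j) (regular_part \<alpha>)))) x - dd (f k) (dd (f k) (dd (f p) (dd (f j) (regular_part \<alpha>)))) x"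
    have "line_analytic V ?F" by (intro line_analytic_diff[OF opV] line_analytic_dd[OF opV] laV)
    then have cont: "continuous_on V ?F"
      using line_analytic_differentiable differentiable_imp_continuous_within by (intro continuous_at_imp_continuous_on) blast
    have "?F x = 0" if "x \<in> V" for x
    proof (rule continuous_zero_of_generic_zero[of "{\<alpha>}" V ?F])
      show "0 \<notin> {\<alpha>}" using roots_B_nonzero[OF \<alpha>(1)] by simp
      fix x assume "x \<in> V" "\<forall>v\<in>{\<alpha>}. v \<bullet> x \<noteq> 0"
      then have "x \<in> V'" by (simp add: V'_def)
      then show "?F x = 0" using k(2)[of x] V'D by (simp add: c4 subset_iff)
    qed (use opV cont that in auto)
    then show ?thesis using k(1) by auto
  qed
  from wall_system.local_alternative[OF ws pde[unfolded V_def]] consider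
    "\<exists>d>0. \<forall>t. \<bar>t\<bar> < d \<longrightarrow> regular_part \<alpha> (x0 - t *\<^sub>R \<alpha>) = regular_part \<alpha> (x0 + t *\<^sub>R \<alpha>)"
    | d where "d > 0" "\<And>j t. j \<noteq> p \<Longrightarrow> \<bar>t\<bar> < d \<Longrightarrow> dd \<alpha> (dd (f j) (regular_part \<alpha>)) (x0 + t *\<^sub>R \<alpha>) = 0"
    unfolding fp by metis
  then show ?thesis
  proof cases
    case 1
    then show ?thesis ..
  next
    case (2 d)
    \<comment> \<open>The second bound keeps x0 + t \<alpha> inside V, where the regular part can be
      differentiated.\<close>
    define e where "e = min d (\<delta> / norm \<alpha>)"
    have na: "norm \<alpha> > 0" using roots_B_nonzero[OF \<alpha>(1)] by simp
    have "e > 0" using 2(1) \<delta>(1) na by (simp add: e_def)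
    moreover have "dd \<alpha> (dd v (regular_part \<alpha>)) (x0 + t *\<^sub>R \<alpha>) = 0" if v: "\<alpha> \<bullet> v = 0" and t: "\<bar>t\<bar> < e" for v t
    proof -
      have "\<bar>t\<bar> * norm \<alpha> < \<delta>" using t na by (simp add: e_def pos_less_divide_eq)
      then have xV: "x0 + t *\<^sub>R \<alpha> \<in> V" by (simp add: V_def dist_norm)
      have "dd v (regular_part \<alpha>) = (\<lambda>x. \<Sum>m\<in>UNIV - {p}. of_real (\<omega> m * (f m \<bullet> v)) * dd (f m) (regular_part \<alpha>) x)"
        using orthogonal_combination v fp by blast
      then have "dd \<alpha> (dd v (regular_part \<alpha>)) (x0 + t *\<^sub>R \<alpha>)
        = (\<Sum>m\<in>UNIV - {p}. of_real (\<omega> m * (f m \<bullet> v)) * dd \<alpha> (dd (f m) (regular_part \<alpha>)) (x0 + t *\<^sub>R \<alpha>))"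
        using line_analytic_differentiable[OF line_analytic_dd[OF opV laV] xV]
        by (simp add: dd_sum dd_cmult differentiable_mult)
      also have "\<dots> = 0" using 2(2) t by (intro sum.neutral) (auto simp: e_def)
      finally show ?thesis .
    qed
    ultimately show ?thesis by blast
  qed
qed

end

subsection \<open>Reflection invariance\<close>

text \<open>A line meets the ball in an open interval, so an identity near one parameter spreads
  along the whole chord. It is applied to functions with cleared denominators, for which the walls
  on the way are harmless.\<close>

lemma line_identity:
  fixes x v :: "'a::real_normed_vector"
  assumes "\<And>t. x + t *\<^sub>R v \<in> ball 0 r \<Longrightarrow> analytic1_at F t"
    and "x + t0 *\<^sub>R v \<in> ball 0 r" "\<forall>\<^sub>F s in nhds t0. F s = 0" "x + t *\<^sub>R v \<in> ball 0 r"
  shows "F t = 0"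
proof -
  define J where "J = {t. x + t *\<^sub>R v \<in> ball 0 r}"
  have "open J"
  proof -
    have "J = (\<lambda>t. x + t *\<^sub>R v) -` ball 0 r" by (auto simp: J_def)
    moreover have "open ((\<lambda>t. x + t *\<^sub>R v) -` ball 0 r)" by (intro open_vimage open_ball continuous_intros)
    ultimately show ?thesis by simp
  qed
  moreover have "convex J"
  proof (rule convexI)
    fix a b c d :: real assume *: "a \<in> J" "b \<in> J" "0 \<le> c" "0 \<le> d" "c + d = 1"
    have "c *\<^sub>R (x + a *\<^sub>R v) + d *\<^sub>R (x + b *\<^sub>R v) \<in> ball 0 r"
      using * by (intro convexD[OF convex_ball]) (auto simp: J_def)
    moreover have "c *\<^sub>R (x + a *\<^sub>R v) + d *\<^sub>R (x + b *\<^sub>R v) = (c + d) *\<^sub>R x + (c *\<^sub>R a + d *\<^sub>R b) *\<^sub>R v"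
      by (simp add: algebra_simps)
    ultimately show "c *\<^sub>R a + d *\<^sub>R b \<in> J" using *(5) by (simp add: J_def)
  qed
  ultimately show ?thesis
    using analytic1_identity[of J F t0 t] assms convex_connected by (auto simp: J_def)
qed

lemma eventually_line_regular:
  fixes x0 v :: "'a::real_inner"
  assumes "x0 \<in> ball 0 r" "finite B" "\<And>\<beta>. \<beta> \<in> B \<Longrightarrow> \<beta> \<bullet> x0 \<noteq> 0"
  shows "\<forall>\<^sub>F t in nhds 0. x0 + t *\<^sub>R v \<in> ball 0 r \<and> (\<forall>\<beta>\<in>B. \<beta> \<bullet> (x0 + t *\<^sub>R v) \<noteq> 0)"
proof -
  have "isCont (\<lambda>t. x0 + t *\<^sub>R v) 0" by (intro continuous_intros)
  then have L: "((\<lambda>t. x0 + t *\<^sub>R v) \<longlongrightarrow> x0 + 0 *\<^sub>R v) (nhds 0)" by (simp add: isCont_def continuous_at tendsto_nhds_iff)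
  have "\<forall>\<^sub>F t in nhds 0. x0 + t *\<^sub>R v \<in> ball 0 r" by (rule topological_tendstoD[OF L open_ball]) (use assms in simp)
  moreover have "\<forall>\<^sub>F t in nhds 0. \<forall>\<beta>\<in>B. \<beta> \<bullet> (x0 + t *\<^sub>R v) \<noteq> 0"
  proof (rule eventually_ball_finite[OF assms(2)], rule ballI)
    fix \<beta> assume "\<beta> \<in> B"
    then have "\<beta> \<bullet> (x0 + 0 *\<^sub>R v) \<noteq> 0" using assms by simp
    then show "\<forall>\<^sub>F t in nhds 0. \<beta> \<bullet> (x0 + t *\<^sub>R v) \<noteq> 0"
      by (rule tendsto_imp_eventually_ne[OF tendsto_inner[OF tendsto_const L, of \<beta>]])
  qed
  ultimately show ?thesis by (rule eventually_conj)
qed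

lemma analytic1_at_inner_line: "analytic1_at (\<lambda>t. of_real (\<beta> \<bullet> (x + t *\<^sub>R v))) t"
proof -
  have "analytic1_at (\<lambda>t. of_real (\<beta> \<bullet> x) + of_real t * of_real (\<beta> \<bullet> v)) t" by (intro analytic1_at_add analytic1_at_mult analytic1_at_const analytic1_at_of_real)
  then show ?thesis by (simp add: inner_add_right)
qed

context quartic_potential
begin

lemma dd_dd_pole:
  assumes "\<beta> \<bullet> x \<noteq> 0"
  shows "dd u (dd v (\<lambda>x. c / of_real ((\<beta> \<bullet> x)\<^sup>2))) x = 6 * c * of_real ((\<beta> \<bullet> u) * (\<beta> \<bullet> v)) / of_real ((\<beta> \<bullet> x) ^ 4)"
proof -
  have op: "open {x. \<beta> \<bullet> x \<noteq> 0}" by (intro open_Collect_neq continuous_intros)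
  have "dd u (dd v (\<lambda>x. c / of_real ((\<beta> \<bullet> x)\<^sup>2))) x = dd u (\<lambda>x. (- 2 * c * of_real (\<beta> \<bullet> v)) / of_real ((\<beta> \<bullet> x) ^ 3)) x"
    by (rule dd_cong[OF op]) (use assms dd_eq[OF dd_pole, of \<beta> _ v c 2] in \<open>auto simp: eval_nat_numeral\<close>)
  also have "\<dots> = 6 * c * of_real ((\<beta> \<bullet> u) * (\<beta> \<bullet> v)) / of_real ((\<beta> \<bullet> x) ^ 4)"
    unfolding dd_eq[OF dd_pole[OF assms]] by (simp add: eval_nat_numeral)
  finally show ?thesis .
qed

lemma dd_dd_regular_part:
  assumes "x \<in> ball 0 r" "\<And>\<beta>. \<beta> \<in> roots_B - {\<alpha>} \<Longrightarrow> \<beta> \<bullet> x \<noteq> 0"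
  shows "dd u (dd v (regular_part \<alpha>)) x
    = (\<Sum>\<beta>\<in>roots_B - {\<alpha>}. 6 * coef \<beta> * of_real ((\<beta> \<bullet> u) * (\<beta> \<bullet> v)) / of_real ((\<beta> \<bullet> x) ^ 4)) + dd u (dd v Rt) x"
proof -
  define G where "G = ball 0 r \<inter> (\<Inter>\<beta>\<in>roots_B - {\<alpha>}. {x. \<beta> \<bullet> x \<noteq> 0})"
  have op: "open G" unfolding G_def
    by (intro open_Int open_INT open_ball ballI open_Collect_neq continuous_intros) (simp add: finite_roots_B)
  have xG: "x \<in> G" using assms by (simp add: G_def)
  have laRtG: "line_analytic G Rt" using laRt by (rule line_analytic_subset) (simp add: G_def)
  have lap: "line_analytic G (\<lambda>x. coef \<beta> / of_real ((\<beta> \<bullet> x)\<^sup>2))" if "\<beta> \<in> roots_B - {\<alpha>}" for \<beta>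
    by (rule line_analytic_pole[OF op]) (use that in \<open>auto simp: G_def\<close>)
  have "dd v (regular_part \<alpha>) y = (\<Sum>\<beta>\<in>roots_B - {\<alpha>}. dd v (\<lambda>x. coef \<beta> / of_real ((\<beta> \<bullet> x)\<^sup>2)) y) + dd v Rt y" if "y \<in> G" for y v
  proof -
    have "(\<lambda>x. \<Sum>\<beta>\<in>roots_B - {\<alpha>}. coef \<beta> / of_real ((\<beta> \<bullet> x)\<^sup>2)) differentiable (at y)"
      by (rule line_analytic_differentiable[OF line_analytic_sum[OF op] that]) (rule lap)
    from dd_add[OF this line_analytic_differentiable[OF laRtG that], of v]
    show ?thesis unfolding regular_part_def[abs_def]
      by (subst (asm) dd_sum) (rule line_analytic_differentiable[OF lap that])
  qed
  then have "dd u (dd v (regular_part \<alpha>)) x = dd u (\<lambda>y. (\<Sum>\<beta>\<in>roots_B - {\<alpha>}. dd v (\<lambda>x. coef \<beta> / of_real ((\<beta> \<bullet> x)\<^sup>2)) y) + dd v Rt y) x"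
    by (rule dd_cong[OF op xG])
  also have "\<dots> = (\<Sum>\<beta>\<in>roots_B - {\<alpha>}. dd u (dd v (\<lambda>x. coef \<beta> / of_real ((\<beta> \<bullet> x)\<^sup>2))) x) + dd u (dd v Rt) x"
  proof -
    have "(\<lambda>y. \<Sum>\<beta>\<in>roots_B - {\<alpha>}. dd v (\<lambda>x. coef \<beta> / of_real ((\<beta> \<bullet> x)\<^sup>2)) y) differentiable (at x)"
      by (rule line_analytic_differentiable[OF line_analytic_sum[OF op] xG]) (rule line_analytic_dd[OF op lap])
    from dd_add[OF this line_analytic_differentiable[OF line_analytic_dd[OF op laRtG] xG], of u]
    show ?thesis by (subst (asm) dd_sum) (rule line_analytic_differentiable[OF line_analytic_dd[OF op lap] xG])
  qed
  also have "(\<Sum>\<beta>\<in>roots_B - {\<alpha>}. dd u (dd v (\<lambda>x. coef \<beta> / of_real ((\<beta> \<bullet> x)\<^sup>2))) x)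
    = (\<Sum>\<beta>\<in>roots_B - {\<alpha>}. 6 * coef \<beta> * of_real ((\<beta> \<bullet> u) * (\<beta> \<bullet> v)) / of_real ((\<beta> \<bullet> x) ^ 4))"
    by (intro sum.cong refl dd_dd_pole assms)
  finally show ?thesis .
qed

lemma small_line_point:
  fixes x0 \<alpha> :: "(real, 'n) vec"
  assumes "norm x0 * (1 + k) < r" "\<bar>t\<bar> * norm \<alpha> \<le> k * norm x0"
  shows "x0 + t *\<^sub>R \<alpha> \<in> ball 0 r"
proof -
  have "norm (x0 + t *\<^sub>R \<alpha>) \<le> norm x0 + \<bar>t\<bar> * norm \<alpha>" by (metis norm_scaleR norm_triangle_ineq)
  then show ?thesis using assms by (simp add: algebra_simps)
qed

text \<open>The second alternative at the wall of \<open>\<alpha>\<close> fails because \<open>\<partial>\<^sub>\<alpha> \<partial>\<^sub>v R\<close> has a pole where the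
  normal line meets the wall of a non-orthogonal \<open>\<gamma>\<close>; clearing denominators makes the continuation
  along the line past the other walls possible.\<close>

lemma regular_part_even:
  assumes \<alpha>: "\<alpha> \<in> roots_B" "coef \<alpha> \<noteq> 0" and \<gamma>: "\<gamma> \<in> roots_B" "coef \<gamma> \<noteq> 0" "\<gamma> \<noteq> \<alpha>" "\<gamma> \<bullet> \<alpha> \<noteq> 0"
    and x0: "\<alpha> \<bullet> x0 = 0" "norm x0 * (1 + norm \<gamma> * norm \<alpha> / \<bar>\<gamma> \<bullet> \<alpha>\<bar>) < r"
    and gen: "\<And>\<beta>. \<beta> \<in> roots_B - {\<alpha>} \<Longrightarrow> \<beta> \<bullet> x0 \<noteq> 0"
    and gen': "\<And>\<beta>. \<beta> \<in> roots_B - {\<alpha>} - {\<gamma>} \<Longrightarrow> (\<beta> - ((\<beta> \<bullet> \<alpha>) / (\<gamma> \<bullet> \<alpha>)) *\<^sub>R \<gamma>) \<bullet> x0 \<noteq> 0"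
  shows "\<exists>d>0. \<forall>t. \<bar>t\<bar> < d \<longrightarrow> regular_part \<alpha> (x0 - t *\<^sub>R \<alpha>) = regular_part \<alpha> (x0 + t *\<^sub>R \<alpha>)"
proof -
  define B where "B = roots_B - {\<alpha>}"
  have fB: "finite B" by (simp add: B_def finite_roots_B)
  have \<gamma>B: "\<gamma> \<in> B" using \<gamma> by (simp add: B_def)
  have x0b: "x0 \<in> ball 0 r" using small_line_point[OF x0(2), of 0 \<alpha>] by simp
  have "\<not> (\<exists>d>0. \<forall>v t. \<alpha> \<bullet> v = 0 \<longrightarrow> \<bar>t\<bar> < d \<longrightarrow> dd \<alpha> (dd v (regular_part \<alpha>)) (x0 + t *\<^sub>R \<alpha>) = 0)"
  proof
    assume "\<exists>d>0. \<forall>v t. \<alpha> \<bullet> v = 0 \<longrightarrow> \<bar>t\<bar> < d \<longrightarrow> dd \<alpha> (dd v (regular_part \<alpha>)) (x0 + t *\<^sub>R \<alpha>) = 0"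
    then obtain d where d: "d > 0" "\<And>v t. \<alpha> \<bullet> v = 0 \<Longrightarrow> \<bar>t\<bar> < d \<Longrightarrow> dd \<alpha> (dd v (regular_part \<alpha>)) (x0 + t *\<^sub>R \<alpha>) = 0" by blast
    have aa: "\<alpha> \<bullet> \<alpha> \<noteq> 0" using roots_B_nonzero[OF \<alpha>(1)] by simp
    \<comment> \<open>The part of \<gamma> orthogonal to \<alpha>. It is tangential and not
      orthogonal to \<gamma>, so the pole of \<gamma> enters the mixed derivative with a nonzero
      coefficient.\<close>
    define v where "v = \<gamma> - ((\<gamma> \<bullet> \<alpha>) / (\<alpha> \<bullet> \<alpha>)) *\<^sub>R \<alpha>"
    have v: "\<alpha> \<bullet> v = 0" using aa by (simp add: v_def inner_diff_right inner_commute)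
    have gv: "\<gamma> \<bullet> v \<noteq> 0"
    proof
      assume "\<gamma> \<bullet> v = 0"
      then have "v \<bullet> v = 0" using v by (simp add: v_def[of] inner_diff_left) 
      then have "\<gamma> = ((\<gamma> \<bullet> \<alpha>) / (\<alpha> \<bullet> \<alpha>)) *\<^sub>R \<alpha>" by (simp add: v_def)
      then show False using roots_B_nonparallel[OF \<gamma>(1) \<alpha>(1)] \<gamma>(3) by blast
    qed
    \<comment> \<open>Second derivatives of the inverse squares have poles of order four, hence the
      fourth powers. A is the mixed derivative multiplied by all of these.\<close>
    define p where "p \<beta> t = (complex_of_real (\<beta> \<bullet> (x0 + t *\<^sub>R \<alpha>))) ^ 4" for \<beta> t
    define A where "A t = (\<Sum>\<beta>\<in>B. 6 * coef \<beta> * of_real ((\<beta> \<bullet> \<alpha>) * (\<beta> \<bullet> v)) * (\<Prod>\<beta>'\<in>B - {\<beta>}. p \<beta>' t))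
      + (\<Prod>\<beta>\<in>B. p \<beta> t) * dd \<alpha> (dd v Rt) (x0 + t *\<^sub>R \<alpha>)" for t
    have anA: "analytic1_at A t" if "x0 + t *\<^sub>R \<alpha> \<in> ball 0 r" for t
      unfolding A_def[abs_def] p_def
      by (intro analytic1_at_add analytic1_at_mult analytic1_at_sum analytic1_at_prod analytic1_at_power analytic1_at_const
          analytic1_at_inner_line line_analytic_line[OF line_analytic_dd[OF open_ball line_analytic_dd[OF open_ball laRt]] that])
    have A0: "A t = 0" if "\<bar>t\<bar> < d" "x0 + t *\<^sub>R \<alpha> \<in> ball 0 r" "\<And>\<beta>. \<beta> \<in> B \<Longrightarrow> \<beta> \<bullet> (x0 + t *\<^sub>R \<alpha>) \<noteq> 0" for t
    proof -
      have pn: "p \<beta> t \<noteq> 0" if "\<beta> \<in> B" for \<beta> using \<open>\<And>\<beta>. \<beta> \<in> B \<Longrightarrow> \<beta> \<bullet> (x0 + t *\<^sub>R \<alpha>) \<noteq> 0\<close>[OF that] unfolding p_def by (simp only: power_eq_0_iff of_real_eq_0_iff not_False_eq_True simp_thms)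
      have "0 = (\<Sum>\<beta>\<in>B. 6 * coef \<beta> * of_real ((\<beta> \<bullet> \<alpha>) * (\<beta> \<bullet> v)) / p \<beta> t) + dd \<alpha> (dd v Rt) (x0 + t *\<^sub>R \<alpha>)"
        using dd_dd_regular_part[OF that(2) that(3)[unfolded B_def], where u = \<alpha> and v = v] d(2)[OF v that(1)]
        by (simp only: B_def p_def of_real_power)
      then have "0 = (\<Prod>\<beta>\<in>B. p \<beta> t) * ((\<Sum>\<beta>\<in>B. 6 * coef \<beta> * of_real ((\<beta> \<bullet> \<alpha>) * (\<beta> \<bullet> v)) / p \<beta> t) + dd \<alpha> (dd v Rt) (x0 + t *\<^sub>R \<alpha>))" by simp
      also have "\<dots> = (\<Sum>\<beta>\<in>B. (\<Prod>\<beta>\<in>B. p \<beta> t) * (6 * coef \<beta> * of_real ((\<beta> \<bullet> \<alpha>) * (\<beta> \<bullet> v)) / p \<beta> t)) + (\<Prod>\<beta>\<in>B. p \<beta> t) * dd \<alpha> (dd v Rt) (x0 + t *\<^sub>R \<alpha>)"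
        by (simp only: distrib_left sum_distrib_left)
      also have "(\<Sum>\<beta>\<in>B. (\<Prod>\<beta>\<in>B. p \<beta> t) * (6 * coef \<beta> * of_real ((\<beta> \<bullet> \<alpha>) * (\<beta> \<bullet> v)) / p \<beta> t))
        = (\<Sum>\<beta>\<in>B. 6 * coef \<beta> * of_real ((\<beta> \<bullet> \<alpha>) * (\<beta> \<bullet> v)) * (\<Prod>\<beta>'\<in>B - {\<beta>}. p \<beta>' t))"
      proof (rule sum.cong[OF refl])
        fix \<beta> assume b: "\<beta> \<in> B"
        show "(\<Prod>\<beta>\<in>B. p \<beta> t) * (6 * coef \<beta> * of_real ((\<beta> \<bullet> \<alpha>) * (\<beta> \<bullet> v)) / p \<beta> t)
          = 6 * coef \<beta> * of_real ((\<beta> \<bullet> \<alpha>) * (\<beta> \<bullet> v)) * (\<Prod>\<beta>'\<in>B - {\<beta>}. p \<beta>' t)"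
          unfolding prod.remove[OF fB b] using pn[OF b] by simp
      qed
      finally show ?thesis by (simp add: A_def)
    qed
    have "\<forall>\<^sub>F t in nhds 0. A t = 0"
    proof -
      have "\<forall>\<^sub>F t in nhds 0. x0 + t *\<^sub>R \<alpha> \<in> ball 0 r \<and> (\<forall>\<beta>\<in>B. \<beta> \<bullet> (x0 + t *\<^sub>R \<alpha>) \<noteq> 0)"
        by (rule eventually_line_regular[OF x0b fB]) (simp add: B_def gen)
      moreover have "\<forall>\<^sub>F t in nhds 0. \<bar>t\<bar> < d" unfolding eventually_nhds_metric using d(1) by (auto simp: dist_real_def)
      ultimately show ?thesis by eventually_elim (use A0 in blast)
    qed
    \<comment> \<open>The parameter at which the normal line meets the wall of \<gamma>. The norm
      bound on x0 keeps this point in the ball, and the last genericity assumption keeps it off the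
      remaining walls.\<close>
    moreover define s where "s = - (\<gamma> \<bullet> x0) / (\<gamma> \<bullet> \<alpha>)"
    have sb: "x0 + s *\<^sub>R \<alpha> \<in> ball 0 r"
    proof (rule small_line_point[OF x0(2)])
      have "\<bar>\<gamma> \<bullet> x0\<bar> \<le> norm \<gamma> * norm x0" by (rule Cauchy_Schwarz_ineq2)
      then have "\<bar>\<gamma> \<bullet> x0\<bar> / \<bar>\<gamma> \<bullet> \<alpha>\<bar> * norm \<alpha> \<le> norm \<gamma> * norm x0 / \<bar>\<gamma> \<bullet> \<alpha>\<bar> * norm \<alpha>"
        by (intro mult_right_mono divide_right_mono) auto
      then show "\<bar>s\<bar> * norm \<alpha> \<le> norm \<gamma> * norm \<alpha> / \<bar>\<gamma> \<bullet> \<alpha>\<bar> * norm x0" by (simp add: s_def mult_ac)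
    qed
    ultimately have As: "A s = 0"
      using line_identity[of x0 \<alpha> r A 0 s, OF anA _ _ sb] x0b by simp
    have gs: "\<gamma> \<bullet> (x0 + s *\<^sub>R \<alpha>) = 0" using \<gamma>(4) by (simp add: s_def inner_add_right inner_diff_right)
    have bs: "\<beta> \<bullet> (x0 + s *\<^sub>R \<alpha>) \<noteq> 0" if "\<beta> \<in> B - {\<gamma>}" for \<beta>
      using gen'[of \<beta>] that by (simp add: B_def s_def inner_add_right inner_diff_right inner_diff_left mult.commute)
    have p0: "p \<gamma> s = 0" by (simp only: p_def gs of_real_0) simp
    have "(\<Prod>\<beta>\<in>B. p \<beta> s) = 0" using fB \<gamma>B p0 by (auto simp: prod_zero_iff)
    moreover have "(\<Prod>\<beta>'\<in>B - {\<beta>}. p \<beta>' s) = 0" if "\<beta> \<in> B - {\<gamma>}" for \<beta>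
      using fB \<gamma>B p0 that by (auto simp: prod_zero_iff)
    \<comment> \<open>At the meeting point every other term of A contains the vanishing factor of
      \<gamma>.\<close>
    ultimately have "A s = 6 * coef \<gamma> * of_real ((\<gamma> \<bullet> \<alpha>) * (\<gamma> \<bullet> v)) * (\<Prod>\<beta>'\<in>B - {\<gamma>}. p \<beta>' s)"
      unfolding A_def by (simp add: sum.remove[OF fB \<gamma>B])
    moreover have "(\<Prod>\<beta>'\<in>B - {\<gamma>}. p \<beta>' s) \<noteq> 0"
      unfolding prod_zero_iff[OF finite_Diff[OF fB]] p_def power_eq_0_iff of_real_eq_0_iff using bs by blast
    ultimately show False using As \<gamma>(2,4) gv by simp
  qed
  then show ?thesis using wall_alternative[OF \<alpha> x0b x0(1) gen] by blast
qed

end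

lemma reflection_line: "\<alpha> \<bullet> x0 = 0 \<Longrightarrow> reflection \<alpha> (x0 + t *\<^sub>R \<alpha>) = x0 + t *\<^sub>R (- \<alpha>)"
proof (cases "\<alpha> = 0")
  case False
  assume "\<alpha> \<bullet> x0 = 0"
  then have "2 * (\<alpha> \<bullet> (x0 + t *\<^sub>R \<alpha>)) / (\<alpha> \<bullet> \<alpha>) = t + t" using False by (simp add: inner_add_right)
  then show ?thesis unfolding reflection_def by (simp only: scaleR_add_left) simp
qed (simp add: reflection_def)

lemma continuous_on_reflection [continuous_intros]: "continuous_on A f \<Longrightarrow> continuous_on A (\<lambda>x. reflection \<alpha> (f x))"
  unfolding reflection_def divide_inverse by (intro continuous_intros)

lemma reflection_root_regular:
  assumes "\<alpha> \<in> roots_B" "\<And>\<beta>. \<beta> \<in> roots_B \<Longrightarrow> \<beta> \<bullet> x \<noteq> 0" "\<beta> \<in> roots_B"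
  shows "\<beta> \<bullet> reflection \<alpha> x \<noteq> 0"
proof -
  have "reflection \<alpha> \<beta> \<in> signed_roots" by (rule reflection_signed_roots) (use assms in \<open>auto simp: signed_roots_def\<close>)
  then show ?thesis unfolding inner_reflection using assms(2) by (auto simp: signed_roots_def)
qed

context quartic_potential
begin

text \<open>This avoids the walls of all roots of type B, also those with zero coefficient, and is
  therefore stable under all their reflections.\<close>

definition regular_set :: "(real, 'n) vec set"
  where "regular_set = {x \<in> ball 0 r. \<forall>\<beta>\<in>roots_B. \<beta> \<bullet> x \<noteq> 0}"

definition root_prod :: "(real, 'n) vec \<Rightarrow> complex"
  where "root_prod x = (\<Prod>\<beta>\<in>roots_B. of_real (\<beta> \<bullet> x) ^ 2)"

text \<open>R times \<open>root_prod\<close>, written so that it is analytic along lines in the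
  whole ball, walls included.\<close>

definition cleared :: "(real, 'n) vec \<Rightarrow> complex"
  where "cleared x = (\<Sum>\<beta>\<in>roots_B. coef \<beta> * (\<Prod>\<beta>'\<in>roots_B - {\<beta>}. of_real (\<beta>' \<bullet> x) ^ 2)) + root_prod x * Rt x"

lemma root_prod_zero_iff: "root_prod x = 0 \<longleftrightarrow> (\<exists>\<beta>\<in>roots_B. \<beta> \<bullet> x = 0)"
  unfolding root_prod_def prod_zero_iff[OF finite_roots_B] by simp

lemma cleared_eq:
  assumes "\<And>\<beta>. \<beta> \<in> roots_B \<Longrightarrow> \<beta> \<bullet> x \<noteq> 0"
  shows "cleared x = R x * root_prod x"
proof -
  have "root_prod x * (coef \<beta> / of_real ((\<beta> \<bullet> x)\<^sup>2)) = coef \<beta> * (\<Prod>\<beta>'\<in>roots_B - {\<beta>}. of_real (\<beta>' \<bullet> x) ^ 2)" if "\<beta> \<in> roots_B" for \<beta>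
    unfolding root_prod_def prod.remove[OF finite_roots_B that] using assms[OF that] by simp
  then have "root_prod x * R x = cleared x"
    unfolding R_eq cleared_def distrib_left sum_distrib_left by simp
  then show ?thesis by (simp add: mult.commute)
qed

lemma analytic1_at_root_prod: "analytic1_at (\<lambda>t. root_prod (x + t *\<^sub>R v)) t"
  unfolding root_prod_def by (intro analytic1_at_prod analytic1_at_power analytic1_at_inner_line)

lemma analytic1_at_cleared: "x + t *\<^sub>R v \<in> ball 0 r \<Longrightarrow> analytic1_at (\<lambda>t. cleared (x + t *\<^sub>R v)) t"
  unfolding cleared_def
  by (intro analytic1_at_add analytic1_at_mult analytic1_at_sum analytic1_at_prod analytic1_at_power analytic1_at_const
      analytic1_at_root_prod analytic1_at_inner_line line_analytic_line[OF laRt])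

lemma continuous_on_Rt: "continuous_on (ball 0 r) Rt"
  using line_analytic_differentiable[OF laRt] differentiable_imp_continuous_within
  by (intro continuous_at_imp_continuous_on) blast

lemma continuous_on_root_prod: "continuous_on A root_prod"
  unfolding root_prod_def[abs_def] by (intro continuous_intros)

lemma continuous_on_cleared: "continuous_on (ball 0 r) cleared"
  unfolding cleared_def[abs_def] by (intro continuous_intros continuous_on_root_prod continuous_on_Rt)

text \<open>Evenness of the regular part near a generic wall point gives G = 0 near that point of
  the normal line, hence along its whole chord. This covers wall points close to the origin only.
  Continuation along rays from the origin reaches generic points of the ball, and density the
  others.\<close>

lemma wall_reflection_invariant:
  assumes \<alpha>: "\<alpha> \<in> roots_B" "coef \<alpha> \<noteq> 0" and \<gamma>: "\<gamma> \<in> roots_B" "coef \<gamma> \<noteq> 0" "\<gamma> \<noteq> \<alpha>" "\<gamma> \<bullet> \<alpha> \<noteq> 0"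
    and x: "x \<in> regular_set"
  shows "R (reflection \<alpha> x) = R x"
proof -
  define k where "k = norm \<gamma> * norm \<alpha> / \<bar>\<gamma> \<bullet> \<alpha>\<bar>"
  have k: "1 + k > 0" by (simp add: k_def add_pos_nonneg)
  define B where "B = roots_B - {\<alpha>}"
  define w where "w \<beta> = \<beta> - ((\<beta> \<bullet> \<alpha>) / (\<gamma> \<bullet> \<alpha>)) *\<^sub>R \<gamma>" for \<beta>
  define \<pi> where "\<pi> x = x - ((x \<bullet> \<alpha>) / (\<alpha> \<bullet> \<alpha>)) *\<^sub>R \<alpha>" for x
  have \<alpha>0: "\<alpha> \<noteq> 0" and aa: "\<alpha> \<bullet> \<alpha> \<noteq> 0" using roots_B_nonzero[OF \<alpha>(1)] by auto
  interpret \<sigma>: linear "reflection \<alpha>" by (rule reflection_linear)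
  have \<sigma>_ball: "reflection \<alpha> x \<in> ball 0 r \<longleftrightarrow> x \<in> ball 0 r" for x using norm_reflection[OF \<alpha>0] by simp
  \<comment> \<open>The invariance of R multiplied by both denominators, so that it can be continued
    across walls.\<close>
  define G where "G x = cleared (reflection \<alpha> x) * root_prod x - cleared x * root_prod (reflection \<alpha> x)" for x
  have anG: "analytic1_at (\<lambda>t. G (x + t *\<^sub>R v)) t" if "x + t *\<^sub>R v \<in> ball 0 r" for x v t
  proof -
    have \<sigma>l: "reflection \<alpha> (x + t *\<^sub>R v) = reflection \<alpha> x + t *\<^sub>R reflection \<alpha> v" for t
      by (simp add: \<sigma>.add \<sigma>.scaleR)
    have "reflection \<alpha> x + t *\<^sub>R reflection \<alpha> v \<in> ball 0 r" using that \<sigma>_ball[of "x + t *\<^sub>R v"] by (simp only: \<sigma>l)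
    then show ?thesis unfolding G_def \<sigma>l
      by (intro analytic1_at_diff analytic1_at_mult analytic1_at_cleared analytic1_at_root_prod that)
  qed
  have G_line: "G (x0 + t *\<^sub>R \<alpha>) = 0"
    if x0: "\<alpha> \<bullet> x0 = 0" "norm x0 * (1 + k) < r" "\<And>\<beta>. \<beta> \<in> B \<Longrightarrow> \<beta> \<bullet> x0 \<noteq> 0" "\<And>\<beta>. \<beta> \<in> B - {\<gamma>} \<Longrightarrow> w \<beta> \<bullet> x0 \<noteq> 0"
      and t: "x0 + t *\<^sub>R \<alpha> \<in> ball 0 r" for x0 t
  proof -
    have "0 \<le> k * norm x0" by (simp add: k_def)
    then have x0b: "x0 \<in> ball 0 r" using small_line_point[OF x0(2), of 0 \<alpha>] by simp
    obtain d where d: "d > 0" "\<And>t. \<bar>t\<bar> < d \<Longrightarrow> regular_part \<alpha> (x0 - t *\<^sub>R \<alpha>) = regular_part \<alpha> (x0 + t *\<^sub>R \<alpha>)"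
      using regular_part_even[OF \<alpha> \<gamma> x0(1) x0(2)[unfolded k_def]] x0(3,4) unfolding B_def w_def by blast
    have fB: "finite B" by (simp add: B_def finite_roots_B)
    have "\<forall>\<^sub>F t in nhds 0. \<bar>t\<bar> < d" unfolding eventually_nhds_metric using d(1) by (auto simp: dist_real_def)
    moreover have "\<forall>\<^sub>F t in nhds 0. x0 + t *\<^sub>R v \<in> ball 0 r \<and> (\<forall>\<beta>\<in>B. \<beta> \<bullet> (x0 + t *\<^sub>R v) \<noteq> 0)" for v
      by (rule eventually_line_regular[OF x0b fB]) (fact x0(3))
    note this[of \<alpha>] this[of "- \<alpha>"]
    ultimately have "\<forall>\<^sub>F t in nhds 0. G (x0 + t *\<^sub>R \<alpha>) = 0"
    proof eventually_elim
      case (elim t)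
      show ?case
      proof (cases "t = 0")
        case True
        have "reflection \<alpha> x0 = x0" using x0(1) by (simp add: reflection_def)
        then show ?thesis using True by (simp add: G_def)
      next
        case False
        have rf: "reflection \<alpha> (x0 + t *\<^sub>R \<alpha>) = x0 + t *\<^sub>R (- \<alpha>)" by (rule reflection_line[OF x0(1)])
        have a: "\<alpha> \<bullet> (x0 + t *\<^sub>R \<alpha>) = t * (\<alpha> \<bullet> \<alpha>)" "\<alpha> \<bullet> (x0 + t *\<^sub>R (- \<alpha>)) = - (t * (\<alpha> \<bullet> \<alpha>))"
          using x0(1) by (simp_all add: inner_add_right inner_diff_right)
        have r1: "\<beta> \<bullet> (x0 + t *\<^sub>R \<alpha>) \<noteq> 0" if "\<beta> \<in> roots_B" for \<beta>
          using elim that a(1) False aa by (cases "\<beta> = \<alpha>") (auto simp: B_def)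
        have r2: "\<beta> \<bullet> (x0 + t *\<^sub>R (- \<alpha>)) \<noteq> 0" if "\<beta> \<in> roots_B" for \<beta>
          using elim that a(2) False aa by (cases "\<beta> = \<alpha>") (auto simp: B_def)
        have "R (x0 + t *\<^sub>R (- \<alpha>)) = R (x0 + t *\<^sub>R \<alpha>)"
          unfolding R_regular_part[OF \<alpha>(1)] a using d(2)[of t] elim by simp
        moreover have "cleared (x0 + t *\<^sub>R \<alpha>) = R (x0 + t *\<^sub>R \<alpha>) * root_prod (x0 + t *\<^sub>R \<alpha>)"
          by (rule cleared_eq) (rule r1)
        moreover have "cleared (x0 + t *\<^sub>R (- \<alpha>)) = R (x0 + t *\<^sub>R (- \<alpha>)) * root_prod (x0 + t *\<^sub>R (- \<alpha>))"
          by (rule cleared_eq) (rule r2)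
        ultimately show ?thesis unfolding G_def rf by (simp only: mult_ac diff_self)
      qed
    qed
    then show ?thesis
      using line_identity[of x0 \<alpha> r "\<lambda>t. G (x0 + t *\<^sub>R \<alpha>)" 0 t] anG x0b t by simp
  qed
  have \<pi>\<alpha>: "\<alpha> \<bullet> \<pi> x = 0" for x using aa by (simp add: \<pi>_def inner_diff_right inner_commute)
  have \<pi>_sym: "v \<bullet> \<pi> x = \<pi> v \<bullet> x" for v x by (simp add: \<pi>_def inner_diff_left inner_diff_right inner_commute)
  \<comment> \<open>The genericity conditions that \<open>regular_part_even\<close> puts on the foot
    of the perpendicular, rewritten as conditions on the point itself through the symmetric
    projection \<pi>.\<close>
  define M where "M = \<pi> ` B \<union> (\<pi> \<circ> w) ` (B - {\<gamma>})"
  have "finite M" by (simp add: M_def B_def finite_roots_B)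
  have "0 \<notin> M"
  proof
    have 1: "\<pi> \<beta> \<noteq> 0" if "\<beta> \<in> B" for \<beta>
      using roots_B_nonparallel[of \<beta> \<alpha> "(\<beta> \<bullet> \<alpha>) / (\<alpha> \<bullet> \<alpha>)"] that \<alpha> by (auto simp: \<pi>_def B_def)
    have 2: "\<pi> (w \<beta>) \<noteq> 0" if "\<beta> \<in> B - {\<gamma>}" for \<beta>
    proof -
      have "w \<beta> \<bullet> \<alpha> = 0" using \<gamma>(4) by (simp add: w_def inner_diff_left)
      then have "\<pi> (w \<beta>) = w \<beta>" by (simp add: \<pi>_def)
      moreover have "w \<beta> \<noteq> 0"
        using roots_B_nonparallel[of \<beta> \<gamma> "(\<beta> \<bullet> \<alpha>) / (\<gamma> \<bullet> \<alpha>)"] that \<gamma> by (auto simp: w_def B_def)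
      ultimately show ?thesis by simp
    qed
    assume "0 \<in> M"
    then show False using 1 2 unfolding M_def by (metis (no_types, lifting) Un_iff comp_apply imageE)
  qed
  have G_generic: "G x = 0" if x: "x \<in> ball 0 r" "\<forall>v\<in>M. v \<bullet> x \<noteq> 0" for x
  proof -
    \<comment> \<open>For s below e the foot of s x satisfies the norm bound of
      \<open>G_line\<close>; the added 1 keeps the denominator positive when x is a multiple of the
      normal.\<close>
    define e where "e = min 1 (r / (norm (\<pi> x) * (1 + k) + 1))"
    have den: "norm (\<pi> x) * (1 + k) + 1 > 0" using k by (simp add: add_nonneg_pos)
    have e: "e > 0" "e \<le> 1" using r den by (auto simp: e_def)
    have small: "G (0 + s *\<^sub>R x) = 0" if s: "0 < s" "s < e" for s
    proof -
      have "s * (norm (\<pi> x) * (1 + k) + 1) < r" using s den by (simp add: e_def pos_less_divide_eq)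
      then have n: "norm (s *\<^sub>R \<pi> x) * (1 + k) < r" using s(1) by (simp add: algebra_simps)
      have "norm (s *\<^sub>R x) \<le> norm x" using s e by (simp add: mult_left_le_one_le)
      then have "s *\<^sub>R x \<in> ball 0 r" using x(1) by simp
      moreover have eq: "s *\<^sub>R x = s *\<^sub>R \<pi> x + (s * ((x \<bullet> \<alpha>) / (\<alpha> \<bullet> \<alpha>))) *\<^sub>R \<alpha>" by (simp add: \<pi>_def algebra_simps)
      moreover have "\<beta> \<bullet> (s *\<^sub>R \<pi> x) \<noteq> 0" if "\<beta> \<in> B" for \<beta>
        using x(2) that s(1) by (auto simp: \<pi>_sym M_def)
      moreover have "w \<beta> \<bullet> (s *\<^sub>R \<pi> x) \<noteq> 0" if "\<beta> \<in> B - {\<gamma>}" for \<beta>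
        using x(2) that s(1) by (auto simp: \<pi>_sym M_def)
      ultimately have "G (s *\<^sub>R \<pi> x + (s * ((x \<bullet> \<alpha>) / (\<alpha> \<bullet> \<alpha>))) *\<^sub>R \<alpha>) = 0"
        using n by (intro G_line) (auto simp: \<pi>\<alpha>)
      then show ?thesis using eq by simp
    qed
    have "\<forall>\<^sub>F s in nhds (e / 2). s \<in> {0<..<e}" by (rule eventually_nhds_in_open) (use e in auto)
    then have "\<forall>\<^sub>F s in nhds (e / 2). G (0 + s *\<^sub>R x) = 0" by eventually_elim (use small in auto)
    moreover have "(e / 2) * norm x \<le> 1 * norm x" by (rule mult_right_mono) (use e in auto)
    then have "norm ((e / 2) *\<^sub>R x) \<le> norm x" using e by simp
    then have "0 + (e / 2) *\<^sub>R x \<in> ball 0 r" using x(1) by simp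
    ultimately have "G (0 + 1 *\<^sub>R x) = 0"
      using x(1) by (intro line_identity[of 0 x r "\<lambda>s. G (0 + s *\<^sub>R x)" "e / 2" 1] anG) auto
    then show ?thesis by simp
  qed
  have contG: "continuous_on (ball 0 r) G"
  proof -
    have "continuous_on (ball 0 r) (\<lambda>x. cleared (reflection \<alpha> x))"
      by (rule continuous_on_compose2[OF continuous_on_cleared]) (auto intro!: continuous_intros simp: norm_reflection[OF \<alpha>0])
    moreover have "continuous_on (ball 0 r) (\<lambda>x. root_prod (reflection \<alpha> x))"
      by (rule continuous_on_compose2[OF continuous_on_root_prod[of UNIV]]) (auto intro!: continuous_intros)
    ultimately show ?thesis unfolding G_def[abs_def] by (intro continuous_intros continuous_on_cleared continuous_on_root_prod)
  qed
  have "x \<in> ball 0 r" and xr: "\<And>\<beta>. \<beta> \<in> roots_B \<Longrightarrow> \<beta> \<bullet> x \<noteq> 0" using x by (auto simp: regular_set_def)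
  then have "G x = 0"
    using continuous_zero_of_generic_zero[OF \<open>finite M\<close> \<open>0 \<notin> M\<close> open_ball contG] G_generic by blast
  moreover have "cleared x = R x * root_prod x" by (rule cleared_eq) (rule xr)
  moreover have "cleared (reflection \<alpha> x) = R (reflection \<alpha> x) * root_prod (reflection \<alpha> x)"
    by (rule cleared_eq) (rule reflection_root_regular[OF \<alpha>(1) xr])
  ultimately have "(R (reflection \<alpha> x) - R x) * (root_prod (reflection \<alpha> x) * root_prod x) = 0"
    unfolding G_def by (simp add: algebra_simps)
  moreover have "root_prod x \<noteq> 0" "root_prod (reflection \<alpha> x) \<noteq> 0"
    using xr reflection_root_regular[OF \<alpha>(1) xr] by (auto simp: root_prod_zero_iff)
  ultimately show ?thesis by simp
qed

lemma reflection_regular_set: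
  assumes "\<alpha> \<in> roots_B" "x \<in> regular_set" shows "reflection \<alpha> x \<in> regular_set"
  using assms norm_reflection[OF roots_B_nonzero[OF assms(1)]] reflection_root_regular[OF assms(1)]
  by (auto simp: regular_set_def)

text \<open>Invariance is available on \<open>regular_set\<close> only, so the induction over
  generated elements also carries that the set is preserved. A reflection is its own inverse in the
  group.\<close>

lemma group_invariant:
  assumes H: "\<And>\<alpha>. \<alpha> \<in> H \<Longrightarrow> \<alpha> \<in> roots_B \<and> coef \<alpha> \<noteq> 0"
    and nb: "\<And>\<alpha>. \<alpha> \<in> H \<Longrightarrow> \<exists>\<gamma>\<in>H. \<gamma> \<noteq> \<alpha> \<and> \<gamma> \<bullet> \<alpha> \<noteq> 0"
    and g: "g \<in> reflection_group H" and x: "x \<in> regular_set"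
  shows "R (g x) = R x"
proof -
  have *: "\<forall>x\<in>regular_set. reflection \<alpha> x \<in> regular_set \<and> R (reflection \<alpha> x) = R x" if \<alpha>: "\<alpha> \<in> H" for \<alpha>
  proof -
    obtain \<gamma> where "\<gamma> \<in> H" "\<gamma> \<noteq> \<alpha>" "\<gamma> \<bullet> \<alpha> \<noteq> 0" using nb[OF \<alpha>] by blast
    then show ?thesis using wall_reflection_invariant[of \<alpha> \<gamma>] reflection_regular_set H[OF \<alpha>] H[of \<gamma>] by blast
  qed
  have inv_reflection: "inv\<^bsub>BijGroup UNIV\<^esub> (reflection \<alpha>) = reflection \<alpha>" if "\<alpha> \<in> H" for \<alpha>
  proof -
    have rr: "reflection \<alpha> (reflection \<alpha> x) = x" for x using H[OF that] roots_B_nonzero by (intro reflection_reflection) blast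
    have "bij (reflection \<alpha>)" using rr by (intro o_bij[of "reflection \<alpha>"]) (auto simp: fun_eq_iff)
    then have "reflection \<alpha> \<in> Bij UNIV" by (simp add: Bij_def extensional_def)
    then have "inv\<^bsub>BijGroup UNIV\<^esub> (reflection \<alpha>) = (\<lambda>x\<in>UNIV. inv_into UNIV (reflection \<alpha>) x)" by (rule inv_BijGroup)
    also have "\<dots> = reflection \<alpha>" using inv_unique_comp[of "reflection \<alpha>" "reflection \<alpha>"] rr by (auto simp: fun_eq_iff)
    finally show ?thesis .
  qed
  have carrier: "reflection \<alpha> \<in> carrier (BijGroup UNIV)" if "\<alpha> \<in> H" for \<alpha>
  proof -
    have rr: "reflection \<alpha> (reflection \<alpha> x) = x" for x using H[OF that] roots_B_nonzero by (intro reflection_reflection) blast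
    have "bij (reflection \<alpha>)" using rr by (intro o_bij[of "reflection \<alpha>"]) (auto simp: fun_eq_iff)
    then show ?thesis by (simp add: BijGroup_def Bij_def extensional_def)
  qed
  have "g \<in> carrier (BijGroup UNIV) \<and> (\<forall>x\<in>regular_set. g x \<in> regular_set \<and> R (g x) = R x)"
    using g unfolding reflection_group_def
  proof (induction rule: generate.induct)
    case one
    show ?case using bij_id[unfolded id_def] by (simp add: BijGroup_def Bij_def extensional_def)
  next
    case (incl h)
    then show ?case using * carrier by auto
  next
    case (inv h)
    then show ?case using * carrier inv_reflection by auto
  next
    case (eng g h)
    then have "g \<otimes>\<^bsub>BijGroup UNIV\<^esub> h \<in> carrier (BijGroup UNIV)"
      using group.is_monoid[OF group_BijGroup, THEN monoid.m_closed] by blast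
    moreover have "g \<otimes>\<^bsub>BijGroup UNIV\<^esub> h = g \<circ> h" using eng.IH by (auto simp: BijGroup_def compose_def)
    moreover have "\<forall>x\<in>regular_set. g (h x) \<in> regular_set \<and> R (g (h x)) = R x" using eng.IH by simp
    ultimately show ?case by (metis comp_apply)
  qed
  then show ?thesis using x by blast
qed

text \<open>Invariance of R compares two sums of double poles with different coefficients. By
  \<open>pole_coefficients_zero\<close> the coefficients agree wall by wall, which leaves the
  invariance of \<open>Rt\<close>.\<close>

lemma reflection_invariant_parts:
  assumes \<alpha>: "\<alpha> \<in> roots_B" and inv: "\<And>x. x \<in> regular_set \<Longrightarrow> R (reflection \<alpha> x) = R x"
  shows "x \<in> ball 0 r \<Longrightarrow> Rt (reflection \<alpha> x) = Rt x"
    and "\<beta> \<in> roots_B \<Longrightarrow> \<beta>' \<in> roots_B \<Longrightarrow> reflection \<alpha> \<beta> = \<beta>' \<or> reflection \<alpha> \<beta> = - \<beta>' \<Longrightarrow> coef \<beta>' = coef \<beta>"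
proof -
  interpret \<sigma>: linear "reflection \<alpha>" by (rule reflection_linear)
  have \<alpha>0: "\<alpha> \<noteq> 0" using roots_B_nonzero[OF \<alpha>] .
  \<comment> \<open>The action of the reflection on roots up to sign, an involution of
    \<open>roots_B\<close>.\<close>
  define \<rho> where "\<rho> \<beta> = (if reflection \<alpha> \<beta> \<in> roots_B then reflection \<alpha> \<beta> else - reflection \<alpha> \<beta>)" for \<beta>
  have \<rho>: "\<rho> \<beta> \<in> roots_B" if "\<beta> \<in> roots_B" for \<beta>
    using reflection_signed_roots[OF \<alpha>, of \<beta>] that by (auto simp: \<rho>_def signed_roots_def)
  have \<rho>\<rho>: "\<rho> (\<rho> \<beta>) = \<beta>" if "\<beta> \<in> roots_B" for \<beta>
    using that roots_B_not_both_signs by (auto simp: \<rho>_def reflection_reflection[OF \<alpha>0] \<sigma>.neg)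
  have \<rho>i: "(\<beta> \<bullet> reflection \<alpha> x)\<^sup>2 = (\<rho> \<beta> \<bullet> x)\<^sup>2" for \<beta> x
    by (simp add: inner_reflection \<rho>_def)
  define h where "h x = Rt (reflection \<alpha> x) - Rt x" for x
  have conth: "continuous_on (ball 0 r) h"
    unfolding h_def[abs_def]
    by (intro continuous_intros continuous_on_Rt continuous_on_compose2[OF continuous_on_Rt, of _ "reflection \<alpha>"])
       (auto simp: norm_reflection[OF \<alpha>0] intro!: continuous_intros)
  have eq: "(\<Sum>\<beta>\<in>roots_B. (coef (\<rho> \<beta>) - coef \<beta>) / of_real ((\<beta> \<bullet> x)\<^sup>2)) + h x = 0" if "x \<in> regular_set" for x
  proof -
    have "(\<Sum>\<beta>\<in>roots_B. coef \<beta> / of_real ((\<beta> \<bullet> reflection \<alpha> x)\<^sup>2)) = (\<Sum>\<beta>\<in>roots_B. coef (\<rho> \<beta>) / of_real ((\<beta> \<bullet> x)\<^sup>2))"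
      unfolding \<rho>i by (rule sum.reindex_bij_witness[of _ \<rho> \<rho>]) (auto simp: \<rho> \<rho>\<rho>)
    then show ?thesis using inv[OF that] unfolding R_eq h_def
      by (simp add: diff_divide_distrib sum_subtractf) (simp add: algebra_simps)
  qed
  have c: "coef (\<rho> \<beta>) - coef \<beta> = 0" if "\<beta> \<in> roots_B" for \<beta>
    by (rule pole_coefficients_zero[OF r conth eq that]) (simp add: regular_set_def)
  have "h x = 0" if "x \<in> ball 0 r" for x
  proof (rule continuous_zero_of_generic_zero[OF finite_roots_B _ open_ball conth _ that])
    show "0 \<notin> roots_B" using roots_B_nonzero by blast
    fix x :: "(real, 'n) vec" assume "x \<in> ball 0 r" "\<forall>v\<in>roots_B. v \<bullet> x \<noteq> 0"
    then show "h x = 0" using eq[of x] c by (simp add: regular_set_def)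
  qed
  then show "Rt (reflection \<alpha> x) = Rt x" if "x \<in> ball 0 r" using that by (simp add: h_def)
  show "coef \<beta>' = coef \<beta>" if "\<beta> \<in> roots_B" "\<beta>' \<in> roots_B" "reflection \<alpha> \<beta> = \<beta>' \<or> reflection \<alpha> \<beta> = - \<beta>'"
  proof -
    have "\<rho> \<beta> = \<beta>'" using that(2,3) roots_B_not_both_signs[OF that(2)] by (auto simp: \<rho>_def)
    then show ?thesis using c[OF that(1)] by simp
  qed
qed

end

subsection \<open>Splitting a function along coordinate projections\<close>

lemma constant_of_dd_zero:
  fixes g :: "(real, 'n::finite) vec \<Rightarrow> complex"
  assumes "\<And>x. x \<in> ball 0 r \<Longrightarrow> g differentiable (at x)" "\<And>x v. x \<in> ball 0 r \<Longrightarrow> dd v g x = 0"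
    and "x \<in> ball 0 r" "y \<in> ball 0 r"
  shows "g x = g y"
proof (rule has_derivative_zero_unique[of "ball 0 r" g])
  fix x :: "(real, 'n) vec" assume "x \<in> ball 0 r"
  then have "(g has_derivative (\<lambda>v. dd v g x)) (at x within ball 0 r)"
    by (rule has_derivative_at_withinI[OF has_derivative_dd[OF assms(1)]])
  then show "(g has_derivative (\<lambda>h. 0)) (at x within ball 0 r)" by (simp only: assms(2)[OF \<open>x \<in> ball 0 r\<close>])
qed (use assms in auto)

lemma constant_on_segment:
  fixes g :: "(real, 'n::finite) vec \<Rightarrow> complex"
  assumes "\<And>x. x \<in> ball 0 r \<Longrightarrow> g differentiable (at x)" "\<And>z. z \<in> ball 0 r \<Longrightarrow> dd (y - x) g z = 0"
    and "x \<in> ball 0 r" "y \<in> ball 0 r"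
  shows "g x = g y"
proof -
  have "g (x + 0 *\<^sub>R (y - x)) = g (x + 1 *\<^sub>R (y - x))"
  proof (rule has_derivative_zero_unique[of "{0..1::real}" "\<lambda>t. g (x + t *\<^sub>R (y - x))"])
    fix t :: real assume t: "t \<in> {0..1}"
    have "(1 - t) *\<^sub>R x + t *\<^sub>R y \<in> ball 0 r" using assms(3,4) t by (intro convexD[OF convex_ball]) auto
    then have z: "x + t *\<^sub>R (y - x) \<in> ball 0 r" by (simp add: algebra_simps)
    then have "((\<lambda>t. g (x + t *\<^sub>R (y - x))) has_vector_derivative 0) (at t)"
      using has_vector_derivative_line[OF assms(1)[OF z]] assms(2)[OF z] by simp
    then show "((\<lambda>t. g (x + t *\<^sub>R (y - x))) has_derivative (\<lambda>h. 0)) (at t within {0..1})"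
      unfolding has_vector_derivative_def by (simp add: has_derivative_at_withinI)
  qed auto
  then show ?thesis by simp
qed

lemma dd_comp_linear:
  assumes "linear \<tau>" "g differentiable (at (\<tau> x))"
  shows "dd v (\<lambda>x. g (\<tau> x)) x = dd (\<tau> v) g (\<tau> x)" "(\<lambda>x. g (\<tau> x)) differentiable (at x)"
proof -
  have "((g \<circ> \<tau>) has_derivative (\<lambda>w. dd w g (\<tau> x)) \<circ> \<tau>) (at x)"
    by (rule diff_chain_at[OF linear_imp_has_derivative[OF assms(1)] has_derivative_dd[OF assms(2)]])
  then have *: "((\<lambda>x. g (\<tau> x)) has_derivative (\<lambda>v. dd (\<tau> v) g (\<tau> x))) (at x)" by (simp add: o_def)
  show "dd v (\<lambda>x. g (\<tau> x)) x = dd (\<tau> v) g (\<tau> x)" by (rule dd_eq[OF *])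
  show "(\<lambda>x. g (\<tau> x)) differentiable (at x)" using * by (rule differentiableI)
qed

text \<open>As the mixed second derivatives between different summands vanish, the derivative of F
  along P m v depends on P m x alone. Hence F minus the sum of its restrictions has zero gradient;
  the constant is found at 0.\<close>

lemma split_by_projections:
  fixes P :: "'m \<Rightarrow> (real, 'n::finite) vec \<Rightarrow> (real, 'n) vec"
  assumes M: "finite M" and lin: "\<And>m. m \<in> M \<Longrightarrow> linear (P m)"
    and ball: "\<And>m x. m \<in> M \<Longrightarrow> x \<in> ball 0 r \<Longrightarrow> P m x \<in> ball 0 r" and sum: "\<And>x. (\<Sum>m\<in>M. P m x) = x"
    and d1: "\<And>x. x \<in> ball 0 r \<Longrightarrow> F differentiable (at x)"
    and d2: "\<And>v x. x \<in> ball 0 r \<Longrightarrow> dd v F differentiable (at x)"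
    and mixed: "\<And>m l v w x. m \<in> M \<Longrightarrow> l \<in> M \<Longrightarrow> l \<noteq> m \<Longrightarrow> x \<in> ball 0 r \<Longrightarrow> dd (P l w) (dd (P m v) F) x = 0"
    and x: "x \<in> ball 0 r"
  shows "F x = (\<Sum>m\<in>M. F (P m x)) + (1 - of_nat (card M)) * F 0"
proof -
  define G where "G x = F x - (\<Sum>m\<in>M. F (P m x))" for x
  have P0: "P m 0 = 0" if "m \<in> M" for m by (rule linear_0[OF lin[OF that]])
  have dP: "(\<lambda>x. F (P m x)) differentiable (at x)" if "m \<in> M" "x \<in> ball 0 r" for m x
    by (rule dd_comp_linear(2)[OF lin[OF that(1)] d1[OF ball[OF that]]])
  have dG: "G differentiable (at x)" if "x \<in> ball 0 r" for x
    unfolding G_def[abs_def] by (intro differentiable_diff d1 differentiable_sum ballI dP that M)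
  have "dd v G x = 0" if x: "x \<in> ball 0 r" for v x
  proof -
    have "dd v G x = dd v F x - (\<Sum>m\<in>M. dd (P m v) F (P m x))"
      unfolding G_def[abs_def] using x dP d1 M ball
      by (subst dd_diff) (auto intro!: differentiable_sum sum.cong simp: dd_sum dd_comp_linear(1)[OF lin])
    also have "dd v F x = (\<Sum>m\<in>M. dd (P m v) F x)" unfolding dd_sum_left[symmetric] sum ..
    also have "\<dots> = (\<Sum>m\<in>M. dd (P m v) F (P m x))"
    proof (rule sum.cong[OF refl])
      fix m assume m: "m \<in> M"
      have "dd (P m v) F (P m x) = dd (P m v) F x"
      proof (rule constant_on_segment[OF d2 _ ball[OF m x] x])
        fix z :: "(real, 'n) vec" assume z: "z \<in> ball 0 r"
        have "x - P m x = (\<Sum>l\<in>M - {m}. P l x)" using sum[of x] sum.remove[OF M m, of "\<lambda>l. P l x"] by (metis add_diff_cancel_left')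
        then show "dd (x - P m x) (dd (P m v) F) z = 0"
          using mixed[OF m _ _ z] by (simp add: dd_sum_left)
      qed
      then show "dd (P m v) F x = dd (P m v) F (P m x)" ..
    qed
    finally show ?thesis by simp
  qed
  then have "G x = G 0" using constant_of_dd_zero[of r G x 0] dG x by (metis centre_in_ball ball_eq_empty empty_iff not_le)
  then show ?thesis using P0 by (simp add: G_def algebra_simps)
qed

subsection \<open>Symmetries\<close>

definition symmetry :: "(real, 'n::finite) vec set \<Rightarrow> ((real, 'n) vec \<Rightarrow> complex) \<Rightarrow> ((real, 'n) vec \<Rightarrow> (real, 'n) vec) \<Rightarrow> bool"
  where "symmetry \<Omega> f \<tau> \<longleftrightarrow> linear \<tau> \<and> (\<forall>x\<in>\<Omega>. \<tau> x \<in> \<Omega> \<and> f (\<tau> x) = f x)"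

lemma symmetry_comp: "symmetry \<Omega> f \<tau> \<Longrightarrow> symmetry \<Omega> f \<tau>' \<Longrightarrow> symmetry \<Omega> f (\<lambda>x. \<tau> (\<tau>' x))"
  unfolding symmetry_def using linear_compose[of \<tau>' \<tau>] by (auto simp: o_def)

lemma symmetry_reflection:
  assumes "\<alpha> \<noteq> 0" "\<And>x. x \<in> ball 0 r \<Longrightarrow> f (reflection \<alpha> x) = f x"
  shows "symmetry (ball 0 r) f (reflection \<alpha>)"
  using assms by (simp add: symmetry_def reflection_linear norm_reflection)

context
  fixes \<Omega> :: "(real, 'n::finite) vec set" and f \<tau>
  assumes op: "open \<Omega>" and la: "line_analytic \<Omega> f" and \<tau>: "symmetry \<Omega> f \<tau>"
begin

lemma symmetry_dd_step:
  assumes "\<And>x. x \<in> \<Omega> \<Longrightarrow> g x = h (\<tau> x)" "line_analytic \<Omega> h" "x \<in> \<Omega>"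
  shows "dd v g x = dd (\<tau> v) h (\<tau> x)"
proof -
  have "dd v g x = dd v (\<lambda>x. h (\<tau> x)) x" by (rule dd_cong[OF op assms(3,1)])
  also have "\<dots> = dd (\<tau> v) h (\<tau> x)"
    using \<tau> assms by (intro dd_comp_linear(1) line_analytic_differentiable[OF assms(2)]) (auto simp: symmetry_def)
  finally show ?thesis .
qed

lemma symmetry_dd: "x \<in> \<Omega> \<Longrightarrow> dd v f x = dd (\<tau> v) f (\<tau> x)"
  by (rule symmetry_dd_step[OF _ la]) (use \<tau> in \<open>auto simp: symmetry_def\<close>)

lemma symmetry_dd2: "x \<in> \<Omega> \<Longrightarrow> dd w (dd v f) x = dd (\<tau> w) (dd (\<tau> v) f) (\<tau> x)"
  by (rule symmetry_dd_step[OF symmetry_dd line_analytic_dd[OF op la]])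

lemma symmetry_dd3: "x \<in> \<Omega> \<Longrightarrow> dd u (dd w (dd v f)) x = dd (\<tau> u) (dd (\<tau> w) (dd (\<tau> v) f)) (\<tau> x)"
  by (rule symmetry_dd_step[OF symmetry_dd2 line_analytic_dd[OF op line_analytic_dd[OF op la]]])

end

subsection \<open>Differential equations for the regular part of the potential\<close>

lemma dd_pole_function:
  assumes "\<And>y. \<beta> \<bullet> y \<noteq> 0 \<Longrightarrow> g y = c / of_real ((\<beta> \<bullet> y) ^ k)" "\<beta> \<bullet> x \<noteq> 0"
  shows "dd v g x = (- of_nat k * c * of_real (\<beta> \<bullet> v)) / of_real ((\<beta> \<bullet> x) ^ Suc k)"
proof -
  have "open {x. \<beta> \<bullet> x \<noteq> 0}" by (intro open_Collect_neq continuous_intros)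
  then have "dd v g x = dd v (\<lambda>y. c / of_real ((\<beta> \<bullet> y) ^ k)) x" by (rule dd_cong) (use assms in auto)
  then show ?thesis unfolding dd_eq[OF dd_pole[OF assms(2)]] .
qed

lemma pderiv4_pole:
  assumes "\<beta> \<bullet> x \<noteq> 0"
  shows "pderiv_at i (pderiv_at j (pderiv_at k (pderiv_at l (\<lambda>x. c / of_real ((\<beta> \<bullet> x)\<^sup>2))))) x
    = 120 * c * of_real (\<beta> $ i * \<beta> $ j * \<beta> $ k * \<beta> $ l) / of_real ((\<beta> \<bullet> x) ^ 6)"
proof -
  let ?g = "\<lambda>x. c / complex_of_real ((\<beta> \<bullet> x)\<^sup>2)"
  define c1 where "c1 = - of_nat 2 * c * of_real (\<beta> \<bullet> stdvec l)"
  define c2 where "c2 = - of_nat (Suc 2) * c1 * of_real (\<beta> \<bullet> stdvec k)"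
  define c3 where "c3 = - of_nat (Suc (Suc 2)) * c2 * of_real (\<beta> \<bullet> stdvec j)"
  have s1: "dd (stdvec l) ?g y = c1 / of_real ((\<beta> \<bullet> y) ^ Suc 2)" if "\<beta> \<bullet> y \<noteq> 0" for y
    unfolding c1_def by (rule dd_pole_function[OF refl that])
  have s2: "dd (stdvec k) (dd (stdvec l) ?g) y = c2 / of_real ((\<beta> \<bullet> y) ^ Suc (Suc 2))" if "\<beta> \<bullet> y \<noteq> 0" for y
    unfolding c2_def by (rule dd_pole_function[OF s1 that])
  have s3: "dd (stdvec j) (dd (stdvec k) (dd (stdvec l) ?g)) y = c3 / of_real ((\<beta> \<bullet> y) ^ Suc (Suc (Suc 2)))" if "\<beta> \<bullet> y \<noteq> 0" for y
    unfolding c3_def by (rule dd_pole_function[OF s2 that])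
  have "dd (stdvec i) (dd (stdvec j) (dd (stdvec k) (dd (stdvec l) ?g))) x
    = (- of_nat (Suc (Suc (Suc 2))) * c3 * of_real (\<beta> \<bullet> stdvec i)) / of_real ((\<beta> \<bullet> x) ^ Suc (Suc (Suc (Suc 2))))"
    by (rule dd_pole_function[OF s3 assms])
  moreover have "Suc (Suc (Suc (Suc 2))) = 6" by simp
  moreover have "dd (stdvec m) = pderiv_at m" for m :: 'a by (simp add: fun_eq_iff)
  ultimately show ?thesis by (simp add: c1_def c2_def c3_def mult_ac)
qed

context quartic_potential
begin

lemma open_regular_set: "open regular_set"
proof -
  have "open (ball 0 r \<inter> (\<Inter>\<beta>\<in>roots_B. {x. \<beta> \<bullet> x \<noteq> 0}))"
    by (intro open_Int open_INT open_ball ballI open_Collect_neq continuous_intros finite_roots_B)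
  also have "ball 0 r \<inter> (\<Inter>\<beta>\<in>roots_B. {x. \<beta> \<bullet> x \<noteq> 0}) = regular_set" by (auto simp: regular_set_def)
  finally show ?thesis .
qed

lemma jet_R:
  assumes x: "x \<in> regular_set"
  shows "jet R {#i,j,k,l#} x
    = (\<Sum>\<beta>\<in>roots_B. 120 * coef \<beta> * of_real (\<beta> $ i * \<beta> $ j * \<beta> $ k * \<beta> $ l) / of_real ((\<beta> \<bullet> x) ^ 6)) + jet Rt {#i,j,k,l#} x"
proof -
  note op = open_regular_set
  have laRt': "line_analytic regular_set Rt" using laRt by (rule line_analytic_subset) (auto simp: regular_set_def)
  have lap: "line_analytic regular_set (\<lambda>x. coef \<beta> / of_real ((\<beta> \<bullet> x)\<^sup>2))" if "\<beta> \<in> roots_B" for \<beta>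
    by (rule line_analytic_pole[OF op]) (use that in \<open>auto simp: regular_set_def\<close>)
  have las: "line_analytic regular_set (\<lambda>x. \<Sum>\<beta>\<in>roots_B. coef \<beta> / of_real ((\<beta> \<bullet> x)\<^sup>2))"
    by (rule line_analytic_sum[OF op]) (rule lap)
  have "R = (\<lambda>x. (\<Sum>\<beta>\<in>roots_B. coef \<beta> / of_real ((\<beta> \<bullet> x)\<^sup>2)) + Rt x)" using R_eq by blast
  then have "jet R {#i,j,k,l#} x = jet (\<lambda>x. \<Sum>\<beta>\<in>roots_B. coef \<beta> / of_real ((\<beta> \<bullet> x)\<^sup>2)) {#i,j,k,l#} x + jet Rt {#i,j,k,l#} x"
    using jet_add[OF op las laRt' x] by simp
  also have "jet (\<lambda>x. \<Sum>\<beta>\<in>roots_B. coef \<beta> / of_real ((\<beta> \<bullet> x)\<^sup>2)) {#i,j,k,l#} x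
    = (\<Sum>\<beta>\<in>roots_B. jet (\<lambda>x. coef \<beta> / of_real ((\<beta> \<bullet> x)\<^sup>2)) {#i,j,k,l#} x)"
    by (rule jet_sum1[OF op lap x])
  also have "\<dots> = (\<Sum>\<beta>\<in>roots_B. 120 * coef \<beta> * of_real (\<beta> $ i * \<beta> $ j * \<beta> $ k * \<beta> $ l) / of_real ((\<beta> \<bullet> x) ^ 6))"
    using x unfolding regular_set_def
    by (intro sum.cong refl) (subst jet_eq_pderiv4[OF op lap x, symmetric], simp, rule pderiv4_pole, simp)
  finally show ?thesis .
qed

lemma regular_set_subset: "regular_set \<subseteq> regular_domain r {\<beta> \<in> roots_B. coef \<beta> \<noteq> 0}"
  by (auto simp: regular_set_def regular_domain_def hyperplane_def)

lemma zero_on_ball: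
  fixes F :: "(real, 'n) vec \<Rightarrow> complex"
  assumes "line_analytic (ball 0 r) F" "\<And>x. x \<in> regular_set \<Longrightarrow> F x = 0" "x \<in> ball 0 r"
  shows "F x = 0"
proof (rule continuous_zero_of_generic_zero[OF finite_roots_B _ open_ball _ _ assms(3)])
  show "continuous_on (ball 0 r) F"
    using line_analytic_differentiable[OF assms(1)] differentiable_imp_continuous_within
    by (intro continuous_at_imp_continuous_on) blast
qed (use assms(2) roots_B_nonzero in \<open>auto simp: regular_set_def\<close>)

text \<open>Each pole satisfies the equation by itself, since an entry of a root is 0, 1 or -1 and
  so equals its cube. Subtracting the poles leaves the equation for \<open>Rt\<close> off the walls,
  and continuity extends it.\<close>

lemma Rt_wave:
  assumes "x \<in> ball 0 r" "i \<noteq> j"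
  shows "jet Rt {#i,j,j,j#} x = jet Rt {#j,i,i,i#} x"
proof -
  have "jet Rt {#i,j,j,j#} x - jet Rt {#j,i,i,i#} x = 0"
  proof (rule zero_on_ball[OF _ _ assms(1)])
    show "line_analytic (ball 0 r) (\<lambda>x. jet Rt {#i,j,j,j#} x - jet Rt {#j,i,i,i#} x)"
      by (intro line_analytic_diff[OF open_ball] line_analytic_jet laRt)
    fix x assume x: "x \<in> regular_set"
    have "\<beta> $ i * \<beta> $ j * \<beta> $ j * \<beta> $ j = \<beta> $ j * \<beta> $ i * \<beta> $ i * \<beta> $ i" if "\<beta> \<in> roots_B" for \<beta> :: "(real, 'n) vec"
      using that by (cases rule: roots_B_cases) (auto simp: stdvec_nth)
    then have "(\<Sum>\<beta>\<in>roots_B. 120 * coef \<beta> * of_real (\<beta> $ i * \<beta> $ j * \<beta> $ j * \<beta> $ j) / of_real ((\<beta> \<bullet> x) ^ 6))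
      = (\<Sum>\<beta>\<in>roots_B. 120 * coef \<beta> * of_real (\<beta> $ j * \<beta> $ i * \<beta> $ i * \<beta> $ i) / of_real ((\<beta> \<bullet> x) ^ 6))"
      by (intro sum.cong refl) (simp only:)
    then show "jet Rt {#i,j,j,j#} x - jet Rt {#j,i,i,i#} x = 0"
      using jet_wave[OF subsetD[OF regular_set_subset x] assms(2)] unfolding jet_R[OF x] by (simp only: add_left_cancel diff_self)
  qed
  then show ?thesis by simp
qed

text \<open>A root has at most two nonzero coordinates, so no pole contributes.\<close>

lemma Rt_mixed3:
  assumes "x \<in> ball 0 r" "i \<noteq> j" "j \<noteq> k" "i \<noteq> k"
  shows "jet Rt {#i,j,k,l#} x = 0"
proof (rule zero_on_ball[OF _ _ assms(1)])
  show "line_analytic (ball 0 r) (jet Rt {#i,j,k,l#})" by (intro line_analytic_jet laRt)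
  fix x assume x: "x \<in> regular_set"
  have "\<beta> $ i * \<beta> $ j * \<beta> $ k * \<beta> $ l = 0" if "\<beta> \<in> roots_B" for \<beta> :: "(real, 'n) vec"
    using that assms by (cases rule: roots_B_cases) (auto simp: stdvec_nth)
  then have "(\<Sum>\<beta>\<in>roots_B. 120 * coef \<beta> * of_real (\<beta> $ i * \<beta> $ j * \<beta> $ k * \<beta> $ l) / of_real ((\<beta> \<bullet> x) ^ 6)) = 0"
    by (intro sum.neutral ballI) (simp only: of_real_0 mult_zero_right div_0)
  then show "jet Rt {#i,j,k,l#} x = 0"
    using jet_mixed3[OF subsetD[OF regular_set_subset x] assms(2-4), of l] unfolding jet_R[OF x] by (simp only: add_0)
qed

text \<open>All derivatives of this third derivative vanish by \<open>Rt_mixed3\<close>, so it is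
  constant. At the fixed point 0 of \<tau> it changes sign under the flip of coordinate k, so the
  constant is zero.\<close>

lemma Rt_third_mixed:
  assumes "i \<noteq> j" "j \<noteq> k" "i \<noteq> k" and x: "x \<in> ball 0 r"
    and \<tau>: "symmetry (ball 0 r) Rt \<tau>" "\<tau> (stdvec i) = stdvec i" "\<tau> (stdvec j) = stdvec j" "\<tau> (stdvec k) = - stdvec k"
  shows "dd (stdvec i) (dd (stdvec j) (dd (stdvec k) Rt)) x = 0"
proof -
  let ?F = "dd (stdvec i) (dd (stdvec j) (dd (stdvec k) Rt))"
  have pd: "dd (stdvec m) = pderiv_at m" for m :: 'n by (simp add: fun_eq_iff)
  have laF: "line_analytic (ball 0 r) ?F" by (intro line_analytic_dd[OF open_ball] laRt)
  have "dd v ?F x = 0" if "x \<in> ball 0 r" for v x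
  proof -
    have "pderiv_at l ?F x = 0" for l
      unfolding pd jet_eq_pderiv4[OF open_ball laRt that] using Rt_mixed3[OF that assms(1-3), of l]
      by (simp add: add_mset_commute)
    then show ?thesis by (simp add: dd_def)
  qed
  then have "?F x = ?F 0"
    using constant_of_dd_zero[of r ?F x 0] line_analytic_differentiable[OF laF] x r by simp
  also have "?F 0 = 0"
  proof -
    have "dd (- stdvec k) Rt = (\<lambda>x. (- 1) * dd (stdvec k) Rt x)" by (simp add: fun_eq_iff dd_minus_left)
    then have 1: "dd (stdvec j) (dd (- stdvec k) Rt) y = - dd (stdvec j) (dd (stdvec k) Rt) y" if "y \<in> ball 0 r" for y
      using dd_cmult[OF line_analytic_differentiable[OF line_analytic_dd[OF open_ball laRt] that], of "stdvec j" "-1" "stdvec k"] by simp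
    have z: "(0 :: (real, 'n) vec) \<in> ball 0 r" using r by simp
    have "dd (stdvec i) (dd (stdvec j) (dd (- stdvec k) Rt)) 0 = dd (stdvec i) (\<lambda>y. - dd (stdvec j) (dd (stdvec k) Rt) y) 0"
      by (rule dd_cong[OF open_ball z 1])
    also have "\<dots> = - ?F 0"
      by (rule dd_minus[OF line_analytic_differentiable[OF line_analytic_dd[OF open_ball line_analytic_dd[OF open_ball laRt]] z]])
    finally have "?F 0 = - ?F 0"
      using symmetry_dd3[OF open_ball laRt \<tau>(1), of 0 "stdvec i" "stdvec j" "stdvec k"] r \<tau>(1)
      by (simp add: \<tau>(2-4) symmetry_def linear_0)
    then show ?thesis by simp
  qed
  finally show ?thesis .
qed

end

subsection \<open>The mixed second derivatives\<close>

lemma pair_connected: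
  assumes sym: "\<And>i j. i \<noteq> j \<Longrightarrow> Q i j = Q j i" and move: "\<And>i j k. i \<noteq> j \<Longrightarrow> i \<noteq> k \<Longrightarrow> j \<noteq> k \<Longrightarrow> Q i j = Q i k"
    and "i \<noteq> j" "k \<noteq> l"
  shows "Q i j = Q k l"
proof -
  have m: "Q i j = Q i k" if "i \<noteq> j" "i \<noteq> k" for i j k
  proof (cases "j = k")
    case False
    show ?thesis by (rule move[OF that False])
  qed simp
  show ?thesis
  proof (cases "i = k")
    case True
    then show ?thesis using m[of i j l] assms(3,4) by (simp only: simp_thms)
  next
    case False
    have "Q i j = Q i k" by (rule m[OF assms(3) False])
    also have "\<dots> = Q k i" by (rule sym[OF False])
    also have "\<dots> = Q k l" by (rule m[OF False[symmetric] assms(4)])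
    finally show ?thesis .
  qed
qed

lemma reflection_minus: "reflection (- \<alpha>) = reflection \<alpha>"
  by (simp add: reflection_def fun_eq_iff)

lemma reflection_diff_stdvec:
  assumes "a \<noteq> b"
  shows "reflection (stdvec a - stdvec b) (stdvec k) = stdvec (if k = a then b else if k = b then a else k)"
proof -
  have "(stdvec a - stdvec b) \<bullet> (stdvec a - stdvec b) = 2" using assms by (simp add: inner_diff_left inner_diff_right stdvec_nth)
  then show ?thesis using assms by (auto simp: reflection_def stdvec_nth)
qed

lemma reflection_add_stdvec:
  assumes "a \<noteq> b"
  shows "reflection (stdvec a + stdvec b) (stdvec k) = (if k = a then - stdvec b else if k = b then - stdvec a else stdvec k)"
proof -
  have "(stdvec a + stdvec b) \<bullet> (stdvec a + stdvec b) = 2" using assms by (simp add: inner_add_left inner_add_right stdvec_nth)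
  then show ?thesis using assms by (auto simp: reflection_def stdvec_nth)
qed

lemma reflection_single_stdvec: "reflection (stdvec a) (stdvec k) = (if k = a then - stdvec a else stdvec k)"
proof -
  have "stdvec a \<bullet> stdvec a = 1" by (simp add: stdvec_nth)
  then show ?thesis by (auto simp: reflection_def stdvec_nth scaleR_2)
qed

lemma norm_le_of_inner:
  assumes "y \<bullet> y = y \<bullet> x" shows "norm y \<le> norm x"
proof -
  have "norm y * norm y \<le> norm y * norm x"
    using assms by (metis norm_cauchy_schwarz power2_norm_eq_inner power2_eq_square)
  then show ?thesis by (cases "norm y = 0") auto
qed

text \<open>T stands for the roots that define the reflection group, of type B or D. The singular
  vectors need only generate that group, so a root of T may have coefficient zero.\<close>

locale symmetric_potential = quartic_potential r coef Rt R s b a0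
  for r :: real and coef :: "(real, 'n::{finite,linorder}) vec \<Rightarrow> complex" and Rt R s b a0 +
  fixes T :: "(real, 'n) vec set"
  assumes TB: "T \<subseteq> roots_B" and DT: "roots_D \<subseteq> T" and type: "T = roots_B \<or> CARD('n) \<ge> 4" and card2: "CARD('n) \<ge> 2"
    and inv: "\<And>\<alpha> x. \<alpha> \<in> T \<Longrightarrow> x \<in> regular_set \<Longrightarrow> R (reflection \<alpha> x) = R x"
begin

lemma diff_signed: "p \<noteq> q \<Longrightarrow> stdvec p - stdvec q \<in> T \<or> - (stdvec p - stdvec q) \<in> T"
  using DT by (cases p q rule: linorder_cases) (auto simp: roots_D_def)

lemma add_signed:
  assumes "p \<noteq> q" shows "stdvec p + stdvec q \<in> T"
proof -
  have D: "stdvec i + stdvec j \<in> T" if "i < j" for i j using that DT by (auto simp: roots_D_def)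
  show ?thesis
  proof (cases "p < q")
    case False
    then have "stdvec q + stdvec p \<in> T" using assms by (intro D) simp
    then show ?thesis by (subst add.commute)
  qed (rule D)
qed

lemma Rt_symmetry: "\<alpha> \<in> T \<or> - \<alpha> \<in> T \<Longrightarrow> symmetry (ball 0 r) Rt (reflection \<alpha>)"
proof (rule symmetry_reflection)
  assume \<alpha>: "\<alpha> \<in> T \<or> - \<alpha> \<in> T"
  show "\<alpha> \<noteq> 0" using \<alpha> TB roots_B_nonzero by fastforce
  fix x :: "(real, 'n) vec" assume x: "x \<in> ball 0 r"
  show "Rt (reflection \<alpha> x) = Rt x"
    using \<alpha>
  proof
    assume a: "\<alpha> \<in> T"
    show ?thesis by (rule reflection_invariant_parts(1)[OF subsetD[OF TB a] inv[OF a] x])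
  next
    assume a: "- \<alpha> \<in> T"
    have "Rt (reflection (- \<alpha>) x) = Rt x" by (rule reflection_invariant_parts(1)[OF subsetD[OF TB a] inv[OF a] x])
    then show ?thesis by (simp only: reflection_minus)
  qed
qed

lemma swap_symmetry: "p \<noteq> q \<Longrightarrow> symmetry (ball 0 r) Rt (reflection (stdvec p - stdvec q))"
  by (intro Rt_symmetry diff_signed)

text \<open>A single sign change is not in the group of type D. There the reflections in e_k + e_l
  and e_k - e_l together change the signs of coordinates k and l, and an index l outside i, j, k
  exists because n is at least 4.\<close>

lemma flip_symmetry:
  assumes "k \<noteq> i" "k \<noteq> j"
  obtains \<tau> where "symmetry (ball 0 r) Rt \<tau>" "\<tau> (stdvec i) = stdvec i" "\<tau> (stdvec j) = stdvec j" "\<tau> (stdvec k) = - stdvec k"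
proof (cases "T = roots_B")
  case True
  then have "symmetry (ball 0 r) Rt (reflection (stdvec k))" by (intro Rt_symmetry) (simp add: roots_B_def)
  then show ?thesis using assms by (intro that[of "reflection (stdvec k)"]) (auto simp: reflection_single_stdvec)
next
  case False
  have "card {i, j, k} < CARD('n)" using False type card_insert_le_m1[of 3 "{j, k}" i] card_insert_le_m1[of 2 "{k}" j] by auto
  then obtain l where l: "l \<notin> {i, j, k}" by (metis UNIV_eq_I less_irrefl)
  have h1: "symmetry (ball 0 r) Rt (reflection (stdvec k - stdvec l))" by (rule swap_symmetry) (use l in auto)
  have h2: "symmetry (ball 0 r) Rt (reflection (stdvec k + stdvec l))" by (rule Rt_symmetry[OF disjI1[OF add_signed]]) (use l in auto)
  interpret \<sigma>: linear "reflection (stdvec k - stdvec l)" by (rule reflection_linear)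
  show ?thesis
  proof (rule that)
    show "symmetry (ball 0 r) Rt (\<lambda>x. reflection (stdvec k - stdvec l) (reflection (stdvec k + stdvec l) x))"
      by (rule symmetry_comp[OF h1 h2])
  qed (use assms l in \<open>auto simp: reflection_add_stdvec reflection_diff_stdvec \<sigma>.neg\<close>)
qed

text \<open>Extended to opposite roots, the coefficient becomes a function invariant under
  reflections without any case distinction on signs.\<close>

definition signed_coef :: "(real, 'n) vec \<Rightarrow> complex"
  where "signed_coef v = coef (if v \<in> roots_B then v else - v)"

lemma signed_coef_minus: "v \<in> signed_roots \<Longrightarrow> signed_coef (- v) = signed_coef v"
  using roots_B_not_both_signs by (auto simp: signed_coef_def signed_roots_def)

lemma signed_coef_reflection:
  assumes "\<alpha> \<in> T \<or> - \<alpha> \<in> T" "v \<in> signed_roots"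
  shows "signed_coef (reflection \<alpha> v) = signed_coef v"
proof -
  have *: "signed_coef (reflection \<alpha> v) = signed_coef v" if \<alpha>: "\<alpha> \<in> T" and v: "v \<in> roots_B" for \<alpha> v
  proof -
    have "reflection \<alpha> v \<in> signed_roots" using \<alpha> v TB by (intro reflection_signed_roots) (auto simp: signed_roots_def)
    then obtain w where w: "w \<in> roots_B" "reflection \<alpha> v = w \<or> reflection \<alpha> v = - w" by (auto simp: signed_roots_def)
    then have "coef w = coef v" using reflection_invariant_parts(2)[OF subsetD[OF TB \<alpha>] inv[OF \<alpha>] v w] by blast
    then show ?thesis using w v roots_B_not_both_signs[OF w(1)] by (auto simp: signed_coef_def)
  qed
  obtain \<alpha>' where \<alpha>': "\<alpha>' \<in> T" "reflection \<alpha> = reflection \<alpha>'" 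
  proof (cases "\<alpha> \<in> T")
    case False
    then show ?thesis using that[of "- \<alpha>"] assms(1) by (simp add: reflection_minus)
  qed (rule that, simp_all)
  interpret \<sigma>: linear "reflection \<alpha>'" by (rule reflection_linear)
  from assms(2) consider "v \<in> roots_B" | w where "w \<in> roots_B" "v = - w" by (auto simp: signed_roots_def)
  then show ?thesis
  proof cases
    case 2
    have w: "w \<in> signed_roots" using 2 by (simp add: signed_roots_def)
    moreover have "reflection \<alpha>' w \<in> signed_roots" by (rule reflection_signed_roots[OF subsetD[OF TB \<alpha>'(1)] w])
    ultimately show ?thesis using *[OF \<alpha>'(1) 2(1)] by (simp add: 2 \<alpha>'(2) \<sigma>.neg signed_coef_minus)
  qed (use * \<alpha>' in auto)
qed

lemma signed_roots_pairs: "p \<noteq> q \<Longrightarrow> stdvec p + stdvec q \<in> signed_roots" "p \<noteq> q \<Longrightarrow> stdvec p - stdvec q \<in> signed_roots"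
  using signed_roots_pair[of p q 1 1] signed_roots_pair[of p q 1 "-1"] by auto

lemma coef_plus:
  assumes "i \<noteq> j" "k \<noteq> l"
  shows "signed_coef (stdvec i + stdvec j) = signed_coef (stdvec k + stdvec l)"
proof (rule pair_connected[where Q = "\<lambda>i j. signed_coef (stdvec i + stdvec j)", OF _ _ assms])
  fix i j k :: 'n assume n: "i \<noteq> j" "i \<noteq> k" "j \<noteq> k"
  interpret \<sigma>: linear "reflection (stdvec j - stdvec k)" by (rule reflection_linear)
  show "signed_coef (stdvec i + stdvec j) = signed_coef (stdvec i + stdvec k)"
    using signed_coef_reflection[OF diff_signed[OF n(3)] signed_roots_pairs(1)[OF n(1)]] n
    by (simp add: \<sigma>.add reflection_diff_stdvec)
qed (simp add: add.commute)

text \<open>In type B the reflection in e_j does it. In type D a third index k is used: e_i + e_j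
  goes to e_i - e_k under the reflection in e_j + e_k, and the swap of j and k gives e_i -
  e_j.\<close>

lemma coef_minus:
  assumes "i \<noteq> j"
  shows "signed_coef (stdvec i - stdvec j) = signed_coef (stdvec i + stdvec j)"
proof (cases "T = roots_B")
  case True
  interpret \<sigma>: linear "reflection (stdvec j)" by (rule reflection_linear)
  have "stdvec j \<in> T" by (simp add: True roots_B_def)
  then show ?thesis
    using signed_coef_reflection[OF _ signed_roots_pairs(1)[OF assms], of "stdvec j"] assms
    by (simp add: \<sigma>.add reflection_single_stdvec)
next
  case False
  have "card {i, j} < CARD('n)" using False type card_insert_le_m1[of 2 "{j}" i] by auto
  then obtain k where k: "k \<notin> {i, j}" by (metis UNIV_eq_I less_irrefl)
  interpret \<sigma>: linear "reflection (stdvec j + stdvec k)" by (rule reflection_linear)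
  interpret \<sigma>': linear "reflection (stdvec j - stdvec k)" by (rule reflection_linear)
  have n: "j \<noteq> k" "i \<noteq> k" using k by auto
  have "signed_coef (stdvec i - stdvec k) = signed_coef (stdvec i + stdvec j)"
    using signed_coef_reflection[OF disjI1[OF add_signed[OF n(1)]] signed_roots_pairs(1)[OF assms]] n assms
    by (simp add: \<sigma>.add reflection_add_stdvec)
  moreover have "signed_coef (stdvec i - stdvec j) = signed_coef (stdvec i - stdvec k)"
    using signed_coef_reflection[OF diff_signed[OF n(1)] signed_roots_pairs(2)[OF n(2)]] n assms
    by (simp add: \<sigma>'.diff reflection_diff_stdvec)
  ultimately show ?thesis by simp
qed

lemma coef_single: "coef (stdvec i) = coef (stdvec j)"
proof (cases "i = j")
  case False
  have "stdvec i \<in> signed_roots" using signed_roots_single[of 1 i] by simp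
  from signed_coef_reflection[OF diff_signed[OF False] this] show ?thesis
    by (simp add: reflection_diff_stdvec[OF False] signed_coef_def roots_B_def)
qed auto

definition F :: "'n \<Rightarrow> 'n \<Rightarrow> (real, 'n) vec \<Rightarrow> complex"
  where "F i j = dd (stdvec i) (dd (stdvec j) Rt)"

lemma la_F: "line_analytic (ball 0 r) (F i j)"
  unfolding F_def by (intro line_analytic_dd[OF open_ball] laRt)

lemma F_commute: "x \<in> ball 0 r \<Longrightarrow> F i j x = F j i x"
  unfolding F_def by (rule dd_pderiv_commute[OF open_ball laRt])

lemma F_symmetry:
  "symmetry (ball 0 r) Rt \<tau> \<Longrightarrow> x \<in> ball 0 r \<Longrightarrow> \<tau> (stdvec i) = stdvec k \<Longrightarrow> \<tau> (stdvec j) = stdvec l \<Longrightarrow> F i j x = F k l (\<tau> x)"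
  unfolding F_def by (subst symmetry_dd2[OF open_ball laRt]) auto

lemma F_flip:
  assumes "symmetry (ball 0 r) Rt \<tau>" "x \<in> ball 0 r" "\<tau> (stdvec i) = stdvec i" "\<tau> (stdvec j) = - stdvec j"
  shows "F i j x = - F i j (\<tau> x)"
proof -
  have b: "\<tau> x \<in> ball 0 r" using assms by (auto simp: symmetry_def)
  have "F i j x = dd (stdvec i) (dd (- stdvec j) Rt) (\<tau> x)"
    unfolding F_def using symmetry_dd2[OF open_ball laRt assms(1,2), of "stdvec i" "stdvec j"] assms(3,4) by simp
  also have "dd (- stdvec j) Rt = (\<lambda>y. - dd (stdvec j) Rt y)" by (simp add: fun_eq_iff dd_minus_left)
  also have "dd (stdvec i) (\<lambda>y. - dd (stdvec j) Rt y) (\<tau> x) = - F i j (\<tau> x)"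
    unfolding F_def by (rule dd_minus[OF line_analytic_differentiable[OF line_analytic_dd[OF open_ball laRt] b]])
  finally show ?thesis .
qed

text \<open>For an index k other than i and j, \<open>flip_symmetry\<close> provides the sign change
  that \<open>Rt_third_mixed\<close> needs.\<close>

lemma F_third:
  assumes "i \<noteq> j" "x \<in> ball 0 r" "w $ i = 0" "w $ j = 0"
  shows "dd w (F i j) x = 0"
  unfolding dd_def
proof (rule sum.neutral, rule ballI)
  fix k
  show "of_real (w $ k) * pderiv_at k (F i j) x = 0"
  proof (cases "k = i \<or> k = j")
    case False
    then obtain \<tau> where \<tau>: "symmetry (ball 0 r) Rt \<tau>" "\<tau> (stdvec i) = stdvec i" "\<tau> (stdvec j) = stdvec j" "\<tau> (stdvec k) = - stdvec k"
      using flip_symmetry[of k i j] by blast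
    have pd: "dd (stdvec m) = pderiv_at m" for m :: 'n by (simp add: fun_eq_iff)
    have "dd (stdvec i) (dd (stdvec j) (dd (stdvec k) Rt)) x = 0"
      using Rt_third_mixed[OF assms(1) _ _ assms(2) \<tau>] False by auto
    then show ?thesis unfolding F_def pd using assms(2)
      by (simp add: jet_eq_pderiv3[OF open_ball laRt] add_mset_commute)
  qed (use assms(3,4) in auto)
qed

text \<open>The fourth derivatives along i,i,i,j and i,j,j,j agree, so the Hessian of F in the
  coordinates i and j has equal diagonal entries. It is therefore diagonal in the directions e_i +
  e_j and e_i - e_j.\<close>

lemma F_second:
  assumes ij: "i \<noteq> j" and x: "x \<in> ball 0 r"
  shows "dd w (dd v (F i j)) x = of_real (w $ i * v $ i + w $ j * v $ j) * jet Rt {#i,i,i,j#} x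
    + of_real (w $ i * v $ j + w $ j * v $ i) * jet Rt {#i,i,j,j#} x"
proof -
  have pd: "dd (stdvec m) = pderiv_at m" for m :: 'n by (simp add: fun_eq_iff)
  have laP: "line_analytic (ball 0 r) (pderiv_at l (F i j))" for l by (intro line_analytic_pderiv la_F)
  have J: "pderiv_at k (pderiv_at l (F i j)) x = jet Rt {#k,l,i,j#} x" for k l
    unfolding F_def pd by (rule jet_eq_pderiv4[OF open_ball laRt x])
  define X where "X k l = of_real (w $ k) * (of_real (v $ l) * jet Rt {#k,l,i,j#} x)" for k l
  have "dd w (dd v (F i j)) x = (\<Sum>l\<in>UNIV. of_real (v $ l) * dd w (pderiv_at l (F i j)) x)"
    unfolding dd_def[of v, abs_def] using line_analytic_differentiable[OF laP x]
    by (simp add: dd_sum dd_cmult differentiable_mult)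
  also have "\<dots> = (\<Sum>l\<in>UNIV. \<Sum>k\<in>UNIV. X k l)"
    unfolding dd_def J X_def sum_distrib_left by (intro sum.cong refl) (simp add: mult_ac)
  also have "\<dots> = (\<Sum>l\<in>{i,j}. \<Sum>k\<in>{i,j}. X k l)"
  proof -
    have zero: "X k l = 0" if "k \<notin> {i,j} \<or> l \<notin> {i,j}" for k l
      using that Rt_mixed3[OF x, of k i j l] Rt_mixed3[OF x, of l i j k] ij by (auto simp: X_def add_mset_commute)
    have "(\<Sum>k\<in>UNIV. X k l) = (\<Sum>k\<in>{i,j}. X k l)" for l
      by (rule sum.mono_neutral_right) (use zero in auto)
    moreover have "(\<Sum>l\<in>UNIV. \<Sum>k\<in>{i,j}. X k l) = (\<Sum>l\<in>{i,j}. \<Sum>k\<in>{i,j}. X k l)"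
      by (rule sum.mono_neutral_right) (use zero ij in auto)
    ultimately show ?thesis by simp
  qed
  also have "\<dots> = X i i + X j i + (X i j + X j j)" using ij by simp
  also have "jet Rt {#j,j,i,j#} x = jet Rt {#i,i,i,j#} x" using Rt_wave[OF x ij] by (simp add: add_mset_commute)
  then have "X i i + X j i + (X i j + X j j) = of_real (w $ i * v $ i + w $ j * v $ j) * jet Rt {#i,i,i,j#} x
    + of_real (w $ i * v $ j + w $ j * v $ i) * jet Rt {#i,i,j,j#} x"
    unfolding X_def by (simp add: add_mset_commute algebra_simps)
  finally show ?thesis .
qed

text \<open>The point of the diagonal of the (i,j)-plane whose two coordinates have sum t.\<close>

definition diagonal_point :: "'n \<Rightarrow> 'n \<Rightarrow> real \<Rightarrow> (real, 'n) vec"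
  where "diagonal_point i j t = (t / 2) *\<^sub>R (stdvec i + stdvec j)"

lemma norm_diagonal_point: "i \<noteq> j \<Longrightarrow> norm (diagonal_point i j t) = \<bar>t\<bar> / sqrt 2"
proof -
  assume "i \<noteq> j"
  then have "(stdvec i + stdvec j) \<bullet> (stdvec i + stdvec j) = 2"
    by (simp add: inner_add_left inner_add_right stdvec_nth)
  then have "norm (stdvec i + stdvec j) = sqrt 2" by (simp add: norm_eq_sqrt_inner)
  then show ?thesis unfolding diagonal_point_def norm_scaleR by (simp add: field_simps)
qed

lemma diagonal_point_ball: "i \<noteq> j \<Longrightarrow> diagonal_point i j t \<in> ball 0 r \<longleftrightarrow> \<bar>t\<bar> < sqrt 2 * r"
  by (simp add: norm_diagonal_point field_simps)

text \<open>The formula of d'Alembert: F satisfies the wave equation in the coordinates i and j and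
  splits into a function of the sum and one of the difference. The three projections go to the
  diagonal, to the antidiagonal and to the remaining coordinates, on which F does not depend.
  Flipping e_j carries the antidiagonal to the diagonal with a change of sign, so both functions
  come from the same one.\<close>

lemma F_split:
  assumes ij: "i \<noteq> j" and x: "x \<in> ball 0 r"
  shows "\<bar>x $ i + x $ j\<bar> < sqrt 2 * r" "\<bar>x $ i - x $ j\<bar> < sqrt 2 * r"
    and "F i j x = F i j (diagonal_point i j (x $ i + x $ j)) - F i j (diagonal_point i j (x $ i - x $ j))"
proof -
  obtain \<tau> where \<tau>: "symmetry (ball 0 r) Rt \<tau>" "\<tau> (stdvec i) = stdvec i" "\<tau> (stdvec j) = - stdvec j"
    using flip_symmetry[of j i i] ij by metis
  interpret \<tau>: linear \<tau> using \<tau>(1) by (simp add: symmetry_def)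
  define P where "P m x = (if m = 0 then diagonal_point i j (x $ i + x $ j)
    else if m = 1 then ((x $ i - x $ j) / 2) *\<^sub>R (stdvec i - stdvec j) else x - (x $ i) *\<^sub>R stdvec i - (x $ j) *\<^sub>R stdvec j)" for m :: nat and x
  have Pij: "P m x $ i = (if m = 0 then (x $ i + x $ j) / 2 else if m = 1 then (x $ i - x $ j) / 2 else 0)"
    "P m x $ j = (if m = 0 then (x $ i + x $ j) / 2 else if m = 1 then (x $ j - x $ i) / 2 else 0)" for m x
    using ij by (simp_all add: P_def diagonal_point_def stdvec_nth minus_divide_left)
  have lin: "linear (P m)" for m
    by (rule linearI) (auto simp: P_def diagonal_point_def vec_eq_iff field_simps)
  have Pn: "norm (P m x) \<le> norm x" for m x
  proof (rule norm_le_of_inner)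
    show "P m x \<bullet> P m x = P m x \<bullet> x"
      using ij by (simp add: P_def diagonal_point_def inner_diff_left inner_diff_right inner_add_left inner_add_right stdvec_nth field_simps)
  qed
  have Pb: "P m x \<in> ball 0 r" if "x \<in> ball 0 r" for m x using Pn[of m x] that by simp
  have sum: "(\<Sum>m\<in>{0,1,2}. P m x) = x" for x
    using ij by (simp add: P_def diagonal_point_def vec_eq_iff stdvec_nth field_simps)
  have "F i j x = (\<Sum>m\<in>{0,1,2}. F i j (P m x)) + (1 - of_nat (card {0::nat,1,2})) * F i j 0"
  proof (rule split_by_projections[OF _ lin Pb sum _ _ _ x])
    show "dd (P l w) (dd (P m v) (F i j)) x = 0" if "m \<in> {0,1,2}" "l \<in> {0,1,2}" "l \<noteq> m" "x \<in> ball 0 r" for m l v w x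
      unfolding F_second[OF ij that(4)] Pij using that(1-3) by (auto simp: field_simps)
  qed (auto intro!: line_analytic_differentiable[OF la_F] line_analytic_differentiable[OF line_analytic_dd[OF open_ball la_F]])
  moreover have "F i j (P 2 x) = F i j 0"
  proof (rule constant_on_segment[OF line_analytic_differentiable[OF la_F]])
    show "dd (0 - P 2 x) (F i j) z = 0" if "z \<in> ball 0 r" for z by (rule F_third[OF ij that]) (simp_all add: Pij)
  qed (use Pb[OF x, of 2] r in auto)
  \<comment> \<open>F is odd under the flip, which fixes 0; this removes the constant of the
    splitting.\<close>
  moreover have "F i j 0 = 0"
    using F_flip[OF \<tau>(1) _ \<tau>(2,3), of 0] r by (simp add: \<tau>.zero)
  moreover have "F i j (P 1 x) = - F i j (diagonal_point i j (x $ i - x $ j))"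
    using F_flip[OF \<tau>(1) Pb[OF x, of 1] \<tau>(2,3)] by (simp add: P_def diagonal_point_def \<tau>.scaleR \<tau>.diff \<tau>.zero \<tau>(2,3))
  moreover have "P 0 x = diagonal_point i j (x $ i + x $ j)" by (simp add: P_def)
  ultimately show "F i j x = F i j (diagonal_point i j (x $ i + x $ j)) - F i j (diagonal_point i j (x $ i - x $ j))" by simp
  show "\<bar>x $ i + x $ j\<bar> < sqrt 2 * r" using Pb[OF x, of 0] diagonal_point_ball[OF ij] by (simp add: P_def)
  have "\<tau> (P 1 x) \<in> ball 0 r" using Pb[OF x, of 1] \<tau>(1) by (auto simp: symmetry_def)
  moreover have "\<tau> (P 1 x) = diagonal_point i j (x $ i - x $ j)" by (simp add: P_def diagonal_point_def \<tau>.scaleR \<tau>.diff \<tau>(2,3))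
  ultimately show "\<bar>x $ i - x $ j\<bar> < sqrt 2 * r" using diagonal_point_ball[OF ij] by simp
qed

text \<open>The bound is that of a sum or difference of two coordinates over the ball. The value 0
  beyond it makes the profiles of different pairs equal as functions.\<close>

definition profile :: "'n \<Rightarrow> 'n \<Rightarrow> real \<Rightarrow> complex"
  where "profile i j t = (if \<bar>t\<bar> < sqrt 2 * r then F i j (diagonal_point i j t) else 0)"

lemma profile_const:
  assumes "i \<noteq> j" "k \<noteq> l" shows "profile i j = profile k l"
proof (rule pair_connected[where Q = profile, OF _ _ assms])
  fix i j :: 'n assume "i \<noteq> j"
  then show "profile i j = profile j i"
    using F_commute[of "diagonal_point i j _" i j] diagonal_point_ball[of i j]
    by (auto simp: fun_eq_iff profile_def diagonal_point_def add.commute)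
next
  fix i j k :: 'n assume n: "i \<noteq> j" "i \<noteq> k" "j \<noteq> k"
  interpret \<sigma>: linear "reflection (stdvec j - stdvec k)" by (rule reflection_linear)
  have "F i j (diagonal_point i j t) = F i k (diagonal_point i k t)" if "\<bar>t\<bar> < sqrt 2 * r" for t
    using F_symmetry[OF swap_symmetry[OF n(3)], of "diagonal_point i j t" i i j k] that n diagonal_point_ball[of i j]
    by (simp add: reflection_diff_stdvec diagonal_point_def \<sigma>.add \<sigma>.scaleR)
  then show "profile i j = profile i k" by (auto simp: fun_eq_iff profile_def)
qed

text \<open>Flipping both coordinates maps the diagonal point to its negative, and the two signs of
  F cancel.\<close>

lemma profile_even: assumes ij: "i \<noteq> j" shows "profile i j (- t) = profile i j t"
proof (cases "\<bar>t\<bar> < sqrt 2 * r")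
  case True
  obtain \<tau> where \<tau>: "symmetry (ball 0 r) Rt \<tau>" "\<tau> (stdvec i) = stdvec i" "\<tau> (stdvec j) = - stdvec j"
    using flip_symmetry[of j i i] ij by metis
  obtain \<tau>' where \<tau>': "symmetry (ball 0 r) Rt \<tau>'" "\<tau>' (stdvec j) = stdvec j" "\<tau>' (stdvec i) = - stdvec i"
    using flip_symmetry[of i j j] ij by metis
  interpret \<tau>: linear \<tau> using \<tau>(1) by (simp add: symmetry_def)
  interpret \<tau>': linear \<tau>' using \<tau>'(1) by (simp add: symmetry_def)
  let ?y = "diagonal_point i j t"
  have y: "?y \<in> ball 0 r" using diagonal_point_ball[OF ij] True by simp
  have \<tau>y: "\<tau> ?y \<in> ball 0 r" using y \<tau>(1) by (auto simp: symmetry_def)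
  have \<tau>\<tau>y: "\<tau>' (\<tau> ?y) \<in> ball 0 r" using \<tau>y \<tau>'(1) by (auto simp: symmetry_def)
  have "F i j ?y = - F i j (\<tau> ?y)" by (rule F_flip[OF \<tau>(1) y \<tau>(2,3)])
  also have "F i j (\<tau> ?y) = F j i (\<tau> ?y)" by (rule F_commute[OF \<tau>y])
  also have "F j i (\<tau> ?y) = - F j i (\<tau>' (\<tau> ?y))" by (rule F_flip[OF \<tau>'(1) \<tau>y \<tau>'(2,3)])
  also have "F j i (\<tau>' (\<tau> ?y)) = F i j (\<tau>' (\<tau> ?y))" by (rule F_commute[OF \<tau>\<tau>y])
  also have "\<tau>' (\<tau> ?y) = diagonal_point i j (- t)"
    by (simp add: diagonal_point_def \<tau>.scaleR \<tau>.add \<tau>.diff \<tau>'.diff \<tau>(2,3) \<tau>'.scaleR \<tau>'.add \<tau>'.neg \<tau>'(2,3))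
       (simp add: algebra_simps)
  finally show ?thesis using True by (simp add: profile_def)
qed (simp add: profile_def)

lemma isCont_profile:
  assumes "i \<noteq> j" "\<bar>t\<bar> < sqrt 2 * r" shows "isCont (profile i j) t"
proof -
  have "isCont (\<lambda>t. F i j (diagonal_point i j t)) t"
  proof (rule isCont_o2[where f = "diagonal_point i j"])
    show "isCont (diagonal_point i j) t" unfolding diagonal_point_def[abs_def] by (intro continuous_intros) simp
    have "F i j differentiable (at (diagonal_point i j t))"
      using assms diagonal_point_ball by (intro line_analytic_differentiable[OF la_F]) blast
    then show "isCont (F i j) (diagonal_point i j t)" by (rule differentiable_imp_continuous_within)
  qed
  moreover have "\<forall>\<^sub>F s in nhds t. profile i j s = F i j (diagonal_point i j s)"
  proof -
    have "\<forall>\<^sub>F s in nhds t. s \<in> {- (sqrt 2 * r)<..<sqrt 2 * r}" by (rule eventually_nhds_in_open) (use assms in auto)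
    then show ?thesis by eventually_elim (auto simp: profile_def)
  qed
  ultimately show ?thesis by (simp add: isCont_cong)
qed

end

subsection \<open>Double primitives of the profile\<close>

lemma primitive_on_interval:
  fixes f :: "real \<Rightarrow> complex"
  assumes "L > 0" "\<And>t. \<bar>t\<bar> < L \<Longrightarrow> isCont f t"
  shows "\<exists>F. \<forall>t. \<bar>t\<bar> < L \<longrightarrow> (F has_vector_derivative f t) (at t)"
proof -
  have "\<exists>F. \<forall>t::real. ereal (- L) < ereal t \<longrightarrow> ereal t < ereal L \<longrightarrow> (F has_vector_derivative f t) (at t)"
    by (rule einterval_antiderivative) (use assms in auto)
  then obtain F where "\<forall>t. - L < t \<longrightarrow> t < L \<longrightarrow> (F has_vector_derivative f t) (at t)" by auto
  then show ?thesis by (intro exI[of _ F]) auto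
qed

text \<open>Symmetrising the primitive makes u even at every t, also outside the interval, where
  nothing is known about it.\<close>

lemma even_double_primitive:
  fixes \<phi> :: "real \<Rightarrow> complex"
  assumes "L > 0" "\<And>t. \<bar>t\<bar> < L \<Longrightarrow> isCont \<phi> t" "\<And>t. \<phi> (- t) = \<phi> t"
  obtains u p where "\<And>t. u (- t) = u t" "\<And>t. \<bar>t\<bar> < L \<Longrightarrow> (u has_vector_derivative p t) (at t)"
    "\<And>t. \<bar>t\<bar> < L \<Longrightarrow> (p has_vector_derivative \<phi> t) (at t)"
proof -
  have refl: "((\<lambda>t. F (- t)) has_vector_derivative - f) (at t)" if "(F has_vector_derivative f) (at (- t))" for F :: "real \<Rightarrow> complex" and f t
  proof -
    have "(uminus has_vector_derivative - 1) (at t)" by (auto intro!: derivative_eq_intros)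
    from vector_diff_chain_at[OF this that] show ?thesis by (simp add: o_def)
  qed
  obtain P where P: "\<And>t. \<bar>t\<bar> < L \<Longrightarrow> (P has_vector_derivative \<phi> t) (at t)"
    using primitive_on_interval[of L \<phi>] assms(1,2) by blast
  have "isCont P t" if "\<bar>t\<bar> < L" for t by (rule has_vector_derivative_continuous[OF P[OF that]])
  then obtain U where U: "\<And>t. \<bar>t\<bar> < L \<Longrightarrow> (U has_vector_derivative P t) (at t)"
    using primitive_on_interval[of L P] assms(1) by blast
  define u where "u t = (1 / 2) *\<^sub>R (U t + U (- t))" for t
  define p where "p t = (1 / 2) *\<^sub>R (P t - P (- t))" for t
  show ?thesis
  proof
    show "u (- t) = u t" for t by (simp add: u_def add.commute)
    show "(u has_vector_derivative p t) (at t)" if "\<bar>t\<bar> < L" for t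
    proof -
      have "((\<lambda>t. U t + U (- t)) has_vector_derivative P t + - P (- t)) (at t)"
        by (rule has_vector_derivative_add[OF U[OF that] refl[OF U]]) (use that in simp)
      then show ?thesis unfolding u_def[abs_def] p_def diff_conv_add_uminus
        by (rule bounded_linear.has_vector_derivative[OF bounded_linear_scaleR_right])
    qed
    show "(p has_vector_derivative \<phi> t) (at t)" if "\<bar>t\<bar> < L" for t
    proof -
      have "((\<lambda>t. P t - P (- t)) has_vector_derivative \<phi> t - - \<phi> (- t)) (at t)"
        by (rule has_vector_derivative_diff[OF P[OF that] refl[OF P]]) (use that in simp)
      then have "((\<lambda>t. P t - P (- t)) has_vector_derivative 2 *\<^sub>R \<phi> t) (at t)" by (simp add: assms(3) scaleR_2)
      from bounded_linear.has_vector_derivative[OF bounded_linear_scaleR_right this, of "1 / 2"]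
      show ?thesis unfolding p_def[abs_def] by simp
    qed
  qed
qed

lemma has_derivative_ridge:
  fixes h :: "real \<Rightarrow> complex"
  assumes "(h has_vector_derivative h') (at (\<beta> \<bullet> x))"
  shows "((\<lambda>x. h (\<beta> \<bullet> x)) has_derivative (\<lambda>v. of_real (\<beta> \<bullet> v) * h')) (at x)"
proof -
  have "((\<lambda>x. \<beta> \<bullet> x) has_derivative (\<lambda>v. \<beta> \<bullet> v)) (at x)" by (intro bounded_linear.has_derivative[OF bounded_linear_inner_right] has_derivative_ident)
  from has_derivative_compose[OF this assms[unfolded has_vector_derivative_def]]
  show ?thesis by (simp add: scaleR_conv_of_real)
qed

lemma sum_roots_D:
  fixes G :: "(real, 'n::{finite,linorder}) vec \<Rightarrow> complex"
  shows "(\<Sum>\<beta>\<in>roots_D. G \<beta>) = (\<Sum>i\<in>UNIV. \<Sum>j\<in>{i<..}. G (stdvec i + stdvec j) + G (stdvec i - stdvec j))"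
proof -
  define G' where "G' \<beta> = (if \<beta> \<in> roots_D then G \<beta> else 0)" for \<beta>
  have "(\<Sum>\<beta>\<in>roots_B. G' \<beta>) = (\<Sum>\<beta>\<in>roots_D. G \<beta>)"
    unfolding G'_def by (rule sum.mono_neutral_cong_right[OF finite_roots_B]) (auto simp: roots_B_def)
  moreover have "G' (stdvec i) = 0" for i
    using root_distinct'[where 'n = 'n] by (auto simp: G'_def roots_D_def)
  moreover have "(\<Sum>j\<in>{i<..}. G' (stdvec i + stdvec j) + G' (stdvec i - stdvec j)) = (\<Sum>j\<in>{i<..}. G (stdvec i + stdvec j) + G (stdvec i - stdvec j))" for i
    by (intro sum.cong refl) (auto simp: G'_def roots_D_def)
  ultimately show ?thesis using sum_roots_B[of G'] by simp
qed

lemma inner_roots_D: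
  assumes "\<beta> \<in> roots_D" "x \<in> ball 0 r"
  shows "\<bar>\<beta> \<bullet> x\<bar> < sqrt 2 * r"
proof -
  have "\<beta> \<bullet> \<beta> = 2" using assms(1)
    by (auto simp: roots_D_def inner_add_left inner_add_right inner_diff_left inner_diff_right stdvec_nth)
  then have "norm \<beta> = sqrt 2" by (simp add: norm_eq_sqrt_inner)
  then have "\<bar>\<beta> \<bullet> x\<bar> \<le> sqrt 2 * norm x" using Cauchy_Schwarz_ineq2[of \<beta> x] by simp
  also have "\<dots> < sqrt 2 * r" using assms(2) by simp
  finally show ?thesis .
qed

text \<open>Only e_l + e_m and the difference of e_l and e_m have both coordinates different from
  zero.\<close>

lemma sum_roots_D_pair:
  fixes x :: "(real, 'n::{finite,linorder}) vec" and \<phi> :: "real \<Rightarrow> complex"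
  assumes "l \<noteq> m" "\<And>t. \<phi> (- t) = \<phi> t"
  shows "(\<Sum>\<beta>\<in>roots_D. of_real (\<beta> $ l) * (of_real (\<beta> $ m) * \<phi> (\<beta> \<bullet> x))) = \<phi> (x $ l + x $ m) - \<phi> (x $ l - x $ m)"
proof -
  have *: "(\<Sum>\<beta>\<in>roots_D. of_real (\<beta> $ l) * (of_real (\<beta> $ m) * \<phi> (\<beta> \<bullet> x))) = \<phi> (x $ l + x $ m) - \<phi> (x $ l - x $ m)" if "l < m" for l m :: 'n
  proof -
    define X where "X = \<phi> (x $ l + x $ m) - \<phi> (x $ l - x $ m)"
    have "(\<Sum>\<beta>\<in>roots_D. of_real (\<beta> $ l) * (of_real (\<beta> $ m) * \<phi> (\<beta> \<bullet> x)))
      = (\<Sum>i\<in>UNIV. \<Sum>j\<in>{i<..}. if j = m then (if i = l then X else 0) else 0)"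
      unfolding sum_roots_D
    proof (intro sum.cong refl)
      fix i j :: 'n assume "j \<in> {i<..}"
      then show "of_real ((stdvec i + stdvec j) $ l) * (of_real ((stdvec i + stdvec j) $ m) * \<phi> ((stdvec i + stdvec j) \<bullet> x))
        + of_real ((stdvec i - stdvec j) $ l) * (of_real ((stdvec i - stdvec j) $ m) * \<phi> ((stdvec i - stdvec j) \<bullet> x))
        = (if j = m then (if i = l then X else 0) else 0)"
        using that by (auto simp: stdvec_nth X_def inner_add_left inner_diff_left)
    qed
    also have "\<dots> = (\<Sum>i\<in>UNIV. if i = l then X else 0)" using that by (intro sum.cong refl) auto
    finally show ?thesis by (simp add: X_def)
  qed
  show ?thesis
  proof (cases "l < m")
    case False
    then have "m < l" using assms(1) by simp
    from *[OF this] show ?thesis using assms(2)[of "x $ l - x $ m"] by (simp add: add.commute mult.left_commute)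
  qed (rule *)
qed

context symmetric_potential
begin

text \<open>With u'' equal to the common profile, the sum of u over the roots of type D has the same
  mixed second derivatives as \<open>Rt\<close>. The difference E therefore splits into functions of
  single coordinates, and symmetry makes these functions equal and even.\<close>

lemma potential_form:
  "\<exists>u v. even_function u \<and> even_function v \<and>
    (\<forall>x\<in>ball 0 r. R x = (\<Sum>i\<in>UNIV. \<Sum>j\<in>{i<..}. u (x $ i + x $ j) + u (x $ i - x $ j)) + (\<Sum>i\<in>UNIV. v (x $ i)))"
proof -
  obtain p q :: 'n where pq: "p \<noteq> q"
  proof -
    have "\<not> is_singleton (UNIV :: 'n set)" using card2 by (simp add: is_singleton_altdef)
    then show ?thesis using that by (metis UNIV_I is_singletonI' empty_iff)
  qed
  define \<phi> where "\<phi> = profile p q"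
  have \<phi>_even: "\<phi> (- t) = \<phi> t" for t unfolding \<phi>_def by (rule profile_even[OF pq])
  have "sqrt 2 * r > 0" using r by simp
  then obtain u p1 where u: "\<And>t. u (- t) = u t" "\<And>t. \<bar>t\<bar> < sqrt 2 * r \<Longrightarrow> (u has_vector_derivative p1 t) (at t)"
    "\<And>t. \<bar>t\<bar> < sqrt 2 * r \<Longrightarrow> (p1 has_vector_derivative \<phi> t) (at t)"
    using even_double_primitive[of "sqrt 2 * r" \<phi>] isCont_profile[OF pq] \<phi>_even unfolding \<phi>_def by metis
  \<comment> \<open>W has second derivatives in terms of \<phi> because \<open>inner_roots_D\<close>
    keeps all arguments within the interval on which u is a double primitive.\<close>
  define W where "W x = (\<Sum>\<beta>\<in>roots_D. u (\<beta> \<bullet> x))" for x :: "(real, 'n) vec"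
  define W1 where "W1 v x = (\<Sum>\<beta>\<in>roots_D. of_real (\<beta> \<bullet> v) * p1 (\<beta> \<bullet> x))" for v x :: "(real, 'n) vec"
  define E where "E x = Rt x - W x" for x
  have hW: "(W has_derivative (\<lambda>v. W1 v x)) (at x)" if "x \<in> ball 0 r" for x
    unfolding W_def[abs_def] W1_def by (intro has_derivative_sum has_derivative_ridge u(2) inner_roots_D that)
  have hW1: "(W1 v has_derivative (\<lambda>w. \<Sum>\<beta>\<in>roots_D. of_real (\<beta> \<bullet> v) * (of_real (\<beta> \<bullet> w) * \<phi> (\<beta> \<bullet> x)))) (at x)" if "x \<in> ball 0 r" for x v
    unfolding W1_def[abs_def]
    by (intro has_derivative_sum has_derivative_mult_right has_derivative_ridge u(3) inner_roots_D that)
  note dRt = line_analytic_differentiable[OF laRt] and d1Rt = line_analytic_differentiable[OF line_analytic_dd[OF open_ball laRt]]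
  have dE: "E differentiable (at x)" if "x \<in> ball 0 r" for x
    unfolding E_def[abs_def] by (intro differentiable_diff dRt that differentiableI[OF hW])
  have ddE: "dd v E x = dd v Rt x - W1 v x" if "x \<in> ball 0 r" for v x
    unfolding E_def[abs_def] dd_diff[OF dRt[OF that] differentiableI[OF hW[OF that]]] dd_eq[OF hW[OF that]] ..
  have d1E: "dd v E differentiable (at x)" if "x \<in> ball 0 r" for v x
  proof (rule differentiable_cong_open[OF open_ball that])
    show "(\<lambda>y. dd v Rt y - W1 v y) differentiable (at x)"
      by (rule differentiable_diff[OF d1Rt[OF that] differentiableI[OF hW1[OF that]]])
  qed (rule ddE)
  have mixed: "dd (stdvec l) (dd (stdvec m) E) x = 0" if lm: "l \<noteq> m" and x: "x \<in> ball 0 r" for l m x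
  proof -
    have "dd (stdvec l) (dd (stdvec m) E) x = dd (stdvec l) (\<lambda>x. dd (stdvec m) Rt x - W1 (stdvec m) x) x"
      by (rule dd_cong[OF open_ball x ddE])
    also have "\<dots> = F l m x - (\<Sum>\<beta>\<in>roots_D. of_real (\<beta> $ m) * (of_real (\<beta> $ l) * \<phi> (\<beta> \<bullet> x)))"
      unfolding dd_diff[OF d1Rt[OF x] differentiableI[OF hW1[OF x]]] dd_eq[OF hW1[OF x]] F_def by (simp only: inner_stdvec)
    also have "\<dots> = F l m x - (\<phi> (x $ m + x $ l) - \<phi> (x $ m - x $ l))"
      unfolding sum_roots_D_pair[where \<phi> = \<phi>, OF lm[symmetric] \<phi>_even] ..
    also have "\<dots> = 0"
    proof -
      have "F l m x = profile l m (x $ l + x $ m) - profile l m (x $ l - x $ m)"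
        using F_split[OF lm x] by (simp add: profile_def)
      also have "profile l m = \<phi>" unfolding \<phi>_def by (rule profile_const[OF lm pq])
      finally show ?thesis using \<phi>_even[of "x $ l - x $ m"] by (simp add: add.commute)
    qed
    finally show ?thesis .
  qed
  define n where "n = of_nat CARD('n) * (1 :: complex)"
  have n0: "n \<noteq> 0" by (simp add: n_def)
  have E_split: "E x = (\<Sum>m\<in>UNIV. E ((x $ m) *\<^sub>R stdvec m)) + (1 - n) * E 0" if "x \<in> ball 0 r" for x
  proof -
    have "E x = (\<Sum>m\<in>UNIV. E ((x $ m) *\<^sub>R stdvec m)) + (1 - of_nat (card (UNIV :: 'n set))) * E 0"
    proof (rule split_by_projections[where P = "\<lambda>m x. (x $ m) *\<^sub>R stdvec m", OF _ _ _ _ dE d1E _ that])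
      show "linear (\<lambda>x. (x $ m) *\<^sub>R stdvec m)" for m :: 'n by (rule linearI) (auto simp: algebra_simps)
      show "(x $ m) *\<^sub>R stdvec m \<in> ball 0 r" if "x \<in> ball 0 r" for m and x :: "(real, 'n) vec"
        using that component_le_norm_cart[of x m] by (simp add: norm_axis_1)
      show "(\<Sum>m\<in>UNIV. (x $ m) *\<^sub>R stdvec m) = x" for x :: "(real, 'n) vec"
        by (simp add: vec_eq_iff stdvec_nth if_distrib[of "\<lambda>a. _ * a"] cong: if_cong)
      show "dd ((w $ l) *\<^sub>R stdvec l) (dd ((v $ m) *\<^sub>R stdvec m) E) x = 0" if "l \<noteq> m" "x \<in> ball 0 r" for l m v w x
      proof -
        have "dd ((v $ m) *\<^sub>R stdvec m) E = (\<lambda>y. of_real (v $ m) * dd (stdvec m) E y)"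
          by (simp only: fun_eq_iff dd_scaleR_left simp_thms)
        then show ?thesis unfolding dd_scaleR_left using mixed[OF that] d1E[OF that(2)] by (simp only: dd_cmult mult_zero_right)
      qed
    qed auto
    then show ?thesis by (simp add: n_def)
  qed
  \<comment> \<open>Written over all ordered pairs, W is visibly invariant under permutations of the
    coordinates; the form with i < j hides this.\<close>
  have W_pairs: "2 * W x = (\<Sum>i\<in>UNIV. \<Sum>j\<in>UNIV. u (x $ i + x $ j) + u (x $ i - x $ j)) - (\<Sum>i\<in>UNIV. u (x $ i + x $ i) + u 0)" for x
  proof -
    have e: "(u (x $ i + x $ j) + u (x $ i - x $ j)) + (u (x $ j + x $ i) + u (x $ j - x $ i)) = 2 * (u (x $ i + x $ j) + u (x $ i - x $ j))" for i j
      using u(1)[of "x $ i - x $ j"] by (simp add: add.commute[of "x $ j" "x $ i"])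
    have "W x = (\<Sum>i\<in>UNIV. \<Sum>j\<in>{i<..}. u (x $ i + x $ j) + u (x $ i - x $ j))"
      unfolding W_def sum_roots_D by (simp add: inner_add_left inner_diff_left)
    then have "2 * W x = (\<Sum>i\<in>UNIV. \<Sum>j\<in>{i<..}. (u (x $ i + x $ j) + u (x $ i - x $ j)) + (u (x $ j + x $ i) + u (x $ j - x $ i)))"
      by (simp only: e sum_distrib_left)
    then show ?thesis using sum_split_strict[of "\<lambda>i j. u (x $ i + x $ j) + u (x $ i - x $ j)"] by simp
  qed
  \<comment> \<open>Invariance under the swap of two coordinates makes the functions of single
    coordinates coincide: for \<open>Rt\<close> by a reflection of T, for W by reindexing.\<close>
  have E_swap: "E (t *\<^sub>R stdvec i) = E (t *\<^sub>R stdvec p)" if t: "\<bar>t\<bar> < r" for i t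
  proof (cases "i = p")
    case False
    define \<pi> where "\<pi> k = (if k = i then p else if k = p then i else k)" for k
    have \<pi>: "bij \<pi>" by (rule o_bij[of \<pi>]) (auto simp: fun_eq_iff \<pi>_def)
    have c: "(t *\<^sub>R stdvec i) $ k = (t *\<^sub>R stdvec p) $ \<pi> k" for k using False by (auto simp: \<pi>_def stdvec_nth)
    have "2 * W (t *\<^sub>R stdvec i) = 2 * W (t *\<^sub>R stdvec p)"
    proof -
      let ?y = "t *\<^sub>R stdvec p :: (real, 'n) vec"
      have "(\<Sum>k\<in>UNIV. \<Sum>l\<in>UNIV. u (?y $ \<pi> k + ?y $ \<pi> l) + u (?y $ \<pi> k - ?y $ \<pi> l))
        = (\<Sum>k\<in>UNIV. \<Sum>l\<in>UNIV. u (?y $ \<pi> k + ?y $ l) + u (?y $ \<pi> k - ?y $ l))"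
        by (simp only: sum.reindex_bij_betw[OF \<pi>, where g = "\<lambda>l. u (z + ?y $ l) + u (z - ?y $ l)" for z])
      also have "\<dots> = (\<Sum>k\<in>UNIV. \<Sum>l\<in>UNIV. u (?y $ k + ?y $ l) + u (?y $ k - ?y $ l))"
        by (rule sum.reindex_bij_betw[OF \<pi>, where g = "\<lambda>k. \<Sum>l\<in>UNIV. u (?y $ k + ?y $ l) + u (?y $ k - ?y $ l)"])
      finally have 1: "(\<Sum>k\<in>UNIV. \<Sum>l\<in>UNIV. u (?y $ \<pi> k + ?y $ \<pi> l) + u (?y $ \<pi> k - ?y $ \<pi> l))
        = (\<Sum>k\<in>UNIV. \<Sum>l\<in>UNIV. u (?y $ k + ?y $ l) + u (?y $ k - ?y $ l))" .
      have 2: "(\<Sum>k\<in>UNIV. u (?y $ \<pi> k + ?y $ \<pi> k) + u 0) = (\<Sum>k\<in>UNIV. u (?y $ k + ?y $ k) + u 0)"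
        by (rule sum.reindex_bij_betw[OF \<pi>, where g = "\<lambda>k. u (?y $ k + ?y $ k) + u 0"])
      show ?thesis unfolding W_pairs c 1 2 ..
    qed
    moreover have "Rt (t *\<^sub>R stdvec i) = Rt (t *\<^sub>R stdvec p)"
    proof -
      interpret \<sigma>: linear "reflection (stdvec p - stdvec i)" by (rule reflection_linear)
      have "Rt (reflection (stdvec p - stdvec i) (t *\<^sub>R stdvec p)) = Rt (t *\<^sub>R stdvec p)"
        using swap_symmetry[of p i] False t by (simp add: symmetry_def norm_axis_1)
      then show ?thesis using False by (simp add: \<sigma>.scaleR reflection_diff_stdvec)
    qed
    ultimately show ?thesis by (simp add: E_def)
  qed simp
  \<comment> \<open>The sign change of coordinate p may flip another coordinate as well, which is
    zero at the points considered.\<close>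
  have E_even: "E ((- t) *\<^sub>R stdvec p) = E (t *\<^sub>R stdvec p)" if t: "\<bar>t\<bar> < r" for t
  proof -
    obtain \<tau> where \<tau>: "symmetry (ball 0 r) Rt \<tau>" "\<tau> (stdvec p) = - stdvec p"
      using flip_symmetry[of p q q] pq by metis
    interpret \<tau>: linear \<tau> using \<tau>(1) by (simp add: symmetry_def)
    have "t *\<^sub>R stdvec p \<in> (ball 0 r :: (real, 'n) vec set)" using t by (simp add: norm_axis_1)
    then have "Rt (\<tau> (t *\<^sub>R stdvec p)) = Rt (t *\<^sub>R stdvec p)" using \<tau>(1) unfolding symmetry_def by blast
    then have "Rt ((- t) *\<^sub>R stdvec p) = Rt (t *\<^sub>R stdvec p)" by (simp add: \<tau>.scaleR \<tau>(2))
    moreover have "W ((- t) *\<^sub>R stdvec p) = W (t *\<^sub>R stdvec p)" by (simp add: W_def u(1))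
    ultimately show ?thesis by (simp only: E_def)
  qed
  define c c' where "c = signed_coef (stdvec p + stdvec q)" and "c' = coef (stdvec p)"
  define u' where "u' t = c / of_real (t\<^sup>2) + u t" for t
  \<comment> \<open>The constant of the splitting is distributed evenly over the n coordinates.
    Outside the interval the bracket is 0, so that v is even everywhere.\<close>
  define v where "v t = c' / of_real (t\<^sup>2) + (if \<bar>t\<bar> < r then E (t *\<^sub>R stdvec p) + (1 - n) * E 0 / n else 0)" for t
  have cp: "coef (stdvec i + stdvec j) = c" "coef (stdvec i - stdvec j) = c" if "i < j" for i j
  proof -
    have "stdvec i + stdvec j \<in> roots_B" "stdvec i - stdvec j \<in> roots_B" "i \<noteq> j" using that by (auto simp: roots_B_def roots_D_def)
    then show "coef (stdvec i + stdvec j) = c" "coef (stdvec i - stdvec j) = c"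
      using coef_plus[OF _ pq, of i j] coef_minus[of i j] by (auto simp: c_def signed_coef_def)
  qed
  have "R x = (\<Sum>i\<in>UNIV. \<Sum>j\<in>{i<..}. u' (x $ i + x $ j) + u' (x $ i - x $ j)) + (\<Sum>i\<in>UNIV. v (x $ i))" if x: "x \<in> ball 0 r" for x
  proof -
    have xi: "\<bar>x $ i\<bar> < r" for i using x component_le_norm_cart[of x i] by simp
    have "(\<Sum>\<beta>\<in>roots_B. coef \<beta> / of_real ((\<beta> \<bullet> x)\<^sup>2))
      = (\<Sum>i\<in>UNIV. \<Sum>j\<in>{i<..}. c / of_real ((x $ i + x $ j)\<^sup>2) + c / of_real ((x $ i - x $ j)\<^sup>2)) + (\<Sum>i\<in>UNIV. c' / of_real ((x $ i)\<^sup>2))"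
    proof -
      have "coef (stdvec i) = c'" for i unfolding c'_def by (rule coef_single)
      then show ?thesis unfolding sum_roots_B using cp by (simp add: inner_add_left inner_diff_left)
    qed
    moreover have "Rt x = (\<Sum>i\<in>UNIV. \<Sum>j\<in>{i<..}. u (x $ i + x $ j) + u (x $ i - x $ j)) + ((\<Sum>m\<in>UNIV. E ((x $ m) *\<^sub>R stdvec p)) + (1 - n) * E 0)"
    proof -
      have "Rt x = W x + E x" by (simp add: E_def)
      also have "E x = (\<Sum>m\<in>UNIV. E ((x $ m) *\<^sub>R stdvec p)) + (1 - n) * E 0"
      proof -
        have "(\<Sum>m\<in>UNIV. E ((x $ m) *\<^sub>R stdvec m)) = (\<Sum>m\<in>UNIV. E ((x $ m) *\<^sub>R stdvec p))"
          by (rule sum.cong[OF refl E_swap[OF xi]])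
        then show ?thesis using E_split[OF x] by (simp only:)
      qed
      finally show ?thesis unfolding W_def sum_roots_D by (simp add: inner_add_left inner_diff_left)
    qed
    moreover have "(\<Sum>i\<in>UNIV. v (x $ i)) = (\<Sum>i\<in>UNIV. c' / of_real ((x $ i)\<^sup>2)) + ((\<Sum>m\<in>UNIV. E ((x $ m) *\<^sub>R stdvec p)) + (1 - n) * E 0)"
      using n0 xi by (simp add: v_def sum.distrib n_def)
    moreover have "(\<Sum>i\<in>UNIV. \<Sum>j\<in>{i<..}. u' (x $ i + x $ j) + u' (x $ i - x $ j))
      = (\<Sum>i\<in>UNIV. \<Sum>j\<in>{i<..}. c / of_real ((x $ i + x $ j)\<^sup>2) + c / of_real ((x $ i - x $ j)\<^sup>2))
        + (\<Sum>i\<in>UNIV. \<Sum>j\<in>{i<..}. u (x $ i + x $ j) + u (x $ i - x $ j))"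
      unfolding sum.distrib[symmetric] by (intro sum.cong refl) (simp add: u'_def)
    ultimately show ?thesis unfolding R_eq by (simp only: add_ac)
  qed
  moreover have "even_function u'" by (simp add: even_function_def u'_def u(1))
  moreover have "even_function v" using E_even by (auto simp: even_function_def v_def)
  ultimately show ?thesis by blast
qed

end

section \<open>Irreducibility and the final assembly\<close>

lemma open_regular_domain: "finite S \<Longrightarrow> open (regular_domain r S)"
  unfolding regular_domain_def hyperplane_def
  by (intro open_Diff open_ball closed_UN ballI closed_Collect_eq continuous_intros)

text \<open>Otherwise {\<alpha>} is an orthogonal component of its own. It cannot be all of S,
  because one vector does not span a space of dimension at least two.\<close>

lemma irreducible_neighbour:
  assumes "irreducible_vectors S" "DIM('a) \<ge> 2" and \<alpha>: "\<alpha> \<in> (S :: 'a::euclidean_space set)"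
  shows "\<exists>\<gamma>\<in>S. \<gamma> \<noteq> \<alpha> \<and> \<gamma> \<bullet> \<alpha> \<noteq> 0"
proof (rule ccontr)
  assume "\<not> ?thesis"
  then have orth: "\<forall>\<gamma>\<in>S - {\<alpha>}. \<alpha> \<bullet> \<gamma> = 0" by (auto simp: inner_commute)
  have "S \<noteq> {\<alpha>}"
  proof
    assume "S = {\<alpha>}"
    then have "span {\<alpha>} = (UNIV :: 'a set)" using assms(1) by (simp add: irreducible_vectors_def)
    then have "DIM('a) = dim {\<alpha>}" by (metis dim_UNIV dim_span)
    then show False using dim_le_card[of "{\<alpha>}" "{\<alpha>}"] assms(2) span_superset[of "{\<alpha>}"] by simp
  qed
  then have "{\<alpha>} \<subset> S" "S - {\<alpha>} \<subset> S" using \<alpha> by auto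
  moreover have "{\<alpha>} \<union> (S - {\<alpha>}) = S" "{\<alpha>} \<inter> (S - {\<alpha>}) = {}" using \<alpha> by auto
  moreover have "\<forall>a\<in>{\<alpha>}. \<forall>b\<in>S - {\<alpha>}. a \<bullet> b = 0" using orth by simp
  ultimately have "\<exists>A B. A \<subset> S \<and> B \<subset> S \<and> A \<union> B = S \<and> A \<inter> B = {} \<and> (\<forall>a\<in>A. \<forall>b\<in>B. a \<bullet> b = 0)"
    by (intro exI[of _ "{\<alpha>}"] exI[of _ "S - {\<alpha>}"] conjI)
  then show False using assms(1) unfolding irreducible_vectors_def by (elim conjE notE)
qed

theorem theorem7p7:
  fixes Cp Cm :: "'n::{finite,linorder} \<Rightarrow> 'n \<Rightarrow> complex"
    and C :: "'n \<Rightarrow> complex"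
    and Rt :: "(real, 'n) vec \<Rightarrow> complex"
    and r :: real
    and R :: "(real, 'n) vec \<Rightarrow> complex"
    and H D :: "(real, 'n) vec set"
    and a2 a1 :: "'n \<Rightarrow> (real, 'n) vec \<Rightarrow> complex"
    and a11 :: "'n \<Rightarrow> 'n \<Rightarrow> (real, 'n) vec \<Rightarrow> complex"
    and a0 :: "(real, 'n) vec \<Rightarrow> complex"
  defines "R \<equiv> potential Cp Cm C Rt"
    and "H \<equiv> singular_vectors Cp Cm C"
    and "D \<equiv> regular_domain r H"
  assumes "r > 0"
    and "real_analytic_on Rt (ball 0 r)"
    and "irreducible_vectors H"
    and "generic_potential Cp Cm C"
    and "(CARD('n) \<ge> 2 \<and> reflection_group H = reflection_group roots_B) \<or>
         (CARD('n) \<ge> 4 \<and> reflection_group H = reflection_group roots_D \<and> (\<forall>i. C i = 0))"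
    and "\<And>i. real_analytic_on (a2 i) D"
    and "\<And>i j. i < j \<Longrightarrow> real_analytic_on (a11 i j) D"
    and "\<And>i. real_analytic_on (a1 i) D"
    and "real_analytic_on a0 D"
    and "commute_on D (schroedinger_op R) (quartic_op a2 a11 a1 a0)"
  shows "\<exists>u v. even_function u \<and> even_function v \<and>
           (\<forall>x\<in>D. R x = (\<Sum>i\<in>UNIV. \<Sum>j\<in>{i<..}. u (x $ i + x $ j) + u (x $ i - x $ j))
                       + (\<Sum>i\<in>UNIV. v (x $ i)))"
proof -
  define coef where "coef = root_coeff Cp Cm C"
  have H_eq: "H = {\<beta> \<in> roots_B. coef \<beta> \<noteq> 0}" unfolding H_def coef_def by (rule singular_vectors_eq)
  have R_eq: "R x = (\<Sum>\<beta>\<in>roots_B. coef \<beta> / of_real ((\<beta> \<bullet> x)\<^sup>2)) + Rt x" for x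
    unfolding R_def coef_def by (rule potential_eq_sum_roots)
  have finH: "finite H" unfolding H_eq by (rule finite_subset[OF _ finite_roots_B]) auto
  have opD: "open D" unfolding D_def by (rule open_regular_domain[OF finH])
  have laRt: "line_analytic (ball 0 r) Rt" by (rule real_analytic_imp_line_analytic[OF assms(5)])
  have laR: "line_analytic D R"
  proof -
    have 1: "line_analytic D (\<lambda>x. coef \<beta> / of_real ((\<beta> \<bullet> x)\<^sup>2))" if "\<beta> \<in> roots_B" for \<beta>
    proof (cases "coef \<beta> = 0")
      case False
      then show ?thesis using that by (intro line_analytic_pole[OF opD]) (auto simp: D_def H_eq regular_domain_def hyperplane_def)
    qed simp
    have 2: "line_analytic D Rt" using laRt by (rule line_analytic_subset) (auto simp: D_def regular_domain_def)
    have 3: "R = (\<lambda>x. (\<Sum>\<beta>\<in>roots_B. coef \<beta> / of_real ((\<beta> \<bullet> x)\<^sup>2)) + Rt x)" using R_eq by blast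
    show ?thesis by (subst 3) (intro line_analytic_add[OF opD] line_analytic_sum[OF opD] 1 2)
  qed
  note la = real_analytic_imp_line_analytic
  have "commuting_system D R (sym_coeff R a2 a11) a1 a0"
    by (rule commuting_system_sym_coeff[OF opD laR la[OF assms(9)] la[OF assms(10)] la[OF assms(11)] la[OF assms(12)] assms(13)])
  then interpret quartic_potential r coef Rt R "sym_coeff R a2 a11" a1 a0
    unfolding D_def H_eq quartic_potential_def quartic_potential_axioms_def using assms(4) laRt R_eq by simp
  have card: "DIM((real, 'n) vec) \<ge> 2" using assms(8) by auto
  \<comment> \<open>The non-orthogonal partner required at each wall is provided by
    irreducibility.\<close>
  have group: "R (g x) = R x" if "g \<in> reflection_group H" "x \<in> regular_set" for g x
    by (rule group_invariant[OF _ _ that]) (use irreducible_neighbour[OF assms(6) card] in \<open>auto simp: H_eq\<close>)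
  have refl: "reflection \<alpha> \<in> reflection_group T" if "\<alpha> \<in> T" for \<alpha> :: "(real, 'n) vec" and T
    unfolding reflection_group_def using that by (intro generate.incl imageI)
  \<comment> \<open>T is \<open>roots_B\<close> or \<open>roots_D\<close>. Its reflections lie in
    the group generated by those of H, so they preserve R even where the coefficient of the root is
    zero.\<close>
  obtain T :: "(real, 'n) vec set" where T: "T \<subseteq> roots_B" "roots_D \<subseteq> T" "T = roots_B \<or> CARD('n) \<ge> 4" "reflection_group H = reflection_group T"
    using assms(8) by (auto simp: roots_B_def)
  interpret symmetric_potential r coef Rt R "sym_coeff R a2 a11" a1 a0 T
  proof
    show "CARD('n) \<ge> 2" using assms(8) by auto
  qed (use T group refl in auto)
  have "D \<subseteq> ball 0 r" by (auto simp: D_def regular_domain_def)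
  then show ?thesis using potential_form by blast
qed

end
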